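(* Let $k\geq 3$ and $1\leq \ell\leq k-2$ be integers and let $\varepsilon>0$. Then there exists $C>0$ such that the following holds. If $G$ is a $k$-graph on $n$ vertices, $n$ divisible by $k-\ell$, with $\delta_{k-2}(G)\geq(\delta_{k-2}^{\mathrm{ham}}(k,\ell)+\varepsilon)\binom{n-k+2}{2}$, then $G$ contains at least $\exp(n\log n - Cn)$ Hamilton $\ell$-cycles.
   Context: A $k$-graph $G$ consists of a vertex set $V(G)$ and an edge set of $k$-element subsets of $V(G)$. For $0\le\ell<k$, a ($k$-uniform) $\ell$-cycle is a $k$-graph whose vertices can be cyclically ordered so that every edge consists of $k$ cyclically consecutive vertices and consecutive edges intersect in exactly $\ell$ vertices. An $\ell$-cycle in $G$ is Hamilton if it covers all vertices of $G$. For $1\le d<k$, $\delta_d(G)$ is the largest $m$ such that every $d$-set of vertices lies in at least $m$ edges. The threshold $\delta_d^{\mathrm{ham}}(k,\ell)$ is the infimum of all $\delta\in[0,1]$ such that for every $\varepsilon>0$ there is $n_0$ such that every $k$-graph $G$ on $n\ge n_0$ vertices with $n$ divisible by $k-\ell$ and $\delta_d(G)\ge(\delta+\varepsilon)\binom{n-d}{k-d}$ contains a Hamilton $\ell$-cycle.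
   Formalization: The bound is proved for all n at least some n_0 (depending on k, ℓ, ε); without "n sufficiently large" the claim fails, e.g. for k=3, ℓ=1, n=2, where an edgeless G satisfies the degree condition but has no Hamilton cycle. *)

theory Defs
  imports Complex_Main
begin

definition kgraph :: "nat \<Rightarrow> 'a set \<Rightarrow> 'a set set \<Rightarrow> bool" where
  "kgraph k V E \<longleftrightarrow> finite V \<and> (\<forall>e\<in>E. e \<subseteq> V \<and> card e = k)"

definition min_deg :: "nat \<Rightarrow> 'a set \<Rightarrow> 'a set set \<Rightarrow> nat" where
  "min_deg d V E = Min ((\<lambda>S. card {e\<in>E. S \<subseteq> e}) ` {S. S \<subseteq> V \<and> card S = d})"

definition ham_cycle :: "nat \<Rightarrow> nat \<Rightarrow> 'a set \<Rightarrow> 'a set set \<Rightarrow> 'a set set \<Rightarrow> bool" where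
  "ham_cycle k l V E H \<longleftrightarrow> H \<subseteq> E \<and>
     (\<exists>f. bij_betw f {..<card V} V \<and>
        (let n = card V; m = n div (k - l);
             edge = (\<lambda>i. f ` ((\<lambda>j. (i * (k - l) + j) mod n) ` {..<k}))
         in (k - l) dvd n \<and> 0 < m \<and>
            H = edge ` {..<m} \<and>
            (\<forall>i<m. card (edge i) = k) \<and>
            (\<forall>i<m. card (edge i \<inter> edge ((i + 1) mod m)) = l)))"

text \<open>The threshold delta_d^ham(k,l) (vertices of the k-graphs taken from nat; the
  property is invariant under relabelling).\<close>
definition ham_threshold :: "nat \<Rightarrow> nat \<Rightarrow> nat \<Rightarrow> real" where
  "ham_threshold d k l = Inf {\<delta> \<in> {0..1}. \<forall>\<epsilon>>0. \<exists>n0. \<forall>(V::nat set) E.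
      kgraph k V E \<and> card V \<ge> n0 \<and> (k - l) dvd card V \<and>
      real (min_deg d V E) \<ge> (\<delta> + \<epsilon>) * real ((card V - d) choose (k - d))
      \<longrightarrow> (\<exists>H. ham_cycle k l V E H)}"

end

theory Submission
  imports Defs "HOL-Number_Theory.Cong" "HOL-Library.Multiset" "HOL-Real_Asymp.Real_Asymp" "HOL-Analysis.Convex"
begin

text \<open>
  Call \<open>E\<close> dense on \<open>V\<close> if every set of \<open>k - 2\<close> vertices is completed to an edge by sufficiently many pairs,
  measured against the threshold. Parity constructions bound the threshold from below, and these bounds
  suffice to replace the vertices of an end tuple one by one; hence any two disjoint \<open>l\<close>-tuples are
  joined by a positive proportion of all tuples of some fixed length (repeated vertices are resolved
  by cloning coordinates). A random set of bounded size inherits density, so by the definition of the threshold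
  it carries a spanning cycle, with or without prescribed extra vertices; two such cycles form a gadget that
  exchanges a tuple \<open>Q\<close> for a tuple \<open>Q'\<close> between fixed ends. Logarithmically many tuples suffice
  to contain, for every way in which an almost spanning cycle can end, one tuple that absorbs its ends,
  and a chain of gadgets can release any one of them. Therefore dense graphs are Hamilton-connected.

  For the count, split the vertex set at random into two halves. By McDiarmid's inequality both remain
  dense up to a loss of order \<open>n powr (-1/4)\<close>, so the least number \<open>g m\<close> of Hamilton paths between given
  ends on \<open>l + r * m\<close> vertices is at least \<open>g (m div 2) * g (m - m div 2)\<close> times the number of splits, which
  is \<open>2 ^ (r * m)\<close> up to a polynomial factor. Induction gives \<open>ln (g m) \<ge> r * m * ln m - C * m\<close>.
  Closing the paths up loses only an exponential factor, because consecutive vertices of a cycle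
  share an edge and every vertex lies in boundedly many edges of the cycle.
\<close>

text \<open>Reordering vertices inside one edge depends on divisibility. The \<open>r\<close>
  vertices leaving a window may re-enter in any order, so if \<open>r\<close> divides
  \<open>l\<close> an edge falls into blocks that never mix; otherwise every order is reachable.
  This decides how one vertex of an end tuple is exchanged. If \<open>r\<close> divides
  \<open>l\<close>, the threshold is at least 1/2 and the old and the new tuple have a common
  completion. If not and \<open>r \<ge> 3\<close>, both fit into one edge. For \<open>r = 2\<close>
  and odd \<open>l\<close>, the bound 1/4 yields two edges through a common vertex. The resulting
  walks revisit vertices, which is why clones are needed.

  Absorption only has to cope with tuples of bounded length: the spanning cycle on the unreserved
  vertices is cut open by deleting \<open>l * (r - 1)\<close> of them, and its two end tuples with
  the deleted vertices form one of at most \<open>n ^ L\<close> tuples. Each greedy choice handles a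
  fixed proportion of these, hence the logarithm.

  In the count, the losses of density over all scales form a geometric sum dominated by the smallest
  size, so a slack of order \<open>m powr (-1/8)\<close> pays for all of them.\<close>

text \<open>The prefix \<open>as\<close> is settled already. The tail is first rearranged behind its
  head \<open>x\<close>, then \<open>x\<close> is carried to its place by swaps. Swaps are assumed
  for lists of total length \<open>n\<close> only, because they will be available only for listings
  of a whole edge.\<close>

lemma adjacent_swaps_generate:
  assumes refl: "\<And>u. P u u" and trans: "\<And>u v w. P u v \<Longrightarrow> P v w \<Longrightarrow> P u w"
    and swap: "\<And>as x y bs. length as + length bs + 2 = n \<Longrightarrow> P (as @ x # y # bs) (as @ y # x # bs)"
  shows "mset xs = mset ys \<Longrightarrow> length as + length xs = n \<Longrightarrow> P (as @ xs) (as @ ys)"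
proof (induction xs arbitrary: as ys)
  case Nil
  then show ?case by (simp add: refl)
next
  case (Cons x xs)
  have "x \<in> set ys"
    using Cons.prems(1) by (metis list.set_intros(1) set_mset_mset)
  then obtain p q where ys: "ys = p @ x # q"
    by (meson split_list)
  have m: "mset xs = mset (p @ q)"
    using Cons.prems(1) ys by simp
  have move: "length as + length p + length q + 1 = n \<Longrightarrow> P (as @ x # p @ q) (as @ p @ x # q)" for as
  proof (induction p arbitrary: as)
    case Nil
    then show ?case by (simp add: refl)
  next
    case (Cons y p)
    have "P (as @ x # y # p @ q) (as @ y # x # p @ q)"
      using Cons.prems by (intro swap) auto
    moreover have "P ((as @ [y]) @ x # p @ q) ((as @ [y]) @ p @ x # q)"
      using Cons.prems by (intro Cons.IH) auto
    ultimately show ?case using trans by force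
  qed
  have "P ((as @ [x]) @ xs) ((as @ [x]) @ (p @ q))"
    using Cons.prems m by (intro Cons.IH) auto
  moreover have "length as + length p + length q + 1 = n"
    using Cons.prems(2) mset_eq_length[OF m] by simp
  ultimately show ?case
    using trans[of "as @ x # xs" "as @ x # p @ q" "as @ ys"] move[of as] ys by simp
qed

text \<open>The uniformity is \<open>l + r\<close>, so consecutive edges of an \<open>l\<close>-cycle are shifted by \<open>r\<close>.\<close>
locale cycle_params =
  fixes l r :: nat
  assumes l_pos: "1 \<le> l" and r_ge2: "2 \<le> r"
begin

section \<open>Walks along edges and how they are glued\<close>

text \<open>The length is forced to be \<open>l\<close> plus a multiple of \<open>r\<close>, so that
  the first and the last \<open>l\<close> entries are end tuples at which walks can be glued. A bare
  \<open>l\<close>-tuple (\<open>m = 0\<close>) is a walk. Entries may repeat as long as each window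
  of \<open>l + r\<close> entries lists an edge.\<close>

definition walk :: "'b set set \<Rightarrow> 'b list \<Rightarrow> bool" where
  "walk E xs \<longleftrightarrow> (\<exists>m. length xs = l + r * m \<and> (\<forall>i<m. set (take (l + r) (drop (i * r) xs)) \<in> E))"

lemma r_pos: "0 < r"
  using r_ge2 by simp

lemma walkI:
  "length xs = l + r * m \<Longrightarrow> (\<And>i. i < m \<Longrightarrow> set (take (l + r) (drop (i * r) xs)) \<in> E) \<Longrightarrow> walk E xs"
  unfolding walk_def by blast

lemma walkD:
  assumes "walk E xs" "length xs = l + r * m" "i < m"
  shows "set (take (l + r) (drop (i * r) xs)) \<in> E"
  using assms r_pos unfolding walk_def by auto

lemma walk_lengthE:
  assumes "walk E xs" obtains m where "length xs = l + r * m"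
  using assms unfolding walk_def by auto

lemma walk_length_ge: "walk E xs \<Longrightarrow> l \<le> length xs"
  unfolding walk_def by auto

lemma walk_base: "length xs = l \<Longrightarrow> walk E xs"
  by (rule walkI[of _ 0]) auto

lemma walk_single: "length xs = l + r \<Longrightarrow> set xs \<in> E \<Longrightarrow> walk E xs"
  by (rule walkI[of _ 1]) auto

lemma walk_mono: "walk E xs \<Longrightarrow> E \<subseteq> F \<Longrightarrow> walk F xs"
  unfolding walk_def by blast

lemma walk_map:
  assumes "walk H xs" "\<And>h. h \<in> H \<Longrightarrow> f ` h \<in> E"
  shows "walk E (map f xs)"
  using assms unfolding walk_def by (auto simp: drop_map take_map)

text \<open>The part before the shared tuple \<open>a\<close> has a length divisible by
  \<open>r\<close>, so the windows of both walks start at multiples of \<open>r\<close> in the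
  concatenation, and each of its windows lies entirely in one of the two walks.\<close>

lemma walk_append:
  assumes "walk E (xs @ a)" "walk E (a @ ys)" "length a = l"
  shows "walk E (xs @ a @ ys)"
proof -
  obtain m1 where m1: "length (xs @ a) = l + r * m1" using assms(1) by (rule walk_lengthE)
  obtain m2 where m2: "length (a @ ys) = l + r * m2" using assms(2) by (rule walk_lengthE)
  have lx: "length xs = r * m1" and ly: "length ys = r * m2"
    using m1 m2 assms(3) by auto
  show ?thesis
  proof (rule walkI[of _ "m1 + m2"])
    show "length (xs @ a @ ys) = l + r * (m1 + m2)"
      using lx ly assms(3) by (simp add: algebra_simps)
    fix i assume i: "i < m1 + m2"
    show "set (take (l + r) (drop (i * r) (xs @ a @ ys))) \<in> E"
    proof (cases "i < m1")
      case True
      then have "(i + 1) * r \<le> m1 * r" by (intro mult_right_mono) auto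
      then have le: "i * r + r \<le> r * m1" by (simp add: algebra_simps)
      have "drop (i * r) ((xs @ a) @ ys) = drop (i * r) (xs @ a) @ ys"
        using le lx by simp
      moreover have "l + r \<le> length (drop (i * r) (xs @ a))" using le lx assms(3) by simp
      ultimately have "take (l + r) (drop (i * r) ((xs @ a) @ ys)) = take (l + r) (drop (i * r) (xs @ a))"
        by (simp only: take_append) simp
      then show ?thesis using walkD[OF assms(1) m1 True] by (simp only: append_assoc)
    next
      case False
      then obtain j where j: "i = m1 + j" "j < m2" using i by (metis add_less_cancel_left le_Suc_ex not_less)
      have "drop (i * r) (xs @ a @ ys) = drop (j * r) (a @ ys)"
        using lx j by (simp add: algebra_simps)
      then show ?thesis using walkD[OF assms(2) m2 j(2)] by simp
    qed
  qed
qed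

lemma walk_drop_block:
  assumes "walk E (xs @ ys)" "length xs = r" "l \<le> length ys"
  shows "walk E ys"
proof -
  obtain m where m: "length (xs @ ys) = l + r * m" using assms(1) by (rule walk_lengthE)
  then have "m \<noteq> 0" using assms(2,3) r_pos by (intro notI) auto
  then obtain m' where m': "m = Suc m'" by (cases m) auto
  show ?thesis
  proof (rule walkI[of _ m'])
    show "length ys = l + r * m'" using m m' assms(2) by simp
    fix i assume "i < m'"
    then have "set (take (l + r) (drop (Suc i * r) (xs @ ys))) \<in> E"
      using m' by (intro walkD[OF assms(1) m]) auto
    then show "set (take (l + r) (drop (i * r) ys)) \<in> E" using assms(2) by simp
  qed
qed

text \<open>Since the length is \<open>l + r * m\<close>, reversal maps the grid of windows to
  itself: window \<open>i\<close> becomes window \<open>m - 1 - i\<close> read backwards.\<close>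

lemma walk_rev:
  assumes "walk E xs" shows "walk E (rev xs)"
proof -
  obtain m where m: "length xs = l + r * m" using assms by (rule walk_lengthE)
  show ?thesis
  proof (rule walkI[of _ m])
    show "length (rev xs) = l + r * m" using m by simp
    fix i assume i: "i < m"
    obtain j where j: "m = i + 1 + j" using i by (metis Suc_eq_plus1 add_Suc_right less_natE semiring_norm(174) add.commute)
    have e1: "length xs - i * r = l + r + j * r" using m j by (simp add: algebra_simps)
    have "drop (i * r) (rev xs) = rev (take (l + r + j * r) xs)"
      using e1 by (simp add: drop_rev)
    moreover have "length (take (l + r + j * r) xs) = l + r + j * r"
      using m j by (simp add: algebra_simps)
    ultimately have "take (l + r) (drop (i * r) (rev xs)) = rev (drop (j * r) (take (l + r + j * r) xs))"
      by (simp add: take_rev)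
    also have "drop (j * r) (take (l + r + j * r) xs) = take (l + r) (drop (j * r) xs)"
      by (simp add: drop_take)
    finally have "set (take (l + r) (drop (i * r) (rev xs))) = set (take (l + r) (drop (j * r) xs))" by simp
    then show "set (take (l + r) (drop (i * r) (rev xs))) \<in> E"
      using walkD[OF assms m, of j] j by simp
  qed
qed

text \<open>The two end tuples of a walk may overlap when the walk is short.\<close>
definition joins :: "'b set set \<Rightarrow> 'b list \<Rightarrow> 'b list \<Rightarrow> 'b list \<Rightarrow> bool" where
  "joins E a xs b \<longleftrightarrow> walk E xs \<and> take l xs = a \<and> drop (length xs - l) xs = b"

lemma joins_trans:
  assumes "joins E a xs b" "joins E b ys c"
  shows "joins E a (xs @ drop l ys) c"
proof -
  have lx: "l \<le> length xs" and ly: "l \<le> length ys"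
    using assms walk_length_ge unfolding joins_def by auto
  define xs' where "xs' = take (length xs - l) xs"
  have xs: "xs = xs' @ b" using assms(1) unfolding joins_def xs'_def by auto
  have ys: "ys = b @ drop l ys" using assms(2) unfolding joins_def by (metis append_take_drop_id)
  have lb: "length b = l" using assms(1) lx unfolding joins_def by auto
  have "walk E (xs' @ b @ drop l ys)"
    using assms xs ys lb unfolding joins_def by (intro walk_append) auto
  moreover have "take l (xs @ drop l ys) = a" using assms(1) lx unfolding joins_def by simp
  moreover have "drop (length (xs @ drop l ys) - l) (xs @ drop l ys) = c"
  proof -
    have "xs @ drop l ys = xs' @ ys" using xs ys by (metis append.assoc)
    moreover have "drop (length (xs' @ ys) - l) (xs' @ ys) = c"
      using assms(2) ly unfolding joins_def by simp
    ultimately show ?thesis by simp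
  qed
  ultimately show ?thesis unfolding joins_def using xs by simp
qed

lemma joins_append: "walk E (a @ xs @ b) \<Longrightarrow> length a = l \<Longrightarrow> length b = l \<Longrightarrow> joins E a (a @ xs @ b) b"
  unfolding joins_def by simp

lemma joins_mono: "joins E a xs b \<Longrightarrow> E \<subseteq> F \<Longrightarrow> joins F a xs b"
  unfolding joins_def using walk_mono by blast

subsection \<open>Walks inside a single edge\<close>

text \<open>The state of a walk inside one edge is its entire last window, not merely an end tuple.
  The guard on \<open>u\<close> makes the relation hold trivially for lists that do not enumerate
  \<open>e\<close>, so that reflexivity and transitivity hold for all lists, as
  \<open>adjacent_swaps_generate\<close> requires.\<close>

definition reach :: "'b set \<Rightarrow> 'b list \<Rightarrow> 'b list \<Rightarrow> bool" where
  "reach e u v \<longleftrightarrow> (length u = l + r \<longrightarrow> set u = e \<longrightarrow>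
     (length v = l + r \<and> set v = e \<and> (\<exists>zs. walk {e} (u @ zs) \<and> drop (length zs) (u @ zs) = v)))"

lemma reach_refl: "reach e u u"
  unfolding reach_def using walk_single[of u "{e}"] by (auto intro!: exI[of _ "[]"])

lemma reach_trans:
  assumes "reach e u v" "reach e v w" shows "reach e u w"
  unfolding reach_def
proof (intro impI)
  assume u: "length u = l + r" "set u = e"
  then obtain zs where v: "length v = l + r" "set v = e" and zs: "walk {e} (u @ zs)" "drop (length zs) (u @ zs) = v"
    using assms(1) unfolding reach_def by auto
  then obtain ys where w: "length w = l + r" "set w = e" and ys: "walk {e} (v @ ys)" "drop (length ys) (v @ ys) = w"
    using assms(2) unfolding reach_def by auto
  define p where "p = take (length zs) (u @ zs)"
  have p: "u @ zs = p @ v" unfolding p_def using zs(2) by (metis append_take_drop_id)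
  \<comment> \<open>Only the last \<open>l\<close> entries of the middle window are shared when
    gluing; its first block of \<open>r\<close> entries is cut off from the second walk.\<close>
  define v1 v2 where "v1 = take r v" and "v2 = drop r v"
  have vv: "v = v1 @ v2" "length v1 = r" "length v2 = l" unfolding v1_def v2_def using v by auto
  have "walk {e} (v1 @ v2 @ ys)" using ys(1) unfolding vv(1) by simp
  then have "walk {e} (v2 @ ys)" by (rule walk_drop_block) (use vv in simp_all)
  moreover have "walk {e} ((p @ v1) @ v2)" using zs(1) unfolding p vv(1) by simp
  ultimately have "walk {e} ((p @ v1) @ v2 @ ys)" using vv(3) by (intro walk_append)
  moreover have uzy: "u @ zs @ ys = (p @ v1) @ v2 @ ys" using p vv(1) by (metis append.assoc)
  ultimately have "walk {e} (u @ zs @ ys)" by (simp only:)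
  moreover have "drop (length (zs @ ys)) (u @ zs @ ys) = w"
  proof -
    have "u @ zs @ ys = p @ (v @ ys)" using p by (metis append.assoc)
    moreover have "length p = length zs" unfolding p_def by simp
    ultimately show ?thesis using ys(2) by (simp only: length_append drop_append) simp
  qed
  ultimately show "length w = l + r \<and> set w = e \<and> (\<exists>zs. walk {e} (u @ zs) \<and> drop (length zs) (u @ zs) = w)"
    using w by blast
qed

text \<open>The next window must again be all of \<open>e\<close>, so exactly the \<open>r\<close>
  vertices that leave the window enter again, in an arbitrary order \<open>p\<close>.\<close>

lemma reach_step:
  assumes "mset p = mset (take r u)"
  shows "reach e u (drop r u @ p)"
  unfolding reach_def
proof (intro impI)
  assume u: "length u = l + r" "set u = e"
  have lp: "length p = r" using assms u by (metis add_leE le_add2 length_take min.absorb2 size_mset)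
  have sp: "set p = set (take r u)" using assms by (metis set_mset_mset)
  have se: "set (drop r u @ p) = e"
    using sp u(2) by (metis append_take_drop_id set_append sup_commute)
  have "walk {e} (u @ p)"
  proof (rule walkI[of _ 2])
    show "length (u @ p) = l + r * 2" using u lp by simp
    fix i :: nat assume "i < 2"
    then consider "i = 0" | "i = 1" by linarith
    then show "set (take (l + r) (drop (i * r) (u @ p))) \<in> {e}"
      using se u lp by cases auto
  qed
  moreover have "drop (length p) (u @ p) = drop r u @ p" using lp u by simp
  ultimately show "length (drop r u @ p) = l + r \<and> set (drop r u @ p) = e \<and>
    (\<exists>zs. walk {e} (u @ zs) \<and> drop (length zs) (u @ zs) = drop r u @ p)"
    using se u lp by auto
qed

lemma reach_rotate:
  assumes "length u = l + r" shows "reach e u (rotate (r * t) u)"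
proof (induction t)
  case 0
  then show ?case by (simp add: reach_refl)
next
  case (Suc t)
  have "reach e (rotate (r * t) u) (drop r (rotate (r * t) u) @ take r (rotate (r * t) u))"
    by (rule reach_step) simp
  also have "drop r (rotate (r * t) u) @ take r (rotate (r * t) u) = rotate r (rotate (r * t) u)"
    using assms r_pos l_pos by (subst (3) rotate_drop_take) auto
  finally show ?case using Suc reach_trans by (auto simp: rotate_rotate)
qed

text \<open>Rotations by multiples of \<open>r\<close> act on the \<open>l + r\<close> positions as
  rotations by multiples of \<open>g = gcd r (l + r)\<close>, and \<open>g < r\<close> because
  \<open>r\<close> does not divide \<open>l\<close>. Hence the two positions can be rotated to
  \<open>s = j mod g\<close> and \<open>s + 1\<close>, both inside the first block of
  \<open>r\<close>, where \<open>reach_step\<close> permutes freely; rotating further restores the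
  rest.\<close>

lemma reach_swap:
  assumes nd: "\<not> r dvd l" and len: "length as + length bs + 2 = l + r"
  shows "reach e (as @ x # y # bs) (as @ y # x # bs)"
proof -
  define k where "k = l + r"
  define j where "j = length as"
  define u v where "u = as @ x # y # bs" and "v = as @ y # x # bs"
  have kpos: "0 < k" and jk: "j + 1 < k" unfolding k_def j_def using len r_pos by auto
  have lu: "length u = k" and lv: "length v = k" unfolding u_def v_def k_def using len by auto
  define g where "g = gcd r k"
  have gr: "g dvd r" "g dvd k" "0 < g" unfolding g_def using r_pos by auto
  have "g \<noteq> r" using nd gr unfolding k_def by (metis dvd_add_left_iff dvd_refl add.commute)
  then have g_lt: "g < r" using gr r_pos by (metis dvd_imp_le le_neq_implies_less)
  \<comment> \<open>At most \<open>g - 1\<close>, so \<open>s + 1 \<le> g < r\<close> and both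
    positions lie in the first block.\<close>
  define s where "s = j mod g"
  have s_lt: "s + 1 < r" using g_lt gr(3) unfolding s_def by (metis Suc_eq_plus1 Suc_lessI less_trans_Suc mod_less_divisor not_less_eq order_less_trans)
  \<comment> \<open>Bezout: some multiple of \<open>r\<close> is congruent to \<open>g\<close>, so
    \<open>j div g\<close> times as many rotations lead from \<open>s\<close> to
    \<open>j\<close>.\<close>
  obtain t0 where t0: "[r * t0 = g] (mod k)"
    using cong_solve_nat[of r k] r_pos unfolding g_def by auto
  define t where "t = t0 * (j div g)"
  define m where "m = r * t"
  have "[r * t0 * (j div g) = g * (j div g)] (mod k)" using t0 by (rule cong_scalar_right)
  then have "[s + m = s + g * (j div g)] (mod k)"
    unfolding m_def t_def by (intro cong_add) (auto simp: mult.assoc)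
  moreover have "s + g * (j div g) = j" unfolding s_def by simp
  ultimately have "[s + m = j] (mod k)" by simp
  then have "(s + m) mod k = j mod k" unfolding unique_euclidean_semiring_class.cong_def .
  then have sm: "(s + m) mod k = j" using jk by simp
  have sm1: "(s + 1 + m) mod k = j + 1"
    using sm jk by (metis (no_types, lifting) add.commute add.left_commute mod_add_left_eq mod_less)
  have inj: "i = i'" if "(i + m) mod k = (i' + m) mod k" "i < k" "i' < k" for i i'
    using that by (metis cong_add_rcancel_nat unique_euclidean_semiring_class.cong_def cong_less_modulus_unique_nat)
  define w where "w = rotate m u"
  have lw: "length w = k" unfolding w_def using lu by simp
  have wn: "w ! i = u ! ((i + m) mod k)" if "i < k" for i
    unfolding w_def using that lu by (simp add: nth_rotate add.commute)
  define w' where "w' = w[s := w ! (s + 1), s + 1 := w ! s]"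
  have rk: "r < k" unfolding k_def using l_pos by simp
  have s_k: "s + 1 < k" using s_lt rk by simp
  have vn: "v ! i = (if i = j then u ! (j + 1) else if i = j + 1 then u ! j else u ! i)" if "i < k" for i
    using that unfolding u_def v_def j_def by (auto simp: nth_append nth_Cons split: nat.splits)
  have w'v: "w' = rotate m v"
  proof (rule nth_equalityI)
    show "length w' = length (rotate m v)" unfolding w'_def using lw lv by simp
    fix i assume "i < length w'"
    then have i: "i < k" unfolding w'_def using lw by simp
    have rv: "rotate m v ! i = v ! ((i + m) mod k)" using i lv by (simp add: nth_rotate add.commute)
    have im: "(i + m) mod k < k" using kpos by simp
    consider "i = s" | "i = s + 1" | "i \<noteq> s" "i \<noteq> s + 1" by blast
    then show "w' ! i = rotate m v ! i"
    proof cases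
      case 1
      then show ?thesis unfolding rv using vn[OF im] sm sm1 wn[OF s_k] lw s_k unfolding w'_def by simp
    next
      case 2
      then show ?thesis unfolding rv using vn[OF im] sm sm1 wn[of s] lw s_k unfolding w'_def by simp
    next
      case 3
      then have "(i + m) mod k \<noteq> j" "(i + m) mod k \<noteq> j + 1"
        using inj[of i s] inj[of i "s + 1"] sm sm1 i s_k by auto
      then show ?thesis unfolding rv using vn[OF im] wn[OF i] 3 unfolding w'_def by simp
    qed
  qed
  have rot: "rotate r xs = drop r xs @ take r xs" if "length xs = k" for xs :: "'a list"
    using that rk by (simp add: rotate_drop_take)
  have "reach e u w" unfolding w_def m_def using lu by (intro reach_rotate) (auto simp: k_def)
  moreover have "reach e w (rotate r w')"
  proof -
    have lw': "length w' = k" unfolding w'_def using lw by simp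
    have "take r w' = (take r w)[s := take r w ! (s + 1), s + 1 := take r w ! s]"
      unfolding w'_def using s_lt by (simp add: take_update_swap)
    then have "mset (take r w') = mset (take r w)"
      using s_lt lw rk mset_swap[of "s + 1" "take r w" s] by simp
    moreover have "drop r w' = drop r w" unfolding w'_def using s_lt by simp
    ultimately show ?thesis using reach_step[of "take r w'" w e] rot[OF lw'] by simp
  qed
  \<comment> \<open>The rotation so far amounts to \<open>r * (t + 1)\<close>; \<open>k - 1\<close>
    further copies of it make the total a multiple of \<open>k\<close>.\<close>
  moreover have "reach e (rotate r w') (rotate (r * ((t + 1) * (k - 1))) (rotate r w'))"
    using lv w'v by (intro reach_rotate) (auto simp: k_def)
  moreover have "rotate (r * ((t + 1) * (k - 1))) (rotate r w') = v"
  proof -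
    obtain k' where "k = Suc k'" using kpos by (cases k) auto
    then have "r * ((t + 1) * (k - 1)) + (r + m) = r * (t + 1) * k"
      unfolding m_def by (simp add: algebra_simps)
    then show ?thesis unfolding w'v rotate_rotate using lv by (metis mod_mult_self2_is_0 rotate_id)
  qed
  ultimately show ?thesis unfolding u_def v_def using reach_trans by metis
qed

text \<open>The tuple \<open>a\<close> begins some listing of \<open>e\<close> and \<open>b\<close>
  ends another; adjacent swaps lead from the first listing to the second.\<close>

lemma edge_joins:
  assumes nd: "\<not> r dvd l" and e: "card e = l + r" "finite e"
    and a: "length a = l" "distinct a" "set a \<subseteq> e" and b: "length b = l" "distinct b" "set b \<subseteq> e"
  shows "\<exists>xs. joins {e} a xs b"
proof -
  obtain p where p: "set p = e - set a" "distinct p" using finite_distinct_list[of "e - set a"] e by auto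
  obtain q where q: "set q = e - set b" "distinct q" using finite_distinct_list[of "e - set b"] e by auto
  have u: "distinct (a @ p)" "set (a @ p) = e" using a p by auto
  have v: "distinct (q @ b)" "set (q @ b) = e" using b q by auto
  have lu: "length (a @ p) = l + r" and lv: "length (q @ b) = l + r"
    using u v e by (metis distinct_card)+
  have "mset (a @ p) = mset (q @ b)" using u v by (metis set_eq_iff_mset_eq_distinct)
  have "reach e ([] @ (a @ p)) ([] @ (q @ b))"
  proof (rule adjacent_swaps_generate[where P = "reach e" and n = "l + r"])
    show "mset (a @ p) = mset (q @ b)" by fact
  qed (use lu in \<open>auto intro: reach_refl reach_swap[OF nd] dest: reach_trans\<close>)
  then obtain zs where zs: "walk {e} ((a @ p) @ zs)" "drop (length zs) ((a @ p) @ zs) = q @ b"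
    unfolding reach_def using lu u by auto
  define xs where "xs = a @ p @ zs"
  have len: "length xs = l + r + length zs" unfolding xs_def using lu by simp
  have "drop r (drop (length zs) xs) = drop r (q @ b)" using zs(2) unfolding xs_def by simp
  then have "drop (length xs - l) xs = b" using len lv b by (simp add: add.commute)
  then have "joins {e} a xs b" unfolding joins_def using zs a unfolding xs_def by simp
  then show ?thesis by blast
qed

end

section \<open>Counting tuples of vertices\<close>

text \<open>Repetitions are allowed, so that the count is exactly a power of \<open>card V\<close>
  and the coordinates are independent; repeated entries are discarded later at a lower-order
  cost.\<close>

definition tuples :: "'a set \<Rightarrow> nat \<Rightarrow> 'a list set" where
  "tuples V q = {xs. set xs \<subseteq> V \<and> length xs = q}"

lemma finite_tuples [simp]: "finite V \<Longrightarrow> finite (tuples V q)"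
  unfolding tuples_def by (rule finite_lists_length_eq)

lemma card_tuples: "finite V \<Longrightarrow> card (tuples V q) = card V ^ q"
  unfolding tuples_def by (rule card_lists_length_eq)

lemma tuples_0 [simp]: "tuples V 0 = {[]}"
  unfolding tuples_def by auto

lemma tuples_Suc: "tuples V (Suc q) = (\<lambda>(v, xs). v # xs) ` (V \<times> tuples V q)"
  unfolding tuples_def by (auto simp: length_Suc_conv)

lemma sum_tuples_Suc:
  "(\<Sum>xs\<in>tuples V (Suc q). f xs) = (\<Sum>v\<in>V. \<Sum>xs\<in>tuples V q. f (v # xs))"
  unfolding tuples_Suc by (subst sum.reindex) (auto simp: inj_on_def sum.cartesian_product case_prod_unfold)

text \<open>Cauchy-Schwarz over the fibres of \<open>g\<close>: the pairs with equal keys number the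
  sum of the squared fibre sizes.\<close>

lemma card_collision_ge:
  assumes "finite A" "finite K" "g ` A \<subseteq> K"
  shows "(card A)\<^sup>2 \<le> card K * card {(x, y) \<in> A \<times> A. g x = g y}"
proof -
  have fib: "finite {x \<in> A. g x = k}" for k using assms(1) by simp
  have A: "A = (\<Union>k\<in>K. {x \<in> A. g x = k})" using assms(3) by auto
  have cA: "card A = (\<Sum>k\<in>K. card {x \<in> A. g x = k})"
    by (subst A, subst card_UN_disjoint) (use assms fib in auto)
  have eq: "{(x, y) \<in> A \<times> A. g x = g y} = (\<Union>k\<in>K. {x \<in> A. g x = k} \<times> {x \<in> A. g x = k})"
    using assms(3) by auto
  have c2: "card {(x, y) \<in> A \<times> A. g x = g y} = (\<Sum>k\<in>K. (card {x \<in> A. g x = k})\<^sup>2)"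
    unfolding eq by (subst card_UN_disjoint) (use assms fib in \<open>auto simp: card_cartesian_product power2_eq_square\<close>)
  have "(\<Sum>k\<in>K. real (card {x \<in> A. g x = k}))\<^sup>2 \<le> (\<Sum>k\<in>K. (real (card {x \<in> A. g x = k}))\<^sup>2) * card K"
    using sum_squared_le_sum_of_squares[of "\<lambda>k. real (card {x \<in> A. g x = k})" K] assms(2) by simp
  then have "real ((card A)\<^sup>2) \<le> real (card K * card {(x, y) \<in> A \<times> A. g x = g y})"
    unfolding cA c2 by (simp add: mult.commute)
  then show ?thesis by (simp only: of_nat_le_iff)
qed

definition del_nth :: "nat \<Rightarrow> 'a list \<Rightarrow> 'a list" where
  "del_nth i xs = take i xs @ drop (Suc i) xs"

lemma del_nth_tuples: "xs \<in> tuples V q \<Longrightarrow> i < q \<Longrightarrow> del_nth i xs \<in> tuples V (q - 1)"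
  unfolding tuples_def del_nth_def by (auto dest: in_set_takeD in_set_dropD)

lemma del_nth_inj:
  assumes "length xs = length ys" "i < length xs" "del_nth i xs = del_nth i ys" "xs ! i = ys ! i"
  shows "xs = ys"
  using assms id_take_nth_drop[of i xs] id_take_nth_drop[of i ys]
  unfolding del_nth_def by (metis append_eq_append_conv length_take)

lemma del_nth_nth: "i < length xs \<Longrightarrow> j < i \<Longrightarrow> del_nth i xs ! j = xs ! j"
  unfolding del_nth_def by (simp add: nth_append)

lemma del_nth_update: "i < length xs \<Longrightarrow> del_nth i (xs[i := v]) = del_nth i xs"
  unfolding del_nth_def by simp

lemma del_nth_eq_update:
  assumes "length xs = length ys" "i < length xs" "del_nth i xs = del_nth i ys"
  shows "ys = xs[i := ys ! i]"
  using assms by (intro del_nth_inj[of ys "xs[i := ys ! i]" i]) (auto simp: del_nth_update)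

text \<open>Covers both exclusions that follow: a coordinate lying in a fixed set, and a coordinate
  equal to another one.\<close>

lemma card_restricted_coordinate:
  assumes "finite V" "i < q" "\<And>y. finite (S y) \<and> card (S y) \<le> c"
  shows "card {x \<in> tuples V q. x ! i \<in> S (del_nth i x)} \<le> c * card V ^ (q - 1)"
proof -
  let ?A = "{x \<in> tuples V q. x ! i \<in> S (del_nth i x)}"
  let ?g = "\<lambda>x. (del_nth i x, x ! i)"
  have "inj_on ?g ?A"
    by (rule inj_onI) (use assms(2) in \<open>auto simp: tuples_def intro: del_nth_inj\<close>)
  moreover have "?g ` ?A \<subseteq> Sigma (tuples V (q - 1)) S"
    using assms(2) del_nth_tuples by fastforce
  moreover have "finite (Sigma (tuples V (q - 1)) S)" using assms by auto
  ultimately have "card ?A \<le> card (Sigma (tuples V (q - 1)) S)" by (rule card_inj_on_le)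
  also have "\<dots> = (\<Sum>y\<in>tuples V (q - 1). card (S y))" using assms by (intro card_SigmaI) auto
  also have "\<dots> \<le> (\<Sum>y\<in>tuples V (q - 1). c)" using assms by (intro sum_mono) auto
  finally show ?thesis using assms(1) by (simp add: card_tuples mult.commute)
qed

lemma card_hitting_tuples:
  assumes "finite V" "finite F"
  shows "card {x \<in> tuples V q. set x \<inter> F \<noteq> {}} \<le> q * card F * card V ^ (q - 1)"
proof -
  have "{x \<in> tuples V q. set x \<inter> F \<noteq> {}} \<subseteq> (\<Union>i<q. {x \<in> tuples V q. x ! i \<in> F})"
    by (fastforce simp: tuples_def in_set_conv_nth)
  then have "card {x \<in> tuples V q. set x \<inter> F \<noteq> {}} \<le> card (\<Union>i<q. {x \<in> tuples V q. x ! i \<in> F})"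
    using assms by (intro card_mono) auto
  also have "\<dots> \<le> (\<Sum>i<q. card {x \<in> tuples V q. x ! i \<in> F})" by (rule card_UN_le) simp
  also have "\<dots> \<le> (\<Sum>i<q. card F * card V ^ (q - 1))"
    using card_restricted_coordinate[of V _ q "\<lambda>_. F"] assms by (intro sum_mono) auto
  finally show ?thesis by simp
qed

lemma card_nondistinct_tuples:
  assumes "finite V"
  shows "card {x \<in> tuples V q. \<not> distinct x} \<le> q * q * card V ^ (q - 1)"
proof -
  \<comment> \<open>The later of two equal positions is the one treated as restricted: deleting it
    leaves the earlier index unchanged, so the forced value is a function of the remaining
    coordinates.\<close>
  have "{x \<in> tuples V q. \<not> distinct x} \<subseteq>
    (\<Union>p\<in>{..<q}\<times>{..<q}. {x \<in> tuples V q. snd p < fst p \<and> x ! fst p = x ! snd p})"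
  proof
    fix x assume x: "x \<in> {x \<in> tuples V q. \<not> distinct x}"
    then obtain i j where ij: "i < length x" "j < length x" "i \<noteq> j" "x ! i = x ! j"
      unfolding distinct_conv_nth by blast
    then have "(max i j, min i j) \<in> {..<q}\<times>{..<q}" "x ! (max i j) = x ! (min i j)" "min i j < max i j"
      using x unfolding tuples_def by (auto simp: max_def min_def)
    then show "x \<in> (\<Union>p\<in>{..<q}\<times>{..<q}. {x \<in> tuples V q. snd p < fst p \<and> x ! fst p = x ! snd p})"
      using x by (intro UN_I[of "(max i j, min i j)"]) auto
  qed
  then have "card {x \<in> tuples V q. \<not> distinct x} \<le>
    card (\<Union>p\<in>{..<q}\<times>{..<q}. {x \<in> tuples V q. snd p < fst p \<and> x ! fst p = x ! snd p})"
    using assms by (intro card_mono) auto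
  also have "\<dots> \<le> (\<Sum>p\<in>{..<q}\<times>{..<q}. card {x \<in> tuples V q. snd p < fst p \<and> x ! fst p = x ! snd p})"
    by (rule card_UN_le) simp
  also have "\<dots> \<le> (\<Sum>p\<in>{..<q}\<times>{..<q}. card V ^ (q - 1))"
  proof (rule sum_mono)
    fix p assume p: "p \<in> {..<q}\<times>{..<q}"
    have "{x \<in> tuples V q. snd p < fst p \<and> x ! fst p = x ! snd p} \<subseteq>
      {x \<in> tuples V q. x ! fst p \<in> {del_nth (fst p) x ! snd p}}"
      using p by (auto simp: tuples_def del_nth_nth)
    then have "card {x \<in> tuples V q. snd p < fst p \<and> x ! fst p = x ! snd p} \<le>
      card {x \<in> tuples V q. x ! fst p \<in> {del_nth (fst p) x ! snd p}}"
      using assms by (intro card_mono) auto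
    also have "\<dots> \<le> 1 * card V ^ (q - 1)"
      using p by (intro card_restricted_coordinate[where S = "\<lambda>y. {y ! snd p}"] assms) auto
    finally show "card {x \<in> tuples V q. snd p < fst p \<and> x ! fst p = x ! snd p} \<le> card V ^ (q - 1)" by simp
  qed
  finally show ?thesis by simp
qed

section \<open>Properties of a positive proportion of all tuples\<close>

text \<open>The proportion refers to all \<open>card V ^ q\<close> lists, repetitions included, so
  that proportions simply multiply when tuples are concatenated.\<close>

definition ample :: "'a set \<Rightarrow> nat \<Rightarrow> real \<Rightarrow> ('a list \<Rightarrow> bool) \<Rightarrow> bool" where
  "ample V q \<alpha> P \<longleftrightarrow> \<alpha> * real (card V) ^ q \<le> real (card {x \<in> tuples V q. P x})"

lemma ample_mono:
  assumes "ample V q \<alpha> P" "finite V" "\<beta> \<le> \<alpha>" "\<And>x. x \<in> tuples V q \<Longrightarrow> P x \<Longrightarrow> Q x"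
  shows "ample V q \<beta> Q"
proof -
  have "\<beta> * real (card V) ^ q \<le> \<alpha> * real (card V) ^ q" using assms(3) by (intro mult_right_mono) auto
  moreover have "card {x \<in> tuples V q. P x} \<le> card {x \<in> tuples V q. Q x}"
    using assms by (intro card_mono) auto
  ultimately show ?thesis using assms(1) unfolding ample_def by linarith
qed

lemma ample_True: "finite V \<Longrightarrow> ample V q 1 (\<lambda>_. True)"
  unfolding ample_def by (simp add: card_tuples)

lemma ample_ex:
  assumes "ample V q \<alpha> P" "\<alpha> > 0" "finite V" "V \<noteq> {}"
  shows "\<exists>x\<in>tuples V q. P x"
proof -
  have "0 < \<alpha> * real (card V) ^ q" using assms by (simp add: card_gt_0_iff)
  then have "card {x \<in> tuples V q. P x} > 0" using assms(1) unfolding ample_def by linarith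
  then have "{x \<in> tuples V q. P x} \<noteq> {}" by (metis card.empty less_irrefl)
  then show ?thesis by blast
qed

text \<open>Fubini. The second property may depend on the tuple already chosen, which is how walks
  are built piece by piece.\<close>

lemma ample_append:
  assumes P: "ample V p \<alpha> P" and Q: "\<And>x. x \<in> tuples V p \<Longrightarrow> P x \<Longrightarrow> ample V q \<beta> (Q x)"
    and "\<beta> \<ge> 0" "finite V"
  shows "ample V (p + q) (\<alpha> * \<beta>) (\<lambda>z. P (take p z) \<and> Q (take p z) (drop p z))"
proof -
  let ?A = "{x \<in> tuples V p. P x}" and ?B = "\<lambda>x. {y \<in> tuples V q. Q x y}"
  let ?C = "{z \<in> tuples V (p + q). P (take p z) \<and> Q (take p z) (drop p z)}"
  have "\<alpha> * \<beta> * real (card V) ^ (p + q) = (\<alpha> * real (card V) ^ p) * (\<beta> * real (card V) ^ q)"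
    by (simp add: power_add)
  also have "\<dots> \<le> real (card ?A) * (\<beta> * real (card V) ^ q)"
    using P assms(3) unfolding ample_def by (intro mult_right_mono) auto
  also have "\<dots> = (\<Sum>x\<in>?A. \<beta> * real (card V) ^ q)" by simp
  also have "\<dots> \<le> (\<Sum>x\<in>?A. real (card (?B x)))"
    using Q unfolding ample_def by (intro sum_mono) auto
  also have "\<dots> = real (card (Sigma ?A ?B))" using assms(4) by (subst card_SigmaI) auto
  also have "card (Sigma ?A ?B) \<le> card ?C"
  proof (rule card_inj_on_le[where f = "\<lambda>(x, y). x @ y"])
    show "inj_on (\<lambda>(x, y). x @ y) (Sigma ?A ?B)" by (auto simp: inj_on_def tuples_def)
    show "(\<lambda>(x, y). x @ y) ` Sigma ?A ?B \<subseteq> ?C" by (auto simp: tuples_def)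
    show "finite ?C" using assms(4) by simp
  qed
  finally show ?thesis unfolding ample_def by simp
qed

lemma ample_diff:
  assumes "ample V q \<alpha> P" "finite V"
    and "real (card {x \<in> tuples V q. B x}) \<le> \<beta> * real (card V) ^ q"
  shows "ample V q (\<alpha> - \<beta>) (\<lambda>x. P x \<and> \<not> B x)"
proof -
  have "{x \<in> tuples V q. P x} \<subseteq> {x \<in> tuples V q. P x \<and> \<not> B x} \<union> {x \<in> tuples V q. B x}" by auto
  then have "card {x \<in> tuples V q. P x} \<le> card ({x \<in> tuples V q. P x \<and> \<not> B x} \<union> {x \<in> tuples V q. B x})"
    using assms(2) by (intro card_mono) auto
  also have "\<dots> \<le> card {x \<in> tuples V q. P x \<and> \<not> B x} + card {x \<in> tuples V q. B x}" by (rule card_Un_le)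
  finally show ?thesis using assms unfolding ample_def by (simp add: left_diff_distrib)
qed

lemma power_pred_le:
  assumes "c \<le> \<beta> * n" "q > 0" "n \<ge> (0::real)" shows "c * n ^ (q - 1) \<le> \<beta> * n ^ q"
proof -
  obtain q' where "q = Suc q'" using assms(2) by (cases q) auto
  then show ?thesis using mult_right_mono[OF assms(1), of "n ^ q'"] assms(3) by (simp add: mult_ac)
qed

lemma ample_avoid:
  assumes "ample V q \<alpha> P" "finite V" "finite F" "real (q * card F) \<le> \<beta> * real (card V)" "0 \<le> \<beta>"
  shows "ample V q (\<alpha> - \<beta>) (\<lambda>x. P x \<and> set x \<inter> F = {})"
proof -
  have "real (card {x \<in> tuples V q. set x \<inter> F \<noteq> {}}) \<le> real (q * card F * card V ^ (q - 1))"
    using card_hitting_tuples[OF assms(2,3)] by (simp only: of_nat_le_iff)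
  also have "\<dots> = real (q * card F) * real (card V) ^ (q - 1)" by simp
  also have "\<dots> \<le> \<beta> * real (card V) ^ q"
  proof (cases "q = 0")
    case False
    then show ?thesis using assms(4) by (intro power_pred_le) auto
  qed (use assms in auto)
  finally show ?thesis using ample_diff[OF assms(1,2), of "\<lambda>x. set x \<inter> F \<noteq> {}" \<beta>] by simp
qed

lemma ample_distinct:
  assumes "ample V q \<alpha> P" "finite V" "real (q * q) \<le> \<beta> * real (card V)" "0 \<le> \<beta>"
  shows "ample V q (\<alpha> - \<beta>) (\<lambda>x. P x \<and> distinct x)"
proof -
  have "real (card {x \<in> tuples V q. \<not> distinct x}) \<le> real (q * q * card V ^ (q - 1))"
    using card_nondistinct_tuples[OF assms(2)] by (simp only: of_nat_le_iff)
  also have "\<dots> = real (q * q) * real (card V) ^ (q - 1)" by simp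
  also have "\<dots> \<le> \<beta> * real (card V) ^ q"
  proof (cases "q = 0")
    case False
    then show ?thesis using assms(3) by (intro power_pred_le) auto
  qed (use assms in auto)
  finally show ?thesis using ample_diff[OF assms(1,2), of "\<lambda>x. \<not> distinct x" \<beta>] by simp
qed

lemma ample_rev:
  assumes "ample V q \<alpha> P" "finite V" shows "ample V q \<alpha> (\<lambda>x. P (rev x))"
proof -
  have "card {x \<in> tuples V q. P x} \<le> card {x \<in> tuples V q. P (rev x)}"
  proof (rule card_inj_on_le[of rev])
    show "finite {x \<in> tuples V q. P (rev x)}" using assms(2) by simp
  qed (auto simp: tuples_def)
  then show ?thesis using assms(1) unfolding ample_def by linarith
qed

text \<open>Serves to fix one combinatorial pattern when every good tuple realises one of boundedly
  many.\<close>

lemma ample_pigeonhole: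
  assumes "ample V q \<alpha> (\<lambda>x. \<exists>c\<in>C. P c x)" "finite V" "finite C" "C \<noteq> {}"
  shows "\<exists>c\<in>C. ample V q (\<alpha> / real (card C)) (P c)"
proof (rule ccontr)
  assume "\<not> ?thesis"
  then have lt: "real (card {x \<in> tuples V q. P c x}) < \<alpha> / real (card C) * real (card V) ^ q" if "c \<in> C" for c
    using that unfolding ample_def by auto
  have "{x \<in> tuples V q. \<exists>c\<in>C. P c x} = (\<Union>c\<in>C. {x \<in> tuples V q. P c x})" by auto
  then have "real (card {x \<in> tuples V q. \<exists>c\<in>C. P c x}) \<le> real (\<Sum>c\<in>C. card {x \<in> tuples V q. P c x})"
    using card_UN_le[OF assms(3), of "\<lambda>c. {x \<in> tuples V q. P c x}"] by (simp only: of_nat_le_iff)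
  also have "\<dots> = (\<Sum>c\<in>C. real (card {x \<in> tuples V q. P c x}))" by simp
  also have "\<dots> < (\<Sum>c\<in>C. \<alpha> / real (card C) * real (card V) ^ q)"
    using lt assms by (intro sum_strict_mono) auto
  also have "\<dots> = \<alpha> * real (card V) ^ q" using assms by simp
  finally show False using assms(1) unfolding ample_def by simp
qed

subsection \<open>Cloning coordinates\<close>

text \<open>Entry \<open>i\<close> of the clone list stands for coordinate \<open>\<pi> ! i\<close>; a new clone is added in front by
  requiring both the old tuple and the tuple overwritten by the clone to survive, so that the
  density is squared by Cauchy--Schwarz.\<close>
primrec clones :: "'a set \<Rightarrow> 'a list set \<Rightarrow> nat list \<Rightarrow> ('a list \<times> 'a list) set" where
  "clones V T [] = T \<times> {[]}"
| "clones V T (i # \<pi>) = {(f, y). \<exists>v z. y = v # z \<and> v \<in> V \<and> (f, z) \<in> clones V T \<pi> \<and> (f[i := v], z) \<in> clones V T \<pi>}"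

lemma clones_subset: "T \<subseteq> tuples V N \<Longrightarrow> clones V T \<pi> \<subseteq> tuples V N \<times> tuples V (length \<pi>)"
proof (induction \<pi>)
  case (Cons i \<pi>)
  then show ?case unfolding tuples_def by fastforce
qed (auto simp: tuples_def)

text \<open>Induction on the clone list. If the newest clone belongs to \<open>W\<close>, the
  overwritten tuple \<open>f[i := v]\<close> is followed, and \<open>v\<close> survives because no
  other member of \<open>W\<close> stands for coordinate \<open>i\<close>; otherwise
  \<open>f\<close> itself is followed. The second conclusion, that coordinates not represented in
  \<open>W\<close> keep the values of \<open>f\<close>, is what carries \<open>v\<close>
  along.\<close>

lemma clones_agree:
  assumes "T \<subseteq> tuples V N"
  shows "(f, y) \<in> clones V T \<pi> \<Longrightarrow> W \<subseteq> {..<length \<pi>} \<Longrightarrow> inj_on ((!) \<pi>) W \<Longrightarrow> set \<pi> \<subseteq> {..<N} \<Longrightarrow>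
    \<exists>g\<in>T. (\<forall>p\<in>W. g ! (\<pi> ! p) = y ! p) \<and> (\<forall>j<N. j \<notin> (!) \<pi> ` W \<longrightarrow> g ! j = f ! j)"
proof (induction \<pi> arbitrary: f y W)
  case Nil
  then show ?case by auto
next
  case (Cons i \<pi>)
  obtain v z where y: "y = v # z" and z1: "(f, z) \<in> clones V T \<pi>" and z2: "(f[i := v], z) \<in> clones V T \<pi>"
    using Cons.prems(1) by auto
  define W' where "W' = {p. Suc p \<in> W}"
  have W': "W' \<subseteq> {..<length \<pi>}" using Cons.prems(2) unfolding W'_def by auto
  have inj': "inj_on ((!) \<pi>) W'"
  proof (rule inj_onI)
    fix p q assume "p \<in> W'" "q \<in> W'" "\<pi> ! p = \<pi> ! q"
    then have "Suc p = Suc q" using Cons.prems(3) unfolding W'_def inj_on_def by fastforce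
    then show "p = q" by simp
  qed
  have fN: "length f = N" using clones_subset[OF assms] z1 unfolding tuples_def by auto
  have i: "i < N" and pi: "set \<pi> \<subseteq> {..<N}" using Cons.prems(4) by auto
  show ?case
  proof (cases "0 \<in> W")
    case True
    obtain g where g: "g \<in> T" "\<forall>p\<in>W'. g ! (\<pi> ! p) = z ! p"
      "\<forall>j<N. j \<notin> (!) \<pi> ` W' \<longrightarrow> g ! j = f[i := v] ! j"
      using Cons.IH[OF z2 W' inj' pi] by auto
    have ni: "i \<notin> (!) \<pi> ` W'"
      using Cons.prems(3) True unfolding W'_def inj_on_def by force
    have "g ! i = v" using g(3) ni i fN by simp
    then have "\<forall>p\<in>W. g ! ((i # \<pi>) ! p) = y ! p"
      using g(2) unfolding y W'_def by (auto simp: nth_Cons split: nat.splits)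
    moreover have "g ! j = f ! j" if "j < N" "j \<notin> (!) (i # \<pi>) ` W" for j
    proof -
      have "j \<noteq> i" using that(2) True by (metis imageI nth_Cons_0)
      moreover have "j \<notin> (!) \<pi> ` W'"
        using that(2) unfolding W'_def by (metis (mono_tags, lifting) image_iff mem_Collect_eq nth_Cons_Suc)
      ultimately show ?thesis using g(3) that(1) by simp
    qed
    ultimately show ?thesis using g(1) by blast
  next
    case False
    obtain g where g: "g \<in> T" "\<forall>p\<in>W'. g ! (\<pi> ! p) = z ! p"
      "\<forall>j<N. j \<notin> (!) \<pi> ` W' \<longrightarrow> g ! j = f ! j"
      using Cons.IH[OF z1 W' inj' pi] by auto
    have W: "W = Suc ` W'"
    proof -
      have "x \<in> Suc ` W'" if "x \<in> W" for x
        using that False unfolding W'_def by (cases x) auto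
      then show ?thesis unfolding W'_def by auto
    qed
    have "\<forall>p\<in>W. g ! ((i # \<pi>) ! p) = y ! p" using g(2) unfolding W y by simp
    moreover have "(!) (i # \<pi>) ` W = (!) \<pi> ` W'" unfolding W by (auto simp: image_iff)
    ultimately show ?thesis using g by auto
  qed
qed

text \<open>Two members of the clone set that agree outside coordinate \<open>i\<close> amount to
  one member with an additional clone. By \<open>card_collision_ge\<close> their number is at least
  the square of the old number divided by the number of keys, so every clone squares the proportion;
  hence the exponent \<open>2 ^ length \<pi>\<close>.\<close>

lemma card_clones:
  assumes V: "finite V" "V \<noteq> {}" and T: "T \<subseteq> tuples V N" and \<rho>: "0 \<le> \<rho>" "\<rho> * real (card V) ^ N \<le> real (card T)"
  shows "set \<pi> \<subseteq> {..<N} \<Longrightarrow>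
    \<rho> ^ (2 ^ length \<pi>) * real (card V) ^ (N + length \<pi>) \<le> real (card (clones V T \<pi>))"
proof (induction \<pi>)
  case Nil
  then show ?case using \<rho> by (simp add: card_cartesian_product)
next
  case (Cons i \<pi>)
  let ?Z = "clones V T \<pi>" and ?q = "length \<pi>" and ?n = "real (card V)"
  have n0: "?n > 0" using V by (simp add: card_gt_0_iff)
  have iN: "i < N" using Cons.prems by simp
  have sub: "?Z \<subseteq> tuples V N \<times> tuples V ?q" using clones_subset[OF T] .
  have fin: "finite ?Z" using sub V by (meson finite_SigmaI finite_subset finite_tuples)
  \<comment> \<open>A fibre consists of tuples that differ in coordinate \<open>i\<close> only; the
    existing clones \<open>z\<close> belong to the key and stay fixed.\<close>
  define key where "key = (\<lambda>(f :: 'a list, z :: 'a list). (del_nth i f, z))"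
  define K where "K = tuples V (N - 1) \<times> tuples V ?q"
  have finK: "finite K" unfolding K_def using V by auto
  have keyK: "key ` ?Z \<subseteq> K" unfolding key_def K_def using sub del_nth_tuples[OF _ iN] by fastforce
  define P where "P = {(a, b) \<in> ?Z \<times> ?Z. key a = key b}"
  have "(card ?Z)\<^sup>2 \<le> card K * card P"
    unfolding P_def using card_collision_ge[OF fin finK keyK] .
  moreover have "card P \<le> card (clones V T (i # \<pi>))"
  proof (rule card_inj_on_le[where f = "\<lambda>(a, b). (fst a, fst b ! i # snd a)"])
    show "inj_on (\<lambda>(a, b). (fst a, fst b ! i # snd a)) P"
    proof (rule inj_onI)
      fix a b assume ab: "a \<in> P" "b \<in> P"
        and e: "(\<lambda>(a, b). (fst a, fst b ! i # snd a)) a = (\<lambda>(a, b). (fst a, fst b ! i # snd a)) b"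
      obtain f z f' z' where a: "a = ((f, z), (f', z'))" by (metis prod.collapse)
      obtain g y g' y' where b: "b = ((g, y), (g', y'))" by (metis prod.collapse)
      have "f = g" "z = y" "f' ! i = g' ! i" using e unfolding a b by auto
      moreover have "z' = z" "y' = y" "del_nth i f' = del_nth i f" "del_nth i g' = del_nth i g"
        using ab unfolding P_def key_def a b by auto
      moreover have "length f' = N" "length g' = N"
        using ab sub unfolding P_def tuples_def a b by auto
      ultimately show "a = b"
        using del_nth_inj[of f' g' i] iN unfolding a b by simp
    qed
    show "(\<lambda>(a, b). (fst a, fst b ! i # snd a)) ` P \<subseteq> clones V T (i # \<pi>)"
    proof clarify
      fix f z f' z' assume h: "((f, z), (f', z')) \<in> P"
      then have z: "(f, z) \<in> ?Z" "(f', z') \<in> ?Z" "z' = z" "del_nth i f = del_nth i f'"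
        unfolding P_def key_def by auto
      then have len: "length f = N" "length f' = N" "set f' \<subseteq> V" using sub unfolding tuples_def by auto
      then have "f' = f[i := f' ! i]" using z(4) iN by (intro del_nth_eq_update) auto
      moreover have "f' ! i \<in> V" using len iN by auto
      ultimately have "(f, f' ! i # z) \<in> clones V T (i # \<pi>)"
        using z unfolding clones.simps by (metis (mono_tags, lifting) case_prodI mem_Collect_eq)
      then show "(fst (f, z), fst (f', z') ! i # snd (f, z)) \<in> clones V T (i # \<pi>)" by simp
    qed
    show "finite (clones V T (i # \<pi>))"
      using clones_subset[OF T, of "i # \<pi>"] V by (meson finite_SigmaI finite_subset finite_tuples)
  qed
  ultimately have "(card ?Z)\<^sup>2 \<le> card K * card (clones V T (i # \<pi>))"
    by (meson le_trans mult_le_mono2)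
  then have "real ((card ?Z)\<^sup>2) \<le> real (card K * card (clones V T (i # \<pi>)))"
    by (simp only: of_nat_le_iff)
  then have le: "(real (card ?Z))\<^sup>2 \<le> ?n ^ (N - 1 + ?q) * real (card (clones V T (i # \<pi>)))"
    unfolding K_def using V by (simp add: card_cartesian_product card_tuples power_add)
  have h1: "(\<rho> ^ (2 ^ ?q) * ?n ^ (N + ?q))\<^sup>2 \<le> (real (card ?Z))\<^sup>2"
    using Cons \<rho>(1) by (intro power_mono) auto
  have h2: "(\<rho> ^ (2 ^ ?q) * ?n ^ (N + ?q))\<^sup>2 = \<rho> ^ (2 ^ Suc ?q) * ?n ^ (N + Suc ?q) * ?n ^ (N - 1 + ?q)"
  proof -
    have e1: "?n ^ (N + ?q) * ?n ^ (N + ?q) = ?n ^ (N + Suc ?q) * ?n ^ (N - 1 + ?q)"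
      unfolding power_add[symmetric] using iN by (intro arg_cong2[of _ _ _ _ "(^)"]) auto
    have e2: "(\<rho> ^ 2 ^ ?q)\<^sup>2 = \<rho> ^ 2 ^ Suc ?q" by (simp add: power_mult[symmetric] mult.commute)
    have "(\<rho> ^ (2 ^ ?q) * ?n ^ (N + ?q))\<^sup>2 = (\<rho> ^ 2 ^ ?q)\<^sup>2 * (?n ^ (N + ?q) * ?n ^ (N + ?q))"
      by (simp only: power2_eq_square mult_ac)
    also have "\<dots> = \<rho> ^ 2 ^ Suc ?q * (?n ^ (N + Suc ?q) * ?n ^ (N - 1 + ?q))" by (simp only: e1 e2)
    finally show ?thesis by (simp only: mult.assoc)
  qed
  have "\<rho> ^ (2 ^ Suc ?q) * ?n ^ (N + Suc ?q) * ?n ^ (N - 1 + ?q)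
    \<le> real (card (clones V T (i # \<pi>))) * ?n ^ (N - 1 + ?q)"
    using order_trans[OF h1 le] unfolding h2 by (subst (2) mult.commute)
  then have "\<rho> ^ (2 ^ Suc ?q) * ?n ^ (N + Suc ?q) \<le> real (card (clones V T (i # \<pi>)))"
    by (rule mult_right_le_imp_le) (use n0 in simp)
  then show ?case by (simp only: length_Cons)
qed

text \<open>The base tuple is projected away: a list of clones has at most \<open>card V ^ N\<close>
  base tuples, so the proportion does not drop. What remains are the clones, which can be made
  distinct even where they stand for the same coordinate.\<close>

lemma ample_clones:
  assumes V: "finite V" "V \<noteq> {}" and P: "ample V N \<rho> P" "0 \<le> \<rho>" and \<pi>: "set \<pi> \<subseteq> {..<N}"
  shows "ample V (length \<pi>) (\<rho> ^ 2 ^ length \<pi>)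
    (\<lambda>y. \<forall>W\<subseteq>{..<length \<pi>}. inj_on ((!) \<pi>) W \<longrightarrow> (\<exists>f\<in>tuples V N. P f \<and> (\<forall>p\<in>W. f ! (\<pi> ! p) = y ! p)))"
    (is "ample V ?q ?\<rho> ?P")
proof -
  let ?n = "real (card V)"
  define T where "T = {x \<in> tuples V N. P x}"
  have T: "T \<subseteq> tuples V N" unfolding T_def by auto
  have n0: "?n > 0" using V by (simp add: card_gt_0_iff)
  have c: "?\<rho> * ?n ^ (N + ?q) \<le> real (card (clones V T \<pi>))"
    using card_clones[OF V T P(2) _ \<pi>] P(1) unfolding ample_def T_def by simp
  have "clones V T \<pi> \<subseteq> tuples V N \<times> {y \<in> tuples V ?q. ?P y}"
  proof clarify
    fix f y assume fy: "(f, y) \<in> clones V T \<pi>"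
    then have "f \<in> tuples V N" "y \<in> tuples V ?q" using clones_subset[OF T] by blast+
    moreover have "?P y" using clones_agree[OF T fy _ _ \<pi>] unfolding T_def by blast
    ultimately show "f \<in> tuples V N \<and> y \<in> {y \<in> tuples V ?q. ?P y}" by blast
  qed
  then have "card (clones V T \<pi>) \<le> card (tuples V N \<times> {y \<in> tuples V ?q. ?P y})"
    using V(1) by (intro card_mono finite_cartesian_product) auto
  then have "real (card (clones V T \<pi>)) \<le> real (card (tuples V N \<times> {y \<in> tuples V ?q. ?P y}))"
    by (simp only: of_nat_le_iff)
  also have "\<dots> = ?n ^ N * real (card {y \<in> tuples V ?q. ?P y})"
    using V(1) by (simp add: card_cartesian_product card_tuples)
  finally have "?n ^ N * (?\<rho> * ?n ^ ?q) \<le> ?n ^ N * real (card {y \<in> tuples V ?q. ?P y})"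
    using c by (simp add: power_add mult_ac)
  then show ?thesis unfolding ample_def using n0 by simp
qed

subsection \<open>Bounded differences\<close>

text \<open>Chosen so that the linear term cancels when summed over centred values; what remains is
  a subgaussian bound.\<close>

lemma exp_le_add_exp_sq: "exp x \<le> x + exp (x\<^sup>2)" for x :: real
proof -
  have sq: "1 + x\<^sup>2 \<le> exp (x\<^sup>2)" by (rule exp_ge_add_one_self)
  consider "x \<ge> 1" | "0 \<le> x" "x \<le> 1" | "x < 0" by linarith
  then show ?thesis
  proof cases
    case 1
    then have "x \<le> x\<^sup>2" by (simp add: power2_eq_square)
    then show ?thesis using 1 by (smt (verit) exp_le_cancel_iff)
  next
    case 2
    then show ?thesis using exp_bound[of x] sq by linarith
  next
    case 3
    define y where "y = - x"
    have y: "y > 0" using 3 unfolding y_def by simp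
    have "1 \<le> (1 + y) * (1 - y + y\<^sup>2)" using y by (simp add: algebra_simps power2_eq_square)
    also have "\<dots> \<le> exp y * (1 - y + y\<^sup>2)"
    proof (rule mult_right_mono)
      show "1 + y \<le> exp y" by (rule exp_ge_add_one_self)
      have "0 \<le> (y - 1/2)\<^sup>2" by simp
      then show "0 \<le> 1 - y + y\<^sup>2" by (simp add: power2_eq_square algebra_simps)
    qed
    finally have "exp (- y) \<le> 1 - y + y\<^sup>2" by (simp add: exp_minus field_simps)
    then have "exp x \<le> 1 + x + x\<^sup>2" unfolding y_def by simp
    then show ?thesis using sq by linarith
  qed
qed

lemma sum_exp_centered_le:
  fixes a :: "'a \<Rightarrow> real"
  assumes "finite V" "(\<Sum>v\<in>V. a v) = 0" "\<And>v. v \<in> V \<Longrightarrow> \<bar>a v\<bar> \<le> c"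
  shows "(\<Sum>v\<in>V. exp (\<theta> * a v)) \<le> real (card V) * exp (\<theta>\<^sup>2 * c\<^sup>2)"
proof -
  have "exp (\<theta> * a v) \<le> \<theta> * a v + exp (\<theta>\<^sup>2 * c\<^sup>2)" if "v \<in> V" for v
  proof -
    have "(a v)\<^sup>2 \<le> c\<^sup>2" using assms(3)[OF that] by (metis abs_ge_zero power2_abs power_mono)
    then have "(\<theta> * a v)\<^sup>2 \<le> \<theta>\<^sup>2 * c\<^sup>2" by (simp add: power_mult_distrib mult_left_mono)
    then have "exp ((\<theta> * a v)\<^sup>2) \<le> exp (\<theta>\<^sup>2 * c\<^sup>2)" by simp
    then show ?thesis using exp_le_add_exp_sq[of "\<theta> * a v"] by linarith
  qed
  then have "(\<Sum>v\<in>V. exp (\<theta> * a v)) \<le> (\<Sum>v\<in>V. \<theta> * a v + exp (\<theta>\<^sup>2 * c\<^sup>2))" by (rule sum_mono)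
  also have "\<dots> = \<theta> * (\<Sum>v\<in>V. a v) + real (card V) * exp (\<theta>\<^sup>2 * c\<^sup>2)"
    by (simp add: sum.distrib sum_distrib_left)
  finally show ?thesis using assms(2) by simp
qed

text \<open>The coordinates are exposed one at a time: \<open>A v\<close> is the conditional mean
  given the first entry, it deviates from the overall mean \<open>M\<close> by at most
  \<open>c\<close>, and the induction hypothesis applies to \<open>F\<close> with the first entry
  fixed.\<close>

lemma bounded_differences_mgf:
  fixes F :: "'a list \<Rightarrow> real"
  assumes V: "finite V" "V \<noteq> {}"
  shows "(\<And>xs i v. xs \<in> tuples V q \<Longrightarrow> i < q \<Longrightarrow> v \<in> V \<Longrightarrow> \<bar>F (xs[i := v]) - F xs\<bar> \<le> c) \<Longrightarrow>
    (\<Sum>xs\<in>tuples V q. exp (\<theta> * (F xs - (\<Sum>xs\<in>tuples V q. F xs) / real (card V) ^ q)))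
      \<le> real (card V) ^ q * exp (\<theta>\<^sup>2 * c\<^sup>2 * real q)"
proof (induction q arbitrary: F)
  case 0
  then show ?case by simp
next
  case (Suc q)
  let ?n = "real (card V)"
  have n0: "?n > 0" using V by (simp add: card_gt_0_iff)
  define A where "A v = (\<Sum>xs\<in>tuples V q. F (v # xs)) / ?n ^ q" for v
  define M where "M = (\<Sum>xs\<in>tuples V (Suc q). F xs) / ?n ^ Suc q"
  have M: "M = (\<Sum>v\<in>V. A v) / ?n"
    unfolding M_def A_def sum_tuples_Suc by (simp add: sum_divide_distrib mult.commute)
  have IH: "(\<Sum>xs\<in>tuples V q. exp (\<theta> * (F (v # xs) - A v))) \<le> ?n ^ q * exp (\<theta>\<^sup>2 * c\<^sup>2 * real q)" if "v \<in> V" for v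
    unfolding A_def
  proof (rule Suc.IH)
    fix xs i w assume "xs \<in> tuples V q" "i < q" "w \<in> V"
    then have "\<bar>F ((v # xs)[Suc i := w]) - F (v # xs)\<bar> \<le> c"
      using that by (intro Suc.prems) (auto simp: tuples_def)
    then show "\<bar>F (v # xs[i := w]) - F (v # xs)\<bar> \<le> c" by simp
  qed
  have dA: "\<bar>A v - A w\<bar> \<le> c" if "v \<in> V" "w \<in> V" for v w
  proof -
    have "\<bar>A v - A w\<bar> = \<bar>\<Sum>xs\<in>tuples V q. F (v # xs) - F (w # xs)\<bar> / ?n ^ q"
      unfolding A_def using n0 by (simp add: sum_subtractf diff_divide_distrib[symmetric])
    also have "\<dots> \<le> (\<Sum>xs\<in>tuples V q. \<bar>F (v # xs) - F (w # xs)\<bar>) / ?n ^ q"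
      using n0 by (intro divide_right_mono sum_abs) auto
    also have "\<dots> \<le> (\<Sum>xs\<in>tuples V q. c) / ?n ^ q"
    proof (intro divide_right_mono sum_mono)
      fix xs assume "xs \<in> tuples V q"
      then have "\<bar>F ((w # xs)[0 := v]) - F (w # xs)\<bar> \<le> c"
        using that by (intro Suc.prems) (auto simp: tuples_def)
      then show "\<bar>F (v # xs) - F (w # xs)\<bar> \<le> c" by simp
    qed (use n0 in auto)
    also have "\<dots> = c" using n0 V by (simp add: card_tuples)
    finally show ?thesis .
  qed
  have dM: "\<bar>A v - M\<bar> \<le> c" if "v \<in> V" for v
  proof -
    have "A v - M = (\<Sum>w\<in>V. A v - A w) / ?n"
      unfolding M using n0 by (simp add: sum_subtractf field_simps)
    then have "\<bar>A v - M\<bar> = \<bar>\<Sum>w\<in>V. A v - A w\<bar> / ?n" using n0 by simp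
    also have "\<dots> \<le> (\<Sum>w\<in>V. \<bar>A v - A w\<bar>) / ?n"
      using n0 by (intro divide_right_mono sum_abs) auto
    also have "\<dots> \<le> (\<Sum>w\<in>V. c) / ?n" using dA that n0 by (intro divide_right_mono sum_mono) auto
    finally show ?thesis using n0 by simp
  qed
  have s0: "(\<Sum>v\<in>V. A v - M) = 0" unfolding M using n0 by (simp add: sum_subtractf)
  have "(\<Sum>xs\<in>tuples V (Suc q). exp (\<theta> * (F xs - M)))
    = (\<Sum>v\<in>V. exp (\<theta> * (A v - M)) * (\<Sum>xs\<in>tuples V q. exp (\<theta> * (F (v # xs) - A v))))"
    unfolding sum_tuples_Suc sum_distrib_left by (simp add: exp_add[symmetric] algebra_simps)
  also have "\<dots> \<le> (\<Sum>v\<in>V. exp (\<theta> * (A v - M)) * (?n ^ q * exp (\<theta>\<^sup>2 * c\<^sup>2 * real q)))"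
    using IH by (intro sum_mono mult_left_mono) auto
  also have "\<dots> = (\<Sum>v\<in>V. exp (\<theta> * (A v - M))) * (?n ^ q * exp (\<theta>\<^sup>2 * c\<^sup>2 * real q))"
    by (simp add: sum_distrib_right)
  also have "\<dots> \<le> (?n * exp (\<theta>\<^sup>2 * c\<^sup>2)) * (?n ^ q * exp (\<theta>\<^sup>2 * c\<^sup>2 * real q))"
    using sum_exp_centered_le[OF V(1) s0 dM] n0 by (intro mult_right_mono) auto
  also have "\<dots> = ?n ^ Suc q * exp (\<theta>\<^sup>2 * c\<^sup>2 * real (Suc q))"
    by (simp add: exp_add[symmetric] algebra_simps)
  finally show ?case unfolding M_def .
qed

lemma bounded_differences_tail:
  fixes F :: "'a list \<Rightarrow> real"
  assumes V: "finite V" "V \<noteq> {}" and q: "q > 0" and c: "c > 0"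
    and bd: "\<And>xs i v. xs \<in> tuples V q \<Longrightarrow> i < q \<Longrightarrow> v \<in> V \<Longrightarrow> \<bar>F (xs[i := v]) - F xs\<bar> \<le> c"
    and mean: "m * real (card V) ^ q \<le> (\<Sum>xs\<in>tuples V q. F xs)" and t: "t \<ge> 0"
  shows "real (card {xs \<in> tuples V q. F xs \<le> m - t}) \<le> real (card V) ^ q * exp (- t\<^sup>2 / (4 * real q * c\<^sup>2))"
proof -
  let ?n = "real (card V)"
  have n0: "?n > 0" using V by (simp add: card_gt_0_iff)
  define A where "A = (\<Sum>xs\<in>tuples V q. F xs) / ?n ^ q"
  have mA: "m \<le> A" using mean n0 unfolding A_def by (simp add: field_simps)
  \<comment> \<open>Negative because the lower tail is wanted; this value minimises
    \<open>\<theta> * t + \<theta>\<^sup>2 * c\<^sup>2 * q\<close>.\<close>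
  define \<theta> where "\<theta> = - t / (2 * real q * c\<^sup>2)"
  define B where "B = {xs \<in> tuples V q. F xs \<le> m - t}"
  have ge: "exp (t\<^sup>2 / (2 * real q * c\<^sup>2)) \<le> exp (\<theta> * (F xs - A))" if "xs \<in> B" for xs
  proof -
    have "F xs - A \<le> - t" using that mA unfolding B_def by simp
    moreover have "\<theta> \<le> 0" unfolding \<theta>_def using t q c by (simp add: divide_nonneg_pos)
    ultimately have "\<theta> * (- t) \<le> \<theta> * (F xs - A)" by (rule mult_left_mono_neg)
    then show ?thesis unfolding \<theta>_def by (simp add: power2_eq_square)
  qed
  have "real (card B) * exp (t\<^sup>2 / (2 * real q * c\<^sup>2)) = (\<Sum>xs\<in>B. exp (t\<^sup>2 / (2 * real q * c\<^sup>2)))" by simp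
  also have "\<dots> \<le> (\<Sum>xs\<in>B. exp (\<theta> * (F xs - A)))" using ge by (rule sum_mono)
  also have "\<dots> \<le> (\<Sum>xs\<in>tuples V q. exp (\<theta> * (F xs - A)))"
    using V unfolding B_def by (intro sum_mono2) auto
  also have "\<dots> \<le> ?n ^ q * exp (\<theta>\<^sup>2 * c\<^sup>2 * real q)"
    unfolding A_def by (intro bounded_differences_mgf V bd)
  also have "\<theta>\<^sup>2 * c\<^sup>2 * real q = t\<^sup>2 / (4 * real q * c\<^sup>2)"
    unfolding \<theta>_def using q c by (simp add: power2_eq_square field_simps)
  also have "?n ^ q * exp (t\<^sup>2 / (4 * real q * c\<^sup>2)) =
      ?n ^ q * exp (- t\<^sup>2 / (4 * real q * c\<^sup>2)) * exp (t\<^sup>2 / (2 * real q * c\<^sup>2))"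
    using q c by (simp add: exp_add[symmetric] mult.assoc field_simps)
  finally show ?thesis unfolding B_def by simp
qed

lemma sum_tuples_coordinate:
  fixes f :: "'a \<Rightarrow> real"
  assumes "finite V"
  shows "i < q \<Longrightarrow> real (card V) * (\<Sum>xs\<in>tuples V q. f (xs ! i)) = real (card V) ^ q * (\<Sum>v\<in>V. f v)"
proof (induction q arbitrary: i)
  case (Suc q)
  show ?case
  proof (cases i)
    case 0
    then show ?thesis using assms by (simp add: sum_tuples_Suc card_tuples sum_distrib_left sum_distrib_right mult_ac)
  next
    case (Suc j)
    then show ?thesis using Suc.IH[of j] Suc.prems by (simp add: sum_tuples_Suc mult_ac)
  qed
qed simp

lemma sum_tuples_two_coordinates_less:
  fixes f :: "'a \<Rightarrow> 'a \<Rightarrow> real"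
  assumes "finite V"
  shows "i < j \<Longrightarrow> j < q \<Longrightarrow>
    (real (card V))\<^sup>2 * (\<Sum>xs\<in>tuples V q. f (xs ! i) (xs ! j)) = real (card V) ^ q * (\<Sum>v\<in>V. \<Sum>w\<in>V. f v w)"
proof (induction q arbitrary: i j)
  case (Suc q)
  obtain j' where j': "j = Suc j'" using Suc.prems by (cases j) auto
  show ?case
  proof (cases i)
    case 0
    have "(real (card V))\<^sup>2 * (\<Sum>xs\<in>tuples V (Suc q). f (xs ! i) (xs ! j))
      = real (card V) * (\<Sum>v\<in>V. real (card V) * (\<Sum>xs\<in>tuples V q. f v (xs ! j')))"
      using 0 j' by (simp add: sum_tuples_Suc power2_eq_square sum_distrib_left mult_ac)
    also have "\<dots> = real (card V) * (\<Sum>v\<in>V. real (card V) ^ q * (\<Sum>w\<in>V. f v w))"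
      using sum_tuples_coordinate[OF assms] j' Suc.prems by simp
    finally show ?thesis by (simp add: sum_distrib_left mult_ac)
  next
    case (Suc i')
    then show ?thesis using Suc.IH[of i' j'] Suc.prems j' by (simp add: sum_tuples_Suc mult_ac)
  qed
qed simp

lemma sum_tuples_two_coordinates:
  fixes f :: "'a \<Rightarrow> 'a \<Rightarrow> real"
  assumes "finite V" "i < q" "j < q" "i \<noteq> j"
  shows "(real (card V))\<^sup>2 * (\<Sum>xs\<in>tuples V q. f (xs ! i) (xs ! j)) = real (card V) ^ q * (\<Sum>v\<in>V. \<Sum>w\<in>V. f v w)"
proof (cases "i < j")
  case True
  then show ?thesis using sum_tuples_two_coordinates_less[OF assms(1) True assms(3)] by simp
next
  case False
  then have "j < i" using assms by simp
  then show ?thesis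
    using sum_tuples_two_coordinates_less[OF assms(1) _ assms(2), of j "\<lambda>v w. f w v"] sum.swap[of f V V] by simp
qed

text \<open>The relation may depend on the positions. In random sampling the entries are vertices
  and the positions are ignored; in random halving the entries are truth values and the positions
  name the vertices.\<close>

definition pair_count :: "nat \<Rightarrow> (nat \<Rightarrow> nat \<Rightarrow> 'a \<Rightarrow> 'a \<Rightarrow> bool) \<Rightarrow> 'a list \<Rightarrow> nat" where
  "pair_count q G xs = card {(i, j) \<in> {..<q} \<times> {..<q}. i \<noteq> j \<and> G i j (xs ! i) (xs ! j)}"

lemma pair_count_update_le:
  assumes "length xs = q" "i < q"
  shows "pair_count q G (xs[i := v]) \<le> pair_count q G xs + 2 * q"
proof -
  let ?P = "\<lambda>ys. {(a, b) \<in> {..<q} \<times> {..<q}. a \<noteq> b \<and> G a b (ys ! a) (ys ! b)}"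
  have "?P (xs[i := v]) \<subseteq> ?P xs \<union> ({i} \<times> {..<q} \<union> {..<q} \<times> {i})"
    using assms by (auto simp: nth_list_update split: if_splits)
  then have "card (?P (xs[i := v])) \<le> card (?P xs \<union> ({i} \<times> {..<q} \<union> {..<q} \<times> {i}))"
    by (intro card_mono) (auto intro: finite_subset[of _ "{..<q} \<times> {..<q}"])
  also have "\<dots> \<le> card (?P xs) + (card ({i} \<times> {..<q}) + card ({..<q} \<times> {i}))"
    by (meson add_left_mono card_Un_le order_trans)
  finally show ?thesis unfolding pair_count_def by (simp add: card_cartesian_product)
qed

text \<open>Two distinct coordinates form a uniform pair, which gives the mean. One coordinate lies
  in at most \<open>2 * q\<close> index pairs, so the difference constant is \<open>2 * q\<close>
  and the exponent has the denominator \<open>4 * q * (2 * q)\<^sup>2\<close>.\<close>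

lemma pair_count_tail:
  assumes V: "finite V" "V \<noteq> {}" and q: "q > 0" and t: "t \<ge> 0"
    and mean: "m * (real (card V))\<^sup>2 \<le> (\<Sum>(i, j)\<in>{(i, j) \<in> {..<q} \<times> {..<q}. i \<noteq> j}. \<Sum>v\<in>V. \<Sum>w\<in>V. of_bool (G i j v w))"
  shows "real (card {xs \<in> tuples V q. real (pair_count q G xs) \<le> m - t})
    \<le> real (card V) ^ q * exp (- t\<^sup>2 / (16 * real q ^ 3))"
proof -
  let ?n = "real (card V)" and ?D = "{(i, j) \<in> {..<q} \<times> {..<q}. i \<noteq> j}"
  have n0: "?n > 0" using V by (simp add: card_gt_0_iff)
  have finD: "finite ?D" by (rule finite_subset[of _ "{..<q} \<times> {..<q}"]) auto
  have pc: "real (pair_count q G xs) = (\<Sum>(i, j)\<in>?D. of_bool (G i j (xs ! i) (xs ! j)))" for xs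
  proof -
    have "{(i, j) \<in> {..<q} \<times> {..<q}. i \<noteq> j \<and> G i j (xs ! i) (xs ! j)} = {p \<in> ?D. case p of (i, j) \<Rightarrow> G i j (xs ! i) (xs ! j)}" by auto
    then have "real (pair_count q G xs) = (\<Sum>p\<in>{p \<in> ?D. case p of (i, j) \<Rightarrow> G i j (xs ! i) (xs ! j)}. 1)"
      unfolding pair_count_def by simp
    also have "\<dots> = (\<Sum>p\<in>?D. if (case p of (i, j) \<Rightarrow> G i j (xs ! i) (xs ! j)) then 1 else 0)"
      using finD by (intro sum.inter_filter)
    also have "\<dots> = (\<Sum>(i, j)\<in>?D. of_bool (G i j (xs ! i) (xs ! j)))"
      by (intro sum.cong) (auto split: prod.splits)
    finally show ?thesis .
  qed
  have "?n\<^sup>2 * (m * ?n ^ q) \<le> ?n ^ q * (\<Sum>(i, j)\<in>?D. \<Sum>v\<in>V. \<Sum>w\<in>V. of_bool (G i j v w))"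
    using mult_left_mono[OF mean, of "?n ^ q"] by (simp add: mult_ac)
  also have "\<dots> = (\<Sum>(i, j)\<in>?D. ?n ^ q * (\<Sum>v\<in>V. \<Sum>w\<in>V. of_bool (G i j v w)))"
    by (simp add: sum_distrib_left case_prod_unfold)
  also have "\<dots> = (\<Sum>(i, j)\<in>?D. ?n\<^sup>2 * (\<Sum>xs\<in>tuples V q. of_bool (G i j (xs ! i) (xs ! j))))"
    by (intro sum.cong refl) (auto simp: sum_tuples_two_coordinates[OF V(1), where f = "\<lambda>v w. of_bool (G _ _ v w)"])
  also have "\<dots> = ?n\<^sup>2 * (\<Sum>(i, j)\<in>?D. \<Sum>xs\<in>tuples V q. of_bool (G i j (xs ! i) (xs ! j)))"
    by (simp add: sum_distrib_left case_prod_unfold)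
  also have "(\<Sum>(i, j)\<in>?D. \<Sum>xs\<in>tuples V q. of_bool (G i j (xs ! i) (xs ! j))) = (\<Sum>xs\<in>tuples V q. real (pair_count q G xs))"
    unfolding pc case_prod_unfold by (rule sum.swap)
  finally have mean': "m * ?n ^ q \<le> (\<Sum>xs\<in>tuples V q. real (pair_count q G xs))" using n0 by simp
  have "real (card {xs \<in> tuples V q. real (pair_count q G xs) \<le> m - t})
    \<le> ?n ^ q * exp (- t\<^sup>2 / (4 * real q * (2 * real q)\<^sup>2))"
  proof (rule bounded_differences_tail[OF V q _ _ mean' t])
    fix xs i v assume h: "xs \<in> tuples V q" "i < q" "v \<in> V"
    have len: "length xs = q" using h unfolding tuples_def by simp
    have "pair_count q G xs \<le> pair_count q G (xs[i := v]) + 2 * q"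
      using pair_count_update_le[of "xs[i := v]" q i G "xs ! i"] len h by simp
    then show "\<bar>real (pair_count q G (xs[i := v])) - real (pair_count q G xs)\<bar> \<le> 2 * real q"
      using pair_count_update_le[OF len h(2), of G v] by linarith
  qed (use q in simp)
  then show ?thesis by (simp add: power2_eq_square power3_eq_cube mult_ac)
qed

lemma ample_conj:
  assumes "ample V q \<alpha> P" "ample V q \<beta> Q" "finite V"
  shows "ample V q (\<alpha> + \<beta> - 1) (\<lambda>x. P x \<and> Q x)"
proof -
  have "real (card {x \<in> tuples V q. \<not> Q x}) = real (card (tuples V q)) - real (card {x \<in> tuples V q. Q x})"
  proof -
    have "{x \<in> tuples V q. \<not> Q x} = tuples V q - {x \<in> tuples V q. Q x}" by auto
    moreover have "card {x \<in> tuples V q. Q x} \<le> card (tuples V q)" using assms(3) by (intro card_mono) auto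
    ultimately show ?thesis using assms(3) by (simp add: card_Diff_subset of_nat_diff)
  qed
  then have "real (card {x \<in> tuples V q. \<not> Q x}) \<le> (1 - \<beta>) * real (card V) ^ q"
    using assms(2,3) unfolding ample_def by (simp add: card_tuples left_diff_distrib)
  then have "ample V q (\<alpha> - (1 - \<beta>)) (\<lambda>x. P x \<and> \<not> \<not> Q x)" by (rule ample_diff[OF assms(1,3)])
  then show ?thesis by (simp add: algebra_simps)
qed

subsection \<open>Dense sets of vertices\<close>

lemma nths_complement_inj:
  "length xs = length ys \<Longrightarrow> nths xs J = nths ys J \<Longrightarrow> nths xs (- J) = nths ys (- J) \<Longrightarrow> xs = ys"
proof (induction xs arbitrary: ys J)
  case (Cons x xs)
  then obtain y zs where ys: "ys = y # zs" "length xs = length zs" by (cases ys) auto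
  have compl: "{j. Suc j \<in> - J} = - {j. Suc j \<in> J}" by auto
  have "x = y \<and> nths xs {j. Suc j \<in> J} = nths zs {j. Suc j \<in> J} \<and> nths xs (- {j. Suc j \<in> J}) = nths zs (- {j. Suc j \<in> J})"
    using Cons.prems(2,3) unfolding ys(1) nths_Cons compl by (cases "0 \<in> J") auto
  then show ?case using Cons.IH[of zs "{j. Suc j \<in> J}"] ys by simp
qed simp

context cycle_params
begin

text \<open>Ordered pairs, so each edge through \<open>T\<close> counts twice. For \<open>T\<close>
  of size \<open>l + r - 2\<close>, degenerate pairs drop out because edges have
  \<open>l + r\<close> elements.\<close>

definition link :: "'a set set \<Rightarrow> 'a set \<Rightarrow> 'a set \<Rightarrow> ('a \<times> 'a) set" where
  "link E V T = {(x, y) \<in> V \<times> V. insert x (insert y T) \<in> E}"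

text \<open>Ordered pairs against \<open>(card V)\<^sup>2\<close> stand in for edges against \<open>card V - (l + r) + 2 choose 2\<close>:
  the two densities differ by lower-order terms only, and this one passes smoothly to subsets.\<close>
definition dense :: "'a set set \<Rightarrow> 'a set \<Rightarrow> real \<Rightarrow> bool" where
  "dense E V \<beta> \<longleftrightarrow> finite V \<and> (\<forall>e\<in>E. card e = l + r) \<and>
     (\<forall>T\<subseteq>V. card T = l + r - 2 \<longrightarrow> \<beta> * (real (card V))\<^sup>2 \<le> real (card (link E V T)))"

lemma denseD:
  "dense E V \<beta> \<Longrightarrow> T \<subseteq> V \<Longrightarrow> card T = l + r - 2 \<Longrightarrow> \<beta> * (real (card V))\<^sup>2 \<le> real (card (link E V T))"
  unfolding dense_def by blast

lemma dense_finite: "dense E V \<beta> \<Longrightarrow> finite V"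
  unfolding dense_def by blast

lemma dense_card: "dense E V \<beta> \<Longrightarrow> e \<in> E \<Longrightarrow> card e = l + r"
  unfolding dense_def by blast

lemma dense_mono: "dense E V \<beta> \<Longrightarrow> \<gamma> \<le> \<beta> \<Longrightarrow> dense E V \<gamma>"
  unfolding dense_def by (meson mult_right_mono order_trans zero_le_power2)

lemma finite_link: "finite V \<Longrightarrow> finite (link E V T)"
  unfolding link_def by (rule finite_subset[of _ "V \<times> V"]) auto

lemma link_distinct:
  assumes "\<And>e. e \<in> E \<Longrightarrow> card e = l + r" "card T = l + r - 2" "finite T" "(x, y) \<in> link E V T"
  shows "x \<noteq> y" "x \<notin> T" "y \<notin> T"
proof -
  have c: "card (insert x (insert y T)) = card T + 2"
    using assms(1,2,4) r_ge2 unfolding link_def by auto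
  show "x \<noteq> y" "x \<notin> T" "y \<notin> T"
    using c assms(3) by (auto simp: card_insert_if split: if_splits)
qed

lemma card_link_ge_pair_count:
  assumes "distinct xs" "set xs \<subseteq> V" "finite V"
  shows "pair_count (length xs) (\<lambda>_ _ u v. (u, v) \<in> link E W T) xs \<le> card (link E V T)"
  unfolding pair_count_def
proof (rule card_inj_on_le[where f = "\<lambda>(i, j). (xs ! i, xs ! j)"])
  show "inj_on (\<lambda>(i, j). (xs ! i, xs ! j)) {(i, j) \<in> {..<length xs} \<times> {..<length xs}. i \<noteq> j \<and> (xs ! i, xs ! j) \<in> link E W T}"
    using assms(1) by (auto simp: inj_on_def nth_eq_iff_index_eq)
  show "(\<lambda>(i, j). (xs ! i, xs ! j)) ` {(i, j) \<in> {..<length xs} \<times> {..<length xs}. i \<noteq> j \<and> (xs ! i, xs ! j) \<in> link E W T} \<subseteq> link E V T"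
    using assms(2) unfolding link_def by (auto simp: subset_iff)
  show "finite (link E V T)" using assms(3) by (rule finite_link)
qed

lemma link_pair_count_tail:
  assumes V: "dense E V \<beta>" "V \<noteq> {}" and T: "T \<subseteq> V" "card T = l + r - 2" and q: "q > 0" and t: "t \<ge> 0"
  shows "real (card {xs \<in> tuples V q. real (pair_count q (\<lambda>_ _ u v. (u, v) \<in> link E V T) xs) \<le> \<beta> * (real q * (real q - 1)) - t})
    \<le> real (card V) ^ q * exp (- t\<^sup>2 / (16 * real q ^ 3))"
proof (rule pair_count_tail[OF dense_finite[OF V(1)] V(2) q t])
  have fin: "finite V" using V dense_finite by blast
  have "(\<Sum>v\<in>V. \<Sum>w\<in>V. of_bool ((v, w) \<in> link E V T)) = (\<Sum>p\<in>V\<times>V. of_bool (p \<in> link E V T) :: real)"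
    by (simp only: sum.cartesian_product case_prod_unfold prod.collapse)
  also have "\<dots> = real (card ((V \<times> V) \<inter> link E V T))" using fin by (simp add: sum.If_cases Int_def of_bool_def)
  also have "(V \<times> V) \<inter> link E V T = link E V T" unfolding link_def by auto
  finally have s: "(\<Sum>v\<in>V. \<Sum>w\<in>V. of_bool ((v, w) \<in> link E V T)) = real (card (link E V T))" .
  let ?D = "{(i, j) \<in> {..<q} \<times> {..<q}. i \<noteq> j}"
  have "?D = {..<q} \<times> {..<q} - (\<lambda>i. (i, i)) ` {..<q}" by auto
  then have "card ?D = q * q - q"
    by (simp add: card_Diff_subset card_image inj_on_def image_subset_iff card_cartesian_product)
  then have D: "real (card ?D) = real q * (real q - 1)" using q by (simp add: of_nat_diff algebra_simps)
  have "\<beta> * (real q * (real q - 1)) * (real (card V))\<^sup>2 = real (card ?D) * (\<beta> * (real (card V))\<^sup>2)"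
    unfolding D by simp
  also have "\<dots> \<le> real (card ?D) * real (card (link E V T))"
    using denseD[OF V(1) T] by (intro mult_left_mono) auto
  also have "\<dots> = (\<Sum>(i, j)\<in>?D. \<Sum>v\<in>V. \<Sum>w\<in>V. of_bool ((v, w) \<in> link E V T))"
    unfolding s by (simp add: case_prod_unfold)
  finally show "\<beta> * (real q * (real q - 1)) * (real (card V))\<^sup>2
    \<le> (\<Sum>(i, j)\<in>?D. \<Sum>v\<in>V. \<Sum>w\<in>V. of_bool ((v, w) \<in> link E V T))" .
qed

text \<open>A uniform sequence of truth values selects a random subset of \<open>V - X\<close>, and
  a pair of vertices survives with probability 1/4. At most \<open>2 * card X * card V\<close>
  ordered pairs touch \<open>X\<close>; they are given up, since \<open>X\<close> will hold end
  tuples that are assigned to the halves by hand.\<close>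

lemma halving_tail:
  assumes V: "dense E V \<beta>" and X: "X \<subseteq> V" and vs: "distinct vs" "set vs = V - X" "vs \<noteq> []"
    and T: "T \<subseteq> V" "card T = l + r - 2" and t: "t \<ge> 0"
  shows "real (card {bs \<in> tuples UNIV (length vs). real (card (link E {vs ! i |i. i < length vs \<and> bs ! i} T))
      \<le> (\<beta> * (real (card V))\<^sup>2 - 2 * real (card X) * real (card V)) / 4 - t})
    \<le> 2 ^ length vs * exp (- t\<^sup>2 / (16 * real (length vs) ^ 3))"
proof -
  let ?q = "length vs" and ?R = "link E V T"
  let ?G = "\<lambda>i j a b. a \<and> b \<and> (vs ! i, vs ! j) \<in> ?R"
  let ?m = "(\<beta> * (real (card V))\<^sup>2 - 2 * real (card X) * real (card V)) / 4"
  let ?D = "{(i, j) \<in> {..<?q} \<times> {..<?q}. i \<noteq> j}"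
  have fin: "finite V" "finite X" using dense_finite[OF V] X finite_subset by auto
  have finD: "finite ?D" by (rule finite_subset[of _ "{..<?q} \<times> {..<?q}"]) auto
  have le: "pair_count ?q ?G bs \<le> card (link E {vs ! i |i. i < ?q \<and> bs ! i} T)" for bs
    unfolding pair_count_def
  proof (rule card_inj_on_le[where f = "\<lambda>(i, j). (vs ! i, vs ! j)"])
    show "inj_on (\<lambda>(i, j). (vs ! i, vs ! j)) {(i, j) \<in> {..<?q} \<times> {..<?q}. i \<noteq> j \<and> ?G i j (bs ! i) (bs ! j)}"
      using vs(1) by (auto simp: inj_on_def nth_eq_iff_index_eq)
    show "(\<lambda>(i, j). (vs ! i, vs ! j)) ` {(i, j) \<in> {..<?q} \<times> {..<?q}. i \<noteq> j \<and> ?G i j (bs ! i) (bs ! j)}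
      \<subseteq> link E {vs ! i |i. i < ?q \<and> bs ! i} T"
      unfolding link_def by auto
    show "finite (link E {vs ! i |i. i < ?q \<and> bs ! i} T)" by (rule finite_link) simp
  qed
  have "?R \<subseteq> (\<lambda>(i, j). (vs ! i, vs ! j)) ` {p \<in> ?D. case p of (i, j) \<Rightarrow> (vs ! i, vs ! j) \<in> ?R} \<union> (X \<times> V \<union> V \<times> X)"
  proof
    fix p assume p: "p \<in> ?R"
    obtain x y where xy: "p = (x, y)" by fastforce
    have V2: "x \<in> V" "y \<in> V" using p xy unfolding link_def by auto
    have "x \<noteq> y" using link_distinct(1)[OF _ T(2)] p xy fin T(1) dense_card[OF V] finite_subset by blast
    show "p \<in> (\<lambda>(i, j). (vs ! i, vs ! j)) ` {p \<in> ?D. case p of (i, j) \<Rightarrow> (vs ! i, vs ! j) \<in> ?R} \<union> (X \<times> V \<union> V \<times> X)"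
    proof (cases "x \<in> X \<or> y \<in> X")
      case False
      then obtain i j where "i < ?q" "j < ?q" "x = vs ! i" "y = vs ! j"
        using V2 vs(2) by (metis DiffI in_set_conv_nth)
      then show ?thesis using p xy \<open>x \<noteq> y\<close> by (intro UnI1 image_eqI[of _ _ "(i, j)"]) auto
    qed (use V2 xy in auto)
  qed
  then have "card ?R \<le> card ((\<lambda>(i, j). (vs ! i, vs ! j)) ` {p \<in> ?D. case p of (i, j) \<Rightarrow> (vs ! i, vs ! j) \<in> ?R} \<union> (X \<times> V \<union> V \<times> X))"
    using fin finD by (intro card_mono) auto
  also have "\<dots> \<le> card {p \<in> ?D. case p of (i, j) \<Rightarrow> (vs ! i, vs ! j) \<in> ?R} + (card (X \<times> V) + card (V \<times> X))"
    using finD by (intro order_trans[OF card_Un_le] add_mono card_Un_le card_image_le) auto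
  finally have "card ?R \<le> card {p \<in> ?D. case p of (i, j) \<Rightarrow> (vs ! i, vs ! j) \<in> ?R} + (card (X \<times> V) + card (V \<times> X))" .
  then have "real (card ?R) \<le> real (card {p \<in> ?D. case p of (i, j) \<Rightarrow> (vs ! i, vs ! j) \<in> ?R} + (card (X \<times> V) + card (V \<times> X)))"
    by (simp only: of_nat_le_iff)
  then have "real (card ?R) \<le> real (card {p \<in> ?D. case p of (i, j) \<Rightarrow> (vs ! i, vs ! j) \<in> ?R}) + 2 * real (card X) * real (card V)"
    unfolding of_nat_add card_cartesian_product of_nat_mult mult.commute[of "real (card V)" "real (card X)"] by linarith
  then have "?m * 4 \<le> real (card {p \<in> ?D. case p of (i, j) \<Rightarrow> (vs ! i, vs ! j) \<in> ?R})"
    using denseD[OF V T] by simp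
  also have "\<dots> = (\<Sum>p\<in>?D. if (case p of (i, j) \<Rightarrow> (vs ! i, vs ! j) \<in> ?R) then 1 else 0)"
    using finD by (subst sum.inter_filter[symmetric]) auto
  also have "\<dots> = (\<Sum>(i, j)\<in>?D. \<Sum>a\<in>UNIV. \<Sum>b\<in>UNIV. of_bool (?G i j a b))"
    by (intro sum.cong) (auto simp: UNIV_bool split: prod.splits)
  finally have "real (card {bs \<in> tuples UNIV ?q. real (pair_count ?q ?G bs) \<le> ?m - t})
    \<le> real (card (UNIV :: bool set)) ^ ?q * exp (- t\<^sup>2 / (16 * real ?q ^ 3))"
    using vs(3) t by (intro pair_count_tail) auto
  moreover have "card {bs \<in> tuples UNIV ?q. real (card (link E {vs ! i |i. i < ?q \<and> bs ! i} T)) \<le> ?m - t}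
    \<le> card {bs \<in> tuples UNIV ?q. real (pair_count ?q ?G bs) \<le> ?m - t}"
    using le by (intro card_mono) (auto intro: order_trans[rotated])
  ultimately show ?thesis by simp
qed

end

section \<open>Random samples of bounded size\<close>

context cycle_params begin
text \<open>The sets \<open>T\<close> to be tested depend on the sample, so the union bound runs
  over positions: \<open>J\<close> marks the entries of the sample lying in \<open>T\<close>, and
  \<open>Q0\<close> is the part of \<open>T\<close> in \<open>Q\<close>. Conditioned on the entries
  at \<open>J\<close>, the others are still independent and \<open>link_pair_count_tail\<close>
  applies. There are polynomially many \<open>J\<close> in terms of \<open>s\<close>, against a
  failure probability exponentially small in \<open>s\<close>; the size of \<open>V\<close> enters
  only through \<open>n0\<close>.\<close>

lemma sample_dense:
  assumes \<beta>: "0 \<le> \<beta>" "\<beta> \<le> 1" and \<mu>: "0 < \<mu>"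
  shows "\<exists>s0. \<forall>s\<ge>s0. \<exists>n0. \<forall>E (V :: 'a set) Q. dense E V \<beta> \<and> n0 \<le> card V \<and> Q \<subseteq> V \<and> card Q = p \<longrightarrow>
    ample V s (7/8) (\<lambda>S. distinct S \<and> set S \<inter> Q = {} \<and> dense E (set S \<union> Q) (\<beta> - \<mu>))"
proof -
  define k where "k = l + r"
  \<comment> \<open>Two demands on \<open>s\<close>: the ordered pairs of free positions nearly
    exhaust \<open>(s + p)\<^sup>2\<close>, and the union bound stays below 1/16.\<close>
  have "eventually (\<lambda>s::nat. (real s + real p)\<^sup>2 - (real s - real k) * (real s - real k - 1) \<le> \<mu> / 2 * (real s + real p)\<^sup>2) at_top"
    using \<mu> by real_asymp
  moreover have "eventually (\<lambda>s::nat. (real s + 1) powr real (k - 2) * 2 ^ p * exp (- \<mu>\<^sup>2 * (real s - real k) / 64) \<le> 1 / 16) at_top"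
    using \<mu> by real_asymp
  ultimately have "eventually (\<lambda>s::nat. s \<ge> k + 2 \<and>
      (real s + real p)\<^sup>2 - (real s - real k) * (real s - real k - 1) \<le> \<mu> / 2 * (real s + real p)\<^sup>2 \<and>
      (real s + 1) powr real (k - 2) * 2 ^ p * exp (- \<mu>\<^sup>2 * (real s - real k) / 64) \<le> 1 / 16) at_top"
    using eventually_ge_at_top[of "k + 2"] by eventually_elim auto
  then obtain s0 where s0: "\<And>s. s \<ge> s0 \<Longrightarrow> s \<ge> k + 2 \<and>
      (real s + real p)\<^sup>2 - (real s - real k) * (real s - real k - 1) \<le> \<mu> / 2 * (real s + real p)\<^sup>2 \<and>
      (real s + 1) powr real (k - 2) * 2 ^ p * exp (- \<mu>\<^sup>2 * (real s - real k) / 64) \<le> 1 / 16"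
    unfolding eventually_at_top_linorder by blast
  show ?thesis
  proof (rule exI[of _ s0], intro allI impI)
    fix s assume "s0 \<le> s"
    then have sk: "s \<ge> k + 2"
      and s1: "(real s + real p)\<^sup>2 - (real s - real k) * (real s - real k - 1) \<le> \<mu> / 2 * (real s + real p)\<^sup>2"
      and s2: "(real s + 1) powr real (k - 2) * 2 ^ p * exp (- \<mu>\<^sup>2 * (real s - real k) / 64) \<le> 1 / 16"
      using s0 by blast+
    \<comment> \<open>Repeated entries and hits of \<open>Q\<close> then cost at most 1/32 each, so
      the total failure is 1/16 + 1/32 + 1/32 = 1/8.\<close>
    define n0 where "n0 = 1 + 32 * (s * s + s * p)"
    show "\<exists>n0. \<forall>E (V :: 'a set) Q. dense E V \<beta> \<and> n0 \<le> card V \<and> Q \<subseteq> V \<and> card Q = p \<longrightarrow>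
      ample V s (7/8) (\<lambda>S. distinct S \<and> set S \<inter> Q = {} \<and> dense E (set S \<union> Q) (\<beta> - \<mu>))"
    proof (intro exI[of _ n0] allI impI, elim conjE)
      fix E and V Q :: "'a set"
      assume V: "dense E V \<beta>" and n0: "n0 \<le> card V" and Q: "Q \<subseteq> V" "card Q = p"
      have fin: "finite V" "finite Q" using dense_finite[OF V] Q finite_subset by auto
      have V0: "V \<noteq> {}" using n0 unfolding n0_def by auto
      define \<J> where "\<J> = {J. J \<subseteq> {..<s} \<and> card J \<le> k - 2}"
      have finJ: "finite \<J>" unfolding \<J>_def by (rule finite_subset[of _ "Pow {..<s}"]) auto
      have cardJ: "card \<J> \<le> Suc s ^ (k - 2)"
      proof -
        \<comment> \<open>The value \<open>s\<close> pads lists of fewer than \<open>k - 2\<close>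
          positions; intersecting with \<open>{..<s}\<close> removes it again.\<close>
        have "\<J> \<subseteq> (\<lambda>js. set js \<inter> {..<s}) ` tuples {..<Suc s} (k - 2)"
        proof
          fix J assume J: "J \<in> \<J>"
          then have "finite J" unfolding \<J>_def by (auto intro: finite_subset[of _ "{..<s}"])
          then obtain js where js: "set js = J" "distinct js" using finite_distinct_list by blast
          then have len: "length js \<le> k - 2" using J unfolding \<J>_def by (metis (mono_tags, lifting) distinct_card mem_Collect_eq)
          then have "js @ replicate (k - 2 - length js) s \<in> tuples {..<Suc s} (k - 2)"
            using js J unfolding tuples_def \<J>_def by auto
          moreover have "set (js @ replicate (k - 2 - length js) s) \<inter> {..<s} = J"
            using js J unfolding \<J>_def by auto
          ultimately show "J \<in> (\<lambda>js. set js \<inter> {..<s}) ` tuples {..<Suc s} (k - 2)" by blast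
        qed
        then have "card \<J> \<le> card (tuples {..<Suc s} (k - 2))"
          by (meson card_image_le card_mono finite_imageI finite_lessThan finite_tuples le_trans)
        then show ?thesis by (simp add: card_tuples)
      qed
      define bad where "bad J Q0 = {S \<in> tuples V s. card (set (nths S J) \<union> Q0) = k - 2 \<and>
        real (pair_count (s - card J) (\<lambda>_ _ u v. (u, v) \<in> link E V (set (nths S J) \<union> Q0)) (nths S (- J)))
          \<le> (\<beta> - \<mu>) * (real s + real p)\<^sup>2}" for J Q0
      define ex where "ex = exp (- \<mu>\<^sup>2 * (real s - real k) / 64)"
      have bad_le: "real (card (bad J Q0)) \<le> real (card V) ^ s * ex" if J: "J \<in> \<J>" and Q0: "Q0 \<subseteq> Q" for J Q0
      proof -
        define s' where "s' = s - card J"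
        have cJ: "card J \<le> k - 2" "J \<subseteq> {..<s}" using J unfolding \<J>_def by auto
        have s': "s' + card J = s" "s' \<ge> s - k" "s' > 0" "s' \<le> s" using cJ sk unfolding s'_def by auto
        have rs': "real s - real k \<le> real s'" using s'(2) sk by linarith
        define small where "small hs = {xs \<in> tuples V s'. card (set hs \<union> Q0) = k - 2 \<and>
          real (pair_count s' (\<lambda>_ _ u v. (u, v) \<in> link E V (set hs \<union> Q0)) xs) \<le> (\<beta> - \<mu>) * (real s + real p)\<^sup>2}" for hs
        \<comment> \<open>Half of \<open>\<mu>\<close> pays for replacing
          \<open>(s + p)\<^sup>2\<close> by the \<open>s' * (s' - 1)\<close> pairs of free
          positions. The other half is the deviation \<open>\<mu> / 2 * s'\<^sup>2\<close>, which
          produces the exponent \<open>\<mu>\<^sup>2 * s' / 64\<close>.\<close>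
        have ineq: "(\<beta> - \<mu>) * (real s + real p)\<^sup>2 \<le> \<beta> * (real s' * (real s' - 1)) - \<mu> / 2 * (real s')\<^sup>2"
        proof -
          have "(real s - real k) * (real s - real k - 1) \<le> real s' * (real s' - 1)"
            using rs' sk by (intro mult_mono) auto
          then have "(1 - \<mu> / 2) * (real s + real p)\<^sup>2 \<le> real s' * (real s' - 1)"
            using s1 by (simp add: algebra_simps)
          then have "\<beta> * ((1 - \<mu> / 2) * (real s + real p)\<^sup>2) \<le> \<beta> * (real s' * (real s' - 1))"
            using \<beta>(1) by (rule mult_left_mono)
          moreover have "\<beta> * (\<mu> / 2 * (real s + real p)\<^sup>2) \<le> 1 * (\<mu> / 2 * (real s + real p)\<^sup>2)"
            using \<beta> \<mu> by (intro mult_right_mono) auto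
          moreover have "\<mu> / 2 * (real s')\<^sup>2 \<le> \<mu> / 2 * (real s + real p)\<^sup>2"
            using \<mu> s'(4) by (intro mult_left_mono power_mono) auto
          ultimately show ?thesis by (simp add: algebra_simps)
        qed
        have small_le: "real (card (small hs)) \<le> real (card V) ^ s' * ex" if hs: "hs \<in> tuples V (card J)" for hs
        proof (cases "card (set hs \<union> Q0) = k - 2")
          case True
          have "real (card (small hs)) \<le> real (card {xs \<in> tuples V s'.
              real (pair_count s' (\<lambda>_ _ u v. (u, v) \<in> link E V (set hs \<union> Q0)) xs) \<le> \<beta> * (real s' * (real s' - 1)) - \<mu> / 2 * (real s')\<^sup>2})"
            unfolding small_def using fin ineq by (intro of_nat_mono card_mono) auto
          also have "\<dots> \<le> real (card V) ^ s' * exp (- (\<mu> / 2 * (real s')\<^sup>2)\<^sup>2 / (16 * real s' ^ 3))"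
            using True Q0 Q hs s' \<mu> unfolding k_def
            by (intro link_pair_count_tail[OF V V0]) (auto simp: tuples_def)
          also have "- (\<mu> / 2 * (real s')\<^sup>2)\<^sup>2 / (16 * real s' ^ 3) = - \<mu>\<^sup>2 * real s' / 64"
            using s'(3) by (simp add: power2_eq_square power3_eq_cube field_simps)
          also have "exp (- \<mu>\<^sup>2 * real s' / 64) \<le> ex"
            unfolding ex_def using rs' by (simp add: divide_right_mono mult_left_mono)
          finally show ?thesis by (simp add: mult_left_mono)
        qed (auto simp: small_def ex_def)
        let ?f = "\<lambda>S. (nths S J, nths S (- J))"
        have len1: "length (nths S J) = card J" and len2: "length (nths S (- J)) = s'" if "length S = s" for S :: "'a list"
        proof -
          have "{i. i < length S \<and> i \<in> J} = J" using that cJ by auto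
          then show "length (nths S J) = card J" by (simp add: length_nths)
          have "{i. i < length S \<and> i \<in> - J} = {..<s} - J" using that by auto
          then show "length (nths S (- J)) = s'"
            using cJ by (simp add: length_nths card_Diff_subset finite_subset[of J "{..<s}"] s'_def)
        qed
        have "card (bad J Q0) \<le> card (Sigma (tuples V (card J)) small)"
        proof (rule card_inj_on_le[where f = ?f])
          show "inj_on ?f (bad J Q0)"
            unfolding bad_def tuples_def by (auto simp: inj_on_def intro: nths_complement_inj[where J = J])
          show "?f ` bad J Q0 \<subseteq> Sigma (tuples V (card J)) small"
            using len1 len2 set_nths_subset unfolding bad_def small_def tuples_def s'_def by fastforce
          show "finite (Sigma (tuples V (card J)) small)" using fin unfolding small_def by auto
        qed
        also have "\<dots> = (\<Sum>hs\<in>tuples V (card J). card (small hs))"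
          using fin unfolding small_def by (intro card_SigmaI) auto
        finally have "real (card (bad J Q0)) \<le> (\<Sum>hs\<in>tuples V (card J). real (card (small hs)))"
          by (simp flip: of_nat_sum)
        also have "\<dots> \<le> (\<Sum>hs\<in>tuples V (card J). real (card V) ^ s' * ex)" using small_le by (rule sum_mono)
        also have "\<dots> = real (card V) ^ s * ex"
          using fin s'(1) by (simp add: card_tuples mult.assoc[symmetric] power_add[symmetric] add.commute)
        finally show ?thesis .
      qed
      define B where "B S \<longleftrightarrow> distinct S \<and> set S \<inter> Q = {} \<and> \<not> dense E (set S \<union> Q) (\<beta> - \<mu>)" for S
      have "{S \<in> tuples V s. B S} \<subseteq> (\<Union>p\<in>\<J> \<times> Pow Q. bad (fst p) (snd p))"
      proof
        fix S assume "S \<in> {S \<in> tuples V s. B S}"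
        then have S: "set S \<subseteq> V" "length S = s" "distinct S" "set S \<inter> Q = {}" "\<not> dense E (set S \<union> Q) (\<beta> - \<mu>)"
          unfolding B_def tuples_def by auto
        have cU: "card (set S \<union> Q) = s + p" using S fin Q by (simp add: card_Un_disjoint distinct_card)
        obtain T where T: "T \<subseteq> set S \<union> Q" "card T = k - 2" "real (card (link E (set S \<union> Q) T)) < (\<beta> - \<mu>) * (real s + real p)\<^sup>2"
          using S(5) V fin unfolding dense_def cU k_def by (auto simp: not_le)
        define J where "J = {i. i < s \<and> S ! i \<in> T}"
        have sJ: "set (nths S J) = set S \<inter> T" unfolding set_nths J_def using S(2) by (auto simp: in_set_conv_nth)
        have dis: "distinct (nths S J)" "distinct (nths S (- J))" using S(3) distinct_nthsI by auto
        have len: "length (nths S J) = card J" unfolding length_nths J_def using S(2) by (auto intro: arg_cong[where f = card])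
        have Jsub: "J \<subseteq> {..<s}" unfolding J_def by auto
        have "{i. i < length S \<and> i \<in> - J} = {..<s} - J" using S(2) by auto
        then have len2: "length (nths S (- J)) = s - card J"
          using Jsub by (simp add: length_nths card_Diff_subset finite_subset[of J "{..<s}"])
        have finT: "finite T" using T(1) fin finite_subset[of T "set S \<union> Q"] by auto
        have "card J = card (set S \<inter> T)" using distinct_card[OF dis(1)] len sJ by simp
        also have "\<dots> \<le> k - 2" using T(2) finT by (metis Int_lower2 card_mono)
        finally have JJ: "J \<in> \<J>" using Jsub unfolding \<J>_def by simp
        have TT: "set (nths S J) \<union> (T \<inter> Q) = T" unfolding sJ using T(1) by auto
        have "pair_count (s - card J) (\<lambda>_ _ u v. (u, v) \<in> link E V T) (nths S (- J)) \<le> card (link E (set S \<union> Q) T)"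
          using card_link_ge_pair_count[of "nths S (- J)" "set S \<union> Q" E V T] dis len2 fin set_nths_subset[of S "- J"] by auto
        then have "S \<in> bad J (T \<inter> Q)"
          unfolding bad_def mem_Collect_eq TT using S T by (simp add: tuples_def)
        then show "S \<in> (\<Union>p\<in>\<J> \<times> Pow Q. bad (fst p) (snd p))" using JJ by force
      qed
      then have "card {S \<in> tuples V s. B S} \<le> card (\<Union>p\<in>\<J> \<times> Pow Q. bad (fst p) (snd p))"
        using fin finJ unfolding bad_def by (intro card_mono) auto
      also have "\<dots> \<le> (\<Sum>p\<in>\<J> \<times> Pow Q. card (bad (fst p) (snd p)))"
        using finJ fin by (intro card_UN_le) auto
      finally have "real (card {S \<in> tuples V s. B S}) \<le> (\<Sum>p\<in>\<J> \<times> Pow Q. real (card (bad (fst p) (snd p))))"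
        by (simp flip: of_nat_sum)
      also have "\<dots> \<le> (\<Sum>p\<in>\<J> \<times> Pow Q. real (card V) ^ s * ex)" using bad_le by (intro sum_mono) auto
      also have "\<dots> = real (card \<J>) * 2 ^ p * (real (card V) ^ s * ex)"
        using fin Q by (simp add: card_cartesian_product card_Pow)
      also have "\<dots> \<le> (real s + 1) powr real (k - 2) * 2 ^ p * (real (card V) ^ s * ex)"
      proof -
        have "real (card \<J>) \<le> real (Suc s ^ (k - 2))" using cardJ by (simp only: of_nat_le_iff)
        also have "\<dots> = (real s + 1) powr real (k - 2)" by (simp add: powr_realpow add.commute)
        finally show ?thesis unfolding ex_def by (intro mult_right_mono) auto
      qed
      also have "\<dots> = ((real s + 1) powr real (k - 2) * 2 ^ p * ex) * real (card V) ^ s" by simp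
      also have "\<dots> \<le> 1 / 16 * real (card V) ^ s" using s2 unfolding ex_def by (intro mult_right_mono) auto
      finally have a1: "ample V s (1 - 1 / 16) (\<lambda>S. True \<and> \<not> B S)"
        using ample_diff[OF ample_True fin(1)] fin(1) by blast
      have n: "real (s * s) \<le> 1 / 32 * real (card V)" "real (s * p) \<le> 1 / 32 * real (card V)"
        using n0 unfolding n0_def by (simp_all flip: of_nat_mult)
      have a2: "ample V s (1 - 1 / 16 - 1 / 32) (\<lambda>S. (True \<and> \<not> B S) \<and> distinct S)"
        by (rule ample_distinct[OF a1 fin(1) n(1)]) simp
      have a3: "ample V s (1 - 1 / 16 - 1 / 32 - 1 / 32) (\<lambda>S. ((True \<and> \<not> B S) \<and> distinct S) \<and> set S \<inter> Q = {})"
        by (rule ample_avoid[OF a2 fin]) (use n(2) Q in auto)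
      show "ample V s (7/8) (\<lambda>S. distinct S \<and> set S \<inter> Q = {} \<and> dense E (set S \<union> Q) (\<beta> - \<mu>))"
        by (rule ample_mono[OF a3 fin(1)]) (auto simp: B_def)
    qed
  qed
qed

end

subsection \<open>The threshold\<close>

lemma set_window:
  assumes "a + k \<le> length xs" shows "set (take k (drop a xs)) = (\<lambda>j. xs ! (a + j)) ` {..<k}"
proof -
  have "set (take k (drop a xs)) = (!) (drop a xs) ` {0..<k}" using assms by (intro nth_image[symmetric]) simp
  also have "\<dots> = (\<lambda>j. xs ! (a + j)) ` {..<k}" using assms by (intro image_cong) auto
  finally show ?thesis .
qed

lemma nth_window: "j < k \<Longrightarrow> a \<le> length xs \<Longrightarrow> take k (drop a xs) ! j = xs ! (a + j)"
  by simp

lemma nth_cyclic: "l \<le> length vs \<Longrightarrow> p < length vs + l \<Longrightarrow> (vs @ take l vs) ! p = vs ! (p mod length vs)"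
  by (auto simp: nth_append mod_if)

lemma card_offdiagonal: "finite A \<Longrightarrow> card {(x, y) \<in> A \<times> A. x \<noteq> y} = card A * card A - card A"
proof -
  assume fin: "finite A"
  have "{(x, y) \<in> A \<times> A. x \<noteq> y} = A \<times> A - (\<lambda>x. (x, x)) ` A" by auto
  then show ?thesis
    using fin by (simp add: card_Diff_subset card_image inj_on_def image_subset_iff card_cartesian_product)
qed

lemma card_inter_distinct:
  assumes "distinct xs" shows "card (set xs \<inter> X) = length (filter (\<lambda>x. x \<in> X) xs)"
proof -
  have "set xs \<inter> X = set (filter (\<lambda>x. x \<in> X) xs)" by auto
  then show ?thesis using distinct_card[of "filter (\<lambda>x. x \<in> X) xs"] assms by simp
qed

lemma length_filter_sum: "length (filter P xs) = (\<Sum>j<length xs. of_bool (P (xs ! j)))"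
  by (induction xs) (simp_all add: sum.lessThan_Suc_shift del: sum.lessThan_Suc)

lemma even_length_filter_chunks:
  "length xs = k * t \<Longrightarrow> (\<And>c. c < t \<Longrightarrow> even (length (filter P (take k (drop (c * k) xs))))) \<Longrightarrow>
    even (length (filter P xs))"
proof (induction t arbitrary: xs)
  case (Suc t)
  have "even (length (filter P (take k (drop (c * k) (drop k xs)))))" if "c < t" for c
  proof -
    have "drop (c * k) (drop k xs) = drop (Suc c * k) xs" by (simp add: add.commute)
    then show ?thesis using Suc.prems(2)[of "Suc c"] that by (simp only: Suc_less_eq)
  qed
  moreover have "length (drop k xs) = k * t" using Suc.prems(1) by simp
  ultimately have "even (length (filter P (drop k xs)))" using Suc.IH[of "drop k xs"] by blast
  moreover have "even (length (filter P (take k xs)))" using Suc.prems(2)[of 0] by simp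
  moreover have "length (filter P xs) = length (filter P (take k xs)) + length (filter P (drop k xs))"
    by (metis append_take_drop_id filter_append length_append)
  ultimately show ?case by simp
qed simp

context cycle_params
begin

text \<open>A Hamilton cycle with a chosen start and direction. Appending the first \<open>l\<close>
  entries turns the cyclic windows into ordinary windows of a walk.\<close>

definition spanning_cycle :: "'a set set \<Rightarrow> 'a set \<Rightarrow> 'a list \<Rightarrow> bool" where
  "spanning_cycle E V vs \<longleftrightarrow> distinct vs \<and> set vs = V \<and> walk E (vs @ take l vs)"

definition threshold :: real where
  "threshold = ham_threshold (l + r - 2) (l + r) l"

lemma card_link:
  assumes "\<And>e. e \<in> E \<Longrightarrow> card e = l + r \<and> e \<subseteq> V" "finite V" "card T = l + r - 2" "T \<subseteq> V"
  shows "card (link E V T) = 2 * card {e \<in> E. T \<subseteq> e}"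
proof -
  have fT: "finite T" using assms finite_subset by blast
  have fE: "finite {e \<in> E. T \<subseteq> e}"
    by (rule finite_subset[of _ "Pow V"]) (use assms in auto)
  have c2: "card (e - T) = 2" if "e \<in> {e \<in> E. T \<subseteq> e}" for e
    using that assms(1,3) fT r_ge2 by (simp add: card_Diff_subset)
  have fe: "finite e" if "e \<in> E" for e using that assms(1,2) finite_subset by blast
  have eq: "link E V T = (\<Union>e\<in>{e \<in> E. T \<subseteq> e}. {(x, y) \<in> (e - T) \<times> (e - T). x \<noteq> y})"
  proof (intro set_eqI iffI)
    fix p assume "p \<in> link E V T"
    then obtain x y where p: "p = (x, y)" "insert x (insert y T) \<in> E" "(x, y) \<in> link E V T"
      unfolding link_def by auto
    have "x \<noteq> y" "x \<notin> T" "y \<notin> T" using link_distinct[OF _ assms(3) fT p(3)] assms(1) by auto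
    then show "p \<in> (\<Union>e\<in>{e \<in> E. T \<subseteq> e}. {(x, y) \<in> (e - T) \<times> (e - T). x \<noteq> y})"
      using p by (intro UN_I[of "insert x (insert y T)"]) auto
  next
    fix p assume "p \<in> (\<Union>e\<in>{e \<in> E. T \<subseteq> e}. {(x, y) \<in> (e - T) \<times> (e - T). x \<noteq> y})"
    then obtain e x y where e: "e \<in> E" "T \<subseteq> e" "x \<in> e - T" "y \<in> e - T" "x \<noteq> y" "p = (x, y)" by auto
    have "{x, y} = e - T" using c2[of e] e fe by (intro card_seteq) auto
    then have "insert x (insert y T) = e" using e(2) by auto
    then show "p \<in> link E V T" using e assms(1) unfolding link_def by auto
  qed
  have "card (link E V T) = (\<Sum>e\<in>{e \<in> E. T \<subseteq> e}. card {(x, y) \<in> (e - T) \<times> (e - T). x \<noteq> y})"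
    unfolding eq
  proof (rule card_UN_disjoint[OF fE])
    show "\<forall>e\<in>{e \<in> E. T \<subseteq> e}. finite {(x, y) \<in> (e - T) \<times> (e - T). x \<noteq> y}"
      using fe by (auto intro: finite_subset[of _ "(_ - T) \<times> (_ - T)"])
    show "\<forall>e\<in>{e \<in> E. T \<subseteq> e}. \<forall>f\<in>{e \<in> E. T \<subseteq> e}. e \<noteq> f \<longrightarrow>
      {(x, y) \<in> (e - T) \<times> (e - T). x \<noteq> y} \<inter> {(x, y) \<in> (f - T) \<times> (f - T). x \<noteq> y} = {}"
    proof (intro ballI impI, rule ccontr)
      fix e f assume e: "e \<in> {e \<in> E. T \<subseteq> e}" and f: "f \<in> {e \<in> E. T \<subseteq> e}" and "e \<noteq> f"
        and "{(x, y) \<in> (e - T) \<times> (e - T). x \<noteq> y} \<inter> {(x, y) \<in> (f - T) \<times> (f - T). x \<noteq> y} \<noteq> {}"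
      then obtain x y where xy: "{x, y} \<subseteq> e - T" "{x, y} \<subseteq> f - T" "x \<noteq> y" by auto
      have "{x, y} = e - T" using xy c2[OF e] e fe by (intro card_seteq) auto
      moreover have "{x, y} = f - T" using xy c2[OF f] f fe by (intro card_seteq) auto
      ultimately have "e = f" using e f by auto
      then show False using \<open>e \<noteq> f\<close> by simp
    qed
  qed
  also have "\<dots> = (\<Sum>e\<in>{e \<in> E. T \<subseteq> e}. 2)"
  proof (intro sum.cong refl)
    fix e assume e: "e \<in> {e \<in> E. T \<subseteq> e}"
    then have "finite (e - T)" using fe by auto
    then show "card {(x, y) \<in> (e - T) \<times> (e - T). x \<noteq> y} = 2"
      using c2[OF e] by (simp only: card_offdiagonal)
  qed
  finally show ?thesis by simp
qed

lemma min_deg_ge: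
  assumes "dense E V \<beta>" "\<And>e. e \<in> E \<Longrightarrow> e \<subseteq> V" "l + r \<le> card V"
  shows "\<beta> * (real (card V))\<^sup>2 / 2 \<le> real (min_deg (l + r - 2) V E)"
proof -
  have fin: "finite V" using assms dense_finite by blast
  let ?S = "(\<lambda>S. card {e \<in> E. S \<subseteq> e}) ` {S. S \<subseteq> V \<and> card S = l + r - 2}"
  obtain T0 where "T0 \<subseteq> V" "card T0 = l + r - 2"
    using obtain_subset_with_card_n[of "l + r - 2" V] assms(3) by (metis diff_le_self le_trans)
  then have "?S \<noteq> {}" by blast
  moreover have "finite ?S" using fin by simp
  ultimately have "Min ?S \<in> ?S" by (intro Min_in)
  then obtain T where T: "T \<subseteq> V" "card T = l + r - 2" "min_deg (l + r - 2) V E = card {e \<in> E. T \<subseteq> e}"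
    unfolding min_deg_def by auto
  have "card (link E V T) = 2 * card {e \<in> E. T \<subseteq> e}"
    using assms fin T dense_card by (intro card_link) auto
  then show ?thesis using denseD[OF assms(1) T(1,2)] T(3) by simp
qed

lemma min_deg_le:
  assumes "kgraph (l + r) V E" "l + r \<le> card V"
  shows "min_deg (l + r - 2) V E \<le> (card V - (l + r - 2)) choose 2"
proof -
  have fin: "finite V" and E: "\<And>e. e \<in> E \<Longrightarrow> e \<subseteq> V \<and> card e = l + r"
    using assms unfolding kgraph_def by auto
  obtain T where T: "T \<subseteq> V" "card T = l + r - 2" "finite T"
    using obtain_subset_with_card_n[of "l + r - 2" V] assms(2) by (metis diff_le_self le_trans)
  have "min_deg (l + r - 2) V E \<le> card {e \<in> E. T \<subseteq> e}"
    unfolding min_deg_def using fin T by (intro Min_le) auto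
  also have "\<dots> \<le> card {B. B \<subseteq> V - T \<and> card B = 2}"
  proof (rule card_inj_on_le[where f = "\<lambda>e. e - T"])
    show "inj_on (\<lambda>e. e - T) {e \<in> E. T \<subseteq> e}" by (auto simp: inj_on_def)
    show "(\<lambda>e. e - T) ` {e \<in> E. T \<subseteq> e} \<subseteq> {B. B \<subseteq> V - T \<and> card B = 2}"
    proof clarify
      fix e assume e: "e \<in> E" "T \<subseteq> e"
      then show "e - T \<subseteq> V - T \<and> card (e - T) = 2"
        using E[of e] T r_ge2 by (auto simp: card_Diff_subset)
    qed
    show "finite {B. B \<subseteq> V - T \<and> card B = 2}" using fin by simp
  qed
  also have "\<dots> = (card V - (l + r - 2)) choose 2"
    using fin T by (simp add: n_subsets card_Diff_subset)
  finally show ?thesis .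
qed

lemma choose_two_le: "real (m choose 2) \<le> (real m)\<^sup>2 / 2"
proof -
  have "real (m choose 2) = real m * (real m - 1) / 2"
    by (cases m) (simp_all add: choose_two real_of_nat_div[of 2] algebra_simps)
  then show ?thesis by (simp add: power2_eq_square algebra_simps)
qed

lemma spanning_cycle_if_ham_cycle:
  assumes "ham_cycle (l + r) l V E H" "l \<le> card V"
  shows "\<exists>vs. spanning_cycle E V vs"
proof -
  define n where "n = card V"
  obtain f where f: "bij_betw f {..<n} V" "r dvd n" "H \<subseteq> E"
    and H: "H = (\<lambda>i. f ` ((\<lambda>j. (i * r + j) mod n) ` {..<l + r})) ` {..<n div r}"
    using assms(1) unfolding ham_cycle_def Let_def n_def by auto
  define vs where "vs = map f [0..<n]"
  have len: "length vs = n" and vn: "\<And>p. p < n \<Longrightarrow> vs ! p = f p" unfolding vs_def by auto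
  have "distinct vs" using f(1) unfolding vs_def bij_betw_def by (simp add: distinct_map atLeast0LessThan)
  moreover have "set vs = V" using f(1) unfolding vs_def bij_betw_def by (simp add: atLeast0LessThan)
  moreover have "walk E (vs @ take l vs)"
  proof (rule walkI[of _ "n div r"])
    show "length (vs @ take l vs) = l + r * (n div r)" using len f(2) assms(2) unfolding n_def by simp
    fix i assume i: "i < n div r"
    then have "(i + 1) * r \<le> n div r * r" by (intro mult_right_mono) auto
    then have ir: "i * r + r \<le> n" using f(2) by simp
    have "set (take (l + r) (drop (i * r) (vs @ take l vs))) = (\<lambda>j. (vs @ take l vs) ! (i * r + j)) ` {..<l + r}"
      using ir len assms(2) unfolding n_def by (intro set_window) auto
    also have "\<dots> = (\<lambda>j. f ((i * r + j) mod n)) ` {..<l + r}"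
    proof (intro image_cong refl)
      fix j assume "j \<in> {..<l + r}"
      then have "i * r + j < length vs + l" using ir len by simp
      then have "(vs @ take l vs) ! (i * r + j) = vs ! ((i * r + j) mod n)"
        using nth_cyclic[of l vs] assms(2) len unfolding n_def by auto
      moreover have "0 < n" using ir r_pos by auto
      ultimately show "(vs @ take l vs) ! (i * r + j) = f ((i * r + j) mod n)" using vn by simp
    qed
    also have "\<dots> \<in> H" unfolding H using i by (auto simp: image_image)
    finally show "set (take (l + r) (drop (i * r) (vs @ take l vs))) \<in> E" using f(3) by auto
  qed
  ultimately show ?thesis unfolding spanning_cycle_def by blast
qed

definition forcing :: "real set" where
  "forcing = {\<delta> \<in> {0..1}. \<forall>\<epsilon>>0. \<exists>n0. \<forall>(V::nat set) E.
      kgraph (l + r) V E \<and> card V \<ge> n0 \<and> r dvd card V \<and>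
      real (min_deg (l + r - 2) V E) \<ge> (\<delta> + \<epsilon>) * real ((card V - (l + r - 2)) choose 2)
      \<longrightarrow> (\<exists>H. ham_cycle (l + r) l V E H)}"

lemma threshold_eq: "threshold = Inf forcing"
proof -
  have "l + r - (l + r - 2) = 2" using r_ge2 by simp
  then show ?thesis unfolding threshold_def ham_threshold_def forcing_def by simp
qed

text \<open>At \<open>\<delta> = 1\<close> the degree condition asks for more edges than there are
  pairs to complete a \<open>(k - 2)\<close>-set, so it fails on all large vertex sets. The set is
  thereby non-empty and its infimum has the usual properties.\<close>

lemma one_forcing: "1 \<in> forcing"
proof -
  have no: "\<not> (1 + \<epsilon>) * real ((card V - (l + r - 2)) choose 2) \<le> real (min_deg (l + r - 2) V E)"
    if "\<epsilon> > 0" "kgraph (l + r) V E" "l + r \<le> card V" for \<epsilon> :: real and V :: "nat set" and E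
  proof -
    let ?c = "real ((card V - (l + r - 2)) choose 2)"
    have "2 \<le> card V - (l + r - 2)" using that(3) r_ge2 by simp
    then have "?c > 0" by simp
    then have "?c < (1 + \<epsilon>) * ?c" using that(1) by simp
    then show ?thesis using min_deg_le[OF that(2,3)] by linarith
  qed
  show ?thesis unfolding forcing_def
  proof (intro CollectI conjI allI impI)
    fix \<epsilon> :: real assume "\<epsilon> > 0"
    then show "\<exists>n0. \<forall>(V :: nat set) E. kgraph (l + r) V E \<and> n0 \<le> card V \<and> r dvd card V \<and>
      (1 + \<epsilon>) * real ((card V - (l + r - 2)) choose 2) \<le> real (min_deg (l + r - 2) V E) \<longrightarrow>
      (\<exists>H. ham_cycle (l + r) l V E H)"
      using no by (intro exI[of _ "l + r"]) blast
  qed simp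
qed

lemma threshold_nonneg: "0 \<le> threshold"
  unfolding threshold_eq
proof (rule cInf_greatest)
  show "forcing \<noteq> {}" using one_forcing by blast
qed (simp add: forcing_def)

text \<open>A \<open>\<delta>\<close> in \<open>forcing\<close> below \<open>c\<close> is refuted by
  the graphs of the hypothesis: with half the gap as \<open>\<epsilon>\<close>, they meet its degree
  condition and have no spanning cycle. The pair density of \<open>dense\<close> passes to
  \<open>min_deg\<close> because \<open>m choose 2\<close> is at most half of
  \<open>m\<^sup>2\<close>.\<close>

lemma threshold_ge:
  assumes "\<And>\<epsilon> n0. \<epsilon> > 0 \<Longrightarrow> \<exists>(V :: nat set) E. dense E V (c - \<epsilon>) \<and> (\<forall>e\<in>E. e \<subseteq> V) \<and> n0 \<le> card V \<and> r dvd card V \<and>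
    \<not> (\<exists>vs. spanning_cycle E V vs)"
  shows "c \<le> threshold"
  unfolding threshold_eq
proof (rule cInf_greatest)
  show "forcing \<noteq> {}" using one_forcing by auto
  fix \<delta> assume \<delta>: "\<delta> \<in> forcing"
  show "c \<le> \<delta>"
  proof (rule ccontr)
    assume "\<not> c \<le> \<delta>"
    define \<epsilon> where "\<epsilon> = (c - \<delta>) / 2"
    have \<epsilon>: "\<epsilon> > 0" "c - \<epsilon> = \<delta> + \<epsilon>" "0 \<le> \<delta>"
      using \<open>\<not> c \<le> \<delta>\<close> \<delta> unfolding \<epsilon>_def forcing_def by (auto simp: field_simps)
    obtain n0 where n0: "\<And>(V::nat set) E. kgraph (l + r) V E \<Longrightarrow> card V \<ge> n0 \<Longrightarrow> r dvd card V \<Longrightarrow>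
      real (min_deg (l + r - 2) V E) \<ge> (\<delta> + \<epsilon>) * real ((card V - (l + r - 2)) choose 2) \<Longrightarrow> \<exists>H. ham_cycle (l + r) l V E H"
      using \<delta> \<epsilon>(1) unfolding forcing_def by blast
    obtain V :: "nat set" and E where V: "dense E V (c - \<epsilon>)" "\<forall>e\<in>E. e \<subseteq> V" "n0 + l + r \<le> card V" "r dvd card V"
      "\<not> (\<exists>vs. spanning_cycle E V vs)" using assms[OF \<epsilon>(1), of "n0 + l + r"] by blast
    have "real ((card V - (l + r - 2)) choose 2) \<le> (real (card V - (l + r - 2)))\<^sup>2 / 2" by (rule choose_two_le)
    also have "\<dots> \<le> (real (card V))\<^sup>2 / 2" by (intro divide_right_mono power_mono) auto
    finally have "(\<delta> + \<epsilon>) * real ((card V - (l + r - 2)) choose 2) \<le> (\<delta> + \<epsilon>) * ((real (card V))\<^sup>2 / 2)"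
      using \<epsilon> by (intro mult_left_mono) auto
    also have "\<dots> \<le> real (min_deg (l + r - 2) V E)"
      using min_deg_ge[OF V(1)] V(2,3) \<epsilon>(2) by auto
    finally obtain H where "ham_cycle (l + r) l V E H"
      using n0[of V E] V dense_finite[OF V(1)] dense_card[OF V(1)] unfolding kgraph_def by auto
    then show False using spanning_cycle_if_ham_cycle V(3,5) by (meson add_leE)
  qed
qed

text \<open>The threshold quantifies over graphs on natural numbers, while samples live in the given
  vertex type. Edges leaving \<open>V\<close> are discarded in the transfer.\<close>

lemma dense_image:
  assumes "dense E V \<beta>" "inj_on g V"
  shows "dense ((`) g ` {e \<in> E. e \<subseteq> V}) (g ` V) \<beta>"
  unfolding dense_def
proof (intro conjI ballI allI impI)
  have fin: "finite V" using assms dense_finite by blast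
  then show "finite (g ` V)" by simp
  show "card e = l + r" if "e \<in> (`) g ` {e \<in> E. e \<subseteq> V}" for e
    using that dense_card[OF assms(1)] assms(2) by (auto simp: card_image inj_on_subset)
  fix T assume T: "T \<subseteq> g ` V" "card T = l + r - 2"
  then obtain S where S: "S \<subseteq> V" "T = g ` S" by (meson subset_imageE)
  have cS: "card S = l + r - 2" using T S assms(2) by (metis card_image inj_on_subset)
  have "card (link E V S) \<le> card (link ((`) g ` {e \<in> E. e \<subseteq> V}) (g ` V) T)"
  proof (rule card_inj_on_le[where f = "map_prod g g"])
    show "inj_on (map_prod g g) (link E V S)"
      using assms(2) unfolding link_def inj_on_def by auto
    show "map_prod g g ` link E V S \<subseteq> link ((`) g ` {e \<in> E. e \<subseteq> V}) (g ` V) T"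
    proof
      fix p assume "p \<in> map_prod g g ` link E V S"
      then obtain x y where "p = (g x, g y)" "x \<in> V" "y \<in> V" "insert x (insert y S) \<in> E" unfolding link_def by auto
      moreover from this have "g ` insert x (insert y S) \<in> (`) g ` {e \<in> E. e \<subseteq> V}"
        using S(1) by (intro imageI) auto
      moreover have "insert (g x) (insert (g y) T) = g ` insert x (insert y S)" unfolding S(2) by simp
      ultimately show "p \<in> link ((`) g ` {e \<in> E. e \<subseteq> V}) (g ` V) T" using S(1) unfolding link_def by auto
    qed
    show "finite (link ((`) g ` {e \<in> E. e \<subseteq> V}) (g ` V) T)" using fin by (intro finite_link) simp
  qed
  moreover have "card (g ` V) = card V" using assms(2) by (rule card_image)
  ultimately show "\<beta> * (real (card (g ` V)))\<^sup>2 \<le> real (card (link ((`) g ` {e \<in> E. e \<subseteq> V}) (g ` V) T))"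
    using denseD[OF assms(1) S(1) cS] by simp
qed

text \<open>The infimum may fail to be attained, so a member \<open>\<delta>\<close> of
  \<open>forcing\<close> below \<open>threshold + \<eta>\<close> is taken and the remaining gap
  serves as its \<open>\<epsilon>\<close>.\<close>

lemma dense_spanning_cycle:
  assumes "\<eta> > 0"
  shows "\<exists>n0. \<forall>E (V :: 'a set). dense E V (threshold + \<eta>) \<and> n0 \<le> card V \<and> r dvd card V \<longrightarrow> (\<exists>vs. spanning_cycle E V vs)"
proof -
  have "Inf forcing < threshold + \<eta>" using assms unfolding threshold_eq by simp
  then obtain \<delta> where \<delta>: "\<delta> \<in> forcing" "\<delta> < threshold + \<eta>"
    using one_forcing cInf_lessD by (metis empty_iff)
  define \<epsilon> where "\<epsilon> = threshold + \<eta> - \<delta>"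
  have \<epsilon>: "\<epsilon> > 0" using \<delta>(2) unfolding \<epsilon>_def by simp
  have te: "threshold + \<eta> = \<delta> + \<epsilon>" unfolding \<epsilon>_def by simp
  obtain n0 where n0: "\<And>(V::nat set) E. kgraph (l + r) V E \<Longrightarrow> card V \<ge> n0 \<Longrightarrow> r dvd card V \<Longrightarrow>
      real (min_deg (l + r - 2) V E) \<ge> (\<delta> + \<epsilon>) * real ((card V - (l + r - 2)) choose 2) \<Longrightarrow> \<exists>H. ham_cycle (l + r) l V E H"
    using \<delta>(1) \<epsilon> unfolding forcing_def by blast
  show ?thesis
  proof (intro exI[of _ "n0 + l + r"] allI impI, elim conjE)
    fix E and V :: "'a set"
    assume V: "dense E V (threshold + \<eta>)" and n: "n0 + l + r \<le> card V" and dv: "r dvd card V"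
    obtain g :: "'a \<Rightarrow> nat" where g: "bij_betw g V {0..<card V}"
      using ex_bij_betw_finite_nat[OF dense_finite[OF V]] by blast
    have inj: "inj_on g V" using g unfolding bij_betw_def by simp
    define W F where "W = g ` V" and "F = (`) g ` {e \<in> E. e \<subseteq> V}"
    have cW: "card W = card V" unfolding W_def using inj by (rule card_image)
    have W: "dense F W (\<delta> + \<epsilon>)" unfolding F_def W_def using dense_image[OF V inj] te by simp
    have FW: "\<And>e. e \<in> F \<Longrightarrow> e \<subseteq> W" unfolding F_def W_def by auto
    have "0 \<le> \<delta>" using \<delta>(1) unfolding forcing_def by simp
    have "real ((card W - (l + r - 2)) choose 2) \<le> (real (card W - (l + r - 2)))\<^sup>2 / 2" by (rule choose_two_le)
    also have "\<dots> \<le> (real (card W))\<^sup>2 / 2" by (intro divide_right_mono power_mono) auto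
    finally have "(\<delta> + \<epsilon>) * real ((card W - (l + r - 2)) choose 2) \<le> (\<delta> + \<epsilon>) * ((real (card W))\<^sup>2 / 2)"
      using \<epsilon> \<open>0 \<le> \<delta>\<close> by (intro mult_left_mono) auto
    also have "\<dots> \<le> real (min_deg (l + r - 2) W F)"
      using min_deg_ge[OF W FW] n cW by simp
    finally obtain H where "ham_cycle (l + r) l W F H"
      using n0[of W F] n dv cW FW dense_finite[OF W] dense_card[OF W] unfolding kgraph_def by auto
    then obtain ws where ws: "spanning_cycle F W ws"
      using spanning_cycle_if_ham_cycle n cW by (metis add_leE)
    define h where "h = inv_into V g"
    have hg: "\<And>x. x \<in> V \<Longrightarrow> h (g x) = x" unfolding h_def using inj by simp
    have hW: "h ` W = V" unfolding W_def using hg by (auto simp: image_image)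
    have "walk E (map h (ws @ take l ws))"
    proof (rule walk_map)
      show "walk F (ws @ take l ws)" using ws unfolding spanning_cycle_def by simp
      fix e assume "e \<in> F"
      then obtain e' where e': "e' \<in> E" "e' \<subseteq> V" "e = g ` e'" unfolding F_def by auto
      have "h ` e = (\<lambda>x. x) ` e'" unfolding e'(3) image_image using hg e'(2) by (intro image_cong) auto
      then show "h ` e \<in> E" using e'(1) by simp
    qed
    moreover have "distinct (map h ws)"
      using ws unfolding spanning_cycle_def h_def W_def
      by (simp add: distinct_map inj_on_inv_into)
    moreover have "set (map h ws) = V" using ws hW unfolding spanning_cycle_def by simp
    ultimately have "spanning_cycle E V (map h ws)" unfolding spanning_cycle_def by (simp add: take_map)
    then show "\<exists>vs. spanning_cycle E V vs" by blast
  qed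
qed

lemma spanning_cycle_length: "spanning_cycle E V vs \<Longrightarrow> length vs = card V"
  unfolding spanning_cycle_def by (metis distinct_card)

section \<open>Parity constructions and lower bounds on the threshold\<close>

text \<open>\<open>X\<close> is about half of the vertices, of odd size, and the edges are the sets
  meeting \<open>X\<close> evenly. As \<open>r\<close> divides \<open>k\<close>, the windows
  starting at multiples of \<open>k\<close> are edges; they partition a spanning cycle, so
  \<open>X\<close> would have even size. A set of \<open>k - 2\<close> vertices is completed either
  by the pairs on one side or by the pairs across, in both cases about half of all pairs.\<close>

lemma threshold_ge_half:
  assumes "r dvd l" shows "1 / 2 \<le> threshold"
proof (rule threshold_ge)
  fix \<epsilon> :: real and n0 :: nat assume \<epsilon>: "\<epsilon> > 0"
  define k where "k = l + r"
  have kpos: "k > 0" unfolding k_def using r_pos by simp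
  have "eventually (\<lambda>N::nat. (1 / 2 - \<epsilon>) * (2 * real N)\<^sup>2 \<le> 2 * ((real N - real k) * (real N - real k) - (real N - real k))) at_top"
    using \<epsilon> by real_asymp
  then have "eventually (\<lambda>N::nat. N \<ge> n0 + k + 2 \<and> (1 / 2 - \<epsilon>) * (2 * real N)\<^sup>2 \<le> 2 * ((real N - real k) * (real N - real k) - (real N - real k))) at_top"
    using eventually_ge_at_top[of "n0 + k + 2"] by eventually_elim auto
  then obtain N0 where N0: "\<And>N. N \<ge> N0 \<Longrightarrow> N \<ge> n0 + k + 2 \<and> (1 / 2 - \<epsilon>) * (2 * real N)\<^sup>2 \<le> 2 * ((real N - real k) * (real N - real k) - (real N - real k))"
    unfolding eventually_at_top_linorder by blast
  define M where "M = Suc N0"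
  \<comment> \<open>A multiple of \<open>k\<close>, so that the \<open>2 * N\<close> vertices split
    into \<open>2 * M\<close> consecutive edges.\<close>
  define N where "N = k * M"
  have "N \<ge> N0" unfolding N_def M_def using kpos by (cases k) auto
  then have N1: "N \<ge> n0 + k + 2" and N2: "(1 / 2 - \<epsilon>) * (2 * real N)\<^sup>2 \<le> 2 * ((real N - real k) * (real N - real k) - (real N - real k))"
    using N0 by auto
  define h where "h = (if odd N then N else N + 1)"
  have h: "odd h" "N \<le> h" "h \<le> N + 1" unfolding h_def by auto
  define V where "V = {..<2 * N}"
  define X where "X = {..<h}"
  define E where "E = {e. e \<subseteq> V \<and> card e = k \<and> even (card (e \<inter> X))}"
  have XV: "X \<subseteq> V" "finite V" "finite X" "card X = h" "card V = 2 * N" unfolding X_def V_def using h N1 by auto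
  have "dense E V (1 / 2 - \<epsilon>)" unfolding dense_def
  proof (intro conjI ballI allI impI)
    show "finite V" by fact
    show "card e = l + r" if "e \<in> E" for e using that unfolding E_def k_def by simp
    fix T assume T: "T \<subseteq> V" "card T = l + r - 2"
    have fT: "finite T" using T XV finite_subset by blast
    define A B where "A = X - T" and "B = V - X - T"
    have fAB: "finite A" "finite B" unfolding A_def B_def using XV by auto
    have cT: "card T + 2 = k" unfolding k_def using T r_ge2 by simp
    have "card X - card T \<le> card A" unfolding A_def by (rule diff_card_le_card_Diff[OF fT])
    then have cA: "N - k \<le> card A" using cT h XV by simp
    have "card (V - X) - card T \<le> card B" unfolding B_def by (rule diff_card_le_card_Diff[OF fT])
    moreover have "card (V - X) = 2 * N - h" using XV by (simp add: card_Diff_subset)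
    ultimately have cB: "N - k \<le> card B" using cT h by simp
    have k2: "card (insert x (insert y T)) = k" if "x \<noteq> y" "x \<notin> T" "y \<notin> T" for x y
      using that fT cT by simp
    define a where "a = N - k"
    have ra: "real a = real N - real k" unfolding a_def using N1 by simp
    have mono: "a * a - a \<le> m * m - m" if "a \<le> m" for m
    proof -
      have "a * (a - 1) \<le> m * (m - 1)" using that by (intro mult_mono) auto
      then show ?thesis by (simp add: diff_mult_distrib2)
    qed
    have "2 * (a * a - a) \<le> card (link E V T)"
    proof (cases "even (card (T \<inter> X))")
      case True
      have sub: "{(x, y) \<in> A \<times> A. x \<noteq> y} \<union> {(x, y) \<in> B \<times> B. x \<noteq> y} \<subseteq> link E V T"
      proof
        fix p assume "p \<in> {(x, y) \<in> A \<times> A. x \<noteq> y} \<union> {(x, y) \<in> B \<times> B. x \<noteq> y}"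
        then obtain x y where p: "p = (x, y)" "x \<noteq> y" and c: "(x \<in> A \<and> y \<in> A) \<or> (x \<in> B \<and> y \<in> B)" by auto
        have "even (card (insert x (insert y T) \<inter> X))"
          using c
        proof
          assume c: "x \<in> A \<and> y \<in> A"
          then have "insert x (insert y T) \<inter> X = insert x (insert y (T \<inter> X))" unfolding A_def by auto
          then show ?thesis using True p c fT unfolding A_def by simp
        next
          assume c: "x \<in> B \<and> y \<in> B"
          then have "insert x (insert y T) \<inter> X = T \<inter> X" unfolding B_def by auto
          then show ?thesis using True by simp
        qed
        moreover have "x \<notin> T" "y \<notin> T" "x \<in> V" "y \<in> V" using c XV unfolding A_def B_def by auto
        ultimately show "p \<in> link E V T" using p k2 T unfolding link_def E_def by auto
      qed
      have "card {(x, y) \<in> A \<times> A. x \<noteq> y} + card {(x, y) \<in> B \<times> B. x \<noteq> y} = card ({(x, y) \<in> A \<times> A. x \<noteq> y} \<union> {(x, y) \<in> B \<times> B. x \<noteq> y})"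
      proof (rule card_Un_disjoint[symmetric])
        show "finite {(x, y) \<in> A \<times> A. x \<noteq> y}" by (rule finite_subset[of _ "A \<times> A"]) (use fAB in auto)
        show "finite {(x, y) \<in> B \<times> B. x \<noteq> y}" by (rule finite_subset[of _ "B \<times> B"]) (use fAB in auto)
      qed (auto simp: A_def B_def)
      also have "\<dots> \<le> card (link E V T)" using sub XV by (intro card_mono finite_link)
      finally have "card A * card A - card A + (card B * card B - card B) \<le> card (link E V T)"
        unfolding card_offdiagonal[OF fAB(1)] card_offdiagonal[OF fAB(2)] .
      then show ?thesis using mono[of "card A"] mono[of "card B"] cA cB unfolding a_def by linarith
    next
      case False
      have sub: "A \<times> B \<union> B \<times> A \<subseteq> link E V T"
      proof
        fix p assume "p \<in> A \<times> B \<union> B \<times> A"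
        then obtain x y where p: "p = (x, y)" and c: "(x \<in> A \<and> y \<in> B) \<or> (x \<in> B \<and> y \<in> A)"
          by (metis SigmaE UnE)
        have "even (card (insert x (insert y T) \<inter> X))"
          using c
        proof
          assume c: "x \<in> A \<and> y \<in> B"
          then have "insert x (insert y T) \<inter> X = insert x (T \<inter> X)" unfolding A_def B_def by auto
          then show ?thesis using False c fT unfolding A_def by simp
        next
          assume c: "x \<in> B \<and> y \<in> A"
          then have "insert x (insert y T) \<inter> X = insert y (T \<inter> X)" unfolding A_def B_def by auto
          then show ?thesis using False c fT unfolding A_def by simp
        qed
        moreover have "x \<notin> T" "y \<notin> T" "x \<in> V" "y \<in> V" "x \<noteq> y" using c XV unfolding A_def B_def by auto
        ultimately show "p \<in> link E V T" using p k2 T unfolding link_def E_def by auto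
      qed
      have "a * a \<le> card A * card B" using cA cB unfolding a_def by (intro mult_mono) auto
      then have "2 * (a * a - a) \<le> card (A \<times> B) + card (B \<times> A)" by (simp add: card_cartesian_product mult.commute)
      also have "\<dots> = card (A \<times> B \<union> B \<times> A)"
        using fAB by (intro card_Un_disjoint[symmetric]) (auto simp: A_def B_def)
      also have "\<dots> \<le> card (link E V T)" using sub XV by (intro card_mono finite_link)
      finally show ?thesis .
    qed
    then have "real (2 * (a * a - a)) \<le> real (card (link E V T))" by (simp only: of_nat_le_iff)
    moreover have "real (2 * (a * a - a)) = 2 * (real a * real a - real a)"
      by (simp add: of_nat_diff)
    ultimately show "(1 / 2 - \<epsilon>) * (real (card V))\<^sup>2 \<le> real (card (link E V T))"
      using N2 ra XV(5) by simp
  qed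
  moreover have "\<forall>e\<in>E. e \<subseteq> V" unfolding E_def by simp
  moreover have "n0 \<le> card V" using XV N1 by simp
  moreover have "r dvd card V" using assms unfolding XV(5) N_def k_def by auto
  moreover have "\<not> (\<exists>vs. spanning_cycle E V vs)"
  proof
    assume "\<exists>vs. spanning_cycle E V vs"
    then obtain vs where vs: "distinct vs" "set vs = V" "walk E (vs @ take l vs)" "length vs = 2 * N"
      using spanning_cycle_length XV unfolding spanning_cycle_def by metis
    obtain p0 where "l = r * p0" using assms by blast
    then have "k = r * (p0 + 1)" unfolding k_def by simp
    then obtain p where p: "k = r * p" by blast
    have lN: "l \<le> 2 * N" using N1 unfolding k_def by simp
    have "even (length (filter (\<lambda>x. x \<in> X) vs))"
    proof (rule even_length_filter_chunks[of vs k "2 * M"])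
      show "length vs = k * (2 * M)" using vs(4) unfolding N_def by simp
      fix c assume c: "c < 2 * M"
      have "(c + 1) * k \<le> 2 * M * k" using c by (intro mult_right_mono) auto
      then have ck: "c * k + k \<le> 2 * N" unfolding N_def by (simp add: mult_ac)
      have "set (take (l + r) (drop ((c * p) * r) (vs @ take l vs))) \<in> E"
      proof (rule walkD[OF vs(3)])
        show "length (vs @ take l vs) = l + r * (p * (2 * M))" using vs(4) lN p unfolding N_def by simp
        show "c * p < p * (2 * M)" using c p kpos by (simp add: mult.commute)
      qed
      also have "take (l + r) (drop ((c * p) * r) (vs @ take l vs)) = take k (drop (c * k) vs)"
      proof -
        have "c * p * r = c * k" using p by simp
        moreover have "take k (drop (c * k) (vs @ take l vs)) = take k (drop (c * k) vs)" using ck vs(4) by simp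
        ultimately show ?thesis unfolding k_def[symmetric] by (simp only:)
      qed
      finally have "even (card (set (take k (drop (c * k) vs)) \<inter> X))" unfolding E_def by simp
      then show "even (length (filter (\<lambda>x. x \<in> X) (take k (drop (c * k) vs))))"
        using vs(1) by (simp add: card_inter_distinct)
    qed
    then have "even (card (set vs \<inter> X))" using vs(1) by (simp add: card_inter_distinct)
    moreover have "set vs \<inter> X = X" using vs(2) XV by auto
    ultimately show False using XV h by simp
  qed
  ultimately show "\<exists>(V :: nat set) E. dense E V (1 / 2 - \<epsilon>) \<and> (\<forall>e\<in>E. e \<subseteq> V) \<and> n0 \<le> card V \<and> r dvd card V \<and>
    \<not> (\<exists>vs. spanning_cycle E V vs)" by blast
qed

text \<open>With \<open>k = 2 * h + 1\<close>, the edges avoid the two middle values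
  \<open>h\<close> and \<open>h + 1\<close> for the size of the intersection with one half
  \<open>X\<close> of the vertices. Consecutive windows are shifted by two vertices, so this size
  changes by at most 2 and cannot jump over the gap: all windows are light or all are heavy. Summing
  over the windows contradicts \<open>card X = N\<close>. The pairs on a single side, chosen
  according to \<open>T \<inter> X\<close>, give density 1/4.\<close>

lemma threshold_ge_quarter:
  assumes "r = 2" "odd l" shows "1 / 4 \<le> threshold"
proof (rule threshold_ge)
  fix \<epsilon> :: real and n0 :: nat assume \<epsilon>: "\<epsilon> > 0"
  define k where "k = l + r"
  obtain b where "l = 2 * b + 1" using assms by (elim oddE)
  then have "k = 2 * (b + 1) + 1" using assms unfolding k_def by simp
  then obtain h where k: "k = 2 * h + 1" by blast
  have h1: "1 \<le> h" using k l_pos assms(1) unfolding k_def by simp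
  have "eventually (\<lambda>N::nat. (1 / 4 - \<epsilon>) * (2 * real N)\<^sup>2 \<le> (real N - real k) * (real N - real k) - (real N - real k)) at_top"
    using \<epsilon> by real_asymp
  then have "eventually (\<lambda>N::nat. N \<ge> n0 + k + 2 \<and> (1 / 4 - \<epsilon>) * (2 * real N)\<^sup>2 \<le> (real N - real k) * (real N - real k) - (real N - real k)) at_top"
    using eventually_ge_at_top[of "n0 + k + 2"] by eventually_elim auto
  then obtain N where N1: "N \<ge> n0 + k + 2" and N2: "(1 / 4 - \<epsilon>) * (2 * real N)\<^sup>2 \<le> (real N - real k) * (real N - real k) - (real N - real k)"
    unfolding eventually_at_top_linorder by blast
  define V where "V = {..<2 * N}"
  define X where "X = {..<N}"
  define E where "E = {e. e \<subseteq> V \<and> card e = k \<and> (card (e \<inter> X) + 1 \<le> h \<or> h + 2 \<le> card (e \<inter> X))}"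
  have XV: "X \<subseteq> V" "finite V" "finite X" "card X = N" "card V = 2 * N" unfolding X_def V_def by auto
  have "dense E V (1 / 4 - \<epsilon>)" unfolding dense_def
  proof (intro conjI ballI allI impI)
    show "finite V" by fact
    show "card e = l + r" if "e \<in> E" for e using that unfolding E_def k_def by simp
    fix T assume T: "T \<subseteq> V" "card T = l + r - 2"
    have fT: "finite T" using T XV finite_subset by blast
    have cT: "card T + 2 = k" unfolding k_def using T r_ge2 by simp
    define a where "a = N - k"
    have ra: "real a = real N - real k" unfolding a_def using N1 by simp
    \<comment> \<open>A light \<open>T\<close> is completed by pairs outside \<open>X\<close>; for
      any other \<open>T\<close>, pairs inside \<open>X\<close> raise the size from at least
      \<open>h\<close> to at least \<open>h + 2\<close>.\<close>
    obtain A where A: "a \<le> card A" "A \<subseteq> V - T" and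
      AE: "\<And>x y. x \<in> A \<Longrightarrow> y \<in> A \<Longrightarrow> x \<noteq> y \<Longrightarrow> card (insert x (insert y T) \<inter> X) + 1 \<le> h \<or> h + 2 \<le> card (insert x (insert y T) \<inter> X)"
    proof (cases "card (T \<inter> X) + 1 \<le> h")
      case True
      have "card (V - X) - card T \<le> card (V - X - T)" by (rule diff_card_le_card_Diff[OF fT])
      moreover have "card (V - X) = N" using XV by (simp add: card_Diff_subset)
      ultimately have "a \<le> card (V - X - T)" using cT unfolding a_def by simp
      moreover have "insert x (insert y T) \<inter> X = T \<inter> X" if "x \<in> V - X - T" "y \<in> V - X - T" for x y
        using that by auto
      ultimately show ?thesis using True by (intro that[of "V - X - T"]) auto
    next
      case False
      have "card X - card T \<le> card (X - T)" by (rule diff_card_le_card_Diff[OF fT])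
      then have "a \<le> card (X - T)" using cT XV unfolding a_def by simp
      moreover have "card (insert x (insert y T) \<inter> X) = card (T \<inter> X) + 2" if "x \<in> X - T" "y \<in> X - T" "x \<noteq> y" for x y
      proof -
        have "insert x (insert y T) \<inter> X = insert x (insert y (T \<inter> X))" using that by auto
        then show ?thesis using that fT by simp
      qed
      ultimately show ?thesis using False XV by (intro that[of "X - T"]) auto
    qed
    have fA: "finite A" using A XV finite_subset by blast
    have "{(x, y) \<in> A \<times> A. x \<noteq> y} \<subseteq> link E V T"
    proof
      fix p assume "p \<in> {(x, y) \<in> A \<times> A. x \<noteq> y}"
      then obtain x y where p: "p = (x, y)" "x \<in> A" "y \<in> A" "x \<noteq> y" by auto
      moreover have "card (insert x (insert y T)) = k" using p A(2) fT cT by (simp add: subset_iff)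
      ultimately show "p \<in> link E V T" using AE[of x y] A(2) T unfolding link_def E_def by (simp add: subset_iff)
    qed
    then have "card {(x, y) \<in> A \<times> A. x \<noteq> y} \<le> card (link E V T)" using XV by (intro card_mono finite_link)
    then have "card A * card A - card A \<le> card (link E V T)" unfolding card_offdiagonal[OF fA] .
    moreover have "a * a - a \<le> card A * card A - card A"
    proof -
      have "a * (a - 1) \<le> card A * (card A - 1)" using A(1) by (intro mult_mono) auto
      then show ?thesis by (simp add: diff_mult_distrib2)
    qed
    ultimately have "real (a * a - a) \<le> real (card (link E V T))" by (simp only: of_nat_le_iff)
    moreover have "real (a * a - a) = real a * real a - real a" by (simp add: of_nat_diff)
    ultimately show "(1 / 4 - \<epsilon>) * (real (card V))\<^sup>2 \<le> real (card (link E V T))"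
      using N2 ra XV(5) by simp
  qed
  moreover have "\<forall>e\<in>E. e \<subseteq> V" unfolding E_def by simp
  moreover have "n0 \<le> card V" using XV N1 by simp
  moreover have "r dvd card V" using assms(1) XV by simp
  moreover have "\<not> (\<exists>vs. spanning_cycle E V vs)"
  proof
    assume "\<exists>vs. spanning_cycle E V vs"
    then obtain vs where vs: "distinct vs" "set vs = V" "walk E (vs @ take l vs)" "length vs = 2 * N"
      using spanning_cycle_length XV unfolding spanning_cycle_def by metis
    have lN: "l \<le> 2 * N" using N1 unfolding k_def by simp
    define c :: "nat \<Rightarrow> nat" where "c p = of_bool (vs ! (p mod (2 * N)) \<in> X)" for p
    have per: "c (p + 2 * N) = c p" for p unfolding c_def by simp
    define W where "W i = (\<Sum>j<2 * h + 1. c (2 * i + j))" for i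
    have W_edge: "W i + 1 \<le> h \<or> h + 2 \<le> W i" if i: "i < N" for i
    proof -
      define w where "w = take k (drop (i * 2) (vs @ take l vs))"
      have "set w \<in> E" unfolding w_def k_def
        using walkD[OF vs(3), of N i] vs(4) lN i assms(1) by simp
      then have w: "card (set w) = k" "card (set w \<inter> X) + 1 \<le> h \<or> h + 2 \<le> card (set w \<inter> X)" unfolding E_def by auto
      have lw: "length w = k" unfolding w_def k_def using vs(4) lN i assms(1) by simp
      have "card (set w \<inter> X) = length (filter (\<lambda>x. x \<in> X) w)"
        using w(1) lw by (intro card_inter_distinct card_distinct) simp
      also have "\<dots> = (\<Sum>j<k. of_bool (w ! j \<in> X))" unfolding length_filter_sum lw by simp
      also have "\<dots> = (\<Sum>j<k. c (2 * i + j))"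
      proof (intro sum.cong refl)
        fix j assume j: "j \<in> {..<k}"
        have "i * 2 \<le> length (vs @ take l vs)" using i vs(4) by simp
        then have "w ! j = (vs @ take l vs) ! (i * 2 + j)"
          unfolding w_def using j by (intro nth_window) auto
        then have "w ! j = (vs @ take l vs) ! (2 * i + j)" by (simp only: mult.commute)
        also have "\<dots> = vs ! ((2 * i + j) mod (2 * N))"
          using nth_cyclic[of l vs "2 * i + j"] j i vs(4) lN assms(1) unfolding k_def by simp
        finally show "of_bool (w ! j \<in> X) = c (2 * i + j)" unfolding c_def by simp
      qed
      finally show ?thesis using w(2) unfolding W_def k by simp
    qed
    have shift: "(\<Sum>j<2 * h + 1. c (2 * i + 2 + j)) + c (2 * i) + c (2 * i + 1) = W i + c (2 * i + 2 * h + 1) + c (2 * i + 2 * h + 2)" for i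
    proof -
      have "(\<Sum>j<Suc (Suc (2 * h + 1)). c (2 * i + j)) = c (2 * i) + c (2 * i + 1) + (\<Sum>j<2 * h + 1. c (2 * i + 2 + j))"
        unfolding sum.lessThan_Suc_shift by (simp add: add.assoc del: sum.lessThan_Suc)
      moreover have "(\<Sum>j<Suc (Suc (2 * h + 1)). c (2 * i + j)) = W i + c (2 * i + 2 * h + 1) + c (2 * i + 2 * h + 2)"
        unfolding W_def by (simp add: add.assoc)
      ultimately show ?thesis by simp
    qed
    have c1: "c p \<le> 1" for p unfolding c_def by simp
    have WS: "W (Suc i) \<le> W i + 2 \<and> W i \<le> W (Suc i) + 2" for i
    proof -
      have "W (Suc i) = (\<Sum>j<2 * h + 1. c (2 * i + 2 + j))" unfolding W_def by simp
      then show ?thesis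
        using shift[of i] c1[of "2 * i"] c1[of "2 * i + 1"] c1[of "2 * i + 2 * h + 1"] c1[of "2 * i + 2 * h + 2"] by linarith
    qed
    have Npos: "0 < N" using N1 by simp
    have low: "W i + 1 \<le> h" if "i < N" "W 0 + 1 \<le> h" for i
      using that(1)
    proof (induction i)
      case (Suc i)
      then show ?case using WS[of i] W_edge[of "Suc i"] by auto
    qed (use that in simp)
    have high: "h + 2 \<le> W i" if "i < N" "h + 2 \<le> W 0" for i
      using that(1)
    proof (induction i)
      case (Suc i)
      then show ?case using WS[of i] W_edge[of "Suc i"] by auto
    qed (use that in simp)
    \<comment> \<open>\<open>S 0\<close> and \<open>S 1\<close> count the vertices of
      \<open>X\<close> at even and at odd positions of the cycle; a window has \<open>h + 1\<close>
      even and \<open>h\<close> odd positions.\<close>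
    define S where "S j = (\<Sum>i<N. c (2 * i + j))" for j
    have S2: "S (j + 2) = S j" for j
    proof -
      have "(\<Sum>i<Suc N. c (2 * i + j)) = c j + S (j + 2)"
        unfolding sum.lessThan_Suc_shift S_def by (simp add: add.assoc add.commute)
      moreover have "(\<Sum>i<Suc N. c (2 * i + j)) = S j + c (j + 2 * N)" unfolding S_def by (simp add: add.commute)
      ultimately show ?thesis using per[of j] by simp
    qed
    have SS: "(\<Sum>j<2 * g + 1. S j) = (g + 1) * S 0 + g * S 1" for g
    proof -
      have par: "S (2 * g) = S 0 \<and> S (2 * g + 1) = S 1" for g
      proof (induction g)
        case (Suc g)
        then show ?case using S2[of "2 * g"] S2[of "2 * g + 1"] by (simp add: add.commute)
      qed simp
      show ?thesis
      proof (induction g)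
        case (Suc g)
        have "(\<Sum>j<2 * Suc g + 1. S j) = (\<Sum>j<2 * g + 1. S j) + S (2 * g + 1) + S (2 * Suc g)" by simp
        then show ?case using Suc par[of g] par[of "Suc g"] by (simp add: algebra_simps)
      qed simp
    qed
    have "(\<Sum>i<m. c (2 * i)) + (\<Sum>i<m. c (2 * i + 1)) = (\<Sum>p<2 * m. c p)" for m
      by (induction m) simp_all
    then have "S 0 + S 1 = (\<Sum>p<2 * N. c p)" unfolding S_def by simp
    also have "\<dots> = length (filter (\<lambda>x. x \<in> X) vs)"
      unfolding length_filter_sum vs(4) c_def by (intro sum.cong) auto
    also have "\<dots> = card (set vs \<inter> X)" using card_inter_distinct[OF vs(1), of X] by simp
    also have "set vs \<inter> X = X" using vs(2) XV by auto
    finally have S01: "S 0 + S 1 = N" using XV by simp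
    have total: "(\<Sum>i<N. W i) = h * N + S 0"
    proof -
      have "(\<Sum>i<N. W i) = (\<Sum>j<2 * h + 1. S j)" unfolding W_def S_def by (rule sum.swap)
      also have "\<dots> = h * (S 0 + S 1) + S 0" unfolding SS by (simp add: algebra_simps)
      finally show ?thesis unfolding S01 .
    qed
    \<comment> \<open>If all windows are light, the total is at most \<open>(h - 1) * N\<close>,
      which is below \<open>h * N + S 0\<close>. If all are heavy, it is at least
      \<open>(h + 2) * N\<close>, which is above it since \<open>S 0 \<le> N\<close>.\<close>
    consider "W 0 + 1 \<le> h" | "h + 2 \<le> W 0" using W_edge[OF Npos] by blast
    then show False
    proof cases
      case 1
      have "(\<Sum>i<N. W i + 1) \<le> (\<Sum>i<N. h)" using low[OF _ 1] by (intro sum_mono) auto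
      moreover have "(\<Sum>i<N. W i + 1) = (\<Sum>i<N. W i) + N" by (simp only: sum.distrib) simp
      ultimately have "h * N + S 0 + N \<le> h * N" unfolding total by (simp add: mult.commute)
      then show False using Npos by linarith
    next
      case 2
      have "(\<Sum>i<N. h + 2) \<le> (\<Sum>i<N. W i)" using high[OF _ 2] by (intro sum_mono) auto
      moreover have "(\<Sum>i<N. h + 2) = h * N + 2 * N" by (simp add: algebra_simps)
      ultimately have "h * N + 2 * N \<le> h * N + S 0" unfolding total by (simp only:)
      then show False using S01 Npos by linarith
    qed
  qed
  ultimately show "\<exists>(V :: nat set) E. dense E V (1 / 4 - \<epsilon>) \<and> (\<forall>e\<in>E. e \<subseteq> V) \<and> n0 \<le> card V \<and> r dvd card V \<and>
    \<not> (\<exists>vs. spanning_cycle E V vs)" by blast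
qed

end

subsection \<open>Extending tuples to edges\<close>

lemma ample_1: "ample V 1 \<alpha> (\<lambda>z. P (z ! 0)) \<longleftrightarrow> \<alpha> * real (card V) \<le> real (card {v \<in> V. P v})"
proof -
  have "{z \<in> tuples V 1. P (z ! 0)} = (\<lambda>v. [v]) ` {v \<in> V. P v}"
    unfolding tuples_def by (auto simp: length_Suc_conv)
  moreover have "card ((\<lambda>v. [v]) ` {v \<in> V. P v}) = card {v \<in> V. P v}"
    by (intro card_image) (auto simp: inj_on_def)
  ultimately show ?thesis unfolding ample_def by simp
qed

lemma ample_1I: "\<alpha> * real (card V) \<le> real (card {v \<in> V. P v}) \<Longrightarrow> ample V 1 \<alpha> (\<lambda>z. P (z ! 0))"
  using ample_1 by blast

lemma nth_relabel: "set xs \<subseteq> {..<length \<sigma>} \<Longrightarrow> map ((!) f) (map ((!) \<sigma>) xs) = map ((!) (map ((!) f) \<sigma>)) xs"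
  by (auto simp: subset_iff)

text \<open>Vertices outside \<open>D\<close> have small degree and account for at most an
  \<open>\<epsilon> / 2\<close> proportion of the pairs; all other pairs lie in
  \<open>D \<times> D\<close>. So the square of \<open>card D\<close> is at least
  \<open>(1 / 4 + \<epsilon> / 2) * n\<^sup>2\<close>. Exceeding one half is the purpose: two such
  sets meet.\<close>

lemma card_pair_link_ge:
  assumes fin: "finite V" "V \<noteq> {}" and R: "R \<subseteq> V \<times> V" "sym R" and \<epsilon>: "0 < \<epsilon>" "\<epsilon> \<le> 1"
    and cR: "(1 / 4 + \<epsilon>) * (real (card V))\<^sup>2 \<le> real (card R)"
  shows "(1 / 2 + \<epsilon> / 4) * real (card V) \<le> real (card {x \<in> V. \<epsilon> / 4 * real (card V) \<le> real (card {y \<in> V. (x, y) \<in> R})})"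
proof -
  let ?n = "real (card V)"
  define D where "D = {x \<in> V. \<epsilon> / 4 * ?n \<le> real (card {y \<in> V. (x, y) \<in> R})}"
  have D: "D \<subseteq> V" "finite D" unfolding D_def using fin by auto
  define S where "S = Sigma (V - D) (\<lambda>x. {y \<in> V. (x, y) \<in> R})"
  have finS: "finite S" unfolding S_def using fin by auto
  have "real (card S) = (\<Sum>x\<in>V - D. real (card {y \<in> V. (x, y) \<in> R}))"
    unfolding S_def using fin by (subst card_SigmaI) auto
  also have "\<dots> \<le> (\<Sum>x\<in>V - D. \<epsilon> / 4 * ?n)" unfolding D_def by (intro sum_mono) auto
  also have "\<dots> = real (card (V - D)) * (\<epsilon> / 4 * ?n)" by simp
  also have "\<dots> \<le> ?n * (\<epsilon> / 4 * ?n)"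
    using fin \<epsilon> by (intro mult_right_mono) (auto intro: card_mono)
  finally have cS: "real (card S) \<le> \<epsilon> / 4 * ?n\<^sup>2" by (simp add: power2_eq_square mult_ac)
  have "R \<subseteq> (D \<times> D) \<union> (S \<union> prod.swap ` S)"
    using R unfolding S_def D_def sym_def by force
  then have "card R \<le> card ((D \<times> D) \<union> (S \<union> prod.swap ` S))"
    using D finS by (intro card_mono) auto
  also have "\<dots> \<le> card (D \<times> D) + (card S + card S)"
    using finS by (intro order_trans[OF card_Un_le] add_mono order_refl order_trans[OF card_Un_le] card_image_le)
  finally have "real (card R) \<le> real (card D * card D + (card S + card S))"
    unfolding card_cartesian_product by (simp only: of_nat_le_iff)
  then have "(1 / 4 + \<epsilon>) * ?n\<^sup>2 \<le> (real (card D))\<^sup>2 + 2 * (\<epsilon> / 4 * ?n\<^sup>2)"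
    using cR cS by (simp add: power2_eq_square)
  then have "(1 / 4 + \<epsilon> / 2) * ?n\<^sup>2 \<le> (real (card D))\<^sup>2" by (simp add: algebra_simps)
  moreover have "((1 / 2 + \<epsilon> / 4) * ?n)\<^sup>2 \<le> (1 / 4 + \<epsilon> / 2) * ?n\<^sup>2"
  proof -
    have "\<epsilon> * \<epsilon> \<le> 1 * \<epsilon>" using \<epsilon> by (intro mult_right_mono) auto
    then have "1 / 4 + \<epsilon> / 4 + \<epsilon> * \<epsilon> / 16 \<le> 1 / 4 + \<epsilon> / 2" using \<epsilon> by linarith
    then have "(1 / 2 + \<epsilon> / 4)\<^sup>2 \<le> 1 / 4 + \<epsilon> / 2" by (simp add: power2_eq_square algebra_simps)
    then show ?thesis unfolding power_mult_distrib by (intro mult_right_mono) auto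
  qed
  ultimately have "((1 / 2 + \<epsilon> / 4) * ?n)\<^sup>2 \<le> (real (card D))\<^sup>2" by linarith
  then show ?thesis unfolding D_def[symmetric] by (rule power2_le_imp_le) simp
qed

lemma eventually_linear_bound:
  assumes "0 < \<eta>" shows "\<exists>n0::nat. \<forall>n\<ge>n0. c \<le> \<eta> * real n"
proof -
  obtain n0 :: nat where "c / \<eta> \<le> real n0" using real_arch_simple by blast
  then have "c \<le> \<eta> * real n" if "n0 \<le> n" for n
    using assms that by (simp add: field_simps) (meson mult_left_mono of_nat_le_iff order_less_imp_le order_trans)
  then show ?thesis by blast
qed

lemma map_nth_upt: "i \<le> j \<Longrightarrow> j \<le> length xs \<Longrightarrow> map ((!) xs) [i..<j] = take (j - i) (drop i xs)"
  by (intro nth_equalityI) auto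

context cycle_params
begin

lemma walk_set_subset:
  assumes "walk E xs" shows "set xs \<subseteq> set (take l xs) \<union> \<Union>E"
proof
  fix x assume "x \<in> set xs"
  then obtain p where p: "p < length xs" "x = xs ! p" by (metis in_set_conv_nth)
  obtain m where m: "length xs = l + r * m" using assms by (rule walk_lengthE)
  show "x \<in> set (take l xs) \<union> \<Union>E"
  proof (cases "p < l")
    case True
    then have "x \<in> set (take l xs)" using p by (auto simp: in_set_conv_nth intro!: exI[of _ p])
    then show ?thesis by simp
  next
    case False
    define i where "i = (p - l) div r"
    define d where "d = (p - l) mod r"
    have d: "d < r" unfolding d_def using r_pos by simp
    have pe: "p = i * r + (l + d)" unfolding i_def d_def using False by simp
    have "i * r < m * r" using p(1) m pe mult.commute[of r m] by linarith
    then have i: "i < m" by simp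
    then have "(i + 1) * r \<le> m * r" by (intro mult_right_mono) auto
    then have "i * r + (l + r) \<le> length xs" using m mult.commute[of r m] by simp
    then have "x \<in> set (take (l + r) (drop (i * r) xs))"
      using p(2) pe d by (subst set_window) auto
    then show ?thesis using walkD[OF assms m i] by blast
  qed
qed

lemma dense_le_one:
  assumes "dense E V \<beta>" "l + r \<le> card V" shows "\<beta> \<le> 1"
proof -
  have fin: "finite V" using assms dense_finite by blast
  obtain T where T: "T \<subseteq> V" "card T = l + r - 2"
    using obtain_subset_with_card_n[of "l + r - 2" V] assms(2) by (metis diff_le_self le_trans)
  have "card (link E V T) \<le> card (V \<times> V)" unfolding link_def using fin by (intro card_mono) auto
  then have "\<beta> * (real (card V))\<^sup>2 \<le> 1 * (real (card V))\<^sup>2"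
    using denseD[OF assms(1) T] by (simp add: card_cartesian_product power2_eq_square flip: of_nat_mult)
  moreover have "card V > 0" using assms(2) l_pos by simp
  ultimately show ?thesis by (metis mult_le_cancel_right_pos of_nat_0_less_iff zero_less_power)
qed

lemma ample_link:
  assumes "dense E V \<beta>" "T \<subseteq> V" "card T = l + r - 2"
  shows "ample V 2 \<beta> (\<lambda>z. T \<union> set z \<in> E)"
proof -
  have fin: "finite V" using assms dense_finite by blast
  have "card (link E V T) \<le> card {z \<in> tuples V 2. T \<union> set z \<in> E}"
  proof (rule card_inj_on_le[where f = "\<lambda>(x, y). [x, y]"])
    show "inj_on (\<lambda>(x, y). [x, y]) (link E V T)" by (auto simp: inj_on_def)
    show "(\<lambda>(x, y). [x, y]) ` link E V T \<subseteq> {z \<in> tuples V 2. T \<union> set z \<in> E}"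
      unfolding link_def tuples_def by (auto simp: insert_commute)
    show "finite {z \<in> tuples V 2. T \<union> set z \<in> E}" using fin by simp
  qed
  then show ?thesis using denseD[OF assms] unfolding ample_def by linarith
qed

text \<open>Before the link applies, the set must have \<open>l + r - 2\<close> vertices; the
  \<open>d\<close> missing ones are arbitrary vertices outside it, at the cost of a factor
  \<open>1 - (l + r) / card V\<close> each.\<close>

lemma ample_extension_exact:
  assumes V: "dense E V \<beta>" "0 \<le> \<beta>" "l + r \<le> card V"
  shows "A \<subseteq> V \<Longrightarrow> card A + d = l + r - 2 \<Longrightarrow>
    ample V (d + 2) (\<beta> * (1 - real (l + r) / real (card V)) ^ d) (\<lambda>z. A \<union> set z \<in> E)"
proof (induction d arbitrary: A)
  case 0
  then show ?case using ample_link[OF V(1)] by (simp add: numeral_2_eq_2)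
next
  case (Suc d)
  let ?n = "real (card V)" and ?c = "1 - real (l + r) / real (card V)"
  have fin: "finite V" using V dense_finite by blast
  have fA: "finite A" using Suc.prems fin finite_subset by blast
  have n0: "?n > 0" using V(3) l_pos by simp
  have c0: "0 \<le> ?c" using V(3) n0 by (simp add: field_simps)
  have "{v \<in> V. v \<notin> A} = V - A" by auto
  then have "card {v \<in> V. v \<notin> A} = card V - card A" using Suc.prems fA by (simp add: card_Diff_subset)
  moreover have "card A \<le> card V" using Suc.prems fin by (intro card_mono) auto
  ultimately have cd: "real (card {v \<in> V. v \<notin> A}) = ?n - real (card A)" by (simp add: of_nat_diff)
  have "?c * ?n = ?n - real (l + r)" using n0 by (simp add: left_diff_distrib)
  moreover have "card A \<le> l + r" using Suc.prems by simp
  ultimately have "?c * ?n \<le> real (card {v \<in> V. v \<notin> A})" unfolding cd by (simp only: diff_left_mono of_nat_le_iff)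
  then have a1: "ample V 1 ?c (\<lambda>z. z ! 0 \<notin> A)"
    by (rule ample_1I[where P = "\<lambda>v. v \<notin> A"])
  have "ample V (1 + (d + 2)) (?c * (\<beta> * ?c ^ d))
    (\<lambda>z. take 1 z ! 0 \<notin> A \<and> insert (take 1 z ! 0) A \<union> set (drop 1 z) \<in> E)"
  proof (rule ample_append[OF a1 _ _ fin])
    fix x assume "x \<in> tuples V 1" "x ! 0 \<notin> A"
    moreover from this have "x ! 0 \<in> V" unfolding tuples_def by (auto simp: length_Suc_conv)
    ultimately show "ample V (d + 2) (\<beta> * ?c ^ d) (\<lambda>z. insert (x ! 0) A \<union> set z \<in> E)"
      using Suc.prems fA by (intro Suc.IH) auto
  qed (use V(2) c0 in auto)
  then have "ample V (Suc d + 2) (?c * (\<beta> * ?c ^ d))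
    (\<lambda>z. take 1 z ! 0 \<notin> A \<and> insert (take 1 z ! 0) A \<union> set (drop 1 z) \<in> E)" by simp
  then show ?case
  proof (rule ample_mono[OF _ fin])
    fix z assume z: "z \<in> tuples V (Suc d + 2)" "take 1 z ! 0 \<notin> A \<and> insert (take 1 z ! 0) A \<union> set (drop 1 z) \<in> E"
    then obtain v zs where "z = v # zs" unfolding tuples_def by (cases z) auto
    then show "A \<union> set z \<in> E" using z(2) by simp
  qed simp
qed

text \<open>Bernoulli's inequality bounds the cost of the arbitrary vertices by
  \<open>\<eta>\<close> once \<open>card V\<close> is large.\<close>

lemma ample_extension:
  assumes V: "dense E V \<beta>" "0 \<le> \<beta>" and \<eta>: "0 < \<eta>" "\<eta> \<le> 1" "real ((l + r) * (l + r)) \<le> \<eta> * real (card V)"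
    and A: "A \<subseteq> V" "card A + q = l + r" "2 \<le> q"
  shows "ample V q (\<beta> - \<eta>) (\<lambda>z. A \<union> set z \<in> E)"
proof -
  define d where "d = q - 2"
  have d: "card A + d = l + r - 2" "d + 2 = q" using A(2,3) unfolding d_def by auto
  let ?n = "real (card V)" and ?k = "real (l + r)"
  have fin: "finite V" using V dense_finite by blast
  have k1: "1 \<le> ?k" using l_pos by linarith
  have "\<eta> * ?n \<le> 1 * ?n" using \<eta> by (intro mult_right_mono) auto
  then have "?k * ?k \<le> 1 * ?n" using \<eta>(3) by simp
  moreover have "1 * ?k \<le> ?k * ?k" using k1 by (intro mult_right_mono) auto
  ultimately have kn: "?k \<le> ?n" by (metis mult_1 order_trans)
  then have n: "l + r \<le> card V" by (simp only: of_nat_le_iff)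
  have n0: "?n > 0" using kn k1 by linarith
  have \<beta>1: "\<beta> \<le> 1" using dense_le_one[OF V(1) n] .
  have "real d * (?k / ?n) \<le> ?k * (?k / ?n)" using d(1) n0 by (intro mult_right_mono) auto
  also have "\<dots> \<le> \<eta>" using \<eta>(3) n0 by (simp add: field_simps)
  finally have "1 - \<eta> \<le> 1 + real d * (- (?k / ?n))" by simp
  also have "\<dots> \<le> (1 + - (?k / ?n)) ^ d" using kn n0 by (intro Bernoulli_inequality) (simp add: field_simps)
  finally have "\<beta> * (1 - \<eta>) \<le> \<beta> * (1 - ?k / ?n) ^ d" using V(2) by (intro mult_left_mono) auto
  moreover have "\<beta> * \<eta> \<le> 1 * \<eta>" using \<beta>1 \<eta> by (intro mult_right_mono) auto
  ultimately have "\<beta> - \<eta> \<le> \<beta> * (1 - ?k / ?n) ^ d" by (simp add: algebra_simps)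
  then show ?thesis using ample_mono[OF ample_extension_exact[OF V n A(1) d(1)] fin] d(2) by metis
qed

lemma window_distinct: "length w = l + r \<Longrightarrow> set w \<in> E \<Longrightarrow> (\<And>e. e \<in> E \<Longrightarrow> card e = l + r) \<Longrightarrow> distinct w"
  by (metis card_distinct)

text \<open>The end tuple lies in the last window, whose \<open>l + r\<close> entries form an edge
  of that size; a walk without windows is its start tuple.\<close>

lemma walk_end_distinct:
  assumes "walk E xs" "distinct (take l xs)" "\<And>e. e \<in> E \<Longrightarrow> card e = l + r"
  shows "distinct (drop (length xs - l) xs)"
proof -
  obtain m where m: "length xs = l + r * m" using assms(1) by (rule walk_lengthE)
  show ?thesis
  proof (cases m)
    case 0
    then show ?thesis using assms(2) m by simp
  next
    case (Suc m')
    define w where "w = take (l + r) (drop (m' * r) xs)"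
    have "set w \<in> E" unfolding w_def using walkD[OF assms(1) m] Suc by simp
    moreover have lw: "w = drop (m' * r) xs" "length w = l + r" unfolding w_def using m Suc by (auto simp: mult.commute)
    ultimately have "distinct w" using assms(3) by (intro window_distinct[of w E])
    then have "distinct (drop r w)" by simp
    moreover have "drop r w = drop (length xs - l) xs" unfolding lw(1) using m Suc by (simp add: mult.commute add.commute)
    ultimately show ?thesis by simp
  qed
qed

text \<open>Only the last \<open>l\<close> vertices matter for the next step, and they are distinct
  by \<open>walk_end_distinct\<close>, so the walk can be extended greedily although it may repeat
  earlier vertices.\<close>

lemma ample_walk_from:
  assumes V: "dense E V \<beta>" "0 \<le> \<beta>" and \<eta>: "0 < \<eta>" "\<eta> \<le> 1" "\<eta> \<le> \<beta>" "real ((l + r) * (l + r)) \<le> \<eta> * real (card V)"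
    and a: "length a = l" "distinct a" "set a \<subseteq> V"
  shows "ample V (r * j) ((\<beta> - \<eta>) ^ j) (\<lambda>y. walk E (a @ y))"
proof (induction j)
  case 0
  have "{x \<in> tuples V 0. walk E (a @ x)} = {[]}" using walk_base[of a E] a(1) by auto
  then show ?case unfolding ample_def by simp
next
  case (Suc j)
  have fin: "finite V" using V dense_finite by blast
  have "ample V (r * j + r) ((\<beta> - \<eta>) ^ j * (\<beta> - \<eta>))
    (\<lambda>z. walk E (a @ take (r * j) z) \<and> set (drop (r * j) (a @ take (r * j) z)) \<union> set (drop (r * j) z) \<in> E)"
  proof (rule ample_append[OF Suc _ _ fin])
    fix y assume y: "y \<in> tuples V (r * j)" "walk E (a @ y)"
    let ?A = "set (drop (r * j) (a @ y))"
    have len: "length (a @ y) - l = r * j" using y a unfolding tuples_def by simp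
    have "distinct (drop (length (a @ y) - l) (a @ y))"
      using a dense_card[OF V(1)] by (intro walk_end_distinct[OF y(2)]) auto
    then have "distinct (drop (r * j) (a @ y))" unfolding len .
    then have "card ?A = length (drop (r * j) (a @ y))" by (rule distinct_card)
    then have "card ?A = l" using y a unfolding tuples_def by simp
    moreover have "?A \<subseteq> V" using y a set_drop_subset[of "r * j" "a @ y"] unfolding tuples_def by auto
    ultimately show "ample V r (\<beta> - \<eta>) (\<lambda>z. ?A \<union> set z \<in> E)"
      using r_ge2 by (intro ample_extension[OF V \<eta>(1,2,4)]) auto
  qed (use \<eta> in simp)
  then have "ample V (r * Suc j) ((\<beta> - \<eta>) ^ Suc j)
    (\<lambda>z. walk E (a @ take (r * j) z) \<and> set (drop (r * j) (a @ take (r * j) z)) \<union> set (drop (r * j) z) \<in> E)"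
    by (simp add: mult.commute add.commute)
  then show ?case
  proof (rule ample_mono[OF _ fin order_refl])
    fix z assume z: "z \<in> tuples V (r * Suc j)"
      "walk E (a @ take (r * j) z) \<and> set (drop (r * j) (a @ take (r * j) z)) \<union> set (drop (r * j) z) \<in> E"
    define p c t where "p = take (r * j) (a @ take (r * j) z)" and "c = drop (r * j) (a @ take (r * j) z)" and "t = drop (r * j) z"
    have lz: "length z = r * Suc j" using z unfolding tuples_def by simp
    have len: "length c = l" "length t = r" unfolding c_def t_def using lz a by auto
    have pc: "p @ c = a @ take (r * j) z" unfolding p_def c_def by (rule append_take_drop_id)
    have "walk E (c @ t)" using z(2) len unfolding c_def[symmetric] t_def[symmetric] by (intro walk_single) auto
    moreover have "walk E (p @ c)" unfolding pc using z(2) by simp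
    ultimately have "walk E (p @ c @ t)" using len by (intro walk_append)
    moreover have "p @ c @ t = a @ z" using pc unfolding t_def by (metis append.assoc append_take_drop_id)
    ultimately show "walk E (a @ z)" by simp
  qed
qed

subsection \<open>Exchanging one vertex of an end tuple\<close>

text \<open>Labels below \<open>l\<close> denote the given end tuple, \<open>l\<close> the new
  vertex, and the other \<open>q\<close> labels auxiliary vertices. The walk is kept as a pattern of
  labels, which may repeat, because it is to be realised later on clones.\<close>

definition exchange_labels :: "nat \<Rightarrow> nat \<Rightarrow> nat list \<Rightarrow> bool" where
  "exchange_labels i q xs \<longleftrightarrow> set xs \<subseteq> {..<l + 1 + q} \<and> (\<exists>m. length xs = l + r * m) \<and>
     take l xs = [0..<l] \<and> drop (length xs - l) xs = [0..<l][i := l]"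

text \<open>Each window is a suffix of \<open>a\<close>, then \<open>z\<close>, then a prefix of
  \<open>a[i := v]\<close>, with both tuples cut at the same place. As they differ only at position
  \<open>i\<close>, the window covers \<open>z\<close> together with one of them. Divisibility makes
  the cut points reach the end of \<open>a\<close>.\<close>

lemma walk_hybrid:
  assumes dv: "r dvd l" and len: "length a = l" "length z = r" and i: "i < l"
    and e: "set a \<union> set z \<in> E" "set (a[i := v]) \<union> set z \<in> E"
  shows "walk E (a @ z @ a[i := v])"
proof -
  obtain m0 where m0: "l = r * m0" using dv by blast
  show ?thesis
  proof (rule walkI[of _ "m0 + 1"])
    show "length (a @ z @ a[i := v]) = l + r * (m0 + 1)" using len m0 by simp
    fix j assume "j < m0 + 1"
    then have "j * r \<le> m0 * r" by (intro mult_right_mono) auto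
    then have jr: "j * r \<le> l" using m0 by (simp add: mult.commute)
    have "take (l + r) (drop (j * r) (a @ z @ a[i := v])) = drop (j * r) a @ z @ take (j * r) (a[i := v])"
      using jr len by simp
    moreover have "set (drop (j * r) a) \<union> set (take (j * r) (a[i := v])) \<in> {set a, set (a[i := v])}"
    proof (cases "j * r \<le> i")
      case True
      then have "take (j * r) (a[i := v]) = take (j * r) a" by simp
      then show ?thesis by (metis Un_commute append_take_drop_id insertI1 set_append)
    next
      case False
      then have "drop (j * r) a = drop (j * r) (a[i := v])" by simp
      then show ?thesis by (metis Un_commute append_take_drop_id insert_iff set_append)
    qed
    ultimately show "set (take (l + r) (drop (j * r) (a @ z @ a[i := v]))) \<in> E"
      using e by (auto simp: Un_ac)
  qed
qed

text \<open>By \<open>card_pair_link_ge\<close>, more than half of all vertices have many partners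
  in each of the two links, so many vertices have partners in both. The constant is
  \<open>\<epsilon> / 2 * (\<epsilon> / 4)\<^sup>2\<close>.\<close>

lemma ample_common_neighbour:
  assumes V: "dense E V \<beta>" "V \<noteq> {}" and \<beta>: "1 / 4 + \<epsilon> \<le> \<beta>" and \<epsilon>: "0 < \<epsilon>" "\<epsilon> \<le> 1"
    and S: "S \<subseteq> V" "card S = l + r - 2" and T: "T \<subseteq> V" "card T = l + r - 2"
  shows "ample V 3 (\<epsilon> ^ 3 / 32) (\<lambda>z. S \<union> {z ! 0, z ! 1} \<in> E \<and> T \<union> {z ! 0, z ! 2} \<in> E)"
proof -
  let ?n = "real (card V)"
  have fin: "finite V" using V dense_finite by blast
  define D where "D A = {x \<in> V. \<epsilon> / 4 * ?n \<le> real (card {y \<in> V. (x, y) \<in> link E V A})}" for A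
  have big: "(1 / 2 + \<epsilon> / 4) * ?n \<le> real (card (D A))" if "A \<subseteq> V" "card A = l + r - 2" for A
    unfolding D_def
  proof (rule card_pair_link_ge[OF fin V(2) _ _ \<epsilon>])
    show "link E V A \<subseteq> V \<times> V" unfolding link_def by auto
    show "sym (link E V A)" unfolding link_def sym_def by (auto simp: insert_commute)
    have "(1 / 4 + \<epsilon>) * ?n\<^sup>2 \<le> \<beta> * ?n\<^sup>2" using \<beta> by (intro mult_right_mono) auto
    then show "(1 / 4 + \<epsilon>) * ?n\<^sup>2 \<le> real (card (link E V A))" using denseD[OF V(1) that] by linarith
  qed
  have DV: "D A \<subseteq> V" "finite (D A)" for A unfolding D_def using fin by auto
  have "card (D S \<union> D T) \<le> card V" using DV fin by (intro card_mono) auto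
  moreover have "card (D S) + card (D T) = card (D S \<union> D T) + card (D S \<inter> D T)" using DV by (intro card_Un_Int)
  ultimately have "card (D S) + card (D T) \<le> card V + card (D S \<inter> D T)" by simp
  then have "real (card (D S)) + real (card (D T)) \<le> ?n + real (card (D S \<inter> D T))" by (simp flip: of_nat_add)
  then have "\<epsilon> / 2 * ?n \<le> real (card (D S \<inter> D T))" using big[OF S] big[OF T] by (simp add: algebra_simps)
  moreover have "D S \<inter> D T = {v \<in> V. v \<in> D S \<and> v \<in> D T}" using DV by auto
  ultimately have a1: "ample V 1 (\<epsilon> / 2) (\<lambda>z. z ! 0 \<in> D S \<and> z ! 0 \<in> D T)"
    using ample_1[of V "\<epsilon> / 2" "\<lambda>v. v \<in> D S \<and> v \<in> D T"] by simp
  have nb: "ample V 1 (\<epsilon> / 4) (\<lambda>z. (x, z ! 0) \<in> link E V A)" if "x \<in> D A" for x A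
    by (rule ample_1I[where P = "\<lambda>v. (x, v) \<in> link E V A"]) (use that in \<open>simp add: D_def\<close>)
  have a2: "ample V (1 + 1) (\<epsilon> / 4 * (\<epsilon> / 4)) (\<lambda>z. (x, take 1 z ! 0) \<in> link E V S \<and> (x, drop 1 z ! 0) \<in> link E V T)"
    if "x \<in> D S" "x \<in> D T" for x
    using ample_append[OF nb[OF that(1)] nb[OF that(2)]] fin \<epsilon> by simp
  have "ample V (1 + (1 + 1)) (\<epsilon> / 2 * (\<epsilon> / 4 * (\<epsilon> / 4))) (\<lambda>z. (take 1 z ! 0 \<in> D S \<and> take 1 z ! 0 \<in> D T) \<and>
    (take 1 z ! 0, take 1 (drop 1 z) ! 0) \<in> link E V S \<and> (take 1 z ! 0, drop 1 (drop 1 z) ! 0) \<in> link E V T)"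
    by (rule ample_append[OF a1 _ _ fin]) (use a2 \<epsilon> in auto)
  moreover have "1 + (1 + 1) = (3::nat)" by simp
  ultimately have a3: "ample V 3 (\<epsilon> / 2 * (\<epsilon> / 4 * (\<epsilon> / 4))) (\<lambda>z. (take 1 z ! 0 \<in> D S \<and> take 1 z ! 0 \<in> D T) \<and>
    (take 1 z ! 0, take 1 (drop 1 z) ! 0) \<in> link E V S \<and> (take 1 z ! 0, drop 1 (drop 1 z) ! 0) \<in> link E V T)"
    by (simp only:)
  show ?thesis
  proof (rule ample_mono[OF a3 fin])
    fix z assume z: "z \<in> tuples V 3" "(take 1 z ! 0 \<in> D S \<and> take 1 z ! 0 \<in> D T) \<and>
    (take 1 z ! 0, take 1 (drop 1 z) ! 0) \<in> link E V S \<and> (take 1 z ! 0, drop 1 (drop 1 z) ! 0) \<in> link E V T"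
    then have "length z = 3" unfolding tuples_def by simp
    then have "(z ! 0, z ! 1) \<in> link E V S" "(z ! 0, z ! 2) \<in> link E V T" using z(2) by (simp_all add: numeral_2_eq_2)
    moreover have "A \<union> {x, y} = insert x (insert y A)" for A and x y :: 'a by auto
    ultimately show "S \<union> {z ! 0, z ! 1} \<in> E \<and> T \<union> {z ! 0, z ! 2} \<in> E" unfolding link_def by simp
  qed (simp add: power3_eq_cube)
qed

text \<open>The pattern depends on \<open>i\<close>, \<open>l\<close> and \<open>r\<close> only, not
  on the graph or the tuple, so that patterns can be composed and cloned. The three cases reflect
  what the lower bounds on the threshold allow.\<close>

lemma vertex_exchange:
  assumes \<epsilon>: "0 < \<epsilon>" "\<epsilon> \<le> 1" and i: "i < l"
  shows "\<exists>q xs \<gamma> n0. 0 < \<gamma> \<and> exchange_labels i q xs \<and> (\<forall>E (V :: 'a set) w. dense E V (threshold + \<epsilon>) \<and> n0 \<le> card V \<and>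
    w \<in> tuples V (l + 1) \<and> distinct w \<longrightarrow> ample V q \<gamma> (\<lambda>z. walk E (map ((!) (w @ z)) xs)))"
proof -
  define \<eta> where "\<eta> = \<epsilon> / 4"
  have \<eta>: "0 < \<eta>" "\<eta> \<le> 1" using \<epsilon> unfolding \<eta>_def by auto
  obtain n0 where n0: "\<And>n. n0 \<le> n \<Longrightarrow> real ((l + r) * (l + r)) \<le> \<eta> * real n"
    using eventually_linear_bound[OF \<eta>(1)] by blast
  let ?a = "[0..<l]" and ?b = "[0..<l][i := l]"
  have ab: "distinct ?a" "distinct ?b" "length ?a = l" "length ?b = l" "set ?a = {..<l}" "set ?b \<subseteq> {..<l + 1}"
    using set_update_subset_insert[of "[0..<l]" i l] by (auto simp: distinct_list_update)
  have w1: "map ((!) (w @ z)) ?a = take l w" if "length w = l + 1" for w z :: "'a list"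
    using that map_nth_upt[of 0 l "w @ z"] by simp
  have w2: "map ((!) (w @ z)) ?b = (take l w)[i := w ! l]" if "length w = l + 1" for w z :: "'a list"
    using w1[OF that] that by (simp add: map_update nth_append)
  have wV: "length w = l + 1" "distinct (take l w)" "distinct ((take l w)[i := w ! l])" "set (take l w) \<subseteq> V" "set ((take l w)[i := w ! l]) \<subseteq> V"
    if "w \<in> tuples V (l + 1)" "distinct w" for w :: "'a list" and V
  proof -
    show lw: "length w = l + 1" using that unfolding tuples_def by simp
    show d: "distinct (take l w)" using that by simp
    show s: "set (take l w) \<subseteq> V" using that set_take_subset[of l w] unfolding tuples_def by auto
    have wl: "w ! l \<in> V" using that lw unfolding tuples_def by auto
    show "set ((take l w)[i := w ! l]) \<subseteq> V" using s wl set_update_subset_insert[of "take l w" i "w ! l"] by auto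
    have "w ! l \<notin> set (take l w)"
      using that lw by (auto simp: in_set_conv_nth nth_eq_iff_index_eq)
    then show "distinct ((take l w)[i := w ! l])" using d by (intro distinct_list_update) auto
  qed
  consider "r dvd l" | "\<not> r dvd l" "r \<ge> 3" | "\<not> r dvd l" "r = 2" using r_ge2 by linarith
  then show ?thesis
  proof cases
    \<comment> \<open>The threshold is at least 1/2: the \<open>r\<close>-tuples completing the old
      end tuple and those completing the new one both exceed half of all, so they overlap, and a
      common completion feeds \<open>walk_hybrid\<close>.\<close>
    case 1
    define xs where "xs = ?a @ [l + 1..<l + 1 + r] @ ?b"
    obtain m0 where m0: "l = r * m0" using 1 by blast
    have "exchange_labels i r xs"
      unfolding exchange_labels_def
    proof (intro conjI)
      show "set xs \<subseteq> {..<l + 1 + r}" using ab unfolding xs_def by auto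
      have "length xs = l + r * (m0 + 1)" unfolding xs_def using m0 by simp
      then show "\<exists>m. length xs = l + r * m" by blast
    qed (simp_all add: xs_def)
    moreover have "ample V r \<epsilon> (\<lambda>z. walk E (map ((!) (w @ z)) xs))"
      if V: "dense E V (threshold + \<epsilon>)" "n0 \<le> card V" and w: "w \<in> tuples V (l + 1)" "distinct w" for E and V :: "'a set" and w
    proof -
      have fin: "finite V" using V dense_finite by blast
      have ext: "ample V r (threshold + \<epsilon> - \<eta>) (\<lambda>z. set A \<union> set z \<in> E)" if "set A \<subseteq> V" "distinct A" "length A = l" for A
        using ample_extension[OF V(1) _ \<eta> n0[OF V(2)] that(1), of r] threshold_nonneg \<epsilon> that r_ge2
        by (simp add: distinct_card)
      have "ample V r ((threshold + \<epsilon> - \<eta>) + (threshold + \<epsilon> - \<eta>) - 1)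
        (\<lambda>z. set (take l w) \<union> set z \<in> E \<and> set ((take l w)[i := w ! l]) \<union> set z \<in> E)"
        using wV[OF w] by (intro ample_conj ext fin) auto
      then show ?thesis
      proof (rule ample_mono[OF _ fin])
        show "\<epsilon> \<le> (threshold + \<epsilon> - \<eta>) + (threshold + \<epsilon> - \<eta>) - 1"
          using threshold_ge_half[OF 1] \<epsilon> unfolding \<eta>_def by simp
        fix z assume z: "z \<in> tuples V r" "set (take l w) \<union> set z \<in> E \<and> set ((take l w)[i := w ! l]) \<union> set z \<in> E"
        have lz: "length z = r" using z unfolding tuples_def by simp
        have "map ((!) (w @ z)) [l + 1..<l + 1 + r] = z"
          using map_nth_upt[of "l + 1" "l + 1 + r" "w @ z"] wV(1)[OF w] lz by simp
        then have "map ((!) (w @ z)) xs = take l w @ z @ (take l w)[i := w ! l]"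
          unfolding xs_def map_append using w1 w2 wV(1)[OF w] by simp
        moreover have "walk E (take l w @ z @ (take l w)[i := w ! l])"
          using z lz wV(1)[OF w] i by (intro walk_hybrid[OF 1]) auto
        ultimately show "walk E (map ((!) (w @ z)) xs)" by simp
      qed
    qed
    ultimately show ?thesis using \<epsilon>(1) by blast
  next
    \<comment> \<open>The old tuple and the new vertex are \<open>l + 1 \<le> l + r - 2\<close>
      vertices, so a single edge contains them all, and a walk inside it leads from one end tuple to
      the other.\<close>
    case 2
    define e where "e = {..<l + r}"
    obtain xs where xs: "joins {e} ?a xs ?b"
    proof -
      have "set ?b \<subseteq> e" using order_trans[OF ab(6), of e] 2(2) unfolding e_def by auto
      then show ?thesis using that edge_joins[OF 2(1), of e ?a ?b] ab(1-5) unfolding e_def by auto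
    qed
    have "exchange_labels i (r - 1) xs"
      unfolding exchange_labels_def
    proof (intro conjI)
      have "set xs \<subseteq> set (take l xs) \<union> e" using walk_set_subset[of "{e}" xs] xs unfolding joins_def by simp
      then show "set xs \<subseteq> {..<l + 1 + (r - 1)}" using xs 2(2) unfolding joins_def e_def by auto
      show "\<exists>m. length xs = l + r * m" using xs walk_lengthE unfolding joins_def by blast
    qed (use xs in \<open>auto simp: joins_def\<close>)
    moreover have "ample V (r - 1) \<eta> (\<lambda>z. walk E (map ((!) (w @ z)) xs))"
      if V: "dense E V (threshold + \<epsilon>)" "n0 \<le> card V" and w: "w \<in> tuples V (l + 1)" "distinct w" for E and V :: "'a set" and w
    proof -
      have fin: "finite V" using V dense_finite by blast
      have cw: "card (set w) = l + 1" "set w \<subseteq> V" using w wV(1)[OF w] unfolding tuples_def by (auto simp: distinct_card)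
      have "ample V (r - 1) (threshold + \<epsilon> - \<eta>) (\<lambda>z. set w \<union> set z \<in> E)"
        using ample_extension[OF V(1) _ \<eta> n0[OF V(2)] cw(2), of "r - 1"] threshold_nonneg \<epsilon> cw 2(2) by simp
      then show ?thesis
      proof (rule ample_mono[OF _ fin])
        show "\<eta> \<le> threshold + \<epsilon> - \<eta>" using threshold_nonneg \<epsilon> unfolding \<eta>_def by simp
        fix z assume z: "z \<in> tuples V (r - 1)" "set w \<union> set z \<in> E"
        have len: "length (w @ z) = l + r" using z wV(1)[OF w] 2(2) unfolding tuples_def by simp
        have "(!) (w @ z) ` e = set (w @ z)" unfolding e_def len[symmetric] lessThan_atLeast0
          using nth_image[of "length (w @ z)" "w @ z"] by simp
        then show "walk E (map ((!) (w @ z)) xs)"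
          using xs z(2) unfolding joins_def by (intro walk_map[of "{e}"]) auto
      qed
    qed
    ultimately show ?thesis using \<eta>(1) by blast
  next
    \<comment> \<open>No edge needs to contain all \<open>l + 1 = k - 1\<close> vertices, so two
      edges are used: the old tuple with \<open>x\<close> and \<open>y\<close>, the new one with
      \<open>x\<close> and \<open>y'\<close>. The tuple with \<open>x\<close> (label
      \<open>l + 1\<close>) at position \<open>i\<close> lies in both edges and serves as an
      intermediate stop.\<close>
    case 3
    have odd: "odd l" using 3 by simp
    define e1 e2 where "e1 = set ?a \<union> {l + 1, l + 2}" and "e2 = set ?b \<union> {l + 1, l + 3}"
    let ?d = "[0..<l][i := l + 1]"
    have "card e1 = card (set ?a) + card {l + 1, l + 2}" unfolding e1_def by (intro card_Un_disjoint) auto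
    then have c1: "card e1 = l + r" "finite e1" unfolding e1_def using 3(2) by auto
    have "card e2 = card (set ?b) + card {l + 1, l + 3}" unfolding e2_def using ab(6) by (intro card_Un_disjoint) auto
    moreover have "card (set ?b) = l" using ab distinct_card by metis
    ultimately have c2: "card e2 = l + r" "finite e2" unfolding e2_def using 3(2) by auto
    have d: "distinct ?d" "length ?d = l" "set ?d \<subseteq> e1" "set ?d \<subseteq> e2"
    proof -
      show "distinct ?d" by (intro distinct_list_update) auto
      show "set ?d \<subseteq> e1" using set_update_subset_insert[of "[0..<l]" i "l + 1"] unfolding e1_def by auto
      show "set ?d \<subseteq> e2"
      proof
        fix x assume "x \<in> set ?d"
        then obtain j where j: "j < l" "x = ?d ! j" by (auto simp: in_set_conv_nth)
        show "x \<in> e2"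
        proof (cases "j = i")
          case False
          then have "x = ?b ! j" using j by simp
          then show ?thesis unfolding e2_def using j(1) by (metis UnI1 ab(4) nth_mem)
        qed (use j i in \<open>simp add: e2_def\<close>)
      qed
    qed simp
    obtain xs1 where xs1: "joins {e1} ?a xs1 ?d"
      using edge_joins[OF 3(1) c1, of ?a ?d] ab d unfolding e1_def by auto
    obtain xs2 where xs2: "joins {e2} ?d xs2 ?b"
      using edge_joins[OF 3(1) c2, of ?d ?b] ab d unfolding e2_def by auto
    define xs where "xs = xs1 @ drop l xs2"
    have xs: "joins {e1, e2} ?a xs ?b"
      unfolding xs_def by (rule joins_trans[OF joins_mono[OF xs1] joins_mono[OF xs2]]) auto
    have "exchange_labels i 3 xs"
      unfolding exchange_labels_def
    proof (intro conjI)
      have "set xs \<subseteq> set (take l xs) \<union> (e1 \<union> e2)" using walk_set_subset[of "{e1, e2}" xs] xs unfolding joins_def by simp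
      moreover have "set (take l xs) \<union> (e1 \<union> e2) \<subseteq> {..<l + 1 + 3}"
      proof -
        have "set ?b \<subseteq> {..<l + 1 + 3}" by (rule order_trans[OF ab(6)]) auto
        then show ?thesis using xs unfolding joins_def e1_def e2_def by auto
      qed
      ultimately show "set xs \<subseteq> {..<l + 1 + 3}" by (rule order_trans)
      show "\<exists>m. length xs = l + r * m" using xs walk_lengthE unfolding joins_def by blast
    qed (use xs in \<open>auto simp: joins_def\<close>)
    moreover have "ample V 3 (\<epsilon> ^ 3 / 32) (\<lambda>z. walk E (map ((!) (w @ z)) xs))"
      if V: "dense E V (threshold + \<epsilon>)" "n0 \<le> card V" and w: "w \<in> tuples V (l + 1)" "distinct w" for E and V :: "'a set" and w
    proof -
      have fin: "finite V" using V dense_finite by blast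
      have "V \<noteq> {}" using w wV(1)[OF w] unfolding tuples_def by (cases w) auto
      then have "ample V 3 (\<epsilon> ^ 3 / 32) (\<lambda>z. set (take l w) \<union> {z ! 0, z ! 1} \<in> E \<and> set ((take l w)[i := w ! l]) \<union> {z ! 0, z ! 2} \<in> E)"
        using threshold_ge_quarter[OF 3(2) odd] \<epsilon> wV[OF w] 3(2) V(1)
        by (intro ample_common_neighbour) (auto simp: distinct_card)
      then show ?thesis
      proof (rule ample_mono[OF _ fin order_refl])
        fix z assume z: "z \<in> tuples V 3" "set (take l w) \<union> {z ! 0, z ! 1} \<in> E \<and> set ((take l w)[i := w ! l]) \<union> {z ! 0, z ! 2} \<in> E"
        let ?f = "(!) (w @ z)"
        have lw: "length w = l + 1" by (rule wV(1)[OF w])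
        have f: "?f (l + 1) = z ! 0" "?f (l + 2) = z ! 1" "?f (l + 3) = z ! 2" using lw by (simp_all add: nth_append)
        have "?f ` e1 = set (map ?f ?a) \<union> {z ! 0, z ! 1}" unfolding e1_def image_Un set_map using f by simp
        also have "set (map ?f ?a) = set (take l w)" using w1[OF lw] by (simp only:)
        finally have i1: "?f ` e1 \<in> E" using z(2) by simp
        have "?f ` e2 = set (map ?f ?b) \<union> {z ! 0, z ! 2}" unfolding e2_def image_Un set_map using f by simp
        also have "set (map ?f ?b) = set ((take l w)[i := w ! l])" using w2[OF lw] by (simp only:)
        finally have i2: "?f ` e2 \<in> E" using z(2) by simp
        show "walk E (map ?f xs)"
          using xs i1 i2 unfolding joins_def by (intro walk_map[of "{e1, e2}"]) auto
      qed
    qed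
    moreover have "0 < \<epsilon> ^ 3 / 32" using \<epsilon> by simp
    ultimately show ?thesis by blast
  qed
qed

text \<open>Labels \<open>0..<l\<close> stand for \<open>a\<close> and \<open>l..<2 * l\<close> for
  \<open>b\<close>; after \<open>j\<close> exchanges the end tuple consists of the first
  \<open>j\<close> entries of \<open>b\<close> and the remaining ones of \<open>a\<close>. At
  \<open>j = l\<close> it is \<open>b\<close>.\<close>

lemma hybrid_walks:
  assumes \<epsilon>: "0 < \<epsilon>" "\<epsilon> \<le> 1"
  shows "j \<le> l \<Longrightarrow> \<exists>q xs \<gamma> n0. 0 < \<gamma> \<and> set xs \<subseteq> {..<2 * l + q} \<and> (\<exists>m. length xs = l + r * m) \<and>
    take l xs = [0..<l] \<and> drop (length xs - l) xs = [l..<l + j] @ [j..<l] \<and>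
    (\<forall>E (V :: 'a set) w. dense E V (threshold + \<epsilon>) \<and> n0 \<le> card V \<and> w \<in> tuples V (2 * l) \<and> distinct w \<longrightarrow>
      ample V q \<gamma> (\<lambda>z. walk E (map ((!) (w @ z)) xs)))"
proof (induction j)
  case 0
  have "ample V 0 1 (\<lambda>z. walk E (map ((!) (w @ z)) [0..<l]))" for E and V :: "'a set" and w
  proof -
    have "{z \<in> tuples V 0. walk E (map ((!) (w @ z)) [0..<l])} = {[]}" using walk_base[of "map ((!) w) [0..<l]" E] by auto
    then show ?thesis unfolding ample_def by simp
  qed
  then show ?case by (intro exI[of _ 0] exI[of _ "[0..<l]"] exI[of _ "1 :: real"]) auto
next
  case (Suc j)
  obtain q xs \<gamma> n0 where \<gamma>: "0 < \<gamma>" and xs: "set xs \<subseteq> {..<2 * l + q}" "\<exists>m. length xs = l + r * m"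
    "take l xs = [0..<l]" "drop (length xs - l) xs = [l..<l + j] @ [j..<l]"
    and A: "\<And>E (V :: 'a set) w. dense E V (threshold + \<epsilon>) \<Longrightarrow> n0 \<le> card V \<Longrightarrow> w \<in> tuples V (2 * l) \<Longrightarrow> distinct w \<Longrightarrow>
      ample V q \<gamma> (\<lambda>z. walk E (map ((!) (w @ z)) xs))"
    using Suc.IH Suc.prems by (metis Suc_leD)
  have jl: "j < l" using Suc.prems by simp
  obtain q' xs' \<gamma>' n0' where \<gamma>': "0 < \<gamma>'" and ex: "exchange_labels j q' xs'"
    and A': "\<And>E (V :: 'a set) w. dense E V (threshold + \<epsilon>) \<Longrightarrow> n0' \<le> card V \<Longrightarrow> w \<in> tuples V (l + 1) \<Longrightarrow> distinct w \<Longrightarrow>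
      ample V q' \<gamma>' (\<lambda>z. walk E (map ((!) (w @ z)) xs'))"
    using vertex_exchange[OF \<epsilon> jl] by metis
  have xs': "set xs' \<subseteq> {..<l + 1 + q'}" "\<exists>m. length xs' = l + r * m" "take l xs' = [0..<l]" "drop (length xs' - l) xs' = [0..<l][j := l]"
    using ex unfolding exchange_labels_def by auto
  define I where "I = [l..<l + j] @ [j..<l] @ [l + j]"
  \<comment> \<open>Translates the labels of the exchange pattern: the current hybrid tuple, then
    the entering vertex \<open>l + j\<close>, then fresh auxiliary labels.\<close>
  define \<sigma> where "\<sigma> = I @ [2 * l + q..<2 * l + q + q']"
  define ys where "ys = map ((!) \<sigma>) xs'"
  define X where "X = [l..<l + j] @ [j..<l]"
  have lI: "length I = l + 1" "distinct I" "set I \<subseteq> {..<2 * l}" unfolding I_def using jl by auto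
  have l\<sigma>: "length \<sigma> = l + 1 + q'" unfolding \<sigma>_def using lI by simp
  have tk: "map ((!) \<sigma>) [0..<l] = X"
  proof -
    have "map ((!) \<sigma>) [0..<l] = take l \<sigma>" using map_nth_upt[of 0 l \<sigma>] l\<sigma> by simp
    then show ?thesis unfolding \<sigma>_def I_def X_def using jl by simp
  qed
  have y1: "take l ys = X" unfolding ys_def take_map xs'(3) tk ..
  have "drop (length ys - l) ys = map ((!) \<sigma>) ([0..<l][j := l])" unfolding ys_def drop_map length_map xs'(4) ..
  also have "\<dots> = X[j := \<sigma> ! l]" unfolding map_update tk ..
  also have "\<sigma> ! l = l + j" unfolding \<sigma>_def I_def using jl by (simp add: nth_append)
  also have "X[j := l + j] = [l..<l + Suc j] @ [Suc j..<l]"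
    unfolding X_def using jl by (simp add: list_update_append upt_conv_Cons[of j l])
  finally have y2: "drop (length ys - l) ys = [l..<l + Suc j] @ [Suc j..<l]" .
  have lys: "length ys = length xs'" unfolding ys_def by simp
  define zs where "zs = xs @ drop l ys"
  have len: "l \<le> length xs" "l \<le> length ys" using xs(2) xs'(2) lys by auto
  have "set ys \<subseteq> set \<sigma>" unfolding ys_def using xs'(1) l\<sigma> by (auto simp: subset_iff)
  also have "set \<sigma> \<subseteq> {..<2 * l + (q + q')}" unfolding \<sigma>_def using lI by auto
  finally have s1: "set zs \<subseteq> {..<2 * l + (q + q')}" unfolding zs_def using xs(1) set_drop_subset[of l ys] by auto
  have s2: "\<exists>m. length zs = l + r * m"
  proof -
    obtain m m' where "length xs = l + r * m" "length xs' = l + r * m'" using xs(2) xs'(2) by auto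
    then have "length zs = l + r * (m + m')" unfolding zs_def using lys by (simp add: algebra_simps)
    then show ?thesis by blast
  qed
  have s3: "take l zs = [0..<l]" unfolding zs_def using xs(3) len by simp
  have xsX: "xs = take (length xs - l) xs @ X" using xs(4) unfolding X_def by (metis append_take_drop_id)
  have ysX: "ys = X @ drop l ys" using y1 by (metis append_take_drop_id)
  have zs': "zs = take (length xs - l) xs @ ys" unfolding zs_def using xsX ysX by (metis append.assoc)
  have s4: "drop (length zs - l) zs = [l..<l + Suc j] @ [Suc j..<l]"
    using y2 len unfolding zs' by simp
  have "ample V (q + q') (\<gamma> * \<gamma>') (\<lambda>z. walk E (map ((!) (w @ z)) zs))"
    if V: "dense E V (threshold + \<epsilon>)" "max n0 n0' \<le> card V" and w: "w \<in> tuples V (2 * l)" "distinct w" for E and V :: "'a set" and w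
  proof -
    have fin: "finite V" using V dense_finite by blast
    have lw: "length w = 2 * l" using w unfolding tuples_def by simp
    define w' where "w' = map ((!) w) I"
    have "set w' \<subseteq> set w" unfolding w'_def using lI lw by (auto simp: subset_iff)
    then have w'1: "w' \<in> tuples V (l + 1)" using w lI unfolding tuples_def w'_def by auto
    have w'2: "distinct w'" unfolding w'_def distinct_map
      using lI lw inj_on_nth[OF w(2), of "set I"] by auto
    have "ample V (q + q') (\<gamma> * \<gamma>') (\<lambda>z. walk E (map ((!) (w @ take q z)) xs) \<and> walk E (map ((!) (w' @ drop q z)) xs'))"
      using V w w'1 w'2 \<gamma>' by (intro ample_append[OF A _ _ fin] A') auto
    then show ?thesis
    proof (rule ample_mono[OF _ fin order_refl])
      fix z assume z: "z \<in> tuples V (q + q')" "walk E (map ((!) (w @ take q z)) xs) \<and> walk E (map ((!) (w' @ drop q z)) xs')"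
      let ?f = "(!) (w @ z)"
      have lz: "length z = q + q'" using z unfolding tuples_def by simp
      have f1: "map ((!) (w @ take q z)) xs = map ?f xs"
        using xs(1) lw lz by (intro map_cong refl) (auto simp: nth_append subset_iff)
      have "map ?f [2 * l + q..<2 * l + q + q'] = drop q z"
        using map_nth_upt[of "2 * l + q" "2 * l + q + q'" "w @ z"] lw lz by simp
      moreover have "map ?f I = w'" unfolding w'_def using lI lw by (intro map_cong refl) (auto simp: nth_append subset_iff)
      ultimately have "map ?f \<sigma> = w' @ drop q z" unfolding \<sigma>_def by simp
      then have f2: "map ((!) (w' @ drop q z)) xs' = map ?f ys"
        unfolding ys_def using xs'(1) l\<sigma> nth_relabel[of xs' \<sigma> "w @ z"] by simp
      have "joins E (map ?f [0..<l]) (map ?f xs) (map ?f X)"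
        unfolding joins_def using z(2) f1 xs(3,4) by (simp add: take_map drop_map X_def)
      moreover have "joins E (map ?f X) (map ?f ys) (map ?f ([l..<l + Suc j] @ [Suc j..<l]))"
        unfolding joins_def using z(2) f2 y1 y2 by (simp add: take_map drop_map)
      ultimately have "joins E (map ?f [0..<l]) (map ?f xs @ drop l (map ?f ys)) (map ?f ([l..<l + Suc j] @ [Suc j..<l]))"
        by (rule joins_trans)
      then show "walk E (map ?f zs)" unfolding joins_def zs_def by (simp add: drop_map)
    qed
  qed
  then show ?case using s1 s2 s3 s4 mult_pos_pos[OF \<gamma> \<gamma>']
    by (intro exI[of _ "q + q'"] exI[of _ zs] exI[of _ "\<gamma> * \<gamma>'"] exI[of _ "max n0 n0'"]) auto
qed

subsection \<open>Connecting end tuples\<close>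

text \<open>\<open>Inl\<close> marks a clone, \<open>Inr\<close> a fixed vertex. The ends of a
  connection and the vertices to be exchanged are prescribed, so they are carried along
  uncloned.\<close>

definition label_value :: "(nat \<Rightarrow> 'a) \<Rightarrow> nat + 'a \<Rightarrow> 'a" where
  "label_value g x = (case x of Inl p \<Rightarrow> g p | Inr v \<Rightarrow> v)"

lemma label_value_simps [simp]: "label_value g (Inl p) = g p" "label_value g (Inr v) = v"
  unfolding label_value_def by simp_all

text \<open>A walk whose labels may repeat becomes a walk on clones: the vertices of one window carry
  different labels, so they agree with a single tuple of the pattern.\<close>
lemma walk_of_clones:
  assumes agree: "\<forall>W\<subseteq>{..<length \<pi>}. inj_on ((!) \<pi>) W \<longrightarrow> (\<exists>f\<in>tuples V N. P f \<and> (\<forall>p\<in>W. f ! (\<pi> ! p) = y ! p))"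
    and wf: "\<And>f. f \<in> tuples V N \<Longrightarrow> P f \<Longrightarrow> walk E (map (label_value (\<lambda>p. f ! (\<pi> ! p))) L)"
    and pos: "\<And>p. Inl p \<in> set L \<Longrightarrow> p < length \<pi>" and E: "\<And>e. e \<in> E \<Longrightarrow> card e = l + r"
  shows "walk E (map (label_value ((!) y)) L)"
proof -
  obtain f0 where f0: "f0 \<in> tuples V N" "P f0" using agree[rule_format, of "{}"] by auto
  have w0: "walk E (map (label_value (\<lambda>p. f0 ! (\<pi> ! p))) L)" using wf[OF f0] .
  obtain m where m: "length L = l + r * m" using walk_lengthE[OF w0] by auto
  show ?thesis
  proof (rule walkI[of _ m])
    show "length (map (label_value ((!) y)) L) = l + r * m" using m by simp
    fix i assume i: "i < m"
    define w where "w = take (l + r) (drop (i * r) L)"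
    have "(i + 1) * r \<le> m * r" using i by (intro mult_right_mono) auto
    then have lw: "length w = l + r" unfolding w_def using m by (simp add: mult.commute)
    have wL: "set w \<subseteq> set L" unfolding w_def by (meson order_trans set_drop_subset set_take_subset)
    have win: "set (map (label_value (\<lambda>p. f ! (\<pi> ! p))) w) \<in> E" if "f \<in> tuples V N" "P f" for f
      using walkD[OF wf[OF that], of m i] m i unfolding w_def by (simp add: take_map drop_map)
    have dis: "distinct (map (label_value (\<lambda>p. f0 ! (\<pi> ! p))) w)"
      by (rule window_distinct[OF _ win[OF f0] E]) (use lw in simp)
    define W where "W = {p. Inl p \<in> set w}"
    have "W \<subseteq> {..<length \<pi>}" unfolding W_def using pos wL by auto
    moreover have "inj_on ((!) \<pi>) W"
    proof (rule inj_onI)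
      fix p p' assume pp: "p \<in> W" "p' \<in> W" "\<pi> ! p = \<pi> ! p'"
      then have "label_value (\<lambda>p. f0 ! (\<pi> ! p)) (Inl p) = label_value (\<lambda>p. f0 ! (\<pi> ! p)) (Inl p')" by simp
      then have "(Inl p :: nat + 'a) = Inl p'"
        using dis pp unfolding distinct_map inj_on_def W_def by blast
      then show "p = p'" by simp
    qed
    ultimately obtain f where f: "f \<in> tuples V N" "P f" "\<forall>p\<in>W. f ! (\<pi> ! p) = y ! p" using agree by blast
    have "map (label_value (\<lambda>p. f ! (\<pi> ! p))) w = map (label_value ((!) y)) w"
    proof (rule map_cong[OF refl])
      fix x assume "x \<in> set w"
      then show "label_value (\<lambda>p. f ! (\<pi> ! p)) x = label_value ((!) y) x"
        using f(3) \<open>x \<in> set w\<close> unfolding W_def by (cases x rule: sum.exhaust) auto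
    qed
    then show "set (take (l + r) (drop (i * r) (map (label_value ((!) y)) L))) \<in> E"
      using win[OF f(1,2)] unfolding w_def by (simp add: take_map drop_map)
  qed
qed

text \<open>The pattern of \<open>hybrid_walks\<close> revisits the vertices of its two ends, and
  prescribed ends cannot be cloned. So random walks first lead away from \<open>a\<close> and,
  backwards, from \<open>b\<close>; their far end tuples are random, they are joined by the pattern,
  and all random vertices are then cloned apart.\<close>

lemma connecting_walks:
  assumes \<epsilon>: "0 < \<epsilon>" "\<epsilon> \<le> 1"
  shows "\<exists>q \<gamma> n0. 0 < \<gamma> \<and> r dvd q + l \<and> (\<forall>E (V :: 'a set) a b. dense E V (threshold + \<epsilon>) \<and> n0 \<le> card V \<and>
    length a = l \<and> length b = l \<and> distinct (a @ b) \<and> set (a @ b) \<subseteq> V \<longrightarrow>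
    ample V q \<gamma> (\<lambda>y. walk E (a @ y @ b) \<and> distinct (a @ y @ b)))"
proof -
  define \<eta> where "\<eta> = \<epsilon> / 4"
  have \<eta>: "0 < \<eta>" "\<eta> \<le> 1" "\<eta> \<le> threshold + \<epsilon>" using \<epsilon> threshold_nonneg unfolding \<eta>_def by auto
  obtain q xs \<gamma> n1 where \<gamma>: "0 < \<gamma>" and xs: "set xs \<subseteq> {..<2 * l + q}" "\<exists>m. length xs = l + r * m"
    "take l xs = [0..<l]" and xs4: "drop (length xs - l) xs = [l..<l + l] @ [l..<l]"
    and A: "\<And>E (V :: 'a set) w. dense E V (threshold + \<epsilon>) \<Longrightarrow> n1 \<le> card V \<Longrightarrow> w \<in> tuples V (2 * l) \<Longrightarrow> distinct w \<Longrightarrow>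
      ample V q \<gamma> (\<lambda>z. walk E (map ((!) (w @ z)) xs))"
    using hybrid_walks[OF \<epsilon> order_refl] by metis
  have xs_end: "drop (length xs - l) xs = [l..<l + l]" using xs4 by simp
  \<comment> \<open>A multiple of \<open>r\<close> that is at least \<open>l\<close>, so the far end
    tuple of such a walk shares no position with the prescribed one.\<close>
  define M where "M = r * l"
  have lM: "l \<le> M" unfolding M_def using r_pos by simp
  define \<sigma> where "\<sigma> = [M - l..<M + l] @ [2 * M..<2 * M + q]"
  \<comment> \<open>Labels of the whole connection in terms of \<open>2 * M + q\<close> coordinates:
    the first walk, the pattern without its first end tuple, and the second walk without its first
    \<open>l\<close> entries, which end the pattern.\<close>
  define \<pi> where "\<pi> = [0..<M] @ drop l (map ((!) \<sigma>) xs) @ [M + l..<2 * M]"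
  have l\<sigma>: "length \<sigma> = 2 * l + q" unfolding \<sigma>_def using lM by simp
  have "set (map ((!) \<sigma>) xs) \<subseteq> set \<sigma>" using xs(1) l\<sigma> by (auto simp: subset_iff)
  moreover have "set \<sigma> \<subseteq> {..<2 * M + q}" unfolding \<sigma>_def using lM by auto
  ultimately have "set (drop l (map ((!) \<sigma>) xs)) \<subseteq> {..<2 * M + q}"
    using set_drop_subset[of l "map ((!) \<sigma>) xs"] by (meson order_trans)
  then have \<pi>N: "set \<pi> \<subseteq> {..<2 * M + q}" unfolding \<pi>_def by auto
  obtain m where m: "length xs = l + r * m" using xs(2) by auto
  define Q where "Q = length \<pi>"
  have Q: "Q + l = r * (l + m + l)" proof -
    have "Q = M + r * m + (M - l)" unfolding Q_def \<pi>_def using m by simp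
    then have "Q + l = M + r * m + M" using lM by simp
    then show ?thesis unfolding M_def by (simp add: algebra_simps)
  qed
  define \<alpha> where "\<alpha> = (threshold + \<epsilon> - \<eta>) ^ l"
  have \<alpha>: "0 < \<alpha>" unfolding \<alpha>_def using threshold_nonneg \<epsilon> \<eta>_def by (intro zero_less_power) linarith
  \<comment> \<open>Two walks, at most half of which are lost to repeated entries, followed by the
    pattern.\<close>
  define \<rho> where "\<rho> = (\<alpha> * \<alpha> / 2) * \<gamma>"
  have \<rho>: "0 < \<rho>" unfolding \<rho>_def using \<alpha> \<gamma> by simp
  define \<rho>' where "\<rho>' = \<rho> ^ 2 ^ Q"
  have \<rho>': "0 < \<rho>'" unfolding \<rho>'_def using \<rho> by simp
  have \<rho>'4: "0 < \<rho>' / 4" using \<rho>' by simp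
  obtain n2 where n2: "\<And>n. n2 \<le> n \<Longrightarrow> real ((l + r) * (l + r)) \<le> \<eta> * real n"
    using eventually_linear_bound[OF \<eta>(1)] by blast
  obtain n3 where n3: "\<And>n. n3 \<le> n \<Longrightarrow> real ((M + M) * (M + M)) \<le> (\<alpha> * \<alpha> / 2) * real n"
    using eventually_linear_bound[of "\<alpha> * \<alpha> / 2"] \<alpha> mult_pos_pos[OF \<alpha> \<alpha>] by (meson half_gt_zero)
  obtain n4 where n4: "\<And>n. n4 \<le> n \<Longrightarrow> real (Q * Q) \<le> (\<rho>' / 4) * real n"
    using eventually_linear_bound[OF \<rho>'4] by blast
  obtain n5 where n5: "\<And>n. n5 \<le> n \<Longrightarrow> real (Q * (2 * l)) \<le> (\<rho>' / 4) * real n"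
    using eventually_linear_bound[OF \<rho>'4] by blast
  have main: "ample V Q (\<rho>' / 2) (\<lambda>y. walk E (a @ y @ b) \<and> distinct (a @ y @ b))"
    if V: "dense E V (threshold + \<epsilon>)" "n1 + n2 + n3 + n4 + n5 \<le> card V" and a: "length a = l" and b: "length b = l"
      and ab: "distinct (a @ b)" "set (a @ b) \<subseteq> V" for E and V :: "'a set" and a b
  proof -
    have fin: "finite V" using V dense_finite by blast
    have V0: "V \<noteq> {}" using ab a l_pos by (cases a) auto
    have th: "0 \<le> threshold + \<epsilon>" using threshold_nonneg \<epsilon> by simp
    have a1: "ample V M \<alpha> (\<lambda>y. walk E (a @ y))"
      unfolding M_def \<alpha>_def using ab a V(2) by (intro ample_walk_from[OF V(1) th \<eta> n2]) auto
    \<comment> \<open>Walks into \<open>b\<close> are the reversals of walks out of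
      \<open>rev b\<close>.\<close>
    have "ample V M \<alpha> (\<lambda>y. walk E (rev b @ y))"
      unfolding M_def \<alpha>_def using ab b V(2) by (intro ample_walk_from[OF V(1) th \<eta> n2]) auto
    then have "ample V M \<alpha> (\<lambda>y. walk E (rev b @ rev y))" by (rule ample_rev[OF _ fin])
    then have a2: "ample V M \<alpha> (\<lambda>y. walk E (y @ b))"
      by (rule ample_mono[OF _ fin order_refl]) (metis rev_append rev_rev_ident walk_rev)
    have "ample V (M + M) (\<alpha> * \<alpha>) (\<lambda>y. walk E (a @ take M y) \<and> walk E (drop M y @ b))"
      using a2 \<alpha> by (intro ample_append[OF a1 _ _ fin]) auto
    then have "ample V (M + M) (\<alpha> * \<alpha> - \<alpha> * \<alpha> / 2) (\<lambda>y. (walk E (a @ take M y) \<and> walk E (drop M y @ b)) \<and> distinct y)"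
      using V(2) \<alpha> by (intro ample_distinct[OF _ fin n3]) auto
    then have a3: "ample V (M + M) (\<alpha> * \<alpha> / 2) (\<lambda>y. (walk E (a @ take M y) \<and> walk E (drop M y @ b)) \<and> distinct y)" by simp
    let ?R = "\<lambda>y z. walk E (map ((!) (take (2 * l) (drop (M - l) y) @ z)) xs)"
    let ?P = "\<lambda>f. ((walk E (a @ take M (take (M + M) f)) \<and> walk E (drop M (take (M + M) f) @ b)) \<and> distinct (take (M + M) f)) \<and> ?R (take (M + M) f) (drop (M + M) f)"
    have a4: "ample V (M + M + q) \<rho> ?P"
      unfolding \<rho>_def
    proof (rule ample_append[OF a3 _ _ fin])
      fix y assume y: "y \<in> tuples V (M + M)" "(walk E (a @ take M y) \<and> walk E (drop M y @ b)) \<and> distinct y"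
      show "ample V q \<gamma> (?R y)"
      proof (rule A[OF V(1)])
        show "take (2 * l) (drop (M - l) y) \<in> tuples V (2 * l)"
          using y(1) lM by (auto simp: tuples_def dest!: in_set_takeD in_set_dropD)
      qed (use V(2) y(2) in auto)
    qed (use \<gamma> in simp)
    have MM: "M + M + q = 2 * M + q" by simp
    have wf: "walk E (a @ map ((!) f) \<pi> @ b)" if f: "f \<in> tuples V (2 * M + q)" "?P f" for f
    proof -
      have lf: "length f = 2 * M + q" using f unfolding tuples_def by simp
      define y1 y2 z where "y1 = take M f" and "y2 = take M (drop M f)" and "z = drop (2 * M) f"
      have fy: "f = y1 @ y2 @ z"
      proof -
        have "drop M f = y2 @ drop M (drop M f)" unfolding y2_def by (rule append_take_drop_id[symmetric])
        moreover have "drop M (drop M f) = z" unfolding z_def by (simp add: mult_2)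
        ultimately show ?thesis unfolding y1_def by (metis append_take_drop_id)
      qed
      have ly: "length y1 = M" "length y2 = M" unfolding y1_def y2_def using lf by auto
      have t1: "take (M + M) f = y1 @ y2" "drop (M + M) f = z" using fy ly by auto
      have P: "walk E (a @ y1)" "walk E (y2 @ b)" "?R (y1 @ y2) z" using f(2) ly unfolding t1 by auto
      define c d where "c = drop (M - l) y1" and "d = take l y2"
      have cd: "take (2 * l) (drop (M - l) (y1 @ y2)) = c @ d" unfolding c_def d_def using ly lM by simp
      have lcd: "length c = l" "length d = l" unfolding c_def d_def using ly lM by auto
      have "map ((!) f) [M - l..<M + l] = c @ d"
        using map_nth_upt[of "M - l" "M + l" f] lM lf cd fy ly by simp
      moreover have "map ((!) f) [2 * M..<2 * M + q] = z"
        using map_nth_upt[of "2 * M" "2 * M + q" f] lf unfolding z_def by simp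
      ultimately have f\<sigma>: "map ((!) f) \<sigma> = (c @ d) @ z" unfolding \<sigma>_def by simp
      define X where "X = map ((!) f) (map ((!) \<sigma>) xs)"
      have X: "X = map ((!) ((c @ d) @ z)) xs" unfolding X_def using nth_relabel[of xs \<sigma> f] xs(1) l\<sigma> f\<sigma> by simp
      have "take l X = c"
        unfolding X take_map xs(3) using map_nth_upt[of 0 l "(c @ d) @ z"] lcd by simp
      moreover have "drop (length X - l) X = d"
      proof -
        have "length X = length xs" unfolding X by simp
        then have "drop (length X - l) X = map ((!) ((c @ d) @ z)) [l..<l + l]" using xs_end unfolding X by (simp add: drop_map)
        then show ?thesis using map_nth_upt[of l "l + l" "(c @ d) @ z"] lcd by simp
      qed
      moreover have "walk E X" using P(3) unfolding cd X .
      ultimately have j2: "joins E c X d" unfolding joins_def by simp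
      have y1c: "y1 = take (M - l) y1 @ c" unfolding c_def by simp
      have y2d: "y2 = d @ drop l y2" unfolding d_def by simp
      have j1: "joins E a (a @ y1) c"
        unfolding joins_def using P(1) a ly lM c_def by simp
      have j3: "joins E d (y2 @ b) b"
        unfolding joins_def d_def using P(2) b ly lM by simp
      have "joins E a (((a @ y1) @ drop l X) @ drop l (y2 @ b)) b"
        by (rule joins_trans[OF joins_trans[OF j1 j2] j3])
      moreover have "map ((!) f) \<pi> = y1 @ drop l X @ drop l y2"
      proof -
        have "map ((!) f) [0..<M] = y1" using map_nth_upt[of 0 M f] lf unfolding y1_def by simp
        moreover have "map ((!) f) [M + l..<2 * M] = drop l y2"
          using map_nth_upt[of "M + l" "2 * M" f] lf lM fy ly by simp
        ultimately show ?thesis unfolding \<pi>_def X_def by (simp add: drop_map)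
      qed
      ultimately show ?thesis unfolding joins_def using ly lM by simp
    qed
    let ?Y = "\<lambda>y. \<forall>W\<subseteq>{..<length \<pi>}. inj_on ((!) \<pi>) W \<longrightarrow> (\<exists>f\<in>tuples V (2 * M + q). ?P f \<and> (\<forall>p\<in>W. f ! (\<pi> ! p) = y ! p))"
    have a5: "ample V Q \<rho>' ?Y"
      unfolding Q_def \<rho>'_def using a4 \<rho> unfolding MM by (intro ample_clones[OF fin V0 _ _ \<pi>N]) auto
    have a6: "ample V Q (\<rho>' - \<rho>' / 4) (\<lambda>y. ?Y y \<and> distinct y)"
      using V(2) \<rho>' by (intro ample_distinct[OF a5 fin n4]) auto
    have a7: "ample V Q (\<rho>' - \<rho>' / 4 - \<rho>' / 4) (\<lambda>y. (?Y y \<and> distinct y) \<and> set y \<inter> set (a @ b) = {})"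
    proof (rule ample_avoid[OF a6 fin])
      have "card (set (a @ b)) = 2 * l" using distinct_card[OF ab(1)] a b by simp
      then show "real (Q * card (set (a @ b))) \<le> \<rho>' / 4 * real (card V)" using n5[of "card V"] V(2) by simp
    qed (use \<rho>' in auto)
    show ?thesis
    proof (rule ample_mono[OF a7 fin])
      fix y assume y: "y \<in> tuples V Q" "(?Y y \<and> distinct y) \<and> set y \<inter> set (a @ b) = {}"
      let ?L = "map Inr a @ map Inl [0..<Q] @ map Inr b"
      have val: "map (label_value g) ?L = a @ map g [0..<Q] @ b" for g :: "nat \<Rightarrow> 'a" by (simp add: comp_def)
      have mp: "map (\<lambda>p. f ! (\<pi> ! p)) [0..<Q] = map ((!) f) \<pi>" for f :: "'a list"
        unfolding Q_def by (simp add: map_nth flip: map_map[unfolded comp_def])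
      have "walk E (map (label_value ((!) y)) ?L)"
      proof (rule walk_of_clones[of \<pi> V "2 * M + q" ?P])
        show "?Y y" using y(2) by blast
        show "walk E (map (label_value (\<lambda>p. f ! (\<pi> ! p))) ?L)" if "f \<in> tuples V (2 * M + q)" "?P f" for f
          unfolding val mp by (rule wf[OF that])
        show "p < length \<pi>" if "Inl p \<in> set ?L" for p using that unfolding Q_def by auto
      qed (rule dense_card[OF V(1)])
      moreover have "map ((!) y) [0..<Q] = y" using y(1) unfolding tuples_def by (auto simp: map_nth)
      ultimately have "walk E (a @ y @ b)" unfolding val by simp
      then show "walk E (a @ y @ b) \<and> distinct (a @ y @ b)" using y(2) ab(1) by auto
    qed simp
  qed
  have dv: "r dvd Q + l" unfolding Q by simp
  show ?thesis
    using main dv \<rho>' by (intro exI[of _ Q] exI[of _ "\<rho>' / 2"] exI[of _ "n1 + n2 + n3 + n4 + n5"]) auto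
qed


subsection \<open>Rotating spanning cycles\<close>

lemma walk_cyclic_iff:
  assumes "l \<le> length vs"
  shows "walk E (vs @ take l vs) \<longleftrightarrow>
    r dvd length vs \<and> (\<forall>i<length vs div r. (\<lambda>j. vs ! ((i * r + j) mod length vs)) ` {..<l + r} \<in> E)"
proof -
  have win: "set (take (l + r) (drop (i * r) (vs @ take l vs))) = (\<lambda>j. vs ! ((i * r + j) mod length vs)) ` {..<l + r}"
    if "length vs = r * m" "i < m" for i m
  proof -
    have "(i + 1) * r \<le> m * r" using that by (intro mult_right_mono) auto
    then have ir: "i * r + r \<le> length vs" using that(1) by (simp add: mult.commute)
    have "set (take (l + r) (drop (i * r) (vs @ take l vs))) = (\<lambda>j. (vs @ take l vs) ! (i * r + j)) ` {..<l + r}"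
      using ir assms by (intro set_window) simp
    also have "\<dots> = (\<lambda>j. vs ! ((i * r + j) mod length vs)) ` {..<l + r}"
      using ir by (intro image_cong refl nth_cyclic[OF assms]) simp
    finally show ?thesis .
  qed
  show ?thesis
  proof
    assume w: "walk E (vs @ take l vs)"
    then obtain m where m: "length (vs @ take l vs) = l + r * m" by (rule walk_lengthE)
    then have lv: "length vs = r * m" using assms by simp
    then have "length vs div r = m" using r_pos by simp
    then show "r dvd length vs \<and> (\<forall>i<length vs div r. (\<lambda>j. vs ! ((i * r + j) mod length vs)) ` {..<l + r} \<in> E)"
      using walkD[OF w m] win[OF lv] lv by simp
  next
    assume h: "r dvd length vs \<and> (\<forall>i<length vs div r. (\<lambda>j. vs ! ((i * r + j) mod length vs)) ` {..<l + r} \<in> E)"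
    then obtain m where m: "length vs = r * m" by blast
    then have dm: "length vs div r = m" using r_pos by simp
    show "walk E (vs @ take l vs)"
    proof (rule walkI[of _ m])
      show "length (vs @ take l vs) = l + r * m" using m assms by simp
      show "set (take (l + r) (drop (i * r) (vs @ take l vs))) \<in> E" if "i < m" for i
        using h dm that unfolding win[OF m that] by simp
    qed
  qed
qed

text \<open>A shift by a multiple of \<open>r\<close> permutes the windows cyclically, because
  \<open>r\<close> divides the number of vertices.\<close>

lemma spanning_cycle_rotate:
  assumes vs: "spanning_cycle E V vs" and l: "l \<le> card V"
  shows "spanning_cycle E V (rotate (r * t) vs)"
proof -
  define n where "n = length vs"
  have ln: "l \<le> n" using l spanning_cycle_length[OF vs] unfolding n_def by simp
  have w: "r dvd n" "\<And>i. i < n div r \<Longrightarrow> (\<lambda>j. vs ! ((i * r + j) mod n)) ` {..<l + r} \<in> E"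
    using vs walk_cyclic_iff[of vs E] ln unfolding spanning_cycle_def n_def by auto
  obtain m where m: "n = r * m" using w(1) by blast
  have "n > 0" using ln l_pos by simp
  then have m0: "m > 0" using m by (cases m) auto
  have dm: "n div r = m" using m r_pos by simp
  have "(\<lambda>j. rotate (r * t) vs ! ((i * r + j) mod n)) ` {..<l + r} \<in> E" if "i < m" for i
  proof -
    have "(\<lambda>j. rotate (r * t) vs ! ((i * r + j) mod n)) ` {..<l + r} = (\<lambda>j. vs ! (((i + t) mod m * r + j) mod n)) ` {..<l + r}"
    proof (intro image_cong refl)
      fix j
      have "((i + t) mod m * r + j) mod n = ((r * (i + t)) mod n + j) mod n"
        unfolding m mult.commute[of "(i + t) mod m" r] mult_mod_right by (rule refl)
      also have "\<dots> = (r * (i + t) + j) mod n" by (rule mod_add_left_eq)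
      also have "\<dots> = (r * t + (i * r + j)) mod n" by (simp add: algebra_simps)
      also have "\<dots> = (r * t + (i * r + j) mod n) mod n" by (rule mod_add_right_eq[symmetric])
      finally show "rotate (r * t) vs ! ((i * r + j) mod n) = vs ! (((i + t) mod m * r + j) mod n)"
        using \<open>n > 0\<close> unfolding n_def by (simp add: nth_rotate)
    qed
    then show ?thesis using w(2)[of "(i + t) mod m"] m0 dm by simp
  qed
  then have "walk E (rotate (r * t) vs @ take l (rotate (r * t) vs))"
    using walk_cyclic_iff[of "rotate (r * t) vs" E] ln w(1) dm unfolding n_def by simp
  then show ?thesis using vs unfolding spanning_cycle_def by simp
qed

text \<open>Pigeonhole: the \<open>card B + 1\<close> stretches of \<open>l\<close> vertices
  starting at multiples of \<open>l * r\<close> are disjoint, so one of them misses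
  \<open>B\<close>. Its start is a multiple of \<open>r\<close>, so the cycle can be rotated
  there.\<close>

lemma spanning_cycle_avoid:
  assumes vs: "spanning_cycle E V vs" and B: "finite B" "l * r * (card B + 1) \<le> card V"
  shows "\<exists>ws. spanning_cycle E V ws \<and> set (take l ws) \<inter> B = {}"
proof -
  define W where "W t = set (take l (drop (t * (l * r)) vs))" for t
  have len: "length vs = card V" and dis: "distinct vs" using spanning_cycle_length[OF vs] vs unfolding spanning_cycle_def by auto
  have lr: "l \<le> l * r" using r_pos by simp
  have le: "t * (l * r) + l * r \<le> length vs" if "t \<le> card B" for t
  proof -
    have "(t + 1) * (l * r) \<le> (card B + 1) * (l * r)" using that by (intro mult_right_mono) auto
    also have "\<dots> \<le> length vs" using B(2) len by (simp only: mult.commute)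
    finally show ?thesis by simp
  qed
  have disj: "W t \<inter> W t' = {}" if "t < t'" "t' \<le> card B" for t t'
  proof -
    have "(t + 1) * (l * r) \<le> t' * (l * r)" using that by (intro mult_right_mono) auto
    moreover have "(t + 1) * (l * r) = t * (l * r) + l * r" by simp
    ultimately have tt: "t * (l * r) + l \<le> t' * (l * r)" using lr by linarith
    have "W t \<subseteq> set (take (t' * (l * r)) vs)"
    proof -
      have "take l (drop (t * (l * r)) vs) = drop (t * (l * r)) (take (t * (l * r) + l) vs)" by (simp add: take_drop add.commute)
      then have "W t \<subseteq> set (take (t * (l * r) + l) vs)" unfolding W_def by (metis set_drop_subset)
      then show ?thesis using set_take_subset_set_take[OF tt, of vs] by auto
    qed
    moreover have "W t' \<subseteq> set (drop (t' * (l * r)) vs)" unfolding W_def by (rule set_take_subset)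
    moreover have "set (take (t' * (l * r)) vs) \<inter> set (drop (t' * (l * r)) vs) = {}"
      using dis by (rule set_take_disj_set_drop_if_distinct) simp
    ultimately show ?thesis by blast
  qed
  have "\<exists>t\<le>card B. W t \<inter> B = {}"
  proof (rule ccontr)
    assume "\<not> ?thesis"
    then have "\<forall>t. \<exists>b. t \<le> card B \<longrightarrow> b \<in> W t \<inter> B" by blast
    then obtain b where b: "\<And>t. t \<le> card B \<Longrightarrow> b t \<in> W t \<inter> B" by metis
    have "inj_on b {..card B}"
    proof (rule inj_onI)
      fix t t' assume h: "t \<in> {..card B}" "t' \<in> {..card B}" "b t = b t'"
      then have "b t \<in> W t \<inter> W t'" using b[of t] b[of t'] by auto
      then show "t = t'" using disj[of t t'] disj[of t' t] h by (metis IntI Int_commute atMost_iff empty_iff linorder_neqE_nat)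
    qed
    moreover have "b ` {..card B} \<subseteq> B" using b by auto
    ultimately have "card {..card B} \<le> card B" using B(1) by (rule card_inj_on_le)
    then show False by simp
  qed
  then obtain t where t: "t \<le> card B" "W t \<inter> B = {}" by blast
  have "l * r \<le> length vs" using le[of 0] by simp
  then have lV: "l \<le> card V" using lr len by linarith
  have "spanning_cycle E V (rotate (r * (t * l)) vs)" by (rule spanning_cycle_rotate[OF vs lV])
  moreover have "take l (rotate (r * (t * l)) vs) = take l (drop (t * (l * r)) vs)"
  proof -
    have "0 < l * r" using l_pos r_pos by simp
    then have lt: "t * (l * r) < length vs" using le[OF t(1)] by linarith
    have "rotate (t * (l * r)) vs = drop (t * (l * r)) vs @ take (t * (l * r)) vs"
      using lt by (simp add: rotate_drop_take)
    moreover have "r * (t * l) = t * (l * r)" by simp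
    moreover have "l \<le> length (drop (t * (l * r)) vs)" unfolding length_drop using le[OF t(1)] lr by linarith
    ultimately show ?thesis by (simp only: take_append) simp
  qed
  ultimately show ?thesis using t(2) unfolding W_def by metis
qed

subsection \<open>Exchange gadgets\<close>

text \<open>A Hamilton path on \<open>X\<close> with given end tuples whose order is forgotten:
  absorption only has to keep account of vertex sets.\<close>

definition spans :: "'b set set \<Rightarrow> 'b list \<Rightarrow> 'b set \<Rightarrow> 'b list \<Rightarrow> bool" where
  "spans E c X d \<longleftrightarrow> (\<exists>xs. joins E c xs d \<and> distinct xs \<and> set xs = X)"

lemma spans_trans:
  assumes "spans E c X d" "spans E d Y e" "X \<inter> Y \<subseteq> set d"
  shows "spans E c (X \<union> Y) e"
proof -
  obtain xs where xs: "joins E c xs d" "distinct xs" "set xs = X" using assms(1) unfolding spans_def by auto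
  obtain ys where ys: "joins E d ys e" "distinct ys" "set ys = Y" using assms(2) unfolding spans_def by auto
  have yd: "ys = d @ drop l ys" using ys(1) unfolding joins_def by (metis append_take_drop_id)
  have dX: "set d \<subseteq> X" using xs unfolding joins_def by (metis set_drop_subset)
  have d: "distinct (d @ drop l ys)" "set d \<union> set (drop l ys) = Y" using ys yd by (metis, metis set_append)
  have "distinct (xs @ drop l ys)" using xs d assms(3) by auto
  moreover have "set (xs @ drop l ys) = X \<union> Y" using xs d dX by auto
  ultimately show ?thesis using joins_trans[OF xs(1) ys(1)] unfolding spans_def by blast
qed

lemma spans_ends:
  assumes "spans E c X d"
  shows "length c = l" "length d = l" "distinct c" "distinct d" "set c \<subseteq> X" "set d \<subseteq> X" "finite X"
proof -
  obtain xs where xs: "joins E c xs d" "distinct xs" "set xs = X" using assms unfolding spans_def by auto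
  have "l \<le> length xs" using xs walk_length_ge unfolding joins_def by auto
  then show "length c = l" "length d = l" "distinct c" "distinct d" "set c \<subseteq> X" "set d \<subseteq> X" "finite X"
    using xs set_take_subset[of l xs] set_drop_subset[of "length xs - l" xs] unfolding joins_def by auto
qed

lemma spans_refl: "length c = l \<Longrightarrow> distinct c \<Longrightarrow> spans E c (set c) c"
  unfolding spans_def joins_def using walk_base by (intro exI[of _ c]) auto

lemma spansI: "walk E (c @ y @ d) \<Longrightarrow> distinct (c @ y @ d) \<Longrightarrow> length c = l \<Longrightarrow> length d = l \<Longrightarrow> spans E c (set c \<union> set y \<union> set d) d"
  unfolding spans_def by (intro exI[of _ "c @ y @ d"]) (auto simp: joins_append)

lemma spans_card:
  assumes "spans E c X d" shows "\<exists>m. card X = l + r * m"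
proof -
  obtain xs where "joins E c xs d" "distinct xs" "set xs = X" using assms unfolding spans_def by auto
  then show ?thesis unfolding joins_def by (metis distinct_card walk_lengthE)
qed

text \<open>The shape of a spanning cycle on a sample together with \<open>Q\<close>:
  \<open>Inl i\<close> stands for entry \<open>i\<close> of the sample, \<open>Inr v\<close> for a
  vertex \<open>v\<close> of \<open>Q\<close>. The start tuple, recorded in \<open>xs\<close>, is
  required to lie in the sample so that it can be cloned.\<close>

definition cyclic_pattern :: "nat \<Rightarrow> 'b list \<Rightarrow> (nat + 'b) list \<Rightarrow> nat list \<Rightarrow> bool" where
  "cyclic_pattern s Q L xs \<longleftrightarrow> length L = s + length Q \<and> set L = Inl ` {..<s} \<union> Inr ` set Q \<and>
     length xs = l \<and> distinct xs \<and> take l L = map Inl xs"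

text \<open>The cycle is rotated until its start tuple avoids \<open>B\<close>, and in particular
  \<open>Q\<close>; then its vertices are replaced by their labels.\<close>

lemma cyclic_patternE:
  assumes vs: "spanning_cycle E (set S \<union> set Q) vs" and S: "distinct S" "length S = s" and Q: "distinct Q" "set S \<inter> set Q = {}"
    and B: "finite B" "set Q \<subseteq> B" "l * r * (card B + 1) \<le> s + length Q"
  obtains L xs where "cyclic_pattern s Q L xs" "walk E (map (label_value ((!) S)) (L @ map Inl xs))" "set (map ((!) S) xs) \<inter> B = {}"
proof -
  have cV: "card (set S \<union> set Q) = s + length Q" using S Q by (simp add: card_Un_disjoint distinct_card)
  obtain ws where ws: "spanning_cycle E (set S \<union> set Q) ws" "set (take l ws) \<inter> B = {}"
    using spanning_cycle_avoid[OF vs B(1)] B(3) cV by auto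
  have lw: "length ws = s + length Q" "distinct ws" "set ws = set S \<union> set Q"
    using ws spanning_cycle_length[OF ws(1)] cV unfolding spanning_cycle_def by auto
  have ex: "\<exists>y. y \<in> Inl ` {..<s} \<union> Inr ` set Q \<and> label_value ((!) S) y = x" if "x \<in> set ws" for x
  proof (cases "x \<in> set Q")
    case False
    then have "x \<in> set S" using that lw(3) by simp
    then obtain i where "i < s" "S ! i = x" using S(2) by (metis in_set_conv_nth)
    then show ?thesis by (intro exI[of _ "Inl i"]) auto
  qed (auto intro!: exI[of _ "Inr x"])
  then obtain h where h: "\<And>x. x \<in> set ws \<Longrightarrow> h x \<in> Inl ` {..<s} \<union> Inr ` set Q \<and> label_value ((!) S) (h x) = x" by metis
  define L where "L = map h ws"
  have mL: "map (label_value ((!) S)) L = ws" unfolding L_def using h by (simp add: map_idI)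
  have dL: "distinct L" using mL lw(2) by (metis distinct_map)
  have sub: "set L \<subseteq> Inl ` {..<s} \<union> Inr ` set Q" unfolding L_def using h by auto
  have "card (Inl ` {..<s} \<union> Inr ` set Q :: (nat + 'a) set) = s + length Q"
    using Q(1) by (subst card_Un_disjoint) (auto simp: card_image distinct_card)
  moreover have "card (set L) = s + length Q" using distinct_card[OF dL] lw(1) unfolding L_def by simp
  ultimately have sL: "set L = Inl ` {..<s} \<union> Inr ` set Q" using sub by (intro card_subset_eq) auto
  have lL: "length L = s + length Q" unfolding L_def using lw by simp
  have ll: "l \<le> length L"
  proof -
    have "l * 1 \<le> l * (r * (card B + 1))" using r_pos by (intro mult_le_mono2) simp
    then have "l \<le> l * r * (card B + 1)" by (simp only: mult.assoc mult_1_right)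
    then show ?thesis using B(3) lL by simp
  qed
  have inl: "\<exists>i. x = Inl i" if "x \<in> set (take l L)" for x
  proof (rule ccontr)
    assume "\<not> ?thesis"
    then obtain v where v: "x = Inr v" by (cases x) auto
    then have "v \<in> set Q" using that sL by (auto dest!: in_set_takeD)
    moreover have "v \<in> set (take l ws)"
      using imageI[OF that, of "label_value ((!) S)"] v mL by (simp flip: set_map take_map)
    ultimately show False using ws(2) B(2) by auto
  qed
  define xs where "xs = map projl (take l L)"
  have "Inl (projl x) = x" if "x \<in> set (take l L)" for x using inl[OF that] by auto
  then have tx: "take l L = map Inl xs" unfolding xs_def by (simp add: map_idI)
  have "distinct (take l L)" using dL by simp
  then have "distinct xs" unfolding tx by (simp add: distinct_map)
  moreover have "length xs = l" unfolding xs_def using ll by simp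
  ultimately have "cyclic_pattern s Q L xs" unfolding cyclic_pattern_def using lL sL tx by simp
  moreover have "map (label_value ((!) S)) (L @ map Inl xs) = ws @ take l ws"
    unfolding map_append mL tx[symmetric] take_map[symmetric] by (simp add: mL take_map[symmetric])
  moreover have "map ((!) S) xs = take l ws"
  proof -
    have "map (label_value ((!) S)) (take l L) = take l ws" using mL by (metis take_map)
    then show ?thesis unfolding tx by (simp add: comp_def)
  qed
  ultimately show ?thesis using that[of L xs] ws unfolding spanning_cycle_def by simp
qed

text \<open>The start tuple is determined by the label list, so the number of patterns is bounded in
  terms of \<open>s\<close> and \<open>length Q\<close> alone, as the pigeonhole argument
  requires.\<close>

lemma finite_cyclic_patterns:
  "finite {(L, xs). cyclic_pattern s Q L xs} \<and> card {(L, xs). cyclic_pattern s Q L xs} \<le> (s + length Q) ^ (s + length Q)"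
proof -
  let ?A = "tuples (Inl ` {..<s} \<union> Inr ` set Q :: (nat + 'a) set) (s + length Q)"
  have fin: "finite ?A" by simp
  have sub: "fst ` {(L, xs). cyclic_pattern s Q L xs} \<subseteq> ?A"
    unfolding cyclic_pattern_def tuples_def by auto
  have inj: "inj_on fst {(L, xs). cyclic_pattern s Q L xs}"
    unfolding cyclic_pattern_def by (auto simp: inj_on_def)
  have "card (Inl ` {..<s} \<union> Inr ` set Q :: (nat + 'a) set) \<le> s + length Q"
    by (rule order_trans[OF card_Un_le add_mono]) (auto intro!: order_trans[OF card_image_le] card_length)
  then have "card ?A \<le> (s + length Q) ^ (s + length Q)" by (simp add: card_tuples power_mono)
  then show ?thesis using fin sub inj by (meson card_inj_on_le finite_imageD finite_subset order_trans)
qed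

text \<open>A random sample has spanning cycles both with \<open>Q\<close> and with
  \<open>Q'\<close>. Let \<open>x1\<close> and \<open>x2\<close> be their start tuples and
  \<open>Y\<close> a connection between these. One route runs round the first cycle and then along
  \<open>Y\<close> to \<open>x2\<close>; the other runs along \<open>Y\<close> and then round the
  second cycle. With a second copy of both start tuples, each route uses every gadget vertex exactly
  once.\<close>

lemma exchange_gadgets:
  assumes \<epsilon>: "0 < \<epsilon>" "\<epsilon> \<le> 1"
  shows "\<exists>N \<gamma> n0. 0 < \<gamma> \<and> (\<forall>E (V :: 'a set) Q Q'. dense E V (threshold + \<epsilon>) \<and> n0 \<le> card V \<and>
    length Q = q \<and> length Q' = q \<and> distinct (Q @ Q') \<and> set (Q @ Q') \<subseteq> V \<longrightarrow>
    ample V N \<gamma> (\<lambda>g. distinct g \<and> set g \<inter> set (Q @ Q') = {} \<and>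
      (\<exists>c d. set c \<subseteq> set g \<and> set d \<subseteq> set g \<and> spans E c (set g \<union> set Q) d \<and> spans E c (set g \<union> set Q') d)))"
proof (cases "threshold + \<epsilon> \<le> 1")
  case False
  then have no: "\<not> (dense E V (threshold + \<epsilon>) \<and> l + r \<le> card V)" for E and V :: "'a set"
    using dense_le_one by blast
  show ?thesis by (rule exI[of _ 0], rule exI[of _ "1 :: real"], rule exI[of _ "l + r"]) (use no in auto)
next
  case True
  obtain n1 where n1: "\<And>E (V :: 'a set). dense E V (threshold + \<epsilon> / 2) \<Longrightarrow> n1 \<le> card V \<Longrightarrow> r dvd card V \<Longrightarrow> \<exists>vs. spanning_cycle E V vs"
    using dense_spanning_cycle[of "\<epsilon> / 2"] \<epsilon> by auto
  obtain s0 where s0: "\<And>s. s0 \<le> s \<Longrightarrow> \<exists>n0. \<forall>E (V :: 'a set) Q. dense E V (threshold + \<epsilon>) \<and> n0 \<le> card V \<and> Q \<subseteq> V \<and> card Q = q \<longrightarrow>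
    ample V s (7/8) (\<lambda>S. distinct S \<and> set S \<inter> Q = {} \<and> dense E (set S \<union> Q) (threshold + \<epsilon> - \<epsilon> / 2))"
    using sample_dense[of "threshold + \<epsilon>" "\<epsilon> / 2" q] threshold_nonneg \<epsilon> True by auto
  \<comment> \<open>Large enough for sampling, for the existence of spanning cycles and for
    \<open>spanning_cycle_avoid\<close> with up to \<open>q + l\<close> forbidden vertices;
    \<open>s\<close> is then chosen so that \<open>s + q\<close> is a multiple of
    \<open>r\<close>.\<close>
  define X where "X = s0 + n1 + q + l * r * (q + l + 1)"
  define s where "s = r * X - q"
  have X: "1 * X \<le> r * X" using r_pos by (intro mult_right_mono) auto
  moreover have "q \<le> X" unfolding X_def by simp
  ultimately have sq: "s + q = r * X" unfolding s_def by linarith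
  have "s0 + q \<le> X" "n1 \<le> X" "l * r * (q + l + 1) \<le> X" unfolding X_def by auto
  then have s: "s0 \<le> s" "n1 \<le> s + q" "l * r * (q + l + 1) \<le> s + q" using X sq by linarith+
  obtain n2 where n2': "\<forall>E (V :: 'a set) Q. dense E V (threshold + \<epsilon>) \<and> n2 \<le> card V \<and> Q \<subseteq> V \<and> card Q = q \<longrightarrow>
    ample V s (7/8) (\<lambda>S. distinct S \<and> set S \<inter> Q = {} \<and> dense E (set S \<union> Q) (threshold + \<epsilon> - \<epsilon> / 2))"
    using s0[OF s(1)] by blast
  have n2: "ample V s (7/8) (\<lambda>S. distinct S \<and> set S \<inter> Q = {} \<and> dense E (set S \<union> Q) (threshold + \<epsilon> - \<epsilon> / 2))"
    if "dense E V (threshold + \<epsilon>)" "n2 \<le> card V" "Q \<subseteq> V" "card Q = q" for E and V Q :: "'a set"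
    using n2' that by blast
  obtain q0 \<gamma>0 n3 where \<gamma>0: "0 < \<gamma>0" and n3: "\<And>E (V :: 'a set) a b. dense E V (threshold + \<epsilon>) \<Longrightarrow> n3 \<le> card V \<Longrightarrow>
    length a = l \<Longrightarrow> length b = l \<Longrightarrow> distinct (a @ b) \<Longrightarrow> set (a @ b) \<subseteq> V \<Longrightarrow>
    ample V q0 \<gamma>0 (\<lambda>y. walk E (a @ y @ b) \<and> distinct (a @ y @ b))"
    using connecting_walks[OF \<epsilon>, where 'a = 'a] by (elim exE conjE) (rule that; blast)
  define K where "K = real ((s + q) ^ (s + q) * (s + q) ^ (s + q))"
  define N where "N = s + l + l + q0"
  \<comment> \<open>Both samplings succeed for 7/8 + 7/8 - 1 = 3/4 of the tuples; one of at most
    \<open>K\<close> pairs of cycle patterns is fixed, and a connection is added.\<close>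
  define \<rho> where "\<rho> = (3 / 4) / K * \<gamma>0"
  define \<rho>' where "\<rho>' = \<rho> ^ 2 ^ N"
  have "0 < l * r * (q + l + 1)" using l_pos r_pos by simp
  then have sq0: "0 < s + q" using s(3) by linarith
  then have K0: "0 < K" unfolding K_def of_nat_0_less_iff by simp
  then have \<rho>: "0 < \<rho>" unfolding \<rho>_def using \<gamma>0 by simp
  then have \<rho>': "0 < \<rho>'" unfolding \<rho>'_def by simp
  then have \<rho>'4: "0 < \<rho>' / 4" by simp
  obtain n4 where n4: "\<And>n. n4 \<le> n \<Longrightarrow> real (N * N) \<le> (\<rho>' / 4) * real n"
    using eventually_linear_bound[OF \<rho>'4] by blast
  obtain n5 where n5: "\<And>n. n5 \<le> n \<Longrightarrow> real (N * (2 * q)) \<le> (\<rho>' / 4) * real n"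
    using eventually_linear_bound[OF \<rho>'4] by blast
  have "ample V N (\<rho>' / 2) (\<lambda>g. distinct g \<and> set g \<inter> set (Q @ Q') = {} \<and>
      (\<exists>c d. set c \<subseteq> set g \<and> set d \<subseteq> set g \<and> spans E c (set g \<union> set Q) d \<and> spans E c (set g \<union> set Q') d))"
    if V: "dense E V (threshold + \<epsilon>)" and n: "n2 + n3 + n4 + n5 + 1 \<le> card V"
      and Q: "length Q = q" "length Q' = q" "distinct (Q @ Q')" "set (Q @ Q') \<subseteq> V" for E and V :: "'a set" and Q Q'
  proof -
    have fin: "finite V" using V dense_finite by blast
    have V0: "V \<noteq> {}" using n by auto
    define C where "C = {(p, p'). p \<in> {(L, xs). cyclic_pattern s Q L xs} \<and> p' \<in> {(L, xs). cyclic_pattern s Q' L xs} \<and> set (snd p) \<inter> set (snd p') = {}}"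
    define F where "F p p' S \<longleftrightarrow> distinct S \<and> walk E (map (label_value ((!) S)) (fst p @ map Inl (snd p))) \<and>
      walk E (map (label_value ((!) S)) (fst p' @ map Inl (snd p')))" for p p' :: "(nat + 'a) list \<times> nat list" and S
    have a1: "ample V s (7/8) (\<lambda>S. distinct S \<and> set S \<inter> set Q = {} \<and> dense E (set S \<union> set Q) (threshold + \<epsilon> - \<epsilon> / 2))"
      using Q n by (intro n2[OF V]) (auto simp: distinct_card)
    have a2: "ample V s (7/8) (\<lambda>S. distinct S \<and> set S \<inter> set Q' = {} \<and> dense E (set S \<union> set Q') (threshold + \<epsilon> - \<epsilon> / 2))"
      using Q n by (intro n2[OF V]) (auto simp: distinct_card)
    have a3: "ample V s (3 / 4) (\<lambda>S. \<exists>pp\<in>C. F (fst pp) (snd pp) S)"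
    proof (rule ample_mono[OF ample_conj[OF a1 a2 fin] fin])
      fix S assume S: "S \<in> tuples V s" and h: "(distinct S \<and> set S \<inter> set Q = {} \<and> dense E (set S \<union> set Q) (threshold + \<epsilon> - \<epsilon> / 2)) \<and>
        (distinct S \<and> set S \<inter> set Q' = {} \<and> dense E (set S \<union> set Q') (threshold + \<epsilon> - \<epsilon> / 2))"
      have lS: "length S = s" using S unfolding tuples_def by simp
      have eps: "threshold + \<epsilon> - \<epsilon> / 2 = threshold + \<epsilon> / 2" by simp
      have "card (set S \<union> set Q) = s + q" using h lS Q by (simp add: card_Un_disjoint distinct_card)
      then obtain vs where vs: "spanning_cycle E (set S \<union> set Q) vs" using n1[of E "set S \<union> set Q"] h s(2) sq eps by auto
      have "card (set S \<union> set Q') = s + q" using h lS Q by (simp add: card_Un_disjoint distinct_card)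
      then obtain vs' where vs': "spanning_cycle E (set S \<union> set Q') vs'" using n1[of E "set S \<union> set Q'"] h s(2) sq eps by auto
      have "card (set Q) = q" using Q by (simp add: distinct_card)
      then have "l * r * (card (set Q) + 1) \<le> l * r * (q + l + 1)" by simp
      then have "l * r * (card (set Q) + 1) \<le> s + length Q" using s(3) Q(1) by linarith
      then have bQ: "l * r * (card (set Q) + 1) \<le> s + length Q" .
      have hS: "distinct S" "set S \<inter> set Q = {}" "set S \<inter> set Q' = {}" and dQ: "distinct Q" "distinct Q'"
        using h Q(3) by auto
      obtain L xs where L: "cyclic_pattern s Q L xs" "walk E (map (label_value ((!) S)) (L @ map Inl xs))"
        using cyclic_patternE[OF vs hS(1) lS dQ(1) hS(2) finite_set subset_refl bQ] by metis
      \<comment> \<open>The second cycle must also start away from the start tuple of the first,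
        because the two are joined by a connection with distinct entries.\<close>
      define B where "B = set Q' \<union> set (map ((!) S) xs)"
      have "card B \<le> card (set Q') + card (set (map ((!) S) xs))" unfolding B_def by (rule card_Un_le)
      also have "\<dots> \<le> length Q' + length (map ((!) S) xs)" by (intro add_mono card_length)
      also have "\<dots> = q + l" using Q(2) L(1) unfolding cyclic_pattern_def by simp
      finally have "l * r * (card B + 1) \<le> l * r * (q + l + 1)" by simp
      then have "l * r * (card B + 1) \<le> s + length Q'" using s(3) Q(2) by linarith
      then have bB: "l * r * (card B + 1) \<le> s + length Q'" .
      have fB: "finite B" "set Q' \<subseteq> B" unfolding B_def by auto
      obtain L' xs' where L': "cyclic_pattern s Q' L' xs'" "walk E (map (label_value ((!) S)) (L' @ map Inl xs'))" "set (map ((!) S) xs') \<inter> B = {}"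
        using cyclic_patternE[OF vs' hS(1) lS dQ(2) hS(3) fB bB] by metis
      have "set xs \<inter> set xs' = {}" using L'(3) unfolding B_def by auto
      then have "((L, xs), (L', xs')) \<in> C" unfolding C_def using L(1) L'(1) by simp
      moreover have "F (L, xs) (L', xs') S" unfolding F_def using h L(2) L'(2) by simp
      ultimately show "\<exists>pp\<in>C. F (fst pp) (snd pp) S" by force
    qed simp
    have CC: "C \<subseteq> {(L, xs). cyclic_pattern s Q L xs} \<times> {(L, xs). cyclic_pattern s Q' L xs}" unfolding C_def by auto
    then have finC: "finite C" by (rule finite_subset) (use finite_cyclic_patterns in blast)
    have "card C \<le> card {(L, xs). cyclic_pattern s Q L xs} * card {(L, xs). cyclic_pattern s Q' L xs}"
      using card_mono[OF _ CC] finite_cyclic_patterns[of s Q] finite_cyclic_patterns[of s Q'] by (simp add: card_cartesian_product)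
    also have "\<dots> \<le> (s + q) ^ (s + q) * (s + q) ^ (s + q)"
      using finite_cyclic_patterns[of s Q] finite_cyclic_patterns[of s Q'] Q by (intro mult_mono) auto
    finally have cC: "real (card C) \<le> K" unfolding K_def by (simp only: of_nat_le_iff)
    have C0: "C \<noteq> {}" using ample_ex[OF a3 _ fin V0] by auto
    obtain p p' where pp: "(p, p') \<in> C" and a4: "ample V s (3 / 4 / real (card C)) (F p p')"
      using ample_pigeonhole[OF a3 fin finC C0] by auto
    obtain L1 x1 L2 x2 where p: "p = (L1, x1)" "p' = (L2, x2)" by fastforce
    have L1: "length L1 = s + q" "set L1 = Inl ` {..<s} \<union> Inr ` set Q" "length x1 = l" "distinct x1" "take l L1 = map Inl x1"
      and L2: "length L2 = s + q" "set L2 = Inl ` {..<s} \<union> Inr ` set Q'" "length x2 = l" "distinct x2" "take l L2 = map Inl x2"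
      and x12: "set x1 \<inter> set x2 = {}"
      using pp Q unfolding C_def p cyclic_pattern_def by auto
    have x_lt: "set x1 \<subseteq> {..<s}" "set x2 \<subseteq> {..<s}"
    proof -
      have "Inl ` set x1 \<subseteq> set L1" using L1(5) by (metis set_map set_take_subset)
      then show "set x1 \<subseteq> {..<s}" using L1(2) by auto
      have "Inl ` set x2 \<subseteq> set L2" using L2(5) by (metis set_map set_take_subset)
      then show "set x2 \<subseteq> {..<s}" using L2(2) by auto
    qed
    have "card C > 0" using C0 finC by (simp add: card_gt_0_iff)
    then have "3 / 4 / K \<le> 3 / 4 / real (card C)" using cC by (intro divide_left_mono) auto
    then have a5: "ample V s (3 / 4 / K) (F p p')" by (rule ample_mono[OF a4 fin]) auto
    let ?G = "\<lambda>S Y. walk E (map ((!) S) x1 @ Y @ map ((!) S) x2)"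
    have a6: "ample V (s + q0) \<rho> (\<lambda>f. F p p' (take s f) \<and> ?G (take s f) (drop s f))"
      unfolding \<rho>_def
    proof (rule ample_append[OF a5 _ _ fin])
      fix S assume S: "S \<in> tuples V s" "F p p' S"
      have lS: "length S = s" "distinct S" "set S \<subseteq> V" using S unfolding tuples_def F_def by auto
      have inj: "inj_on ((!) S) (set (x1 @ x2))" using x_lt lS by (intro inj_on_nth) auto
      have "distinct (map ((!) S) (x1 @ x2))" unfolding distinct_map using L1 L2 x12 inj by auto
      moreover have "set (map ((!) S) (x1 @ x2)) \<subseteq> V" using x_lt lS by (auto simp: subset_iff)
      ultimately have "ample V q0 \<gamma>0 (\<lambda>Y. walk E (map ((!) S) x1 @ Y @ map ((!) S) x2) \<and> distinct (map ((!) S) x1 @ Y @ map ((!) S) x2))"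
        using n L1(3) L2(3) by (intro n3[OF V]) auto
      then show "ample V q0 \<gamma>0 (?G S)" by (rule ample_mono[OF _ fin]) auto
    qed (use \<gamma>0 in simp)
    \<comment> \<open>Coordinates of the gadget: the sample, a copy of \<open>x1\<close>, a copy of
      \<open>x2\<close>, and the connection.\<close>
    define \<pi> where "\<pi> = [0..<s] @ x1 @ x2 @ [s..<s + q0]"
    have l\<pi>: "length \<pi> = N" unfolding \<pi>_def N_def using L1 L2 by simp
    have s\<pi>: "set \<pi> \<subseteq> {..<s + q0}" unfolding \<pi>_def using x_lt by auto
    have \<pi>n: "\<And>i. i < s \<Longrightarrow> \<pi> ! i = i" "\<And>j. j < l \<Longrightarrow> \<pi> ! (s + j) = x1 ! j" "\<And>j. j < l \<Longrightarrow> \<pi> ! (s + l + j) = x2 ! j"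
      "\<And>j. j < q0 \<Longrightarrow> \<pi> ! (s + l + l + j) = s + j"
      unfolding \<pi>_def using L1(3) L2(3) by (simp_all add: nth_append)
    define A1 A2 A3 where "A1 = [s..<s + l]" and "A2 = [s + l..<s + l + l]" and "A3 = [s + l + l..<s + l + l + q0]"
    define idx where "idx i = (LEAST j. j < l \<and> x1 ! j = i)" for i
    have idx: "idx i < l" "x1 ! idx i = i" if i: "i \<in> set x1" for i
    proof -
      obtain j where j: "j < l \<and> x1 ! j = i" using i L1(3) unfolding in_set_conv_nth by auto
      have "idx i < l \<and> x1 ! idx i = i" unfolding idx_def by (rule LeastI[of "\<lambda>j. j < l \<and> x1 ! j = i", OF j])
      then show "idx i < l" "x1 ! idx i = i" by auto
    qed
    have idx_nth: "idx (x1 ! j) = j" if "j < l" for j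
    proof -
      have "x1 ! j \<in> set x1" using that L1(3) by simp
      then show ?thesis using idx[of "x1 ! j"] that L1(3,4) by (metis nth_eq_iff_index_eq)
    qed
    \<comment> \<open>The second route begins with the original of \<open>x1\<close>, so the
      occurrences of \<open>x1\<close> inside the second cycle are redirected to the copy.\<close>
    define \<tau> :: "nat + 'a \<Rightarrow> nat + 'a" where "\<tau> x = (case x of Inl i \<Rightarrow> Inl (if i \<in> set x1 then s + idx i else i) | Inr v \<Rightarrow> Inr v)" for x
    \<comment> \<open>Both routes begin with the original of \<open>x1\<close> and end with the copy
      of \<open>x2\<close>, so either can stand in for the other.\<close>
    define M1 where "M1 = L1 @ map Inl A1 @ map Inl A3 @ map Inl A2"
    define M2 where "M2 = map Inl x1 @ map Inl A3 @ map \<tau> L2 @ map Inl A2"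
    let ?P = "\<lambda>f. F p p' (take s f) \<and> ?G (take s f) (drop s f)"
    have wf: "walk E (map (label_value (\<lambda>p. f ! (\<pi> ! p))) M1) \<and> walk E (map (label_value (\<lambda>p. f ! (\<pi> ! p))) M2)"
      if f: "f \<in> tuples V (s + q0)" "?P f" for f
    proof -
      define S Y where "S = take s f" and "Y = drop s f"
      have lf: "length f = s + q0" using f unfolding tuples_def by simp
      let ?v = "label_value (\<lambda>p. f ! (\<pi> ! p))"
      have Sn: "\<And>i. i < s \<Longrightarrow> f ! i = S ! i" unfolding S_def by simp
      have vL: "map ?v L = map (label_value ((!) S)) L" if "set L \<subseteq> Inl ` {..<s} \<union> Inr ` W" for L W
        using that \<pi>n(1) Sn by (intro map_cong refl) auto
      have v1: "map ?v (map Inl A1) = map ((!) S) x1"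
        unfolding A1_def using L1(3) \<pi>n(2) Sn x_lt by (intro nth_equalityI) (auto simp: subset_iff)
      have v2: "map ?v (map Inl A2) = map ((!) S) x2"
        unfolding A2_def using L2(3) \<pi>n(3) Sn x_lt by (intro nth_equalityI) (auto simp: subset_iff)
      have v3: "map ?v (map Inl A3) = Y"
        unfolding A3_def Y_def using lf \<pi>n(4) by (intro nth_equalityI) auto
      have v4: "map ?v (map \<tau> L2) = map (label_value ((!) S)) L2"
      proof -
        have "?v (\<tau> x) = label_value ((!) S) x" if "x \<in> set L2" for x
        proof (cases x)
          case (Inl i)
          then have "i < s" using that L2(2) by auto
          then show ?thesis using Inl idx[of i] \<pi>n(1)[of i] \<pi>n(2)[of "idx i"] Sn[of i] unfolding \<tau>_def by simp
        qed (simp add: \<tau>_def)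
        then show ?thesis by simp
      qed
      have v5: "map ?v (map Inl x1) = map ((!) S) x1" using \<pi>n(1) Sn x_lt by (auto simp: subset_iff)
      have W1: "walk E (map (label_value ((!) S)) L1 @ map ((!) S) x1)" and W2: "walk E (map (label_value ((!) S)) L2 @ map ((!) S) x2)"
        and W3: "walk E (map ((!) S) x1 @ Y @ map ((!) S) x2)"
        using f(2) unfolding F_def p S_def Y_def by (simp_all add: comp_def)
      have "walk E (map (label_value ((!) S)) L1 @ map ((!) S) x1 @ Y @ map ((!) S) x2)"
        using walk_append[OF W1 W3] L1(3) by simp
      moreover have "map ?v M1 = map (label_value ((!) S)) L1 @ map ((!) S) x1 @ Y @ map ((!) S) x2"
        unfolding M1_def map_append v1 v2 v3 using vL[of L1 "set Q"] L1(2) by simp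
      moreover have "walk E (map ((!) S) x1 @ Y @ map (label_value ((!) S)) L2 @ map ((!) S) x2)"
      proof -
        define R where "R = map (label_value ((!) S)) (drop l L2)"
        have "L2 = map Inl x2 @ drop l L2" using L2(5) by (metis append_take_drop_id)
        then have "map (label_value ((!) S)) L2 = map ((!) S) x2 @ R" unfolding R_def
          by (metis (no_types, lifting) comp_apply label_value_simps(1) list.map_comp map_append map_eq_conv)
        then show ?thesis using walk_append[of E "map ((!) S) x1 @ Y" "map ((!) S) x2" "R @ map ((!) S) x2"] W2 W3 L2(3) by simp
      qed
      moreover have "map ?v M2 = map ((!) S) x1 @ Y @ map (label_value ((!) S)) L2 @ map ((!) S) x2"
        unfolding M2_def map_append v2 v3 v4 v5 by simp
      ultimately show ?thesis by simp
    qed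
    let ?Y = "\<lambda>y. \<forall>W\<subseteq>{..<length \<pi>}. inj_on ((!) \<pi>) W \<longrightarrow> (\<exists>f\<in>tuples V (s + q0). ?P f \<and> (\<forall>p\<in>W. f ! (\<pi> ! p) = y ! p))"
    have a7: "ample V N \<rho>' ?Y"
      using ample_clones[OF fin V0 a6 _ s\<pi>] \<rho> unfolding l\<pi> \<rho>'_def by simp
    have a8: "ample V N (\<rho>' - \<rho>' / 4) (\<lambda>y. ?Y y \<and> distinct y)"
      using n \<rho>' by (intro ample_distinct[OF a7 fin n4]) auto
    have a9: "ample V N (\<rho>' - \<rho>' / 4 - \<rho>' / 4) (\<lambda>y. (?Y y \<and> distinct y) \<and> set y \<inter> set (Q @ Q') = {})"
    proof (rule ample_avoid[OF a8 fin])
      have "card (set (Q @ Q')) = 2 * q" using distinct_card[OF Q(3)] Q by simp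
      then show "real (N * card (set (Q @ Q'))) \<le> \<rho>' / 4 * real (card V)" using n5[of "card V"] n by simp
    qed (use \<rho>' in auto)
    show ?thesis
    proof (rule ample_mono[OF a9 fin])
      fix y assume y: "y \<in> tuples V N" "(?Y y \<and> distinct y) \<and> set y \<inter> set (Q @ Q') = {}"
      have ly: "length y = N" using y unfolding tuples_def by simp
      let ?v = "label_value ((!) y)"
      have vy: "?v ` (Inl ` I) = (!) y ` I" for I by (simp add: image_image)
      have sety: "set y = (!) y ` {..<N}" using ly nth_image[of N y] by (simp add: lessThan_atLeast0)
      have setA: "set A1 = {s..<s + l}" "set A2 = {s + l..<s + l + l}" "set A3 = {s + l + l..<N}" unfolding A1_def A2_def A3_def N_def by auto
      have len: "length M1 = N + q" "length M2 = N + q" unfolding M1_def M2_def A1_def A2_def A3_def N_def using L1 L2 by auto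
      have un: "{..<s} \<union> ({s..<s + l} \<union> ({s + l + l..<N} \<union> {s + l..<s + l + l})) = {..<N}" unfolding N_def by auto
      have sM1: "set M1 = Inl ` {..<N} \<union> Inr ` set Q"
        unfolding M1_def set_append set_map setA L1(2) un[symmetric] by (simp add: image_Un Un_ac)
      have \<tau>L2: "\<tau> ` set L2 = Inl ` (({..<s} - set x1) \<union> {s..<s + l}) \<union> Inr ` set Q'"
      proof -
        have "\<tau> ` set L2 = Inl ` ((\<lambda>i. if i \<in> set x1 then s + idx i else i) ` {..<s}) \<union> Inr ` set Q'"
          unfolding L2(2) image_Un image_image \<tau>_def by simp
        moreover have "(\<lambda>i. if i \<in> set x1 then s + idx i else i) ` {..<s} = ({..<s} - set x1) \<union> {s..<s + l}"
        proof (intro set_eqI iffI)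
          fix j assume "j \<in> (\<lambda>i. if i \<in> set x1 then s + idx i else i) ` {..<s}"
          then show "j \<in> ({..<s} - set x1) \<union> {s..<s + l}" using idx by (auto split: if_splits)
        next
          fix j assume j: "j \<in> ({..<s} - set x1) \<union> {s..<s + l}"
          show "j \<in> (\<lambda>i. if i \<in> set x1 then s + idx i else i) ` {..<s}"
          proof (cases "j < s")
            case True
            then show ?thesis using j by (intro image_eqI[of _ _ j]) auto
          next
            case False
            define t where "t = j - s"
            have t: "t < l" "j = s + t" using j False unfolding t_def by auto
            have "x1 ! t \<in> set x1" using t L1(3) by simp
            then show ?thesis using t idx_nth[of t] x_lt by (intro image_eqI[of _ _ "x1 ! t"]) auto
          qed
        qed
        ultimately show ?thesis by simp
      qed
      have un2: "set x1 \<union> ({s + l + l..<N} \<union> ((({..<s} - set x1) \<union> {s..<s + l}) \<union> {s + l..<s + l + l})) = {..<N}"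
        unfolding un[symmetric] using x_lt(1) by auto
      have sM2: "set M2 = Inl ` {..<N} \<union> Inr ` set Q'"
        unfolding M2_def set_append set_map setA \<tau>L2 un2[symmetric] by (simp add: image_Un Un_ac)
      have S1: "set (map ?v M1) = set y \<union> set Q" unfolding set_map sM1 image_Un vy sety by (simp add: image_image)
      have S2: "set (map ?v M2) = set y \<union> set Q'" unfolding set_map sM2 image_Un vy sety by (simp add: image_image)
      have "card (set y \<union> set Q) = N + q" using y Q ly by (subst card_Un_disjoint) (auto simp: distinct_card)
      then have D1: "distinct (map ?v M1)" using S1 len by (intro card_distinct) simp
      have "card (set y \<union> set Q') = N + q" using y Q ly by (subst card_Un_disjoint) (auto simp: distinct_card)
      then have D2: "distinct (map ?v M2)" using S2 len by (intro card_distinct) simp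
      have pos1: "Inl i \<in> set M1 \<Longrightarrow> i < length \<pi>" and pos2: "Inl i \<in> set M2 \<Longrightarrow> i < length \<pi>" for i
        using sM1 sM2 l\<pi> by auto
      have Yy: "?Y y" using y(2) by blast
      have W1: "walk E (map ?v M1)"
        by (rule walk_of_clones[OF Yy _ pos1 dense_card[OF V]]) (use wf in blast)+
      have W2: "walk E (map ?v M2)"
        by (rule walk_of_clones[OF Yy _ pos2 dense_card[OF V]]) (use wf in blast)+
      define c d where "c = map ((!) y) x1" and "d = map ((!) y) A2"
      have vI: "map ?v (map Inl I) = map ((!) y) I" for I by (simp add: comp_def)
      have ll: "l \<le> length L1" using L1(5) L1(3) by (metis length_map length_take min.absorb_iff2 min.commute)
      have t1: "take l (map ?v M1) = c" unfolding M1_def c_def using L1(5) ll by (simp add: take_map comp_def)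
      have t2: "take l (map ?v M2) = c" unfolding M2_def c_def using L1(3) by (simp add: comp_def)
      have lA2: "length A2 = l" unfolding A2_def by simp
      have d1: "drop (length (map ?v M1) - l) (map ?v M1) = d"
        unfolding M1_def d_def map_append vI length_append length_map lA2 append_assoc[symmetric] by (simp add: lA2)
      have d2: "drop (length (map ?v M2) - l) (map ?v M2) = d"
        unfolding M2_def d_def map_append vI length_append length_map lA2 append_assoc[symmetric] by (simp add: lA2)
      have "spans E c (set y \<union> set Q) d" unfolding spans_def joins_def using W1 D1 S1 t1 d1 by blast
      moreover have "spans E c (set y \<union> set Q') d" unfolding spans_def joins_def using W2 D2 S2 t2 d2 by blast
      moreover have "set c \<subseteq> set y" unfolding c_def sety using x_lt by (auto simp: N_def)
      moreover have "set d \<subseteq> set y" unfolding d_def sety using setA by (auto simp: N_def)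
      ultimately show "distinct y \<and> set y \<inter> set (Q @ Q') = {} \<and>
        (\<exists>c d. set c \<subseteq> set y \<and> set d \<subseteq> set y \<and> spans E c (set y \<union> set Q) d \<and> spans E c (set y \<union> set Q') d)"
        using y(2) by blast
    qed simp
  qed
  then show ?thesis using \<rho>' by (intro exI[of _ N] exI[of _ "\<rho>' / 2"] exI[of _ "n2 + n3 + n4 + n5 + 1"]) auto
qed

end

subsection \<open>Greedy covers\<close>

text \<open>The denominator carries \<open>q + 1\<close> instead of \<open>q\<close>, so that it is
  positive for empty tuples too.\<close>

lemma ample_avoid_half:
  assumes "ample V q \<gamma> P" "0 < \<gamma>" "finite V" "finite F" "real (card F) \<le> \<gamma> / (2 * (real q + 1)) * real (card V)"
  shows "ample V q (\<gamma> / 2) (\<lambda>x. P x \<and> set x \<inter> F = {})"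
proof -
  have "real (q * card F) \<le> (real q + 1) * real (card F)" by (simp add: algebra_simps)
  also have "\<dots> \<le> (real q + 1) * (\<gamma> / (2 * (real q + 1)) * real (card V))" using assms(5) by (intro mult_left_mono) auto
  also have "\<dots> = \<gamma> / 2 * real (card V)" by (simp add: field_simps)
  finally have "ample V q (\<gamma> - \<gamma> / 2) (\<lambda>x. P x \<and> set x \<inter> F = {})"
    using assms by (intro ample_avoid) auto
  then show ?thesis by simp
qed

text \<open>Double counting of good pairs. That \<open>Q\<close> is good for some
  \<open>\<sigma>\<close> is stated separately, since its distinctness and its avoidance of
  forbidden vertices are read off from there.\<close>

lemma ample_averaging:
  assumes fin: "finite V" "V \<noteq> {}" "finite U" "U \<noteq> {}" and \<gamma>: "0 < \<gamma>"
    and G: "\<And>\<sigma>. \<sigma> \<in> U \<Longrightarrow> ample V q \<gamma> (G \<sigma>)"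
  shows "\<exists>Q\<in>tuples V q. (\<exists>\<sigma>\<in>U. G \<sigma> Q) \<and> \<gamma> * real (card U) \<le> real (card {\<sigma> \<in> U. G \<sigma> Q})"
proof (rule ccontr)
  assume no: "\<not> ?thesis"
  have U0: "0 < real (card U)" using fin by (simp add: card_gt_0_iff)
  have lt: "real (card {\<sigma> \<in> U. G \<sigma> Q}) < \<gamma> * real (card U)" if "Q \<in> tuples V q" for Q
  proof (cases "\<exists>\<sigma>\<in>U. G \<sigma> Q")
    case True
    show ?thesis
    proof (rule ccontr)
      assume "\<not> ?thesis"
      then have "\<gamma> * real (card U) \<le> real (card {\<sigma> \<in> U. G \<sigma> Q})" by linarith
      then show False using no that True by blast
    qed
  next
    case False
    then have "{\<sigma> \<in> U. G \<sigma> Q} = {}" by auto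
    then have "card {\<sigma> \<in> U. G \<sigma> Q} = 0" by (simp only: card.empty)
    then show ?thesis using U0 \<gamma> by simp
  qed
  have T: "finite (tuples V q)" "tuples V q \<noteq> {}"
  proof -
    obtain v where "v \<in> V" using fin by blast
    then have "replicate q v \<in> tuples V q" unfolding tuples_def by auto
    then show "tuples V q \<noteq> {}" by blast
  qed (use fin in simp)
  have "real (card U) * (\<gamma> * real (card V) ^ q) = (\<Sum>\<sigma>\<in>U. \<gamma> * real (card V) ^ q)" by simp
  also have "\<dots> \<le> (\<Sum>\<sigma>\<in>U. real (card {Q \<in> tuples V q. G \<sigma> Q}))" using G unfolding ample_def by (intro sum_mono)
  also have "\<dots> = (\<Sum>\<sigma>\<in>U. \<Sum>Q\<in>tuples V q. of_bool (G \<sigma> Q))" using T by (simp add: Int_def)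
  also have "\<dots> = (\<Sum>Q\<in>tuples V q. \<Sum>\<sigma>\<in>U. of_bool (G \<sigma> Q))" by (rule sum.swap)
  also have "\<dots> = (\<Sum>Q\<in>tuples V q. real (card {\<sigma> \<in> U. G \<sigma> Q}))" using fin by (simp add: Int_def)
  also have "\<dots> < (\<Sum>Q\<in>tuples V q. \<gamma> * real (card U))" using lt T by (intro sum_strict_mono)
  also have "\<dots> = real (card U) * (\<gamma> * real (card V) ^ q)" using fin by (simp add: card_tuples)
  finally show False by simp
qed

text \<open>Every round picks a tuple that is good for at least a \<open>\<gamma> / 2\<close>
  proportion of the \<open>\<sigma>\<close> still uncovered and disjoint from all earlier ones. The
  bound on \<open>card F + M * q\<close> keeps the occupied set small enough for
  \<open>ample_avoid_half\<close>.\<close>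

lemma greedy_cover:
  assumes fin: "finite V" "V \<noteq> {}" "finite \<Sigma>" "\<Sigma> \<noteq> {}" "finite F" and \<gamma>: "0 < \<gamma>" "\<gamma> \<le> 1"
    and G: "\<And>\<sigma>. \<sigma> \<in> \<Sigma> \<Longrightarrow> ample V q \<gamma> (G \<sigma>)" and dis: "\<And>\<sigma> Q. G \<sigma> Q \<Longrightarrow> distinct Q"
  shows "real (card F + M * q) \<le> \<gamma> / (2 * (real q + 1)) * real (card V) \<Longrightarrow>
    \<exists>Qs. length Qs = M \<and> set Qs \<subseteq> tuples V q \<and> distinct (concat Qs) \<and> set (concat Qs) \<inter> F = {} \<and>
      real (card {\<sigma> \<in> \<Sigma>. \<forall>Q\<in>set Qs. \<not> G \<sigma> Q}) \<le> (1 - \<gamma> / 2) ^ M * real (card \<Sigma>)"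
proof (induction M)
  case 0
  then show ?case by (intro exI[of _ "[]"]) auto
next
  case (Suc M)
  have "real (card F + M * q) \<le> real (card F + Suc M * q)" by simp
  then have le: "real (card F + M * q) \<le> \<gamma> / (2 * (real q + 1)) * real (card V)" using Suc.prems by linarith
  obtain Qs where Qs: "length Qs = M" "set Qs \<subseteq> tuples V q" "distinct (concat Qs)" "set (concat Qs) \<inter> F = {}"
    "real (card {\<sigma> \<in> \<Sigma>. \<forall>Q\<in>set Qs. \<not> G \<sigma> Q}) \<le> (1 - \<gamma> / 2) ^ M * real (card \<Sigma>)"
    using Suc.IH[OF le] by blast
  define F' where "F' = F \<union> set (concat Qs)"
  have "length (concat Qs) = M * q" using Qs(1,2)
    by (induction Qs arbitrary: M) (auto simp: tuples_def)
  then have "card (set (concat Qs)) \<le> M * q" using card_length[of "concat Qs"] by simp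
  then have "card F' \<le> card F + M * q" unfolding F'_def using card_Un_le[of F "set (concat Qs)"] by linarith
  then have "real (card F') \<le> real (card F + M * q)" by (simp only: of_nat_le_iff)
  then have cF': "real (card F') \<le> \<gamma> / (2 * (real q + 1)) * real (card V)" using le by linarith
  have finF': "finite F'" unfolding F'_def using fin by simp
  have G': "ample V q (\<gamma> / 2) (\<lambda>Q. G \<sigma> Q \<and> set Q \<inter> F' = {})" if "\<sigma> \<in> \<Sigma>" for \<sigma>
    using G[OF that] \<gamma>(1) fin(1) finF' cF' by (rule ample_avoid_half)
  define U where "U = {\<sigma> \<in> \<Sigma>. \<forall>Q\<in>set Qs. \<not> G \<sigma> Q}"
  have U: "finite U" "U \<subseteq> \<Sigma>" unfolding U_def using fin by auto
  obtain Q where Q: "Q \<in> tuples V q" "\<exists>\<sigma>. G \<sigma> Q \<and> set Q \<inter> F' = {}"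
    "\<gamma> / 2 * real (card U) \<le> real (card {\<sigma> \<in> U. G \<sigma> Q \<and> set Q \<inter> F' = {}})"
  proof (cases "U = {}")
    \<comment> \<open>Everything is covered already; to reach exactly \<open>M\<close> tuples, any
      further good one is added.\<close>
    case True
    obtain Q where "Q \<in> tuples V q" "\<exists>\<sigma>\<in>\<Sigma>. G \<sigma> Q \<and> set Q \<inter> F' = {}"
      using ample_averaging[OF fin(1,2,3,4), of "\<gamma> / 2" q "\<lambda>\<sigma> Q. G \<sigma> Q \<and> set Q \<inter> F' = {}"] G' \<gamma> by auto
    then show ?thesis using that[of Q] True by auto
  next
    case False
    obtain Q where "Q \<in> tuples V q" "\<exists>\<sigma>\<in>U. G \<sigma> Q \<and> set Q \<inter> F' = {}"
      "\<gamma> / 2 * real (card U) \<le> real (card {\<sigma> \<in> U. G \<sigma> Q \<and> set Q \<inter> F' = {}})"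
    proof -
      have G'': "ample V q (\<gamma> / 2) (\<lambda>Q. G \<sigma> Q \<and> set Q \<inter> F' = {})" if "\<sigma> \<in> U" for \<sigma>
        using G' U(2) that by blast
      have \<gamma>2: "0 < \<gamma> / 2" using \<gamma> by simp
      show ?thesis using ample_averaging[OF fin(1,2) U(1) False \<gamma>2, of q "\<lambda>\<sigma> Q. G \<sigma> Q \<and> set Q \<inter> F' = {}", OF G''] that
        by blast
    qed
    then show ?thesis using that[of Q] by auto
  qed
  have "{\<sigma> \<in> \<Sigma>. \<forall>Q'\<in>set (Qs @ [Q]). \<not> G \<sigma> Q'} \<subseteq> U - {\<sigma> \<in> U. G \<sigma> Q \<and> set Q \<inter> F' = {}}"
    unfolding U_def by auto
  then have "card {\<sigma> \<in> \<Sigma>. \<forall>Q'\<in>set (Qs @ [Q]). \<not> G \<sigma> Q'} \<le> card (U - {\<sigma> \<in> U. G \<sigma> Q \<and> set Q \<inter> F' = {}})"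
    using U by (intro card_mono) auto
  also have "\<dots> = card U - card {\<sigma> \<in> U. G \<sigma> Q \<and> set Q \<inter> F' = {}}"
    using U by (intro card_Diff_subset) auto
  finally have c1: "card {\<sigma> \<in> \<Sigma>. \<forall>Q'\<in>set (Qs @ [Q]). \<not> G \<sigma> Q'} \<le> card U - card {\<sigma> \<in> U. G \<sigma> Q \<and> set Q \<inter> F' = {}}" .
  have "card {\<sigma> \<in> U. G \<sigma> Q \<and> set Q \<inter> F' = {}} \<le> card U" using U by (intro card_mono) auto
  then have "real (card U - card {\<sigma> \<in> U. G \<sigma> Q \<and> set Q \<inter> F' = {}}) = real (card U) - real (card {\<sigma> \<in> U. G \<sigma> Q \<and> set Q \<inter> F' = {}})"
    by (rule of_nat_diff)
  then have "real (card {\<sigma> \<in> \<Sigma>. \<forall>Q'\<in>set (Qs @ [Q]). \<not> G \<sigma> Q'}) \<le> (1 - \<gamma> / 2) * real (card U)"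
    using c1 Q(3) by (simp add: algebra_simps)
  also have "\<dots> \<le> (1 - \<gamma> / 2) * ((1 - \<gamma> / 2) ^ M * real (card \<Sigma>))"
    using Qs(5) \<gamma> unfolding U_def by (intro mult_left_mono) auto
  finally have c2: "real (card {\<sigma> \<in> \<Sigma>. \<forall>Q'\<in>set (Qs @ [Q]). \<not> G \<sigma> Q'}) \<le> (1 - \<gamma> / 2) ^ Suc M * real (card \<Sigma>)" by simp
  have "distinct Q" "set Q \<inter> F' = {}" using Q(2) dis by auto
  then have "distinct (concat (Qs @ [Q]))" "set (concat (Qs @ [Q])) \<inter> F = {}"
    using Qs(3,4) unfolding F'_def by auto
  then show ?case using Qs(1,2) Q(1) c2 by (intro exI[of _ "Qs @ [Q]"]) auto
qed

context cycle_params
begin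

subsection \<open>Connections through prescribed vertices\<close>

text \<open>Induction on the number of vertices to be picked up: \<open>z\<close> is completed to an
  end tuple \<open>z # c\<close> by \<open>l - 1\<close> random vertices, \<open>a\<close> is
  connected to it, and the remaining vertices are picked up on the way from there to
  \<open>b\<close>.\<close>

lemma absorbing_connections:
  assumes \<epsilon>: "0 < \<epsilon>" "\<epsilon> \<le> 1"
  shows "\<exists>q \<gamma> n0. 0 < \<gamma> \<and> r dvd q + x + l \<and> (\<forall>E (V :: 'a set) a b Z. dense E V (threshold + \<epsilon>) \<and> n0 \<le> card V \<and>
    length a = l \<and> length b = l \<and> length Z = x \<and> distinct (a @ b @ Z) \<and> set (a @ b @ Z) \<subseteq> V \<longrightarrow>
    ample V q \<gamma> (\<lambda>Q. distinct Q \<and> set Q \<inter> set (a @ b @ Z) = {} \<and> spans E a (set (a @ b @ Z) \<union> set Q) b))"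
proof (induction x)
  case 0
  obtain q \<gamma> n0 where \<gamma>: "0 < \<gamma>" and dv: "r dvd q + l" and A: "\<And>E (V :: 'a set) a b. dense E V (threshold + \<epsilon>) \<Longrightarrow> n0 \<le> card V \<Longrightarrow>
    length a = l \<Longrightarrow> length b = l \<Longrightarrow> distinct (a @ b) \<Longrightarrow> set (a @ b) \<subseteq> V \<Longrightarrow>
    ample V q \<gamma> (\<lambda>y. walk E (a @ y @ b) \<and> distinct (a @ y @ b))"
    using connecting_walks[OF \<epsilon>, where 'a = 'a] by (elim exE conjE) (rule that; blast)
  have "ample V q \<gamma> (\<lambda>Q. distinct Q \<and> set Q \<inter> set (a @ b @ Z) = {} \<and> spans E a (set (a @ b @ Z) \<union> set Q) b)"
    if V: "dense E V (threshold + \<epsilon>)" "n0 \<le> card V" and a: "length a = l" "length b = l" "length Z = 0" "distinct (a @ b @ Z)" "set (a @ b @ Z) \<subseteq> V"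
    for E and V :: "'a set" and a b Z
  proof -
    have "ample V q \<gamma> (\<lambda>y. walk E (a @ y @ b) \<and> distinct (a @ y @ b))" using a by (intro A V) auto
    then show ?thesis
    proof (rule ample_mono[OF _ dense_finite[OF V(1)] order_refl])
      fix Q assume Q: "walk E (a @ Q @ b) \<and> distinct (a @ Q @ b)"
      have "spans E a (set a \<union> set Q \<union> set b) b" using Q a by (intro spansI) auto
      moreover have "set a \<union> set Q \<union> set b = set (a @ b @ Z) \<union> set Q" using a(3) by auto
      ultimately show "distinct Q \<and> set Q \<inter> set (a @ b @ Z) = {} \<and> spans E a (set (a @ b @ Z) \<union> set Q) b"
        using Q a(3) by auto
    qed
  qed
  then show ?case using \<gamma> dv by (intro exI[of _ q] exI[of _ \<gamma>] exI[of _ n0]) auto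
next
  case (Suc x)
  obtain q \<gamma> n0 where \<gamma>: "0 < \<gamma>" and dv: "r dvd q + x + l" and A: "\<And>E (V :: 'a set) a b Z. dense E V (threshold + \<epsilon>) \<Longrightarrow> n0 \<le> card V \<Longrightarrow>
    length a = l \<Longrightarrow> length b = l \<Longrightarrow> length Z = x \<Longrightarrow> distinct (a @ b @ Z) \<Longrightarrow> set (a @ b @ Z) \<subseteq> V \<Longrightarrow>
    ample V q \<gamma> (\<lambda>Q. distinct Q \<and> set Q \<inter> set (a @ b @ Z) = {} \<and> spans E a (set (a @ b @ Z) \<union> set Q) b)"
    using Suc.IH by (elim exE conjE) (rule that; blast)
  obtain q' \<gamma>' n0' where \<gamma>': "0 < \<gamma>'" and dv': "r dvd q' + l" and A': "\<And>E (V :: 'a set) a b. dense E V (threshold + \<epsilon>) \<Longrightarrow> n0' \<le> card V \<Longrightarrow>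
    length a = l \<Longrightarrow> length b = l \<Longrightarrow> distinct (a @ b) \<Longrightarrow> set (a @ b) \<subseteq> V \<Longrightarrow>
    ample V q' \<gamma>' (\<lambda>y. walk E (a @ y @ b) \<and> distinct (a @ y @ b))"
    using connecting_walks[OF \<epsilon>, where 'a = 'a] by (elim exE conjE) (rule that; blast)
  define P where "P = (l - 1) + (q' + q)"
  \<comment> \<open>A crude common bound for the sizes of all sets to be avoided, multiplied so as
    to cover the choice of \<open>c\<close> as well.\<close>
  define c0 where "c0 = real ((l + l + (l + l + Suc x) + q') * (l + 1))"
  obtain n1 where n1: "\<And>n. n1 \<le> n \<Longrightarrow> c0 \<le> 1 / 4 * real n" using eventually_linear_bound[of "1 / 4"] by auto
  have "0 < \<gamma>' / (2 * (real q' + 1))" using \<gamma>' by simp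
  then obtain n2 where n2: "\<And>n. n2 \<le> n \<Longrightarrow> c0 \<le> \<gamma>' / (2 * (real q' + 1)) * real n" using eventually_linear_bound by blast
  have "0 < \<gamma> / (2 * (real q + 1))" using \<gamma> by simp
  then obtain n3 where n3: "\<And>n. n3 \<le> n \<Longrightarrow> c0 \<le> \<gamma> / (2 * (real q + 1)) * real n" using eventually_linear_bound by blast
  have "ample V P (1 / 2 * (\<gamma>' / 2 * (\<gamma> / 2))) (\<lambda>Q. distinct Q \<and> set Q \<inter> set (a @ b @ Z) = {} \<and> spans E a (set (a @ b @ Z) \<union> set Q) b)"
    if V: "dense E V (threshold + \<epsilon>)" "n0 + n0' + n1 + n2 + n3 \<le> card V"
      and a: "length a = l" "length b = l" "length Z = Suc x" "distinct (a @ b @ Z)" "set (a @ b @ Z) \<subseteq> V"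
    for E and V :: "'a set" and a b Z
  proof -
    have fin: "finite V" using V dense_finite by blast
    obtain z Z' where Z: "Z = z # Z'" using a(3) by (cases Z) auto
    have small: "real m \<le> c0" if "m \<le> l + l + (l + l + Suc x) + q'" for m
    proof -
      have "m * 1 \<le> (l + l + (l + l + Suc x) + q') * (l + 1)" using that by (intro mult_mono) auto
      then show ?thesis unfolding c0_def by (simp only: of_nat_le_iff mult_1_right)
    qed
    have b1: "ample V (l - 1) (1 - 1 / 4) (\<lambda>c. True \<and> distinct c)"
    proof (rule ample_distinct[OF ample_True[OF fin] fin])
      have "(l - 1) * (l - 1) \<le> (l + l + (l + l + Suc x) + q') * (l + 1)" by (intro mult_mono) auto
      then have "real ((l - 1) * (l - 1)) \<le> c0" unfolding c0_def by (simp only: of_nat_le_iff)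
      then show "real ((l - 1) * (l - 1)) \<le> 1 / 4 * real (card V)" using n1[of "card V"] V(2) by linarith
    qed simp
    have b2: "ample V (l - 1) (1 - 1 / 4 - 1 / 4) (\<lambda>c. (True \<and> distinct c) \<and> set c \<inter> set (a @ b @ Z) = {})"
    proof (rule ample_avoid[OF b1 fin])
      have "card (set (a @ b @ Z)) \<le> l + l + Suc x" using card_length[of "a @ b @ Z"] a by simp
      then have "(l - 1) * card (set (a @ b @ Z)) \<le> (l + 1) * (l + l + (l + l + Suc x) + q')" by (intro mult_mono) auto
      then have "real ((l - 1) * card (set (a @ b @ Z))) \<le> c0" unfolding c0_def mult.commute[of _ "l + 1"] by (simp only: of_nat_le_iff)
      then show "real ((l - 1) * card (set (a @ b @ Z))) \<le> 1 / 4 * real (card V)" using n1[of "card V"] V(2) by linarith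
    qed simp_all
    then have b3: "ample V (l - 1) (1 / 2) (\<lambda>c. distinct c \<and> set c \<inter> set (a @ b @ Z) = {})" by simp
    let ?R1 = "\<lambda>c Q. (walk E (a @ Q @ (z # c)) \<and> distinct (a @ Q @ (z # c))) \<and> set Q \<inter> set (b @ Z') = {}"
    let ?R2 = "\<lambda>c Q1 Q2. (distinct Q2 \<and> set Q2 \<inter> set ((z # c) @ b @ Z') = {} \<and> spans E (z # c) (set ((z # c) @ b @ Z') \<union> set Q2) b) \<and> set Q2 \<inter> set (a @ Q1) = {}"
    have b4: "ample V (q' + q) (\<gamma>' / 2 * (\<gamma> / 2)) (\<lambda>w. ?R1 c (take q' w) \<and> ?R2 c (take q' w) (drop q' w))"
      if c: "c \<in> tuples V (l - 1)" "distinct c" "set c \<inter> set (a @ b @ Z) = {}" for c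
    proof (rule ample_append[OF _ _ _ fin])
      have lc: "length (z # c) = l" "set c \<subseteq> V" using c(1) l_pos unfolding tuples_def by auto
      show "ample V q' (\<gamma>' / 2) (?R1 c)"
      proof (rule ample_avoid_half[OF A' \<gamma>' fin])
        have "card (set (b @ Z')) \<le> l + Suc x" using card_length[of "b @ Z'"] a Z by simp
        then show "real (card (set (b @ Z'))) \<le> \<gamma>' / (2 * (real q' + 1)) * real (card V)"
          using small[of "card (set (b @ Z'))"] n2[of "card V"] V(2) by linarith
      qed (use V a c lc Z in auto)
      fix Q1 assume Q1: "Q1 \<in> tuples V q'" "?R1 c Q1"
      show "ample V q (\<gamma> / 2) (?R2 c Q1)"
      proof (rule ample_avoid_half[OF A \<gamma> fin])
        have "card (set (a @ Q1)) \<le> l + q'" using card_length[of "a @ Q1"] a Q1(1) unfolding tuples_def by simp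
        then show "real (card (set (a @ Q1))) \<le> \<gamma> / (2 * (real q + 1)) * real (card V)"
          using small[of "card (set (a @ Q1))"] n3[of "card V"] V(2) by linarith
      qed (use V a c lc Z in auto)
    qed (use \<gamma> in simp)
    have "ample V P (1 / 2 * (\<gamma>' / 2 * (\<gamma> / 2))) (\<lambda>w. (distinct (take (l - 1) w) \<and> set (take (l - 1) w) \<inter> set (a @ b @ Z) = {}) \<and>
      ?R1 (take (l - 1) w) (take q' (drop (l - 1) w)) \<and> ?R2 (take (l - 1) w) (take q' (drop (l - 1) w)) (drop q' (drop (l - 1) w)))"
      unfolding P_def using b4 \<gamma> \<gamma>' by (intro ample_append[OF b3 _ _ fin]) auto
    then show ?thesis
    proof (rule ample_mono[OF _ fin order_refl])
      fix w assume w: "w \<in> tuples V P" and h: "(distinct (take (l - 1) w) \<and> set (take (l - 1) w) \<inter> set (a @ b @ Z) = {}) \<and>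
        ?R1 (take (l - 1) w) (take q' (drop (l - 1) w)) \<and> ?R2 (take (l - 1) w) (take q' (drop (l - 1) w)) (drop q' (drop (l - 1) w))"
      define c Q1 Q2 where "c = take (l - 1) w" and "Q1 = take q' (drop (l - 1) w)" and "Q2 = drop q' (drop (l - 1) w)"
      have wc: "w = c @ Q1 @ Q2" unfolding c_def Q1_def Q2_def append_take_drop_id ..
      have lc: "length (z # c) = l" using w l_pos unfolding c_def tuples_def P_def by simp
      have c: "distinct c" "set c \<inter> set (a @ b @ Z) = {}" and R1: "?R1 c Q1" and R2: "?R2 c Q1 Q2"
        using h unfolding c_def Q1_def Q2_def by blast+
      have s1: "spans E a (set a \<union> set Q1 \<union> set (z # c)) (z # c)" using R1 a lc by (intro spansI) auto
      have s2: "spans E (z # c) (set ((z # c) @ b @ Z') \<union> set Q2) b" using R2 by blast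
      have "spans E a ((set a \<union> set Q1 \<union> set (z # c)) \<union> (set ((z # c) @ b @ Z') \<union> set Q2)) b"
        by (rule spans_trans[OF s1 s2]) (use R1 R2 c a Z in auto)
      moreover have "(set a \<union> set Q1 \<union> set (z # c)) \<union> (set ((z # c) @ b @ Z') \<union> set Q2) = set (a @ b @ Z) \<union> set w"
        unfolding wc Z by auto
      ultimately show "distinct w \<and> set w \<inter> set (a @ b @ Z) = {} \<and> spans E a (set (a @ b @ Z) \<union> set w) b"
        using R1 R2 c unfolding wc Z by auto
    qed
  qed
  moreover have "r dvd P + Suc x + l"
  proof -
    have "P + Suc x + l = (q' + l) + (q + x + l)" unfolding P_def using l_pos by simp
    then show ?thesis using dv dv' by (metis dvd_add)
  qed
  moreover have "0 < 1 / 2 * (\<gamma>' / 2 * (\<gamma> / 2))" using \<gamma> \<gamma>' by simp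
  ultimately show ?case by (intro exI[of _ P] exI[of _ "1 / 2 * (\<gamma>' / 2 * (\<gamma> / 2))"] exI[of _ "n0 + n0' + n1 + n2 + n3"]) blast
qed

text \<open>A tuple \<open>\<sigma>\<close> lists the two end tuples of a path to be inserted between \<open>a\<close> and \<open>b\<close>, followed by
  the leftover vertices.\<close>
definition inserts :: "'b set set \<Rightarrow> 'b list \<Rightarrow> 'b list \<Rightarrow> 'b list \<Rightarrow> 'b list \<Rightarrow> bool" where
  "inserts E a b \<sigma> Q \<longleftrightarrow> distinct Q \<and> set Q \<inter> set (a @ b @ \<sigma>) = {} \<and>
    (\<exists>A B. spans E a A (take l \<sigma>) \<and> spans E (take l (drop l \<sigma>)) B b \<and> A \<inter> B = {} \<and> A \<union> B = set (a @ b @ \<sigma>) \<union> set Q)"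

text \<open>Two disjoint connections: from \<open>a\<close> to the first end tuple of
  \<open>\<sigma>\<close>, picking up the leftover vertices, and directly from the second end tuple
  to \<open>b\<close>.\<close>

lemma ample_inserts:
  assumes \<epsilon>: "0 < \<epsilon>" "\<epsilon> \<le> 1"
  shows "\<exists>q \<gamma> n0. 0 < \<gamma> \<and> r dvd q + x + 2 * l \<and> (\<forall>E (V :: 'a set) a b \<sigma>. dense E V (threshold + \<epsilon>) \<and> n0 \<le> card V \<and>
    length a = l \<and> length b = l \<and> length \<sigma> = 2 * l + x \<and> distinct (a @ b @ \<sigma>) \<and> set (a @ b @ \<sigma>) \<subseteq> V \<longrightarrow>
    ample V q \<gamma> (inserts E a b \<sigma>))"
proof -
  obtain q \<gamma> n0 where \<gamma>: "0 < \<gamma>" and dv: "r dvd q + x + l" and A: "\<And>E (V :: 'a set) a b Z. dense E V (threshold + \<epsilon>) \<Longrightarrow> n0 \<le> card V \<Longrightarrow>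
    length a = l \<Longrightarrow> length b = l \<Longrightarrow> length Z = x \<Longrightarrow> distinct (a @ b @ Z) \<Longrightarrow> set (a @ b @ Z) \<subseteq> V \<Longrightarrow>
    ample V q \<gamma> (\<lambda>Q. distinct Q \<and> set Q \<inter> set (a @ b @ Z) = {} \<and> spans E a (set (a @ b @ Z) \<union> set Q) b)"
    using absorbing_connections[OF \<epsilon>, of x, where 'a = 'a] by (elim exE conjE) (rule that; blast)
  obtain q' \<gamma>' n0' where \<gamma>': "0 < \<gamma>'" and dv': "r dvd q' + l" and A': "\<And>E (V :: 'a set) a b. dense E V (threshold + \<epsilon>) \<Longrightarrow> n0' \<le> card V \<Longrightarrow>
    length a = l \<Longrightarrow> length b = l \<Longrightarrow> distinct (a @ b) \<Longrightarrow> set (a @ b) \<subseteq> V \<Longrightarrow>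
    ample V q' \<gamma>' (\<lambda>y. walk E (a @ y @ b) \<and> distinct (a @ y @ b))"
    using connecting_walks[OF \<epsilon>, where 'a = 'a] by (elim exE conjE) (rule that; blast)
  have "0 < \<gamma> / (2 * (real q + 1))" using \<gamma> by simp
  then obtain n1 where n1: "\<And>n. n1 \<le> n \<Longrightarrow> real (2 * l) \<le> \<gamma> / (2 * (real q + 1)) * real n" using eventually_linear_bound by blast
  have "0 < \<gamma>' / (2 * (real q' + 1))" using \<gamma>' by simp
  then obtain n2 where n2: "\<And>n. n2 \<le> n \<Longrightarrow> real (2 * l + x + q) \<le> \<gamma>' / (2 * (real q' + 1)) * real n" using eventually_linear_bound by blast
  have "ample V (q + q') (\<gamma> / 2 * (\<gamma>' / 2)) (inserts E a b \<sigma>)"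
    if V: "dense E V (threshold + \<epsilon>)" "n0 + n0' + n1 + n2 \<le> card V"
      and a: "length a = l" "length b = l" "length \<sigma> = 2 * l + x" "distinct (a @ b @ \<sigma>)" "set (a @ b @ \<sigma>) \<subseteq> V"
    for E and V :: "'a set" and a b \<sigma>
  proof -
    have fin: "finite V" using V dense_finite by blast
    define \<alpha> \<beta> Z where "\<alpha> = take l \<sigma>" and "\<beta> = take l (drop l \<sigma>)" and "Z = drop (2 * l) \<sigma>"
    have \<sigma>: "\<sigma> = \<alpha> @ \<beta> @ Z"
    proof -
      have "drop l \<sigma> = \<beta> @ Z" unfolding \<beta>_def Z_def by (metis append_take_drop_id drop_drop mult_2)
      then show ?thesis unfolding \<alpha>_def by (metis append_take_drop_id)
    qed
    have len: "length \<alpha> = l" "length \<beta> = l" "length Z = x" unfolding \<alpha>_def \<beta>_def Z_def using a(3) by auto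
    let ?R1 = "\<lambda>Q. (distinct Q \<and> set Q \<inter> set (a @ \<alpha> @ Z) = {} \<and> spans E a (set (a @ \<alpha> @ Z) \<union> set Q) \<alpha>) \<and> set Q \<inter> set (\<beta> @ b) = {}"
    let ?R2 = "\<lambda>Q Q'. (walk E (\<beta> @ Q' @ b) \<and> distinct (\<beta> @ Q' @ b)) \<and> set Q' \<inter> set (a @ \<alpha> @ Z @ Q) = {}"
    have "ample V (q + q') (\<gamma> / 2 * (\<gamma>' / 2)) (\<lambda>w. ?R1 (take q w) \<and> ?R2 (take q w) (drop q w))"
    proof (rule ample_append[OF _ _ _ fin])
      show "ample V q (\<gamma> / 2) ?R1"
      proof (rule ample_avoid_half[OF A \<gamma> fin])
        have "card (set (\<beta> @ b)) \<le> 2 * l" using card_length[of "\<beta> @ b"] a len by simp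
        then show "real (card (set (\<beta> @ b))) \<le> \<gamma> / (2 * (real q + 1)) * real (card V)"
          using n1[of "card V"] V(2) by simp
      qed (use V a len \<sigma> in auto)
      fix Q assume Q: "Q \<in> tuples V q" "?R1 Q"
      show "ample V q' (\<gamma>' / 2) (?R2 Q)"
      proof (rule ample_avoid_half[OF A' \<gamma>' fin])
        have "card (set (a @ \<alpha> @ Z @ Q)) \<le> 2 * l + x + q" using card_length[of "a @ \<alpha> @ Z @ Q"] a len Q(1) unfolding tuples_def by simp
        then have "real (card (set (a @ \<alpha> @ Z @ Q))) \<le> real (2 * l + x + q)" by (simp only: of_nat_le_iff)
        then show "real (card (set (a @ \<alpha> @ Z @ Q))) \<le> \<gamma>' / (2 * (real q' + 1)) * real (card V)"
          using n2[of "card V"] V(2) by linarith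
      qed (use V a len \<sigma> in auto)
    qed (use \<gamma>' in simp)
    then show ?thesis
    proof (rule ample_mono[OF _ fin order_refl])
      fix w assume "w \<in> tuples V (q + q')" and h: "?R1 (take q w) \<and> ?R2 (take q w) (drop q w)"
      define Q Q' where "Q = take q w" and "Q' = drop q w"
      have w: "w = Q @ Q'" unfolding Q_def Q'_def by simp
      have R: "?R1 Q" "?R2 Q Q'" using h unfolding Q_def Q'_def by blast+
      have s2: "spans E \<beta> (set \<beta> \<union> set Q' \<union> set b) b" using R(2) len a by (intro spansI) auto
      show "inserts E a b \<sigma> w"
        unfolding inserts_def \<alpha>_def[symmetric] \<beta>_def[symmetric]
      proof (intro conjI exI)
        show "spans E a (set (a @ \<alpha> @ Z) \<union> set Q) \<alpha>" using R by blast
        show "spans E \<beta> (set \<beta> \<union> set Q' \<union> set b) b" by (rule s2)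
        show "distinct w" using R unfolding w by auto
        show "set w \<inter> set (a @ b @ \<sigma>) = {}" using R unfolding w \<sigma> by auto
        show "(set (a @ \<alpha> @ Z) \<union> set Q) \<inter> (set \<beta> \<union> set Q' \<union> set b) = {}" using R a(4) unfolding \<sigma> by auto
        show "set (a @ \<alpha> @ Z) \<union> set Q \<union> (set \<beta> \<union> set Q' \<union> set b) = set (a @ b @ \<sigma>) \<union> set w" unfolding w \<sigma> by auto
      qed
    qed
  qed
  moreover have "r dvd (q + q') + x + 2 * l"
  proof -
    have "(q + q') + x + 2 * l = (q + x + l) + (q' + l)" by simp
    then show ?thesis using dv dv' by (metis dvd_add)
  qed
  moreover have "0 < \<gamma> / 2 * (\<gamma>' / 2)" using \<gamma> \<gamma>' by simp
  ultimately show ?thesis by (intro exI[of _ "q + q'"] exI[of _ "\<gamma> / 2 * (\<gamma>' / 2)"] exI[of _ "n0 + n0' + n1 + n2"]) blast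
qed

end

lemma distinct_concat_del_nth:
  assumes "distinct (concat Qs)" "i < length Qs"
  shows "set (concat (del_nth i Qs)) \<inter> set (Qs ! i) = {}" "set (concat (del_nth i Qs)) \<union> set (Qs ! i) = set (concat Qs)"
proof -
  have Qs: "Qs = take i Qs @ Qs ! i # drop (Suc i) Qs" using assms(2) by (rule id_take_nth_drop)
  then have "concat Qs = concat (take i Qs) @ Qs ! i @ concat (drop (Suc i) Qs)" by (metis concat.simps(2) concat_append)
  then have c: "distinct (concat (take i Qs) @ Qs ! i @ concat (drop (Suc i) Qs))"
    "set (concat Qs) = set (concat (take i Qs)) \<union> set (Qs ! i) \<union> set (concat (drop (Suc i) Qs))"
    using assms(1) by auto
  show "set (concat (del_nth i Qs)) \<inter> set (Qs ! i) = {}" "set (concat (del_nth i Qs)) \<union> set (Qs ! i) = set (concat Qs)"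
    using c unfolding del_nth_def by auto
qed

context cycle_params
begin

text \<open>At most \<open>2 * card U * card V\<close> ordered pairs meet \<open>U\<close>; the
  comparison with the smaller square of \<open>card (V - U)\<close> only helps, as the new density
  is non-negative.\<close>

lemma dense_remove:
  assumes V: "dense E V \<beta>" and U: "U \<subseteq> V" "real (card U) \<le> \<eta> * real (card V)" and \<beta>: "0 \<le> \<beta> - 2 * \<eta>"
  shows "dense E (V - U) (\<beta> - 2 * \<eta>)"
  unfolding dense_def
proof (intro conjI ballI allI impI)
  have fin: "finite V" "finite U" using dense_finite[OF V] U finite_subset by auto
  then show "finite (V - U)" by simp
  show "card e = l + r" if "e \<in> E" for e using that dense_card[OF V] by blast
  fix T assume T: "T \<subseteq> V - U" "card T = l + r - 2"
  let ?n = "real (card V)"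
  have "link E V T \<subseteq> link E (V - U) T \<union> (U \<times> V \<union> V \<times> U)" unfolding link_def by auto
  then have "card (link E V T) \<le> card (link E (V - U) T \<union> (U \<times> V \<union> V \<times> U))"
    using fin by (intro card_mono) (auto intro: finite_link)
  also have "\<dots> \<le> card (link E (V - U) T) + (card (U \<times> V) + card (V \<times> U))"
    by (intro order_trans[OF card_Un_le] add_mono card_Un_le order_refl)
  finally have "real (card (link E V T)) \<le> real (card (link E (V - U) T) + (card (U \<times> V) + card (V \<times> U)))"
    by (simp only: of_nat_le_iff)
  then have l1: "real (card (link E V T)) \<le> real (card (link E (V - U) T)) + 2 * (real (card U) * ?n)"
    unfolding of_nat_add card_cartesian_product of_nat_mult mult.commute[of "real (card V)" "real (card U)"] by linarith
  have "real (card U) * ?n \<le> \<eta> * ?n * ?n" using U(2) by (intro mult_right_mono) auto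
  then have "(\<beta> - 2 * \<eta>) * ?n\<^sup>2 \<le> real (card (link E (V - U) T))"
    using l1 denseD[OF V, of T] T by (simp add: power2_eq_square algebra_simps) (use T in \<open>auto simp: subset_iff\<close>)
  moreover have "(\<beta> - 2 * \<eta>) * (real (card (V - U)))\<^sup>2 \<le> (\<beta> - 2 * \<eta>) * ?n\<^sup>2"
    using \<beta> fin by (intro mult_left_mono power_mono) (auto intro: card_mono)
  ultimately show "(\<beta> - 2 * \<eta>) * (real (card (V - U)))\<^sup>2 \<le> real (card (link E (V - U) T))" by linarith
qed

lemma ample_ex_avoid:
  assumes "ample V q \<gamma> P" "0 < \<gamma>" "finite V" "V \<noteq> {}" "finite F" "real (card F) \<le> \<gamma> / (2 * (real q + 1)) * real (card V)"
  shows "\<exists>x\<in>tuples V q. P x \<and> set x \<inter> F = {}"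
proof -
  have "ample V q (\<gamma> / 2) (\<lambda>x. P x \<and> set x \<inter> F = {})" by (rule ample_avoid_half[OF assms(1,2,3,5,6)])
  moreover have "0 < \<gamma> / 2" using assms(2) by simp
  ultimately show ?thesis using assms(3,4) by (rule ample_ex)
qed

subsection \<open>Chains of exchange gadgets\<close>

text \<open>Consecutive gadgets exchange neighbouring members of the list, so the chain can leave out any
  single member.\<close>
lemma exchange_chain:
  assumes \<epsilon>: "0 < \<epsilon>" "\<epsilon> \<le> 1"
  shows "\<exists>K \<delta> n0. 0 < \<delta> \<and> (\<forall>E (V :: 'a set) a. dense E V (threshold + \<epsilon>) \<and> n0 \<le> card V \<and> length a = l \<and> distinct a \<and> set a \<subseteq> V \<longrightarrow>
    (\<forall>Qs F. Qs \<noteq> [] \<and> set Qs \<subseteq> tuples V q \<and> distinct (concat Qs) \<and> set a \<inter> set (concat Qs) = {} \<and> finite F \<and>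
      F \<inter> (set a \<union> set (concat Qs)) = {} \<and> real (card F + (length Qs + 1) * K) \<le> \<delta> * real (card V) \<longrightarrow>
      (\<exists>B g. B \<subseteq> V \<and> B \<inter> (F \<union> set (concat Qs)) = {} \<and> card B \<le> length Qs * K \<and> set g \<subseteq> B \<and>
        (\<forall>i<length Qs. spans E a (B \<union> set (concat (del_nth i Qs))) g))))"
proof -
  obtain N \<gamma> n1 where \<gamma>: "0 < \<gamma>" and A: "\<And>E (V :: 'a set) Q Q'. dense E V (threshold + \<epsilon>) \<Longrightarrow> n1 \<le> card V \<Longrightarrow>
    length Q = q \<Longrightarrow> length Q' = q \<Longrightarrow> distinct (Q @ Q') \<Longrightarrow> set (Q @ Q') \<subseteq> V \<Longrightarrow>
    ample V N \<gamma> (\<lambda>g. distinct g \<and> set g \<inter> set (Q @ Q') = {} \<and>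
      (\<exists>c d. set c \<subseteq> set g \<and> set d \<subseteq> set g \<and> spans E c (set g \<union> set Q) d \<and> spans E c (set g \<union> set Q') d))"
    using exchange_gadgets[OF \<epsilon>, of q, where 'a = 'a] by (elim exE conjE) (rule that; blast)
  obtain q' \<gamma>' n2 where \<gamma>': "0 < \<gamma>'" and A': "\<And>E (V :: 'a set) a b. dense E V (threshold + \<epsilon>) \<Longrightarrow> n2 \<le> card V \<Longrightarrow>
    length a = l \<Longrightarrow> length b = l \<Longrightarrow> distinct (a @ b) \<Longrightarrow> set (a @ b) \<subseteq> V \<Longrightarrow>
    ample V q' \<gamma>' (\<lambda>y. walk E (a @ y @ b) \<and> distinct (a @ y @ b))"
    using connecting_walks[OF \<epsilon>, where 'a = 'a] by (elim exE conjE) (rule that; blast)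
  define K where "K = N + q' + q + l"
  \<comment> \<open>The occupied vertices and the next gadget together number at most twice the
    budget in the statement, which \<open>3 * \<delta>\<close> covers.\<close>
  define \<delta> where "\<delta> = min (\<gamma> / (2 * (real N + 1))) (\<gamma>' / (2 * (real q' + 1))) / 3"
  have \<delta>: "0 < \<delta>" unfolding \<delta>_def using \<gamma> \<gamma>' by simp
  have \<delta>1: "3 * \<delta> \<le> \<gamma> / (2 * (real N + 1))" and \<delta>2: "3 * \<delta> \<le> \<gamma>' / (2 * (real q' + 1))" unfolding \<delta>_def by auto
  have "\<exists>B g. B \<subseteq> V \<and> B \<inter> (F \<union> set (concat Qs)) = {} \<and> card B \<le> length Qs * K \<and> set g \<subseteq> B \<and>
        (\<forall>i<length Qs. spans E a (B \<union> set (concat (del_nth i Qs))) g)"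
    if V: "dense E V (threshold + \<epsilon>)" "n1 + n2 \<le> card V" and a: "length a = l" "distinct a" "set a \<subseteq> V"
      and Qs: "Qs \<noteq> []" "set Qs \<subseteq> tuples V q" "distinct (concat Qs)" "set a \<inter> set (concat Qs) = {}"
      and F: "finite F" "F \<inter> (set a \<union> set (concat Qs)) = {}" "real (card F + (length Qs + 1) * K) \<le> \<delta> * real (card V)"
    for E and V :: "'a set" and a Qs F
    using Qs F
  proof (induction Qs arbitrary: F rule: rev_nonempty_induct)
    \<comment> \<open>Leaving out the only member leaves the end tuple \<open>a\<close> itself, a
      path consisting of one tuple.\<close>
    case (single Q)
    have "spans E a (set a \<union> set (concat (del_nth 0 [Q]))) a"
      using spans_refl[OF a(1,2), of E] by (simp add: del_nth_def)
    moreover have "card (set a) \<le> length [Q] * K" using card_length[of a] a(1) unfolding K_def by simp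
    ultimately show ?case using single a by (intro exI[of _ "set a"] exI[of _ a]) auto
  next
    case (snoc Q' Qs)
    have fin: "finite V" using V dense_finite by blast
    have lQ': "length Q' = q" "set Q' \<subseteq> V" using snoc.prems(1) unfolding tuples_def by auto
    have cQ': "card (set Q') \<le> q" using card_length[of Q'] lQ' by simp
    \<comment> \<open>\<open>Q'\<close> is not yet part of the chain, so the shorter chain has to
      treat it as forbidden.\<close>
    have "card (F \<union> set Q') \<le> card F + K" using card_Un_le[of F "set Q'"] cQ' unfolding K_def by linarith
    then have "card (F \<union> set Q') + (length Qs + 1) * K \<le> card F + (length (Qs @ [Q']) + 1) * K" by simp
    then have small: "real (card (F \<union> set Q') + (length Qs + 1) * K) \<le> \<delta> * real (card V)"
      using snoc.prems(6) by (meson of_nat_mono order_trans)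
    obtain B g where B: "B \<subseteq> V" "B \<inter> ((F \<union> set Q') \<union> set (concat Qs)) = {}" "card B \<le> length Qs * K" "set g \<subseteq> B"
      "\<And>i. i < length Qs \<Longrightarrow> spans E a (B \<union> set (concat (del_nth i Qs))) g"
    proof -
      have p1: "set Qs \<subseteq> tuples V q" "distinct (concat Qs)" "set a \<inter> set (concat Qs) = {}" "finite (F \<union> set Q')"
        using snoc.prems by auto
      have p2: "(F \<union> set Q') \<inter> (set a \<union> set (concat Qs)) = {}" using snoc.prems(2,3,5) by auto
      show ?thesis using snoc.IH[OF p1 p2 small] that by blast
    qed
    obtain Qs0 Q where Qs0: "Qs = Qs0 @ [Q]" using snoc.hyps by (metis rev_exhaust)
    have lQ: "length Q = q" "set Q \<subseteq> V" using snoc.prems(1) unfolding tuples_def Qs0 by auto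
    have finB: "finite B" using B(1) fin finite_subset by blast
    define W where "W = F \<union> (B \<union> set (concat (Qs @ [Q'])))"
    have finW: "finite W" unfolding W_def using snoc.prems(4) finB by simp
    have "length (concat (Qs @ [Q'])) = length (Qs @ [Q']) * q"
    proof -
      have "length (concat Xs) = length Xs * q" if "set Xs \<subseteq> tuples V q" for Xs :: "'a list list"
        using that by (induction Xs) (auto simp: tuples_def)
      then show ?thesis using snoc.prems(1) by blast
    qed
    then have "card (set (concat (Qs @ [Q']))) \<le> length (Qs @ [Q']) * K"
      using card_length[of "concat (Qs @ [Q'])"] mult_le_mono2[of q K "length (Qs @ [Q'])"] unfolding K_def by linarith
    then have "card W \<le> card F + (length Qs * K + length (Qs @ [Q']) * K)"
      unfolding W_def using card_Un_le[of F "B \<union> set (concat (Qs @ [Q']))"] card_Un_le[of B "set (concat (Qs @ [Q']))"] B(3) by linarith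
    then have cW: "card W + K \<le> 2 * (card F + (length (Qs @ [Q']) + 1) * K)" by simp
    then have "real (card W + K) \<le> real (2 * (card F + (length (Qs @ [Q']) + 1) * K))" by (simp only: of_nat_le_iff)
    also have "\<dots> \<le> 2 * (\<delta> * real (card V))" using snoc.prems(6) by simp
    also have "\<dots> \<le> (3 * \<delta>) * real (card V)" using \<delta> by simp
    finally have cW3: "real (card W + K) \<le> (3 * \<delta>) * real (card V)" .
    have d1: "(3 * \<delta>) * real (card V) \<le> \<gamma> / (2 * (real N + 1)) * real (card V)" using \<delta>1 by (intro mult_right_mono) auto
    have d2: "(3 * \<delta>) * real (card V) \<le> \<gamma>' / (2 * (real q' + 1)) * real (card V)" using \<delta>2 by (intro mult_right_mono) auto
    have V0: "V \<noteq> {}" using a l_pos by (cases a) auto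
    have QQ: "distinct (Q @ Q')" using snoc.prems(2) unfolding Qs0 by auto
    have "ample V N \<gamma> (\<lambda>g. distinct g \<and> set g \<inter> set (Q @ Q') = {} \<and>
      (\<exists>c d. set c \<subseteq> set g \<and> set d \<subseteq> set g \<and> spans E c (set g \<union> set Q) d \<and> spans E c (set g \<union> set Q') d))"
      using V QQ lQ lQ' by (intro A) auto
    moreover have "real (card W) \<le> \<gamma> / (2 * (real N + 1)) * real (card V)" using cW3 d1 by simp
    ultimately obtain h c d where h: "h \<in> tuples V N" "set h \<inter> W = {}" "set c \<subseteq> set h" "set d \<subseteq> set h"
      "spans E c (set h \<union> set Q) d" "spans E c (set h \<union> set Q') d"
      using ample_ex_avoid[OF _ \<gamma> fin V0 finW] by blast
    have ch: "card (set h) \<le> N" using h(1) card_length[of h] unfolding tuples_def by simp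
    have g: "length g = l" "distinct g"
      using spans_ends[OF B(5)[of 0]] snoc.hyps by auto
    have c: "length c = l" "distinct c" using spans_ends[OF h(5)] by auto
    have "set g \<inter> set h = {}" using B(4) h(2) unfolding W_def by auto
    then have gc: "distinct (g @ c)" "set (g @ c) \<subseteq> V" using g c h(1,3) B(1,4) unfolding tuples_def by auto
    define W' where "W' = W \<union> set h"
    have finW': "finite W'" unfolding W'_def using finW by simp
    have "card W' \<le> card W + K" unfolding W'_def using card_Un_le[of W "set h"] ch unfolding K_def by linarith
    then have "real (card W') \<le> real (card W + K)" by (simp only: of_nat_le_iff)
    then have "real (card W') \<le> \<gamma>' / (2 * (real q' + 1)) * real (card V)" using cW3 d2 by linarith
    moreover have "real (card (W' - set (g @ c))) \<le> real (card W')" using finW' by (simp add: card_mono)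
    ultimately have cW': "real (card (W' - set (g @ c))) \<le> \<gamma>' / (2 * (real q' + 1)) * real (card V)" by linarith
    have "ample V q' \<gamma>' (\<lambda>y. walk E (g @ y @ c) \<and> distinct (g @ y @ c))"
      using V g c gc by (intro A') auto
    then obtain y where y: "y \<in> tuples V q'" "walk E (g @ y @ c)" "distinct (g @ y @ c)" "set y \<inter> (W' - set (g @ c)) = {}"
      using ample_ex_avoid[OF _ \<gamma>' fin V0 _ cW'] finW' by blast
    have yW: "set y \<inter> W = {}" "set y \<inter> set h = {}" using y(3,4) h(2) unfolding W'_def by auto
    have cy: "card (set y) \<le> q'" using y(1) card_length[of y] unfolding tuples_def by simp
    have s1: "spans E g (set g \<union> set y \<union> set c) c" using y g c by (intro spansI) auto
    define B' where "B' = B \<union> (set y \<union> set h)"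
    have "card B' \<le> card B + (card (set y) + card (set h))"
      unfolding B'_def by (meson add_left_mono card_Un_le order_trans)
    then have cB': "card B' \<le> length (Qs @ [Q']) * K" using B(3) cy ch unfolding K_def by simp
    \<comment> \<open>The shorter chain followed by the connection and the gadget: \<open>X\<close>
      is what the chain carries, \<open>Y\<close> the tuple carried by the gadget.\<close>
    have comb: "spans E a (B' \<union> set (concat X) \<union> set Y) d"
      if "spans E a (B \<union> set (concat X)) g" "spans E c (set h \<union> set Y) d" "set (concat X) \<subseteq> set (concat Qs)" "set Y \<subseteq> set (concat (Qs @ [Q']))"
        "set (concat X) \<inter> set Y = {}" for X Y
    proof -
      have XW: "set (concat X) \<subseteq> W" using that(3) unfolding W_def concat_append set_append by blast
      have BW: "B \<subseteq> W" unfolding W_def by blast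
      have i1: "(B \<union> set (concat X)) \<inter> (set g \<union> set y \<union> set c) \<subseteq> set g"
        using XW BW yW h(2,3) by blast
      have s2: "spans E a ((B \<union> set (concat X)) \<union> (set g \<union> set y \<union> set c)) c"
        by (rule spans_trans[OF that(1) s1 i1])
      have BY: "B \<inter> set Y = {}" using B(2) that(4) by auto
      have gY: "set g \<inter> set Y = {}" using B(4) BY by auto
      have i2: "((B \<union> set (concat X)) \<union> (set g \<union> set y \<union> set c)) \<inter> (set h \<union> set Y) \<subseteq> set c"
      proof -
        have "B \<inter> set h = {}" "set (concat X) \<inter> set h = {}" "set g \<inter> set h = {}"
          using h(2) XW BW B(4) by blast+
        moreover have "set y \<inter> set Y = {}" using yW(1) that(4) unfolding W_def by blast
        moreover have "set c \<inter> set Y \<subseteq> set c" by auto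
        ultimately show ?thesis using BY gY that(5) yW(2) by blast
      qed
      have "spans E a (((B \<union> set (concat X)) \<union> (set g \<union> set y \<union> set c)) \<union> (set h \<union> set Y)) d"
        by (rule spans_trans[OF s2 that(2) i2])
      moreover have "((B \<union> set (concat X)) \<union> (set g \<union> set y \<union> set c)) \<union> (set h \<union> set Y) = B' \<union> set (concat X) \<union> set Y"
        unfolding B'_def using B(4) h(3) by auto
      ultimately show ?thesis by simp
    qed
    \<comment> \<open>If an earlier member is left out, the gadget carries \<open>Q'\<close>. If
      \<open>Q'\<close> itself is left out, the shorter chain leaves out its last member
      \<open>Q\<close> and the gadget carries \<open>Q\<close> instead.\<close>
    have fl: "spans E a (B' \<union> set (concat (del_nth i (Qs @ [Q'])))) d" if "i < length (Qs @ [Q'])" for i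
    proof (cases "i < length Qs")
      case True
      have del: "del_nth i (Qs @ [Q']) = del_nth i Qs @ [Q']" unfolding del_nth_def using True by simp
      have dq: "distinct (concat Qs)" using snoc.prems(2) by simp
      have "set (concat (del_nth i Qs)) \<subseteq> set (concat Qs)" using distinct_concat_del_nth(2)[OF dq True] by blast
      moreover have "set (concat Qs) \<inter> set Q' = {}" using snoc.prems(2) by simp
      ultimately have "spans E a (B' \<union> set (concat (del_nth i Qs)) \<union> set Q') d"
        using comb[OF B(5)[OF True] h(6)] by auto
      then show ?thesis unfolding del by (simp add: Un_assoc)
    next
      case False
      then have i: "i = length Qs" using that by simp
      have del: "del_nth i (Qs @ [Q']) = Qs0 @ [Q]" unfolding del_nth_def i Qs0 by simp
      have "del_nth (length Qs0) Qs = Qs0" unfolding del_nth_def Qs0 by simp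
      then have "spans E a (B \<union> set (concat Qs0)) g" using B(5)[of "length Qs0"] unfolding Qs0 by simp
      moreover have "set (concat Qs0) \<inter> set Q = {}" using snoc.prems(2) unfolding Qs0 by auto
      ultimately have "spans E a (B' \<union> set (concat Qs0) \<union> set Q) d"
        using comb[OF _ h(5), of Qs0] unfolding Qs0 by auto
      then show ?thesis unfolding del by (simp add: Un_assoc)
    qed
    have "B' \<subseteq> V" unfolding B'_def using B(1) y(1) h(1) unfolding tuples_def by auto
    moreover have "B' \<inter> (F \<union> set (concat (Qs @ [Q']))) = {}"
      unfolding B'_def using B(2) yW(1) h(2) unfolding W_def by auto
    moreover have "set d \<subseteq> B'" unfolding B'_def using h(4) by auto
    ultimately show ?case using cB' fl by blast
  qed
  note chain = this
  show ?thesis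
  proof (rule exI[of _ K], rule exI[of _ \<delta>], rule exI[of _ "n1 + n2"], intro conjI allI impI)
    show "0 < \<delta>" by (rule \<delta>)
  next
    fix E and V :: "'a set" and a Qs F
    assume "dense E V (threshold + \<epsilon>) \<and> n1 + n2 \<le> card V \<and> length a = l \<and> distinct a \<and> set a \<subseteq> V"
      and "Qs \<noteq> [] \<and> set Qs \<subseteq> tuples V q \<and> distinct (concat Qs) \<and> set a \<inter> set (concat Qs) = {} \<and> finite F \<and>
        F \<inter> (set a \<union> set (concat Qs)) = {} \<and> real (card F + (length Qs + 1) * K) \<le> \<delta> * real (card V)"
    then show "\<exists>B g. B \<subseteq> V \<and> B \<inter> (F \<union> set (concat Qs)) = {} \<and> card B \<le> length Qs * K \<and> set g \<subseteq> B \<and>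
        (\<forall>i<length Qs. spans E a (B \<union> set (concat (del_nth i Qs))) g)"
      by (elim conjE) (rule chain; assumption)
  qed
qed

section \<open>Absorption and Hamilton-connectedness\<close>

lemma eventually_log_linear_bound:
  fixes A B \<kappa> :: real
  assumes "0 < \<kappa>" shows "\<exists>n0::nat. \<forall>n\<ge>n0. A * ln (real n) + B \<le> \<kappa> * real n"
proof -
  have "eventually (\<lambda>n::nat. A * ln (real n) + B \<le> \<kappa> * real n) at_top" using assms by real_asymp
  then show ?thesis by (simp add: eventually_at_top_linorder)
qed

lemma walk_take: "walk E xs \<Longrightarrow> l + r * t \<le> length xs \<Longrightarrow> walk E (take (l + r * t) xs)"
proof -
  assume w: "walk E xs" and t: "l + r * t \<le> length xs"
  obtain m where m: "length xs = l + r * m" using w by (rule walk_lengthE)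
  have tm: "t \<le> m" using t m r_pos by simp
  show ?thesis
  proof (rule walkI[of _ t])
    fix i assume i: "i < t"
    then have "Suc i * r \<le> t * r" by (intro mult_le_mono1) simp
    then have "i * r + (l + r) \<le> l + r * t" by (simp add: mult.commute)
    then have "take (l + r) (drop (i * r) (take (l + r * t) xs)) = take (l + r) (drop (i * r) xs)"
      by (simp add: drop_take)
    then show "set (take (l + r) (drop (i * r) (take (l + r * t) xs))) \<in> E" using walkD[OF w m, of i] i tm by simp
  qed (use t in simp)
qed

text \<open>The path is assembled from the chain from \<open>a\<close> to \<open>g\<close>, a
  connection to an auxiliary tuple \<open>a'\<close>, a passage from \<open>a'\<close> into the long
  path \<open>P\<close>, then \<open>P\<close> itself and a passage from \<open>P\<close> to
  \<open>b\<close>. The two passages consume the tuple \<open>Q\<close> that the chain leaves out,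
  and the \<open>x\<close> leftover vertices. Everything except \<open>P\<close> and the leftovers
  is reserved beforehand.\<close>

lemma hamilton_connected:
  assumes \<epsilon>: "0 < \<epsilon>" "\<epsilon> \<le> 1"
  shows "\<exists>m0. \<forall>E (V :: 'a set) a b m. dense E V (threshold + \<epsilon>) \<and> m0 \<le> m \<and> card V = l + r * m \<and>
    length a = l \<and> length b = l \<and> distinct (a @ b) \<and> set (a @ b) \<subseteq> V \<longrightarrow> spans E a V b"
proof -
  \<comment> \<open>Deleting \<open>x\<close> vertices from a spanning cycle on
    \<open>r * n'\<close> vertices leaves \<open>l + r * (n' - l)\<close>, which is the length of a
    walk.\<close>
  define x where "x = l * (r - 1)"
  have xl: "x + l = r * l" unfolding x_def using r_pos by (cases r) (auto simp: algebra_simps)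
  obtain q \<gamma>0 n1 where \<gamma>0: "0 < \<gamma>0" and dv: "r dvd q + x + 2 * l" and A1: "\<And>E (V :: 'a set) a b \<sigma>. dense E V (threshold + \<epsilon>) \<Longrightarrow> n1 \<le> card V \<Longrightarrow>
    length a = l \<Longrightarrow> length b = l \<Longrightarrow> length \<sigma> = 2 * l + x \<Longrightarrow> distinct (a @ b @ \<sigma>) \<Longrightarrow> set (a @ b @ \<sigma>) \<subseteq> V \<Longrightarrow>
    ample V q \<gamma>0 (inserts E a b \<sigma>)"
    using ample_inserts[OF \<epsilon>, of x, where 'a = 'a] by (elim exE conjE) (rule that; blast)
  define \<gamma> where "\<gamma> = min \<gamma>0 1"
  have \<gamma>: "0 < \<gamma>" "\<gamma> \<le> 1" "\<gamma> \<le> \<gamma>0" unfolding \<gamma>_def using \<gamma>0 by auto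
  obtain K \<delta> n2 where \<delta>: "0 < \<delta>" and A2: "\<forall>E (V :: 'a set) a. dense E V (threshold + \<epsilon>) \<and> n2 \<le> card V \<and> length a = l \<and> distinct a \<and> set a \<subseteq> V \<longrightarrow>
    (\<forall>Qs F. Qs \<noteq> [] \<and> set Qs \<subseteq> tuples V q \<and> distinct (concat Qs) \<and> set a \<inter> set (concat Qs) = {} \<and> finite F \<and>
      F \<inter> (set a \<union> set (concat Qs)) = {} \<and> real (card F + (length Qs + 1) * K) \<le> \<delta> * real (card V) \<longrightarrow>
      (\<exists>B g. B \<subseteq> V \<and> B \<inter> (F \<union> set (concat Qs)) = {} \<and> card B \<le> length Qs * K \<and> set g \<subseteq> B \<and>
        (\<forall>i<length Qs. spans E a (B \<union> set (concat (del_nth i Qs))) g)))"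
    using exchange_chain[OF \<epsilon>, of q, where 'a = 'a] by (elim exE conjE) (rule that; assumption)
  obtain qc \<gamma>c n3 where \<gamma>c: "0 < \<gamma>c" and A3: "\<And>E (V :: 'a set) a b. dense E V (threshold + \<epsilon>) \<Longrightarrow> n3 \<le> card V \<Longrightarrow>
    length a = l \<Longrightarrow> length b = l \<Longrightarrow> distinct (a @ b) \<Longrightarrow> set (a @ b) \<subseteq> V \<Longrightarrow>
    ample V qc \<gamma>c (\<lambda>y. walk E (a @ y @ b) \<and> distinct (a @ y @ b))"
    using connecting_walks[OF \<epsilon>, where 'a = 'a] by (elim exE conjE) (rule that; blast)
  obtain n4 where A4: "\<And>E (V :: 'a set). dense E V (threshold + \<epsilon> / 2) \<and> n4 \<le> card V \<and> r dvd card V \<Longrightarrow> \<exists>vs. spanning_cycle E V vs"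
    using dense_spanning_cycle[of "\<epsilon> / 2", where 'a = 'a] \<epsilon> by auto
  define L where "L = 2 * l + x"
  define \<kappa> where "\<kappa> = Min {\<gamma> / (2 * (real q + 1)), \<delta>, \<gamma>c / (2 * (real qc + 1)), \<epsilon> / 4}"
  have "0 < \<kappa>" unfolding \<kappa>_def using \<gamma> \<delta> \<gamma>c \<epsilon> by (subst Min_gr_iff) auto
  moreover have "\<kappa> \<le> \<gamma> / (2 * (real q + 1))" "\<kappa> \<le> \<delta>" "\<kappa> \<le> \<gamma>c / (2 * (real qc + 1))" "\<kappa> \<le> \<epsilon> / 4"
    unfolding \<kappa>_def by (rule Min_le; simp)+
  ultimately have \<kappa>: "0 < \<kappa>" "\<kappa> \<le> \<gamma> / (2 * (real q + 1))" "\<kappa> \<le> \<delta>" "\<kappa> \<le> \<gamma>c / (2 * (real qc + 1))" "\<kappa> \<le> \<epsilon> / 4"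
    by blast+
  \<comment> \<open>Growth of the reserved set: logarithmically many tuples and gadgets, each of
    bounded size.\<close>
  define A where "A = 2 / \<gamma> * (real L + 1) * real (K + q)"
  define B where "B = real (3 * (K + q) + 3 * l + qc)"
  obtain n5 where n5: "\<And>n. n5 \<le> n \<Longrightarrow> A * ln (real n) + B \<le> \<kappa> * real n"
    using eventually_log_linear_bound[OF \<kappa>(1)] by blast
  define m0 where "m0 = n1 + n2 + n3 + n5 + 2 * n4 + 4 * L + 4 * l + 2"
  have "spans E a V b"
    if V: "dense E V (threshold + \<epsilon>)" and m: "m0 \<le> m" "card V = l + r * m" and lab: "length a = l" "length b = l" "distinct (a @ b)" "set (a @ b) \<subseteq> V"
    for E and V :: "'a set" and a b m
  proof -
    have a: "length a = l" "distinct a" "set a \<subseteq> V" and b: "length b = l" "distinct b" "set b \<subseteq> V" and ab: "set a \<inter> set b = {}"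
      using lab by auto
    have fin: "finite V" using V dense_finite by blast
    have "1 * m \<le> r * m" using r_pos by (intro mult_le_mono1) simp
    then have n: "m0 \<le> card V" using m by linarith
    then have V0: "V \<noteq> {}" unfolding m0_def by auto
    define N where "N = real (card V)"
    have N2: "2 \<le> N" unfolding N_def using n unfolding m0_def by simp
    then have lnN: "0 \<le> ln N" by simp
    \<comment> \<open>Makes \<open>(1 - \<gamma> / 2) ^ M\<close> at most
      \<open>1 / N ^ (L + 1)\<close>, while there are at most \<open>N ^ L\<close> tuples to cover:
      fewer than one, hence none, remains uncovered.\<close>
    define M where "M = nat \<lceil>2 / \<gamma> * (real L + 1) * ln N\<rceil> + 1"
    have "0 \<le> 2 / \<gamma> * (real L + 1) * ln N" using \<gamma> lnN by (intro mult_nonneg_nonneg) auto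
    then have M: "2 / \<gamma> * (real L + 1) * ln N \<le> real M" "real M \<le> 2 / \<gamma> * (real L + 1) * ln N + 2"
      unfolding M_def by linarith+
    have M0: "0 < M" unfolding M_def by simp
    have small: "real (3 * l + qc + (M + 1) * (K + q)) \<le> \<kappa> * N"
    proof -
      have "real M * real (K + q) \<le> (2 / \<gamma> * (real L + 1) * ln N + 2) * real (K + q)" using M(2) by (intro mult_right_mono) auto
      also have "\<dots> = A * ln N + 2 * real (K + q)" unfolding A_def by (simp add: algebra_simps)
      finally have "real (3 * l + qc + (M + 1) * (K + q)) \<le> A * ln N + B" unfolding B_def by (simp add: algebra_simps)
      also have "\<dots> \<le> \<kappa> * N" unfolding N_def using n unfolding m0_def by (intro n5) simp
      finally show ?thesis .
    qed
    have smaller: "real t \<le> \<rho> * real (card V)" if "t \<le> 3 * l + qc + (M + 1) * (K + q)" "\<kappa> \<le> \<rho>" for t \<rho>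
    proof -
      have "real t \<le> real (3 * l + qc + (M + 1) * (K + q))" using that(1) by (simp only: of_nat_le_iff)
      also have "\<dots> \<le> \<kappa> * N" by (rule small)
      also have "\<dots> \<le> \<rho> * real (card V)" unfolding N_def using that(2) by (intro mult_right_mono) auto
      finally show ?thesis .
    qed
    \<comment> \<open>The tuples \<open>Qs\<close> must be chosen before the end \<open>g\<close> of
      the chain is known, so they are anchored at a tuple \<open>a'\<close> set aside in
      advance.\<close>
    have "card (set a \<union> set b) \<le> 2 * l" using card_Un_le[of "set a" "set b"] card_length[of a] card_length[of b] a b by linarith
    then have "l \<le> card (V - (set a \<union> set b))" using n diff_card_le_card_Diff[of "set a \<union> set b" V] unfolding m0_def by simp
    then obtain S where S: "S \<subseteq> V - (set a \<union> set b)" "card S = l" using obtain_subset_with_card_n by metis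
    then have "finite S" using fin by (meson finite_Diff finite_subset)
    then obtain a' where "set a' = S" "distinct a'" using finite_distinct_list by blast
    then have a': "length a' = l" "distinct a'" "set a' \<subseteq> V" "set a' \<inter> set a = {}" "set a' \<inter> set b = {}"
      using S distinct_card[of a'] by auto
    define \<Sigma> where "\<Sigma> = {\<sigma> \<in> tuples V L. distinct (a' @ b @ \<sigma>)}"
    have fS: "finite \<Sigma>" unfolding \<Sigma>_def using fin by simp
    have cS: "real (card \<Sigma>) \<le> N ^ L"
    proof -
      have "card \<Sigma> \<le> card (tuples V L)" unfolding \<Sigma>_def using fin by (intro card_mono) auto
      then have "real (card \<Sigma>) \<le> real (card V ^ L)" unfolding card_tuples[OF fin] by (simp only: of_nat_le_iff)
      then show ?thesis unfolding N_def by simp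
    qed
    define F where "F = set a \<union> set a' \<union> set b"
    have finF: "finite F" unfolding F_def by simp
    have cF: "card F \<le> 3 * l"
      unfolding F_def using card_Un_le[of "set a \<union> set a'" "set b"] card_Un_le[of "set a" "set a'"] card_length[of a] card_length[of a'] card_length[of b] a b a' by linarith
    have "\<exists>Qs. length Qs = M \<and> set Qs \<subseteq> tuples V q \<and> distinct (concat Qs) \<and> set (concat Qs) \<inter> F = {} \<and>
      (\<forall>\<sigma>\<in>\<Sigma>. \<exists>Q\<in>set Qs. inserts E a' b \<sigma> Q)"
    proof -
      have sF: "real (card F + M * q) \<le> \<gamma> / (2 * (real q + 1)) * real (card V)"
        using cF by (intro smaller \<kappa>) (simp add: algebra_simps)
      have G: "ample V q \<gamma> (inserts E a' b \<sigma>)" if "\<sigma> \<in> \<Sigma>" for \<sigma>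
      proof (rule ample_mono[OF A1 fin \<gamma>(3)])
        show "n1 \<le> card V" using n unfolding m0_def by simp
      qed (use that V a' b in \<open>auto simp: \<Sigma>_def tuples_def L_def\<close>)
      have "\<exists>Qs. length Qs = M \<and> set Qs \<subseteq> tuples V q \<and> distinct (concat Qs) \<and> set (concat Qs) \<inter> F = {} \<and>
        real (card {\<sigma> \<in> \<Sigma>. \<forall>Q\<in>set Qs. \<not> inserts E a' b \<sigma> Q}) \<le> (1 - \<gamma> / 2) ^ M * real (card \<Sigma>)" if "\<Sigma> \<noteq> {}"
        by (rule greedy_cover[OF fin V0 fS that finF \<gamma>(1,2) G _ sF]) (auto simp: inserts_def)
      moreover have "\<Sigma> \<noteq> {}"
      proof -
        have "card (set a' \<union> set b) \<le> 2 * l" using card_Un_le[of "set a'" "set b"] card_length[of a'] card_length[of b] a' b by linarith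
        then have "L \<le> card (V - (set a' \<union> set b))" using n diff_card_le_card_Diff[of "set a' \<union> set b" V] unfolding m0_def by simp
        then obtain T where T: "T \<subseteq> V - (set a' \<union> set b)" "card T = L" using obtain_subset_with_card_n by metis
        then have "finite T" using fin by (meson finite_Diff finite_subset)
        then obtain t where "set t = T" "distinct t" using finite_distinct_list by blast
        then have "t \<in> \<Sigma>" using T distinct_card[of t] a' b unfolding \<Sigma>_def tuples_def by auto
        then show ?thesis by blast
      qed
      ultimately obtain Qs where Qs: "length Qs = M" "set Qs \<subseteq> tuples V q" "distinct (concat Qs)" "set (concat Qs) \<inter> F = {}"
        "real (card {\<sigma> \<in> \<Sigma>. \<forall>Q\<in>set Qs. \<not> inserts E a' b \<sigma> Q}) \<le> (1 - \<gamma> / 2) ^ M * real (card \<Sigma>)" by blast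
      have "(1 - \<gamma> / 2) ^ M \<le> exp (- (\<gamma> / 2)) ^ M"
        using exp_ge_add_one_self[of "- (\<gamma> / 2)"] \<gamma>(2) by (intro power_mono) auto
      also have "\<dots> = exp (- (\<gamma> / 2 * real M))" by (simp add: exp_of_nat_mult[symmetric] mult.commute)
      also have "\<dots> \<le> exp (- ((real L + 1) * ln N))"
      proof -
        have "\<gamma> / 2 * (2 / \<gamma> * (real L + 1) * ln N) \<le> \<gamma> / 2 * real M" using M(1) \<gamma>(1) by (intro mult_left_mono) auto
        moreover have "\<gamma> / 2 * (2 / \<gamma> * (real L + 1) * ln N) = (real L + 1) * ln N" using \<gamma>(1) by simp
        ultimately show ?thesis by simp
      qed
      also have "\<dots> = inverse (N ^ (L + 1))"
      proof -
        have "(real L + 1) * ln N = ln (N ^ (L + 1))" using ln_realpow[of N "L + 1"] N2 by (simp add: algebra_simps)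
        then show ?thesis using N2 by (simp add: exp_minus)
      qed
      finally have le: "(1 - \<gamma> / 2) ^ M \<le> inverse (N ^ (L + 1))" .
      have "(1 - \<gamma> / 2) ^ M * real (card \<Sigma>) \<le> inverse (N ^ (L + 1)) * N ^ L"
        using le cS N2 by (intro mult_mono) auto
      also have "\<dots> = inverse N" using N2 by simp
      also have "\<dots> < 1" using N2 by (simp add: inverse_less_1_iff)
      finally have "real (card {\<sigma> \<in> \<Sigma>. \<forall>Q\<in>set Qs. \<not> inserts E a' b \<sigma> Q}) < 1" using Qs(5) by linarith
      then have "card {\<sigma> \<in> \<Sigma>. \<forall>Q\<in>set Qs. \<not> inserts E a' b \<sigma> Q} = 0" by linarith
      then have "{\<sigma> \<in> \<Sigma>. \<forall>Q\<in>set Qs. \<not> inserts E a' b \<sigma> Q} = {}" using fS by simp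
      then show ?thesis using Qs by blast
    qed
    then obtain Qs where Qs: "length Qs = M" "set Qs \<subseteq> tuples V q" "distinct (concat Qs)" "set (concat Qs) \<inter> F = {}"
      and cover: "\<And>\<sigma>. \<sigma> \<in> \<Sigma> \<Longrightarrow> \<exists>Q\<in>set Qs. inserts E a' b \<sigma> Q" by blast
    have Qs0: "Qs \<noteq> []" using Qs(1) M0 by auto
    have cQs: "card (set (concat Qs)) = M * q"
    proof -
      have "length (concat Xs) = length Xs * q" if "set Xs \<subseteq> tuples V q" for Xs :: "'a list list"
        using that by (induction Xs) (auto simp: tuples_def)
      then show ?thesis using Qs distinct_card[OF Qs(3)] by simp
    qed
    have QV: "set (concat Qs) \<subseteq> V" using Qs(2) unfolding tuples_def by auto
    define F' where "F' = set a' \<union> set b"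
    have cF': "card F' \<le> 2 * l" unfolding F'_def using card_Un_le[of "set a'" "set b"] card_length[of a'] card_length[of b] a' b by linarith
    have sF': "real (card F' + (length Qs + 1) * K) \<le> \<delta> * real (card V)"
      using cF' unfolding Qs(1) by (intro smaller \<kappa>) (simp add: algebra_simps)
    have dis: "F' \<inter> (set a \<union> set (concat Qs)) = {}" "set a \<inter> set (concat Qs) = {}" "finite F'"
      using Qs(4) a' ab unfolding F_def F'_def by blast+
    have n2': "n2 \<le> card V" using n unfolding m0_def by simp
    have "\<exists>B g. B \<subseteq> V \<and> B \<inter> (F' \<union> set (concat Qs)) = {} \<and> card B \<le> length Qs * K \<and> set g \<subseteq> B \<and>
        (\<forall>i<length Qs. spans E a (B \<union> set (concat (del_nth i Qs))) g)"
      by (intro A2[rule_format] conjI; fact)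
    then obtain B g where B: "B \<subseteq> V" "B \<inter> (F' \<union> set (concat Qs)) = {}" "card B \<le> M * K" "set g \<subseteq> B"
      and Bg: "\<And>i. i < M \<Longrightarrow> spans E a (B \<union> set (concat (del_nth i Qs))) g"
      unfolding Qs(1) by blast
    have finB: "finite B" using B(1) fin finite_subset by blast
    have g: "length g = l" "distinct g" using spans_ends[OF Bg[OF M0]] by auto
    \<comment> \<open>Everything occupied except the two ends of the connection about to be
      found.\<close>
    define W where "W = (B \<union> F' \<union> set (concat Qs)) - set (g @ a')"
    have finW: "finite W" unfolding W_def F'_def using finB by simp
    have ga': "distinct (g @ a')" "set (g @ a') \<subseteq> V" using g a' B unfolding F'_def by auto
    have amp: "ample V qc \<gamma>c (\<lambda>y. walk E (g @ y @ a') \<and> distinct (g @ y @ a'))"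
      using n unfolding m0_def by (intro A3[OF V _ g(1) a'(1) ga']) simp
    have cU: "card (B \<union> F' \<union> set (concat Qs)) \<le> 2 * l + M * K + M * q"
      using card_Un_le[of "B \<union> F'" "set (concat Qs)"] card_Un_le[of B F'] cF' B(3) cQs by linarith
    have "card W \<le> card (B \<union> F' \<union> set (concat Qs))" unfolding W_def using finB by (intro card_mono) (auto simp: F'_def)
    then have "real (card W) \<le> \<gamma>c / (2 * (real qc + 1)) * real (card V)"
      using cU by (intro smaller \<kappa>) (simp add: algebra_simps)
    then obtain y where y: "y \<in> tuples V qc" "walk E (g @ y @ a')" "distinct (g @ y @ a')" "set y \<inter> W = {}"
      using ample_ex_avoid[OF amp \<gamma>c fin V0 finW] by blast
    have yV: "set y \<subseteq> V" "card (set y) \<le> qc" using y(1) card_length[of y] unfolding tuples_def by auto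
    have yW: "set y \<inter> (B \<union> F' \<union> set (concat Qs)) = {}" using y(3,4) unfolding W_def by auto
    have sy: "spans E g (set g \<union> set y \<union> set a') a'" using y g a' by (intro spansI) auto
    define U where "U = B \<union> F' \<union> set (concat Qs) \<union> set y"
    have UV: "U \<subseteq> V" unfolding U_def F'_def using B QV yV a' b by auto
    have finU: "finite U" using UV fin finite_subset by blast
    have cU4: "real (card U) \<le> \<epsilon> / 4 * real (card V)"
      using cU card_Un_le[of "B \<union> F' \<union> set (concat Qs)" "set y"] yV(2) unfolding U_def
      by (intro smaller \<kappa>) (simp add: algebra_simps)
    have nn: "0 \<le> threshold + \<epsilon> - 2 * (\<epsilon> / 4)" using threshold_nonneg \<epsilon> by simp
    have half: "threshold + \<epsilon> - 2 * (\<epsilon> / 4) = threshold + \<epsilon> / 2" by simp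
    have dU: "dense E (V - U) (threshold + \<epsilon> / 2)" using dense_remove[OF V UV cU4 nn] unfolding half .
    have cVU: "card V = card (V - U) + card U" using card_Diff_subset[OF finU UV] card_mono[OF fin UV] by linarith
    have big: "m0 \<le> 2 * card (V - U)"
    proof -
      have "\<epsilon> / 4 * real (card V) \<le> 1 / 4 * real (card V)" using \<epsilon> by (intro mult_right_mono) auto
      then have "real (card U) \<le> real (card V) / 4" using cU4 by linarith
      then show ?thesis using cVU n by linarith
    qed
    \<comment> \<open>Counted modulo \<open>r\<close>: the chain, the connection and the tuples
      contribute known residues, and the choice of \<open>x\<close> and the length \<open>q\<close>
      make these cancel against \<open>card V = l + r * m\<close>.\<close>
    have "r dvd card (V - U)"
    proof -
      obtain m1 where m1: "card (B \<union> set (concat (del_nth 0 Qs))) = l + r * m1" using spans_card[OF Bg[OF M0]] by blast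
      have i0: "0 < length Qs" using M0 Qs(1) by simp
      have Q0: "card (set (Qs ! 0)) = q"
      proof -
        have "Qs ! 0 \<in> set Qs" using i0 by simp
        moreover from this have "distinct (Qs ! 0)" using Qs(3) by (simp add: distinct_concat_iff)
        ultimately show ?thesis using Qs(2) distinct_card[of "Qs ! 0"] unfolding tuples_def by auto
      qed
      have "card (B \<union> set (concat Qs)) = card ((B \<union> set (concat (del_nth 0 Qs))) \<union> set (Qs ! 0))"
        using distinct_concat_del_nth(2)[OF Qs(3) i0] by (metis Un_assoc)
      also have "\<dots> = l + r * m1 + q"
      proof -
        have "Qs ! 0 \<in> set Qs" using i0 by simp
        then have "set (Qs ! 0) \<subseteq> set (concat Qs)" by auto
        then have "(B \<union> set (concat (del_nth 0 Qs))) \<inter> set (Qs ! 0) = {}"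
          using distinct_concat_del_nth(1)[OF Qs(3) i0] B(2) by blast
        then show ?thesis using m1 Q0 finB by (simp add: card_Un_disjoint)
      qed
      finally have c1: "card (B \<union> set (concat Qs)) = l + r * m1 + q" .
      obtain m2 where m2: "card (set g \<union> set y \<union> set a') = l + r * m2" using spans_card[OF sy] by blast
      have "set g \<union> set y \<union> set a' = set (g @ y @ a')" by auto
      then have "card (set g \<union> set y \<union> set a') = l + card (set y) + l" using y(3) g(1) a'(1) distinct_card[OF y(3)] distinct_card[of y] by simp
      then have c2: "card (set y) + l = r * m2" using m2 by simp
      have c3: "card F' = 2 * l" unfolding F'_def using a' b by (simp add: card_Un_disjoint distinct_card)
      have "U = (B \<union> set (concat Qs)) \<union> F' \<union> set y" unfolding U_def by auto
      moreover have "(B \<union> set (concat Qs)) \<inter> F' = {}" using B(2) Qs(4) unfolding F'_def F_def by auto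
      moreover have "((B \<union> set (concat Qs)) \<union> F') \<inter> set y = {}" using yW by auto
      ultimately have "card U = (l + r * m1 + q) + 2 * l + card (set y)"
        using c1 c3 finB by (simp add: card_Un_disjoint F'_def)
      then have "card U + x + l = r * m1 + r * m2 + (q + x + 2 * l) + l" using c2 by linarith
      have e: "card (V - U) + (r * m1 + r * m2 + (q + x + 2 * l)) = r * l + r * m"
        using \<open>card U + x + l = _\<close> cVU m(2) xl by linarith
      obtain z where z: "q + x + 2 * l = r * z" using dv by (elim dvdE)
      have "card (V - U) + r * (m1 + m2 + z) = r * (l + m)" using e unfolding z by (simp add: distrib_left)
      then show ?thesis by (metis dvd_add_left_iff dvd_triv_left)
    qed
    moreover have "n4 \<le> card (V - U)" using big unfolding m0_def by simp
    ultimately obtain vs where vs: "spanning_cycle E (V - U) vs" using A4 dU by blast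
    have vs': "distinct vs" "set vs = V - U" "walk E (vs @ take l vs)" using vs unfolding spanning_cycle_def by auto
    have lvs: "length vs = card (V - U)" by (rule spanning_cycle_length[OF vs])
    obtain n' where n': "length vs = r * n'" using \<open>r dvd card (V - U)\<close> lvs by auto
    have L2: "2 * L \<le> length vs" using big lvs unfolding m0_def by simp
    \<comment> \<open>The long path cut out of the spanning cycle; the \<open>x\<close> vertices
      after it are the leftovers \<open>Z\<close>.\<close>
    define P where "P = take (length vs - x) vs"
    define Z where "Z = drop (length vs - x) vs"
    have PZ: "P @ Z = vs" unfolding P_def Z_def by simp
    have lP: "length P = length vs - x" "2 * l \<le> length P" "length Z = x" unfolding P_def Z_def using L2 unfolding L_def by auto
    have wP: "walk E P"
    proof -
      have "x + l \<le> 2 * (2 * l + x)" by simp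
      then have "x + l \<le> length vs" using L2 unfolding L_def by (rule order_trans)
      then have "r * l \<le> r * n'" unfolding xl n' .
      then have "length vs - x = l + r * (n' - l)" using n' xl by (simp add: diff_mult_distrib2)
      moreover have "P = take (length vs - x) (vs @ take l vs)" unfolding P_def by simp
      moreover have "length vs - x \<le> length (vs @ take l vs)" by simp
      ultimately show ?thesis using walk_take[OF vs'(3)] by metis
    qed
    define \<alpha> where "\<alpha> = take l P"
    define \<beta> where "\<beta> = drop (length P - l) P"
    have l\<alpha>\<beta>: "length \<alpha> = l" "length \<beta> = l" unfolding \<alpha>_def \<beta>_def using lP by auto
    have dP: "distinct P" "distinct Z" "set P \<inter> set Z = {}" "set P \<union> set Z = V - U"
      using vs' PZ[symmetric] by auto
    have \<alpha>P: "set \<alpha> \<subseteq> set P" "set \<beta> \<subseteq> set P" unfolding \<alpha>_def \<beta>_def by (auto dest: in_set_takeD in_set_dropD)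
    have \<alpha>\<beta>: "set \<alpha> \<inter> set \<beta> = {}" unfolding \<alpha>_def \<beta>_def using dP(1) lP by (intro set_take_disj_set_drop_if_distinct) auto
    have d\<alpha>\<beta>: "distinct \<alpha>" "distinct \<beta>" unfolding \<alpha>_def \<beta>_def using dP(1) by auto
    have sP: "spans E \<alpha> (set P) \<beta>" unfolding spans_def joins_def \<alpha>_def \<beta>_def using wP dP(1) by blast
    \<comment> \<open>One of the tuples covered in advance, so some \<open>Q\<close> in
      \<open>Qs\<close> inserts \<open>P\<close> together with the leftovers.\<close>
    define \<sigma> where "\<sigma> = \<alpha> @ \<beta> @ Z"
    have \<sigma>VU: "set \<sigma> \<subseteq> V - U" unfolding \<sigma>_def using \<alpha>P dP by auto
    have "distinct \<sigma>" unfolding \<sigma>_def using d\<alpha>\<beta> \<alpha>\<beta> \<alpha>P dP by auto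
    moreover have "set a' \<union> set b \<subseteq> U" unfolding U_def F'_def by auto
    ultimately have "\<sigma> \<in> \<Sigma>" unfolding \<Sigma>_def tuples_def using \<sigma>VU l\<alpha>\<beta> lP a' b unfolding L_def by (auto simp: \<sigma>_def)
    then obtain Q where Q: "Q \<in> set Qs" "inserts E a' b \<sigma> Q" using cover by blast
    have t\<sigma>: "take l \<sigma> = \<alpha>" "take l (drop l \<sigma>) = \<beta>" unfolding \<sigma>_def using l\<alpha>\<beta> by auto
    obtain C D where CD: "spans E a' C \<alpha>" "spans E \<beta> D b" "C \<inter> D = {}" "C \<union> D = set (a' @ b @ \<sigma>) \<union> set Q"
      using Q(2) unfolding inserts_def t\<sigma> by blast
    obtain i where i: "i < M" "Qs ! i = Q" using Q(1) Qs(1) by (metis in_set_conv_nth)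
    have iQ: "i < length Qs" using i Qs(1) by simp
    define X where "X = B \<union> set (concat (del_nth i Qs))"
    have dq: "set (concat (del_nth i Qs)) \<inter> set Q = {}" "set (concat (del_nth i Qs)) \<union> set Q = set (concat Qs)"
      using distinct_concat_del_nth[OF Qs(3) iQ] i by auto
    have XF: "X \<inter> F' = {}" unfolding X_def F'_def using B(2) Qs(4) dq(2) unfolding F_def F'_def by blast
    have Xy: "X \<inter> set y = {}" unfolding X_def using yW dq(2) by blast
    have XQ: "X \<inter> set Q = {}" unfolding X_def using B(2) dq by blast
    have gX: "set g \<subseteq> X" unfolding X_def using B(4) by blast
    have Qy: "set Q \<inter> set y = {}" "set Q \<inter> F' = {}" using yW dq(2) Qs(4) unfolding F_def F'_def by blast+
    have Fy: "F' \<inter> set y = {}" using yW by blast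
    have U_eq: "U = X \<union> F' \<union> set Q \<union> set y" unfolding U_def X_def using dq(2) by blast
    \<comment> \<open>The chain without \<open>Q\<close>, prolonged to \<open>a'\<close>; it
      exhausts the reserved set apart from \<open>b\<close> and \<open>Q\<close>.\<close>
    define X2 where "X2 = X \<union> (set g \<union> set y \<union> set a')"
    have "spans E a X2 a'"
      unfolding X2_def by (rule spans_trans[OF Bg[OF i(1), folded X_def] sy]) (use XF Xy in \<open>auto simp: F'_def\<close>)
    moreover have X2U: "X2 \<subseteq> U" unfolding X2_def U_eq F'_def using gX by blast
    moreover have aD: "set a' \<subseteq> C" "set \<alpha> \<subseteq> C" "set \<beta> \<subseteq> D" "set b \<subseteq> D" using spans_ends[OF CD(1)] spans_ends[OF CD(2)] by auto
    moreover have X2CD: "X2 \<inter> (C \<union> D) \<subseteq> set a'"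
    proof -
      have "X2 \<inter> set b = {}" unfolding X2_def using XF gX Fy a'(5) unfolding F'_def by blast
      moreover have "X2 \<inter> set \<sigma> = {}" using X2U \<sigma>VU by blast
      moreover have "X2 \<inter> set Q = {}" unfolding X2_def using XQ gX Qy unfolding F'_def by blast
      ultimately show ?thesis unfolding CD(4) by auto
    qed
    ultimately have s3: "spans E a (X2 \<union> C) \<alpha>" using spans_trans[OF _ CD(1)] by blast
    have "(X2 \<union> C) \<inter> set P \<subseteq> set \<alpha>"
    proof -
      have "X2 \<inter> set P = {}" using X2U dP(4) by blast
      moreover have "C \<inter> set P \<subseteq> set \<alpha> \<union> set \<beta>"
      proof
        fix v assume v: "v \<in> C \<inter> set P"
        then have "v \<in> set a' \<union> set b \<union> set \<sigma> \<union> set Q" using CD(4) by auto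
        moreover have "v \<notin> U" using v dP(4) by blast
        moreover have "v \<notin> set Z" using v dP(3) by blast
        ultimately show "v \<in> set \<alpha> \<union> set \<beta>" unfolding U_eq F'_def \<sigma>_def by auto
      qed
      moreover have "C \<inter> set \<beta> = {}" using aD(3) CD(3) by blast
      ultimately show ?thesis by blast
    qed
    then have s4: "spans E a ((X2 \<union> C) \<union> set P) \<beta>" by (rule spans_trans[OF s3 sP])
    have "((X2 \<union> C) \<union> set P) \<inter> D \<subseteq> set \<beta>"
    proof -
      have "X2 \<inter> D = {}" using X2CD aD(1) CD(3) by blast
      moreover have "set P \<inter> D \<subseteq> set \<alpha> \<union> set \<beta>"
      proof
        fix v assume v: "v \<in> set P \<inter> D"
        then have "v \<in> set a' \<union> set b \<union> set \<sigma> \<union> set Q" using CD(4) by auto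
        moreover have "v \<notin> U" using v dP(4) by blast
        moreover have "v \<notin> set Z" using v dP(3) by blast
        ultimately show "v \<in> set \<alpha> \<union> set \<beta>" unfolding U_eq F'_def \<sigma>_def by auto
      qed
      moreover have "D \<inter> set \<alpha> = {}" using aD(2) CD(3) by blast
      ultimately show ?thesis using CD(3) by blast
    qed
    then have s5: "spans E a (((X2 \<union> C) \<union> set P) \<union> D) b" by (rule spans_trans[OF s4 CD(2)])
    have "((X2 \<union> C) \<union> set P) \<union> D = X2 \<union> set P \<union> (set (a' @ b @ \<sigma>) \<union> set Q)" using CD(4) by blast
    also have "\<dots> = U \<union> (set P \<union> set Z)"
    proof -
      have "set \<sigma> \<union> set P = set P \<union> set Z" unfolding \<sigma>_def using \<alpha>P by auto
      moreover have "X2 \<union> (set a' \<union> set b) \<union> set Q = U" unfolding X2_def U_eq F'_def using gX by blast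
      ultimately show ?thesis by auto
    qed
    also have "\<dots> = V" using dP(4) UV by blast
    finally show ?thesis using s5 by simp
  qed
  note main = this
  show ?thesis
    by (intro exI[of _ m0] allI impI, elim conjE) (rule main; assumption)
qed


subsection \<open>Balanced splits of the vertex set\<close>

lemma halving_tail_sets:
  assumes V: "dense E V \<beta>" and X: "X \<subseteq> V" and vs: "distinct vs" "set vs = V - X" "vs \<noteq> []"
    and T: "T \<subseteq> V" "card T = l + r - 2" and t: "t \<ge> 0"
  shows "real (card {A. A \<subseteq> {..<length vs} \<and> real (card (link E ((!) vs ` A) T))
      \<le> (\<beta> * (real (card V))\<^sup>2 - 2 * real (card X) * real (card V)) / 4 - t})
    \<le> 2 ^ length vs * exp (- t\<^sup>2 / (16 * real (length vs) ^ 3))"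
proof -
  define q where "q = length vs"
  define \<mu> where "\<mu> = (\<beta> * (real (card V))\<^sup>2 - 2 * real (card X) * real (card V)) / 4 - t"
  define \<phi> where "\<phi> A = map (\<lambda>i. i \<in> A) [0..<q]" for A :: "nat set"
  have \<phi>n: "i < q \<Longrightarrow> \<phi> A ! i \<longleftrightarrow> i \<in> A" for i A unfolding \<phi>_def by simp
  have inj: "inj_on \<phi> (Pow {..<q})"
  proof (rule inj_onI)
    fix A B assume AB: "A \<in> Pow {..<q}" "B \<in> Pow {..<q}" and e: "\<phi> A = \<phi> B"
    have "i \<in> A \<longleftrightarrow> i \<in> B" if "i < q" for i using \<phi>n[OF that, of A] \<phi>n[OF that, of B] e by simp
    then show "A = B" using AB by (auto simp: subset_iff)
  qed
  have img: "{vs ! i |i. i < length vs \<and> \<phi> A ! i} = (!) vs ` A" if "A \<subseteq> {..<q}" for A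
    using that \<phi>n unfolding q_def by (auto simp: subset_iff image_iff)
  let ?L = "{A. A \<subseteq> {..<q} \<and> real (card (link E ((!) vs ` A) T)) \<le> \<mu>}"
  let ?R = "{bs \<in> tuples UNIV (length vs). real (card (link E {vs ! i |i. i < length vs \<and> bs ! i} T)) \<le> \<mu>}"
  have "\<phi> ` ?L \<subseteq> ?R"
  proof
    fix bs assume "bs \<in> \<phi> ` ?L"
    then obtain A where A: "bs = \<phi> A" "A \<subseteq> {..<q}" "real (card (link E ((!) vs ` A) T)) \<le> \<mu>" by blast
    have "\<phi> A \<in> tuples UNIV (length vs)" unfolding \<phi>_def tuples_def q_def by simp
    then show "bs \<in> ?R" unfolding A(1) using A(3) by (simp only: img[OF A(2)] mem_Collect_eq simp_thms)
  qed
  moreover have "finite ?R" by simp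
  moreover have "inj_on \<phi> ?L" using inj by (rule inj_on_subset) auto
  ultimately have "card ?L \<le> card ?R" by (meson card_inj_on_le)
  then have "real (card ?L) \<le> real (card ?R)" by (simp only: of_nat_le_iff)
  also have "\<dots> \<le> 2 ^ length vs * exp (- t\<^sup>2 / (16 * real (length vs) ^ 3))"
    unfolding \<mu>_def by (rule halving_tail[OF V X vs T t])
  finally show ?thesis unfolding \<mu>_def q_def .
qed

text \<open>Union bound over all \<open>T\<close> and both sides. The failure bound counts subsets
  of every size, relative to \<open>2 ^ length vs\<close>; for \<open>h\<close> near the middle,
  restricting to size \<open>h\<close> changes this by a polynomial factor only, which the
  exponential term outweighs.\<close>

lemma balanced_splits:
  assumes V: "dense E V \<beta>" "l + r \<le> card V" and X: "X \<subseteq> V" and vs: "distinct vs" "set vs = V - X" "vs \<noteq> []" and t: "t \<ge> 0"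
    and \<mu>: "\<mu> = (\<beta> * (real (card V))\<^sup>2 - 2 * real (card X) * real (card V)) / 4 - t"
  shows "real (length vs choose h) - 2 * real (card V) ^ (l + r - 2) * (2 ^ length vs * exp (- t\<^sup>2 / (16 * real (length vs) ^ 3)))
    \<le> real (card {A. A \<subseteq> {..<length vs} \<and> card A = h \<and> (\<forall>T. T \<subseteq> V \<and> card T = l + r - 2 \<longrightarrow>
      \<mu> < real (card (link E ((!) vs ` A) T)) \<and> \<mu> < real (card (link E ((!) vs ` ({..<length vs} - A)) T)))})"
proof -
  define q where "q = length vs"
  define b where "b = 2 ^ q * exp (- t\<^sup>2 / (16 * real q ^ 3))"
  have fin: "finite V" using V dense_finite by blast
  define TT where "TT = {T. T \<subseteq> V \<and> card T = l + r - 2}"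
  define Bad where "Bad T = {A. A \<subseteq> {..<q} \<and> real (card (link E ((!) vs ` A) T)) \<le> \<mu>}" for T
  define Bad' where "Bad' T = {A. A \<subseteq> {..<q} \<and> real (card (link E ((!) vs ` ({..<q} - A)) T)) \<le> \<mu>}" for T
  have b1: "real (card (Bad T)) \<le> b" if "T \<in> TT" for T
    unfolding Bad_def b_def q_def \<mu> by (rule halving_tail_sets[OF V(1) X vs _ _ t]) (use that in \<open>auto simp: TT_def\<close>)
  have fB: "finite (Bad T)" "finite (Bad' T)" for T unfolding Bad_def Bad'_def by auto
  have b2: "real (card (Bad' T)) \<le> b" if "T \<in> TT" for T
  proof -
    have "(\<lambda>A. {..<q} - A) ` Bad' T \<subseteq> Bad T" unfolding Bad_def Bad'_def by auto
    moreover have "inj_on (\<lambda>A. {..<q} - A) (Bad' T)" unfolding Bad'_def by (rule inj_onI) blast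
    ultimately have "card (Bad' T) \<le> card (Bad T)" using fB by (meson card_inj_on_le)
    then have "real (card (Bad' T)) \<le> real (card (Bad T))" by (simp only: of_nat_le_iff)
    then show ?thesis using b1[OF that] by linarith
  qed
  have fTT: "finite TT" unfolding TT_def using fin by simp
  have "card TT = card V choose (l + r - 2)" unfolding TT_def by (rule n_subsets[OF fin])
  also have "\<dots> \<le> card V ^ (l + r - 2)" using V(2) by (intro binomial_le_pow) simp
  finally have cTT: "real (card TT) \<le> real (card V) ^ (l + r - 2)" by (metis of_nat_le_iff of_nat_power)
  have b0: "0 \<le> b" unfolding b_def by simp
  define Bd where "Bd = (\<Union>T\<in>TT. Bad T \<union> Bad' T)"
  have "card Bd \<le> (\<Sum>T\<in>TT. card (Bad T \<union> Bad' T))" unfolding Bd_def by (rule card_UN_le[OF fTT])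
  also have "\<dots> \<le> (\<Sum>T\<in>TT. card (Bad T) + card (Bad' T))" by (intro sum_mono card_Un_le)
  finally have "real (card Bd) \<le> real (\<Sum>T\<in>TT. card (Bad T) + card (Bad' T))" by (simp only: of_nat_le_iff)
  also have "\<dots> = (\<Sum>T\<in>TT. real (card (Bad T)) + real (card (Bad' T)))" by simp
  also have "\<dots> \<le> (\<Sum>T\<in>TT. b + b)" using b1 b2 by (intro sum_mono add_mono)
  also have "\<dots> = real (card TT) * (2 * b)" by simp
  also have "\<dots> \<le> real (card V) ^ (l + r - 2) * (2 * b)" using cTT b0 by (intro mult_right_mono) auto
  finally have cB: "real (card Bd) \<le> 2 * real (card V) ^ (l + r - 2) * b" by simp
  define AA where "AA = {A. A \<subseteq> {..<q} \<and> card A = h}"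
  have fAA: "finite AA" unfolding AA_def by simp
  have cAA: "card AA = q choose h" unfolding AA_def using n_subsets[of "{..<q}" h] by simp
  have fBd: "finite Bd" unfolding Bd_def using fTT fB by simp
  define Gd where "Gd = {A. A \<subseteq> {..<q} \<and> card A = h \<and> (\<forall>T. T \<subseteq> V \<and> card T = l + r - 2 \<longrightarrow>
      \<mu> < real (card (link E ((!) vs ` A) T)) \<and> \<mu> < real (card (link E ((!) vs ` ({..<q} - A)) T)))}"
  have "AA \<subseteq> Gd \<union> Bd" unfolding AA_def Gd_def Bd_def Bad_def Bad'_def TT_def by force
  moreover have fG: "finite Gd" unfolding Gd_def by (rule finite_subset[of _ "Pow {..<q}"]) auto
  ultimately have "card AA \<le> card (Gd \<union> Bd)" using fBd by (intro card_mono) auto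
  also have "\<dots> \<le> card Gd + card Bd" by (rule card_Un_le)
  finally have "real (q choose h) \<le> real (card Gd) + real (card Bd)" unfolding cAA by linarith
  then show ?thesis using cB unfolding Gd_def b_def q_def by linarith
qed

subsection \<open>Counting Hamilton paths\<close>

definition ham_paths :: "'b set set \<Rightarrow> 'b set \<Rightarrow> 'b list \<Rightarrow> 'b list \<Rightarrow> 'b list set" where
  "ham_paths E V a b = {xs. joins E a xs b \<and> distinct xs \<and> set xs = V}"

lemma ham_paths_subset: "ham_paths E V a b \<subseteq> tuples V (card V)"
  unfolding ham_paths_def tuples_def using distinct_card by fastforce

lemma finite_ham_paths: "finite V \<Longrightarrow> finite (ham_paths E V a b)"
  using ham_paths_subset by (rule finite_subset) simp

lemma spans_iff_ham_paths: "spans E a V b \<longleftrightarrow> ham_paths E V a b \<noteq> {}"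
  unfolding spans_def ham_paths_def by auto

text \<open>The middle tuple \<open>c\<close> is the same for all splits, so gluing is injective:
  the first \<open>2 * l + h\<close> entries are the path on the first side, and its vertex set
  determines the split \<open>A\<close>.\<close>

lemma card_ham_paths_split:
  fixes g1 g2 :: real
  assumes fin: "finite V" and a: "length a = l" and b: "length b = l" and c: "length c = l"
    and abc: "distinct (a @ b @ c)" "set (a @ b @ c) \<subseteq> V"
    and vs: "distinct vs" "set vs = V - set (a @ b @ c)"
    and G: "G \<subseteq> {A. A \<subseteq> {..<length vs} \<and> card A = h}" and g: "0 \<le> g1" "0 \<le> g2"
    and g1: "\<And>A. A \<in> G \<Longrightarrow> g1 \<le> real (card (ham_paths E (set a \<union> set c \<union> (!) vs ` A) a c))"
    and g2: "\<And>A. A \<in> G \<Longrightarrow> g2 \<le> real (card (ham_paths E (set c \<union> set b \<union> (!) vs ` ({..<length vs} - A)) c b))"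
  shows "real (card G) * (g1 * g2) \<le> real (card (ham_paths E V a b))"
proof -
  let ?P = "\<lambda>A. ham_paths E (set a \<union> set c \<union> (!) vs ` A) a c"
  let ?Q = "\<lambda>A. ham_paths E (set c \<union> set b \<union> (!) vs ` ({..<length vs} - A)) c b"
  define S where "S = (SIGMA A:G. ?P A \<times> ?Q A)"
  define \<Phi> where "\<Phi> p = fst (snd p) @ drop l (snd (snd p))" for p :: "nat set \<times> 'a list \<times> 'a list"
  have fG: "finite G" using G by (rule finite_subset) simp
  have vV: "(!) vs ` A \<subseteq> V - set (a @ b @ c)" if "A \<subseteq> {..<length vs}" for A using that vs(2) nth_mem by blast
  have injv: "inj_on ((!) vs) {..<length vs}" using vs(1) by (intro inj_on_nth) auto
  have dj: "(!) vs ` A \<inter> (!) vs ` ({..<length vs} - A) = {}" if "A \<subseteq> {..<length vs}" for A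
    using inj_on_image_Int[OF injv that, of "{..<length vs} - A"] by auto
  have un: "(!) vs ` A \<union> (!) vs ` ({..<length vs} - A) = V - set (a @ b @ c)" if "A \<subseteq> {..<length vs}" for A
  proof -
    have "(!) vs ` A \<union> (!) vs ` ({..<length vs} - A) = (!) vs ` {..<length vs}" using that by blast
    also have "\<dots> = set vs" using nth_image[of "length vs" vs] by (simp add: lessThan_atLeast0)
    finally show ?thesis using vs(2) by simp
  qed
  have GA: "A \<subseteq> {..<length vs}" "card A = h" if "A \<in> G" for A using that G by auto
  have P: "length xs = 2 * l + h \<and> joins E a xs c \<and> distinct xs \<and> set xs = set a \<union> set c \<union> (!) vs ` A"
    if "A \<in> G" "xs \<in> ?P A" for A xs
  proof -
    have xs: "joins E a xs c" "distinct xs" "set xs = set a \<union> set c \<union> (!) vs ` A" using that(2) unfolding ham_paths_def by auto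
    have "card ((!) vs ` A) = h" using GA[OF that(1)] injv by (metis card_image inj_on_subset)
    moreover have "finite ((!) vs ` A)" using GA[OF that(1)] finite_subset by blast
    moreover have "(set a \<union> set c) \<inter> (!) vs ` A = {}" using vV[OF GA(1)[OF that(1)]] by auto
    ultimately have "card (set xs) = card (set a \<union> set c) + h" unfolding xs(3) by (simp add: card_Un_disjoint)
    moreover have "card (set a \<union> set c) = 2 * l"
    proof -
      have "distinct (a @ c)" using abc(1) by auto
      from distinct_card[OF this] show ?thesis using a c by simp
    qed
    ultimately show ?thesis using xs distinct_card[OF xs(2)] by simp
  qed
  have Q: "joins E c ys b \<and> distinct ys \<and> set ys = set c \<union> set b \<union> (!) vs ` ({..<length vs} - A) \<and> ys = c @ drop l ys"
    if "ys \<in> ?Q A" for A ys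
  proof -
    have ys: "joins E c ys b" "distinct ys" "set ys = set c \<union> set b \<union> (!) vs ` ({..<length vs} - A)" using that unfolding ham_paths_def by auto
    have "take l ys = c" using ys(1) unfolding joins_def by simp
    then have "ys = c @ drop l ys" by (metis append_take_drop_id)
    then show ?thesis using ys by simp
  qed
  have inj: "inj_on \<Phi> S"
  proof (rule inj_onI)
    fix p p' assume pp: "p \<in> S" "p' \<in> S" and e: "\<Phi> p = \<Phi> p'"
    obtain A xs ys where p: "p = (A, xs, ys)" by (cases p) auto
    obtain A' xs' ys' where p': "p' = (A', xs', ys')" by (cases p') auto
    have m: "A \<in> G" "xs \<in> ?P A" "ys \<in> ?Q A" "A' \<in> G" "xs' \<in> ?P A'" "ys' \<in> ?Q A'"
      using pp unfolding S_def p p' by auto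
    have x: "length xs = 2 * l + h" "set xs = set a \<union> set c \<union> (!) vs ` A" "length xs' = 2 * l + h" "set xs' = set a \<union> set c \<union> (!) vs ` A'"
      using P[OF m(1,2)] P[OF m(4,5)] by auto
    have e': "xs = xs'" "drop l ys = drop l ys'" using e x unfolding \<Phi>_def p p' by auto
    have "ys = c @ drop l ys" "ys' = c @ drop l ys'" using Q[OF m(3)] Q[OF m(6)] by auto
    then have "ys = ys'" using e'(2) by simp
    moreover have "(!) vs ` A = (!) vs ` A'"
    proof -
      have "(!) vs ` A = set xs - (set a \<union> set c)" "(!) vs ` A' = set xs' - (set a \<union> set c)"
        unfolding x(2,4) using vV[OF GA(1)[OF m(1)]] vV[OF GA(1)[OF m(4)]] unfolding set_append by blast+
      then show ?thesis using e'(1) by simp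
    qed
    then have "A = A'" using inj_on_image_eq_iff[OF injv GA(1)[OF m(1)] GA(1)[OF m(4)]] by simp
    ultimately show "p = p'" using e' unfolding p p' by simp
  qed
  have "\<Phi> ` S \<subseteq> ham_paths E V a b"
  proof
    fix zs assume "zs \<in> \<Phi> ` S"
    then obtain A xs ys where z: "zs = xs @ drop l ys" "A \<in> G" "xs \<in> ?P A" "ys \<in> ?Q A" unfolding S_def \<Phi>_def by auto
    have x: "joins E a xs c" "distinct xs" "set xs = set a \<union> set c \<union> (!) vs ` A" using P[OF z(2,3)] by auto
    have y: "joins E c ys b" "distinct ys" "set ys = set c \<union> set b \<union> (!) vs ` ({..<length vs} - A)" "ys = c @ drop l ys" using Q[OF z(4)] by auto
    have j: "joins E a zs b" unfolding z(1) by (rule joins_trans[OF x(1) y(1)])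
    have dy: "distinct (drop l ys)" using y(2) by simp
    have "distinct (c @ drop l ys)" using y(2,4) by simp
    then have cd: "set c \<inter> set (drop l ys) = {}" by simp
    have ry: "set c \<union> set (drop l ys) = set ys" using y(4) by (metis set_append)
    have A: "A \<subseteq> {..<length vs}" using GA z(2) by blast
    have "set xs \<inter> set ys \<subseteq> set c"
      unfolding x(3) y(3) using dj[OF A] vV[OF A] vV[of "{..<length vs} - A"] abc(1) by auto
    then have "set xs \<inter> set (drop l ys) = {}" using ry cd by blast
    then have d: "distinct zs" unfolding z(1) using x(2) dy by simp
    have "set c \<subseteq> set xs" using x(3) by blast
    then have "set zs = set xs \<union> set ys" unfolding z(1) using ry by auto
    also have "\<dots> = V" unfolding x(3) y(3) using un[OF A] abc(2) by auto
    finally show "zs \<in> ham_paths E V a b" using j d unfolding ham_paths_def by simp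
  qed
  then have "card S \<le> card (ham_paths E V a b)" using inj finite_ham_paths[OF fin] by (metis card_inj_on_le)
  then have le: "real (card S) \<le> real (card (ham_paths E V a b))" by (simp only: of_nat_le_iff)
  have "real (card G) * (g1 * g2) = (\<Sum>A\<in>G. g1 * g2)" by simp
  also have "\<dots> \<le> (\<Sum>A\<in>G. real (card (?P A)) * real (card (?Q A)))"
    using g1 g2 g by (intro sum_mono mult_mono) auto
  also have "\<dots> = real (\<Sum>A\<in>G. card (?P A \<times> ?Q A))" by (simp add: card_cartesian_product)
  also have "\<dots> = real (card S)"
  proof -
    have "finite (?P A \<times> ?Q A)" if "A \<in> G" for A
      using finite_subset[OF GA(1)[OF that]] by (intro finite_cartesian_product finite_ham_paths) auto
    then show ?thesis unfolding S_def using fG by (subst card_SigmaI) auto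
  qed
  finally show ?thesis using le by linarith
qed

text \<open>This is \<open>5 * t / n\<^sup>2\<close> with \<open>t = n powr (7/4)\<close>, that is
  \<open>5 * n powr (-1/4)\<close>. The deviation \<open>t\<close> in one half counts as
  \<open>4 * t\<close> after rescaling, and a fifth \<open>t\<close> absorbs the lower-order terms.
  Since \<open>t\<^sup>2 / n ^ 3 = sqrt n\<close>, the failure probability beats every
  polynomial.\<close>

definition loss :: "nat \<Rightarrow> real" where
  "loss n = 5 * sqrt (real n ^ 3 * sqrt (real n)) / (real n)\<^sup>2"

lemma eventually_poly_exp_le:
  fixes A c :: real assumes "0 < A" "0 < c"
  shows "eventually (\<lambda>n::nat. A * real n powr c * exp (- (sqrt (real n) / 16)) \<le> 1) at_top"
  using assms by real_asymp

text \<open>The factor bounds from below the number of balanced splits that keep both halves dense.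
  With \<open>q\<close> vertices outside the three end tuples, \<open>r * m = q + 2 * l\<close>,
  which explains the power of 2 in the denominator.\<close>

lemma halving_step:
  "\<exists>M. \<forall>E (V :: 'a set) a b m \<beta> g1 g2. M \<le> m \<and> dense E V \<beta> \<and> card V = l + r * m \<and> loss (card V) \<le> \<beta> \<and>
    length a = l \<and> length b = l \<and> distinct (a @ b) \<and> set (a @ b) \<subseteq> V \<and> 0 \<le> (g1 :: real) \<and> 0 \<le> (g2 :: real) \<and>
    (\<forall>W a b. dense E W (\<beta> - loss (card V)) \<and> card W = l + r * (m div 2) \<and> length a = l \<and> length b = l \<and> distinct (a @ b) \<and> set (a @ b) \<subseteq> W
      \<longrightarrow> g1 \<le> real (card (ham_paths E W a b))) \<and>
    (\<forall>W a b. dense E W (\<beta> - loss (card V)) \<and> card W = l + r * (m - m div 2) \<and> length a = l \<and> length b = l \<and> distinct (a @ b) \<and> set (a @ b) \<subseteq> W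
      \<longrightarrow> g2 \<le> real (card (ham_paths E W a b)))
    \<longrightarrow> 2 ^ (r * m) / (2 ^ (2 * l + r + 1) * real (card V)) * (g1 * g2) \<le> real (card (ham_paths E V a b))"
proof -
  define k where "k = l + r"
  have k: "real k \<ge> 0" by simp
  have "eventually (\<lambda>n::nat. 2 * real k * real n + (real k)\<^sup>2 + 6 * real l * real n \<le> sqrt (real n ^ 3 * sqrt (real n))) at_top"
    by real_asymp
  then obtain n1 where n1: "\<And>n. n1 \<le> n \<Longrightarrow> 2 * real k * real n + (real k)\<^sup>2 + 6 * real l * real n \<le> sqrt (real n ^ 3 * sqrt (real n))"
    by (auto simp: eventually_at_top_linorder)
  have "eventually (\<lambda>n::nat. 2 * 2 ^ (r + 1) * real n powr (real (k - 1)) * exp (- (sqrt (real n) / 16)) \<le> 1) at_top"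
    using r_ge2 l_pos unfolding k_def by (intro eventually_poly_exp_le) auto
  then obtain n2 where n2: "\<And>n. n2 \<le> n \<Longrightarrow> 2 * 2 ^ (r + 1) * real n powr (real (k - 1)) * exp (- (sqrt (real n) / 16)) \<le> 1"
    by (auto simp: eventually_at_top_linorder)
  define M where "M = n1 + n2 + 8 * l + 8"
  have "2 ^ (r * m) / (2 ^ (2 * l + r + 1) * real (card V)) * (g1 * g2) \<le> real (card (ham_paths E V a b))"
    if m: "M \<le> m" and V: "dense E V \<beta>" "card V = l + r * m" "loss (card V) \<le> \<beta>" and a: "length a = l" and b: "length b = l"
      and ab: "distinct (a @ b)" "set (a @ b) \<subseteq> V" and g: "0 \<le> g1" "0 \<le> g2"
      and g1: "\<And>W a b. dense E W (\<beta> - loss (card V)) \<Longrightarrow> card W = l + r * (m div 2) \<Longrightarrow> length a = l \<Longrightarrow> length b = l \<Longrightarrow>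
        distinct (a @ b) \<Longrightarrow> set (a @ b) \<subseteq> W \<Longrightarrow> g1 \<le> real (card (ham_paths E W a b))"
      and g2: "\<And>W a b. dense E W (\<beta> - loss (card V)) \<Longrightarrow> card W = l + r * (m - m div 2) \<Longrightarrow> length a = l \<Longrightarrow> length b = l \<Longrightarrow>
        distinct (a @ b) \<Longrightarrow> set (a @ b) \<subseteq> W \<Longrightarrow> g2 \<le> real (card (ham_paths E W a b))"
    for E and V :: "'a set" and a b m \<beta> and g1 g2 :: real
  proof -
    define n where "n = card V"
    define t where "t = sqrt (real n ^ 3 * sqrt (real n))"
    have t0: "0 \<le> t" unfolding t_def by simp
    have fin: "finite V" using V dense_finite by blast
    have "2 * m \<le> r * m" using r_ge2 by (intro mult_le_mono1) simp
    then have nm: "2 * m \<le> n" unfolding n_def using V by linarith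
    then have n: "n1 \<le> n" "n2 \<le> n" "0 < n" "8 * l \<le> n" using m unfolding M_def by auto
    have kn: "k \<le> n" unfolding k_def n_def V(2) using m unfolding M_def by simp
    have \<beta>1: "\<beta> \<le> 1" using dense_le_one[OF V(1)] kn unfolding k_def n_def by simp
    define \<beta>' where "\<beta>' = \<beta> - loss n"
    have \<beta>': "0 \<le> \<beta>'" "\<beta>' \<le> 1" unfolding \<beta>'_def using V(3) \<beta>1 unfolding n_def loss_def by (auto intro: order_trans[of _ \<beta>])
    have loss: "loss n * (real n)\<^sup>2 = 5 * t" unfolding loss_def t_def using n by simp
    have "card (set (a @ b)) = 2 * l" using distinct_card[OF ab(1)] a b by simp
    then have "l \<le> card (V - set (a @ b))" using n(4) diff_card_le_card_Diff[of "set (a @ b)" V] unfolding n_def by simp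
    then obtain C where C: "C \<subseteq> V - set (a @ b)" "card C = l" using obtain_subset_with_card_n by metis
    then have "finite C" using fin by (meson finite_Diff finite_subset)
    then obtain c where c': "set c = C" "distinct c" using finite_distinct_list by blast
    then have c: "length c = l" using C distinct_card[of c] by simp
    have abc: "distinct (a @ b @ c)" "set (a @ b @ c) \<subseteq> V" using ab c' C by auto
    define X where "X = set (a @ b @ c)"
    have cX: "card X = 3 * l" unfolding X_def using distinct_card[OF abc(1)] a b c by simp
    have XV: "X \<subseteq> V" unfolding X_def by (rule abc(2))
    obtain vs where vs: "distinct vs" "set vs = V - X" using finite_distinct_list[of "V - X"] fin by auto
    define q where "q = length vs"
    have "q = card (V - X)" unfolding q_def using distinct_card[OF vs(1)] vs(2) by simp
    also have "\<dots> = n - 3 * l" unfolding n_def cX[symmetric] using XV fin by (intro card_Diff_subset) (auto intro: finite_subset)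
    finally have q: "q = n - 3 * l" .
    have n3: "n = q + 3 * l" using q n(4) by simp
    have qn: "q \<le> n" "0 < q" using q n(3,4) l_pos by auto
    \<comment> \<open>Each half holds two end tuples, so its size is
      \<open>2 * l + h = l + r * (m div 2)\<close>.\<close>
    define h where "h = r * (m div 2) - l"
    have "2 * (m div 2) \<le> r * (m div 2)" using r_ge2 by (intro mult_le_mono1) simp
    moreover have "2 * l + 1 \<le> 2 * (m div 2)" using m unfolding M_def by linarith
    ultimately have hl: "h + l = r * (m div 2)" "0 < h" unfolding h_def by linarith+
    have m2: "m = m div 2 + (m - m div 2)" by simp
    have "r * m = r * (m div 2) + r * (m - m div 2)" using m2 by (metis distrib_left)
    then have qh: "q = h + (r * (m - m div 2) - l)" "l \<le> r * (m - m div 2)"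
    proof -
      have "m div 2 \<le> m - m div 2" by simp
      then have "r * (m div 2) \<le> r * (m - m div 2)" by (rule mult_le_mono2)
      then show "l \<le> r * (m - m div 2)" using hl by linarith
      then show "q = h + (r * (m - m div 2) - l)" using q hl V(2) \<open>r * m = _\<close> unfolding n_def by linarith
    qed
    have rr: "r * (m - m div 2) \<le> r * (m div 2) + r"
    proof -
      have "m - m div 2 \<le> m div 2 + 1" by simp
      then have "r * (m - m div 2) \<le> r * (m div 2 + 1)" by (rule mult_le_mono2)
      then show ?thesis by simp
    qed
    have q2h: "q \<le> 2 * h + r" "2 * h \<le> q"
    proof -
      show "q \<le> 2 * h + r" using qh hl rr by linarith
      have "m div 2 \<le> m - m div 2" by simp
      then have "r * (m div 2) \<le> r * (m - m div 2)" by (rule mult_le_mono2)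
      then show "2 * h \<le> q" using qh hl by linarith
    qed
    have j2: "2 * (q - h) \<le> q + r" using q2h by simp
    define \<mu> where "\<mu> = (\<beta> * (real (card V))\<^sup>2 - 2 * real (card X) * real (card V)) / 4 - t"
    define G where "G = {A. A \<subseteq> {..<length vs} \<and> card A = h \<and> (\<forall>T. T \<subseteq> V \<and> card T = l + r - 2 \<longrightarrow>
      \<mu> < real (card (link E ((!) vs ` A) T)) \<and> \<mu> < real (card (link E ((!) vs ` ({..<length vs} - A)) T)))}"
    \<comment> \<open>A half has at most \<open>(n + k) / 2\<close> vertices; the excess over
      \<open>n / 2\<close> and the pairs touching \<open>X\<close> are together covered by one
      \<open>t\<close>.\<close>
    have key: "\<beta>' * (real w)\<^sup>2 \<le> \<mu>" if "2 * w \<le> n + k" for w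
    proof -
      have "(2 * real w)\<^sup>2 \<le> (real n + real k)\<^sup>2" using that by (intro power_mono) linarith+
      then have "\<beta>' * (4 * (real w)\<^sup>2) \<le> \<beta>' * (real n + real k)\<^sup>2" using \<beta>' by (intro mult_left_mono) (auto simp: power_mult_distrib)
      also have "\<dots> = \<beta>' * (real n)\<^sup>2 + \<beta>' * (2 * real k * real n + (real k)\<^sup>2)" by (simp add: power2_eq_square algebra_simps)
      also have "\<dots> \<le> \<beta>' * (real n)\<^sup>2 + 1 * (2 * real k * real n + (real k)\<^sup>2)" using \<beta>' by (intro add_left_mono mult_right_mono) auto
      also have "\<beta>' * (real n)\<^sup>2 = \<beta> * (real n)\<^sup>2 - 5 * t" unfolding \<beta>'_def left_diff_distrib loss ..
      finally have "\<beta>' * (4 * (real w)\<^sup>2) \<le> \<beta> * (real n)\<^sup>2 - 5 * t + (2 * real k * real n + (real k)\<^sup>2)" by simp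
      also have "\<dots> \<le> \<beta> * (real n)\<^sup>2 - 4 * t - 6 * real l * real n" using n1[OF n(1)] unfolding t_def[symmetric] by linarith
      also have "\<dots> = 4 * \<mu>" unfolding \<mu>_def cX n_def by simp
      finally show ?thesis by linarith
    qed
    have sub_dense: "dense E W \<beta>'" if W: "W \<subseteq> V" "S \<subseteq> W" "2 * card W \<le> n + k"
      and S: "\<And>T. T \<subseteq> V \<Longrightarrow> card T = l + r - 2 \<Longrightarrow> \<mu> < real (card (link E S T))" for W S
      unfolding dense_def
    proof (intro conjI ballI allI impI)
      show fW: "finite W" using W(1) fin finite_subset by blast
      show "card e = l + r" if "e \<in> E" for e using that dense_card[OF V(1)] by blast
      fix T assume T: "T \<subseteq> W" "card T = l + r - 2"
      have "link E S T \<subseteq> link E W T" unfolding link_def using W(2) by auto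
      then have "card (link E S T) \<le> card (link E W T)" using finite_link[OF fW] by (intro card_mono)
      then have "real (card (link E S T)) \<le> real (card (link E W T))" by (simp only: of_nat_le_iff)
      moreover have "\<mu> < real (card (link E S T))" using T W(1) by (intro S) auto
      ultimately show "\<beta>' * (real (card W))\<^sup>2 \<le> real (card (link E W T))" using key[OF W(3)] by linarith
    qed
    have injv: "inj_on ((!) vs) {..<length vs}" using vs(1) by (intro inj_on_nth) auto
    have cW: "(!) vs ` A \<subseteq> V - X" "card (set d \<union> set e \<union> (!) vs ` A) = 2 * l + card A" "set d \<union> set e \<union> (!) vs ` A \<subseteq> V"
      if "A \<subseteq> {..<length vs}" "set d \<union> set e \<subseteq> X" "length d = l" "length e = l" "distinct (d @ e)" for A d e
    proof -
      show A: "(!) vs ` A \<subseteq> V - X" using that(1) vs(2) nth_mem by blast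
      then have "(set d \<union> set e) \<inter> (!) vs ` A = {}" using that(2) by blast
      moreover have "card ((!) vs ` A) = card A" using that(1) injv by (metis card_image inj_on_subset)
      moreover have "finite ((!) vs ` A)" using A fin by (meson finite_Diff finite_subset)
      moreover have "card (set d \<union> set e) = 2 * l" using distinct_card[OF that(5)] that(3,4) by simp
      ultimately show "card (set d \<union> set e \<union> (!) vs ` A) = 2 * l + card A" by (simp add: card_Un_disjoint)
      show "set d \<union> set e \<union> (!) vs ` A \<subseteq> V" using A that(2) XV by blast
    qed
    have fG: "G \<subseteq> {A. A \<subseteq> {..<length vs} \<and> card A = h}" unfolding G_def by blast
    have main: "real (card G) * (g1 * g2) \<le> real (card (ham_paths E V a b))"
    proof (rule card_ham_paths_split[OF fin a b c abc vs(1) _ fG g])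
      show "set vs = V - set (a @ b @ c)" using vs(2) unfolding X_def .
    next
      fix A assume A: "A \<in> G"
      have AA: "A \<subseteq> {..<length vs}" "card A = h" "\<And>T. T \<subseteq> V \<Longrightarrow> card T = l + r - 2 \<Longrightarrow> \<mu> < real (card (link E ((!) vs ` A) T))"
        using A unfolding G_def by blast+
      have ac: "set a \<union> set c \<subseteq> X" "distinct (a @ c)" unfolding X_def using abc(1) by auto
      note W = cW[OF AA(1) ac(1) a c ac(2)]
      have cw: "card (set a \<union> set c \<union> (!) vs ` A) = l + r * (m div 2)" using W(2) AA(2) hl by simp
      show "g1 \<le> real (card (ham_paths E (set a \<union> set c \<union> (!) vs ` A) a c))"
      proof (rule g1[OF _ cw a c ac(2)])
        have "2 * card (set a \<union> set c \<union> (!) vs ` A) \<le> n + k"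
          unfolding cw hl(1)[symmetric] k_def n3 using q2h by simp
        then show "dense E (set a \<union> set c \<union> (!) vs ` A) (\<beta> - loss (card V))"
          using sub_dense[OF W(3) _ _ AA(3)] unfolding \<beta>'_def n_def by blast
      qed auto
    next
      fix A assume A: "A \<in> G"
      define A' where "A' = {..<length vs} - A"
      have AA: "A \<subseteq> {..<length vs}" "card A = h" "\<And>T. T \<subseteq> V \<Longrightarrow> card T = l + r - 2 \<Longrightarrow> \<mu> < real (card (link E ((!) vs ` A') T))"
        using A unfolding G_def A'_def by blast+
      have A': "A' \<subseteq> {..<length vs}" "card A' = q - h" unfolding A'_def q_def using AA by (auto simp: card_Diff_subset finite_subset)
      have ac: "set c \<union> set b \<subseteq> X" "distinct (c @ b)" unfolding X_def using abc(1) by auto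
      have rw: "r * (m - m div 2) = q - h + l" using qh by simp
      note W = cW[OF A'(1) ac(1) c b ac(2)]
      have cw: "card (set c \<union> set b \<union> (!) vs ` A') = l + r * (m - m div 2)" using W(2) A'(2) qh by simp
      show "g2 \<le> real (card (ham_paths E (set c \<union> set b \<union> (!) vs ` ({..<length vs} - A)) c b))"
        unfolding A'_def[symmetric]
      proof (rule g2[OF _ cw c b ac(2)])
        have "2 * card (set c \<union> set b \<union> (!) vs ` A') \<le> n + k"
          unfolding cw rw k_def n3 using j2 by simp
        then show "dense E (set c \<union> set b \<union> (!) vs ` A') (\<beta> - loss (card V))"
          using sub_dense[OF W(3) _ _ AA(3)] unfolding \<beta>'_def n_def by blast
      qed auto
    qed
    have vs0: "vs \<noteq> []" using qn unfolding q_def by auto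
    have lrV: "l + r \<le> card V" using kn unfolding k_def n_def .
    have cG: "real (q choose h) - 2 * real n ^ (k - 2) * (2 ^ q * exp (- t\<^sup>2 / (16 * real q ^ 3))) \<le> real (card G)"
      unfolding G_def q_def n_def k_def by (rule balanced_splits[OF V(1) lrV XV vs vs0 t0 \<mu>_def])
    \<comment> \<open>As \<open>2 * h \<le> q \<le> 2 * h + r\<close>, the binomial coefficient is
      compared with the central one for \<open>2 * h\<close>.\<close>
    have "2 ^ q / (2 ^ r * real n) \<le> real (q choose h)"
    proof -
      have "(2::real) ^ q \<le> 2 ^ (2 * h + r)" using q2h by (intro power_increasing) auto
      then have "2 ^ q \<le> 2 ^ r * (4::real) ^ h" unfolding power_add power_mult by (simp add: mult.commute)
      moreover have "real (2 * h) \<le> real n" using q2h(2) qn(1) by linarith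
      ultimately have "2 ^ q * real (2 * h) \<le> 2 ^ r * 4 ^ h * real n" by (intro mult_mono) auto
      then have "2 ^ q / (2 ^ r * real n) \<le> 4 ^ h / real (2 * h)" using n(3) hl(2) by (simp add: field_simps)
      also have "\<dots> \<le> real (2 * h choose h)" using central_binomial_lower_bound[OF hl(2)] by simp
      also have "\<dots> \<le> real (q choose h)" using q2h(2) by (simp add: binomial_right_mono)
      finally show ?thesis .
    qed
    \<comment> \<open>The exceptional splits take up at most half of the bound just found.\<close>
    moreover have "2 * real n ^ (k - 2) * (2 ^ q * exp (- t\<^sup>2 / (16 * real q ^ 3))) \<le> 2 ^ q / (2 ^ (r + 1) * real n)"
    proof -
      have "sqrt (real n) / 16 = real n ^ 3 * sqrt (real n) / (16 * real n ^ 3)" using n(3) by simp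
      also have "\<dots> \<le> real n ^ 3 * sqrt (real n) / (16 * real q ^ 3)"
        using qn by (intro divide_left_mono mult_left_mono power_mono mult_pos_pos) auto
      also have "\<dots> = t\<^sup>2 / (16 * real q ^ 3)" unfolding t_def by simp
      finally have "exp (- t\<^sup>2 / (16 * real q ^ 3)) \<le> exp (- (sqrt (real n) / 16))" by simp
      then have "2 * real n ^ (k - 2) * (2 ^ q * exp (- t\<^sup>2 / (16 * real q ^ 3))) \<le> 2 * real n ^ (k - 2) * (2 ^ q * exp (- (sqrt (real n) / 16)))"
        by (intro mult_left_mono) auto
      also have "\<dots> = 2 ^ q / (2 ^ (r + 1) * real n) * (2 * 2 ^ (r + 1) * (real n ^ (k - 2) * real n) * exp (- (sqrt (real n) / 16)))"
        using n(3) by (simp add: field_simps)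
      also have "real n ^ (k - 2) * real n = real n powr (real (k - 1))"
      proof -
        have "real n ^ (k - 2) * real n = real n ^ Suc (k - 2)" by simp
        also have "Suc (k - 2) = k - 1" using l_pos r_ge2 unfolding k_def by simp
        finally show ?thesis using n(3) by (simp add: powr_realpow)
      qed
      also have "2 ^ q / (2 ^ (r + 1) * real n) * (2 * 2 ^ (r + 1) * real n powr (real (k - 1)) * exp (- (sqrt (real n) / 16)))
        \<le> 2 ^ q / (2 ^ (r + 1) * real n) * 1" using n2[OF n(2)] by (intro mult_left_mono) auto
      finally show ?thesis by simp
    qed
    moreover have "2 ^ q / (2 ^ r * real n) = 2 ^ q / (2 ^ (r + 1) * real n) + 2 ^ q / (2 ^ (r + 1) * real n)"
      using n(3) by (simp add: field_simps)
    ultimately have cG2: "2 ^ q / (2 ^ (r + 1) * real n) \<le> real (card G)" using cG by linarith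
    have "2 ^ (r * m) / (2 ^ (2 * l + r + 1) * real (card V)) = 2 ^ q / (2 ^ (r + 1) * real n)"
    proof -
      have "r * m = q + 2 * l" using q V(2) n(4) unfolding n_def by linarith
      then show ?thesis using n(3) unfolding n_def[symmetric] by (simp add: power_add)
    qed
    then have "2 ^ (r * m) / (2 ^ (2 * l + r + 1) * real (card V)) * (g1 * g2) \<le> real (card G) * (g1 * g2)"
      using cG2 g by (intro mult_right_mono) auto
    then show ?thesis using main by linarith
  qed
  note main = this
  show ?thesis by (intro exI[of _ M] allI impI, elim conjE) (rule main; (assumption | blast))
qed


section \<open>Induction over repeated halving\<close>

text \<open>The tangent of \<open>z * ln z\<close> at the midpoint, added up for \<open>x\<close>
  and \<open>y\<close>. It allows the unequal halves of an odd \<open>m\<close> to be treated as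
  equal ones.\<close>

lemma halves_entropy:
  fixes x y :: real
  assumes "0 < x" "0 < y"
  shows "(x + y) * ln ((x + y) / 2) \<le> x * ln x + y * ln y"
proof -
  define s where "s = (x + y) / 2"
  have s: "0 < s" "x + y = 2 * s" using assms unfolding s_def by auto
  have ge: "z * ln s + (z - s) \<le> z * ln z" if "0 < z" for z
  proof -
    have "ln (s / z) \<le> s / z - 1" using s that by (intro ln_le_minus_one) simp
    then have "ln s - ln z \<le> s / z - 1" using s that by (simp add: ln_div)
    then have "z * (ln s - ln z) \<le> z * (s / z - 1)" using that by (intro mult_left_mono) auto
    also have "\<dots> = s - z" using that by (simp add: field_simps)
    finally show ?thesis by (simp add: algebra_simps)
  qed
  have "x * ln s + y * ln s = (x + y) * ln ((x + y) / 2)" unfolding s_def by (simp add: algebra_simps)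
  then show ?thesis using ge[OF assms(1)] ge[OF assms(2)] s(2) by linarith
qed

text \<open>Two strengthenings carry the induction. The density hypothesis has a slack
  \<open>m powr (-1/8)\<close> that grows by a constant factor with each halving, and this growth
  exceeds the loss of order \<open>m powr (-1/4)\<close>. The bound \<open>f\<close> has an extra
  \<open>sqrt m\<close>, whose growth under splitting pays for the logarithm of the polynomial
  factor lost in each step.\<close>

lemma count_ham_paths:
  assumes \<epsilon>: "0 < \<epsilon>" "\<epsilon> \<le> 1"
  shows "\<exists>C m0. \<forall>E (V :: 'a set) a b m. dense E V (threshold + \<epsilon>) \<and> m0 \<le> m \<and> card V = l + r * m \<and>
    length a = l \<and> length b = l \<and> distinct (a @ b) \<and> set (a @ b) \<subseteq> V
    \<longrightarrow> exp (real (r * m) * ln (real m) - C * real m) \<le> real (card (ham_paths E V a b))"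
proof -
  have \<epsilon>2: "0 < \<epsilon> / 2" "\<epsilon> / 2 \<le> 1" using \<epsilon> by auto
  obtain m1 where m1: "\<forall>E (V :: 'a set) a b m. dense E V (threshold + \<epsilon> / 2) \<and> m1 \<le> m \<and> card V = l + r * m \<and>
    length a = l \<and> length b = l \<and> distinct (a @ b) \<and> set (a @ b) \<subseteq> V \<longrightarrow> spans E a V b"
    using hamilton_connected[OF \<epsilon>2] by blast
  obtain m2 where m2: "\<forall>E (V :: 'a set) a b m \<beta> g1 g2. m2 \<le> m \<and> dense E V \<beta> \<and> card V = l + r * m \<and> loss (card V) \<le> \<beta> \<and>
    length a = l \<and> length b = l \<and> distinct (a @ b) \<and> set (a @ b) \<subseteq> V \<and> 0 \<le> (g1 :: real) \<and> 0 \<le> (g2 :: real) \<and>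
    (\<forall>W a b. dense E W (\<beta> - loss (card V)) \<and> card W = l + r * (m div 2) \<and> length a = l \<and> length b = l \<and> distinct (a @ b) \<and> set (a @ b) \<subseteq> W
      \<longrightarrow> g1 \<le> real (card (ham_paths E W a b))) \<and>
    (\<forall>W a b. dense E W (\<beta> - loss (card V)) \<and> card W = l + r * (m - m div 2) \<and> length a = l \<and> length b = l \<and> distinct (a @ b) \<and> set (a @ b) \<subseteq> W
      \<longrightarrow> g2 \<le> real (card (ham_paths E W a b)))
    \<longrightarrow> 2 ^ (r * m) / (2 ^ (2 * l + r + 1) * real (card V)) * (g1 * g2) \<le> real (card (ham_paths E V a b))"
    using halving_step by blast
  define R where "R = real r"
  have R: "0 < R" unfolding R_def using r_pos by simp
  define L where "L = real l"
  define D where "D = (2 :: real) ^ (2 * l + r + 1)"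
  have D: "0 < D" unfolding D_def by simp
  define N where "N m = L + R * real m" for m
  define \<kappa> where "\<kappa> m = 5 * sqrt (N m ^ 3 * sqrt (N m)) / (N m)\<^sup>2" for m
  \<comment> \<open>A half has size at most \<open>2 / 3 * m\<close>, so the slack grows at least by
    the factor \<open>1 + c\<close>.\<close>
  define c where "c = (2 / 3 :: real) powr (-1/8) - 1"
  have "(1 :: real) powr (-1/8) < (2 / 3) powr (-1/8)" by (intro powr_less_mono2_neg) auto
  then have c: "0 < c" unfolding c_def by simp
  have "eventually (\<lambda>m. real m powr (-1/8) \<le> \<epsilon> / 2) at_top" using \<epsilon> by real_asymp
  moreover have "eventually (\<lambda>m. \<kappa> m \<le> c * real m powr (-1/8)) at_top" unfolding N_def \<kappa>_def using R c by real_asymp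
  moreover have "eventually (\<lambda>m. \<kappa> m \<le> \<epsilon> / 2) at_top" unfolding N_def \<kappa>_def using R \<epsilon> by real_asymp
  moreover have "eventually (\<lambda>m. ln (D * N m) \<le> 1 / 3 * sqrt (real m)) at_top" unfolding N_def using R D by real_asymp
  ultimately have "eventually (\<lambda>m. real m powr (-1/8) \<le> \<epsilon> / 2 \<and> \<kappa> m \<le> c * real m powr (-1/8) \<and> \<kappa> m \<le> \<epsilon> / 2 \<and>
      ln (D * N m) \<le> 1 / 3 * sqrt (real m)) at_top"
    by eventually_elim simp
  then obtain m3 where m3: "\<And>m. m3 \<le> m \<Longrightarrow> real m powr (-1/8) \<le> \<epsilon> / 2" "\<And>m. m3 \<le> m \<Longrightarrow> \<kappa> m \<le> c * real m powr (-1/8)"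
      "\<And>m. m3 \<le> m \<Longrightarrow> \<kappa> m \<le> \<epsilon> / 2" "\<And>m. m3 \<le> m \<Longrightarrow> ln (D * N m) \<le> 1 / 3 * sqrt (real m)"
    by (auto simp: eventually_at_top_linorder)
  define m0 where "m0 = m1 + m2 + m3 + 9"
  \<comment> \<open>Makes \<open>f m \<le> 0\<close> in the base range below \<open>2 * m0\<close>,
    where the existence of a single path suffices.\<close>
  define C where "C = R * ln (2 * real m0) + 1"
  define f where "f m = R * real m * ln (real m) - C * real m + sqrt (real m)" for m
  have claim: "exp (f m) \<le> real (card (ham_paths E V a b))"
    if "m0 \<le> m" "dense E V (threshold + (\<epsilon> - real m powr (-1/8)))" "card V = l + r * m" "length a = l" "length b = l" "distinct (a @ b)" "set (a @ b) \<subseteq> V"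
    for E and V :: "'a set" and a b m
    using that
  proof (induction m arbitrary: V a b rule: less_induct)
    case (less m)
    note m = less.prems(1) and V = less.prems(2) and cV = less.prems(3) and ab = less.prems(4-7)
    have fin: "finite V" using V dense_finite by blast
    have mm: "m1 \<le> m" "m2 \<le> m" "m3 \<le> m" "1 \<le> m" "9 \<le> m" using m unfolding m0_def by auto
    have e2: "\<epsilon> / 2 \<le> \<epsilon> - real m powr (-1/8)" using m3(1)[OF mm(3)] by linarith
    show ?case
    proof (cases "m < 2 * m0")
      case True
      have "dense E V (threshold + \<epsilon> / 2)" using V e2 by (intro dense_mono[OF V]) simp
      then have "spans E a V b" using m1 mm(1) cV ab by blast
      then have "card (ham_paths E V a b) \<noteq> 0" using finite_ham_paths[OF fin] by (simp add: spans_iff_ham_paths)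
      then have one: "1 \<le> real (card (ham_paths E V a b))" by linarith
      have "ln (real m) \<le> ln (2 * real m0)" using True mm(4) by (subst ln_le_cancel_iff) auto
      then have "R * real m * ln (real m) \<le> R * real m * ln (2 * real m0)" using R by (intro mult_left_mono) auto
      moreover have "sqrt (real m) \<le> real m"
        using mm(4) real_sqrt_le_mono[of "real m" "real m * real m"] by simp
      moreover have "C * real m = R * real m * ln (2 * real m0) + real m" unfolding C_def by (simp add: algebra_simps)
      ultimately have "f m \<le> 0" unfolding f_def by linarith
      then have "exp (f m) \<le> 1" by simp
      then show ?thesis using one by linarith
    next
      case False
      define u where "u = m div 2"
      define w where "w = m - m div 2"
      have uw: "m0 \<le> u" "m0 \<le> w" "u < m" "w < m" "real u + real w = real m"
        using False mm(4) unfolding u_def w_def m0_def by (auto simp: of_nat_diff) 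
      have uw2: "2 * real u \<le> real m + 1" "2 * real w \<le> real m + 1" "real m - 1 \<le> 2 * real u" "real m - 1 \<le> 2 * real w"
      proof -
        have "2 * u \<le> m" "m \<le> 2 * u + 1" unfolding u_def by linarith+
        then have "2 * real u \<le> real m" "real m \<le> 2 * real u + 1" by linarith+
        then show "2 * real u \<le> real m + 1" "2 * real w \<le> real m + 1" "real m - 1 \<le> 2 * real u" "real m - 1 \<le> 2 * real w"
          using uw(5) by linarith+
      qed
      have m9: "9 \<le> real m" using mm(5) by simp
      have pos: "1 \<le> u" "1 \<le> w" using uw unfolding m0_def by auto
      have NV: "real (card V) = N m" unfolding cV N_def L_def R_def by simp
      have lossV: "loss (card V) = \<kappa> m" unfolding loss_def NV \<kappa>_def ..
      have l1: "loss (card V) \<le> threshold + (\<epsilon> - real m powr (-1/8))"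
        unfolding lossV using m3(3)[OF mm(3)] e2 threshold_nonneg by linarith
      have dec: "threshold + (\<epsilon> - real v powr (-1/8)) \<le> threshold + (\<epsilon> - real m powr (-1/8)) - loss (card V)"
        if "1 \<le> v" "2 * real v \<le> real m + 1" for v
      proof -
        have "real v \<le> 2 / 3 * real m" using that(2) m9 by linarith
        then have "(2 / 3 * real m) powr (-1/8) \<le> real v powr (-1/8)" using that by (intro powr_mono2') auto
        moreover have "(2 / 3 * real m) powr (-1/8) = (c + 1) * real m powr (-1/8)" unfolding c_def powr_mult by simp
        moreover have "\<dots> = c * real m powr (-1/8) + real m powr (-1/8)" by (simp add: algebra_simps)
        ultimately show ?thesis unfolding lossV using m3(2)[OF mm(3)] by linarith
      qed
      have step: "exp (f v) \<le> real (card (ham_paths E W a b))"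
        if v: "m0 \<le> v" "v < m" "2 * real v \<le> real m + 1"
          and W: "dense E W (threshold + (\<epsilon> - real m powr (-1/8)) - loss (card V))" "card W = l + r * v"
          and ab: "length a = l" "length b = l" "distinct (a @ b)" "set (a @ b) \<subseteq> W" for v W a b
      proof (rule less.IH[OF v(2) v(1) _ W(2) ab])
        have "1 \<le> v" using v(1) unfolding m0_def by simp
        then show "dense E W (threshold + (\<epsilon> - real v powr (-1/8)))" using dec v(3) by (intro dense_mono[OF W(1)]) auto
      qed
      have gu: "\<forall>W a b. dense E W (threshold + (\<epsilon> - real m powr (-1/8)) - loss (card V)) \<and> card W = l + r * (m div 2) \<and>
        length a = l \<and> length b = l \<and> distinct (a @ b) \<and> set (a @ b) \<subseteq> W \<longrightarrow> exp (f u) \<le> real (card (ham_paths E W a b))"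
        using step[OF uw(1,3) uw2(1)] unfolding u_def by blast
      have gw: "\<forall>W a b. dense E W (threshold + (\<epsilon> - real m powr (-1/8)) - loss (card V)) \<and> card W = l + r * (m - m div 2) \<and>
        length a = l \<and> length b = l \<and> distinct (a @ b) \<and> set (a @ b) \<subseteq> W \<longrightarrow> exp (f w) \<le> real (card (ham_paths E W a b))"
        using step[OF uw(2,4) uw2(2)] unfolding w_def by blast
      have "2 ^ (r * m) / (2 ^ (2 * l + r + 1) * real (card V)) * (exp (f u) * exp (f w)) \<le> real (card (ham_paths E V a b))"
      proof (rule m2[rule_format], intro conjI)
        show "0 \<le> exp (f u)" "0 \<le> exp (f w)" by simp_all
      qed (use mm V cV l1 ab gu gw in blast)+
      moreover have "exp (f m) \<le> 2 ^ (r * m) / (2 ^ (2 * l + r + 1) * real (card V)) * (exp (f u) * exp (f w))"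
      proof -
        have "0 < card V" unfolding cV using l_pos by simp
        then have n0: "0 < real (card V)" by simp
        have "(2 :: real) ^ (r * m) = exp (real (r * m) * ln 2)" unfolding exp_of_nat_mult by simp
        also have "real (r * m) * ln 2 = R * real m * ln 2" unfolding R_def by simp
        finally have p2: "(2 :: real) ^ (r * m) = exp (R * real m * ln 2)" .
        have DN: "2 ^ (2 * l + r + 1) * real (card V) = exp (ln (D * N m))" using D n0 unfolding NV[symmetric] D_def by simp
        have "(real u + real w) * ln ((real u + real w) / 2) \<le> real u * ln (real u) + real w * ln (real w)"
          using pos by (intro halves_entropy) auto
        then have "R * (real m * ln (real m / 2)) \<le> R * (real u * ln (real u) + real w * ln (real w))"
          unfolding uw(5) using R by (intro mult_left_mono) auto
        moreover have "ln (real m / 2) = ln (real m) - ln 2" using mm(4) by (simp add: ln_div)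
        ultimately have ent: "R * real m * ln (real m) - R * real m * ln 2 \<le> R * real u * ln (real u) + R * real w * ln (real w)"
          by (simp add: algebra_simps)
        \<comment> \<open>Since \<open>m \<ge> 9\<close>, each half is at least four ninths of
          \<open>m\<close>, so the two square roots add up to at least
          \<open>4 / 3 * sqrt m\<close>; this leaves \<open>1 / 3 * sqrt m\<close> for
          \<open>ln (D * N m)\<close>.\<close>
        have "4 / 9 * real m \<le> real u" "4 / 9 * real m \<le> real w" using uw2(3,4) m9 by linarith+
        then have "sqrt (4 / 9 * real m) \<le> sqrt (real u)" "sqrt (4 / 9 * real m) \<le> sqrt (real w)" by (auto intro: real_sqrt_le_mono)
        moreover have "sqrt (4 / 9 * real m) = 2 / 3 * sqrt (real m)"
        proof -
          have "sqrt (4 / 9 :: real) = 2 / 3" by (rule real_sqrt_unique) (simp_all add: power2_eq_square)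
          then show ?thesis by (simp only: real_sqrt_mult)
        qed
        ultimately have sq: "ln (D * N m) + sqrt (real m) \<le> sqrt (real u) + sqrt (real w)" using m3(4)[OF mm(3)] by linarith
        have "C * real u + C * real w = C * real m" using uw(5) by (metis distrib_left)
        then have "f m \<le> R * real m * ln 2 - ln (D * N m) + (f u + f w)" unfolding f_def using ent sq by linarith
        then have "exp (f m) \<le> exp (R * real m * ln 2 - ln (D * N m) + (f u + f w))" by simp
        also have "\<dots> = 2 ^ (r * m) / (2 ^ (2 * l + r + 1) * real (card V)) * (exp (f u) * exp (f w))"
          unfolding p2 DN by (simp add: exp_add exp_diff)
        finally show ?thesis .
      qed
      ultimately show ?thesis by linarith
    qed
  qed
  have "exp (real (r * m) * ln (real m) - C * real m) \<le> real (card (ham_paths E V a b))"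
    if "dense E V (threshold + \<epsilon>)" "m0 \<le> m" "card V = l + r * m" "length a = l" "length b = l" "distinct (a @ b)" "set (a @ b) \<subseteq> V"
    for E and V :: "'a set" and a b m
  proof -
    have "dense E V (threshold + (\<epsilon> - real m powr (-1/8)))" by (rule dense_mono[OF that(1)]) simp
    then have "exp (f m) \<le> real (card (ham_paths E V a b))" using that by (intro claim) auto
    moreover have "exp (real (r * m) * ln (real m) - C * real m) \<le> exp (f m)" unfolding f_def R_def by simp
    ultimately show ?thesis by linarith
  qed
  then show ?thesis by (intro exI[of _ C] exI[of _ m0]) blast
qed

subsection \<open>From spanning cycles to Hamilton cycles\<close>

definition cycle_edge :: "'b list \<Rightarrow> nat \<Rightarrow> 'b set" where
  "cycle_edge vs i = (\<lambda>j. vs ! ((i * r + j) mod length vs)) ` {..<l + r}"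

definition cycle_edges :: "'b list \<Rightarrow> 'b set set" where
  "cycle_edges vs = cycle_edge vs ` {..<length vs div r}"

text \<open>Two consecutive edges occupy \<open>l + 2 * r\<close> cyclic positions. Once
  \<open>card V\<close> is that large these carry different vertices, so the edges meet in exactly
  \<open>l\<close> of them.\<close>

lemma ham_cycle_cycle_edges:
  assumes vs: "spanning_cycle E V vs" and n: "l + 2 * r \<le> card V"
  shows "ham_cycle (l + r) l V E (cycle_edges vs)"
proof -
  define n where "n = card V"
  have len: "length vs = n" unfolding n_def by (rule spanning_cycle_length[OF vs])
  have vs': "distinct vs" "set vs = V" "walk E (vs @ take l vs)" using vs unfolding spanning_cycle_def by auto
  have ln: "l \<le> length vs" using n len unfolding n_def by simp
  have w: "r dvd n" "\<And>i. i < n div r \<Longrightarrow> cycle_edge vs i \<in> E"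
    using vs'(3) unfolding walk_cyclic_iff[OF ln] len cycle_edge_def by auto
  obtain m where m: "n = r * m" using w(1) by blast
  have dm: "n div r = m" using m r_pos by simp
  have n0: "0 < n" using n r_pos unfolding n_def by simp
  have m0: "0 < m" using n0 m by (cases m) auto
  have inj: "inj_on (\<lambda>j. vs ! ((s + j) mod n)) {..<l + 2 * r}" for s
  proof (rule inj_onI)
    fix i j assume ij: "i \<in> {..<l + 2 * r}" "j \<in> {..<l + 2 * r}" and e: "vs ! ((s + i) mod n) = vs ! ((s + j) mod n)"
    have "(s + i) mod n < n" "(s + j) mod n < n" using n0 by auto
    then have "(s + i) mod n = (s + j) mod n" using e vs'(1) len nth_eq_iff_index_eq by metis
    then have "[s + i = s + j] (mod n)" unfolding unique_euclidean_semiring_class.cong_def .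
    then have "[i = j] (mod n)" by (simp add: cong_add_lcancel_nat)
    from cong_less_modulus_unique_nat[OF this] show "i = j" using ij n unfolding n_def[symmetric] by simp
  qed
  define \<psi> where "\<psi> i = (\<lambda>j. vs ! ((i * r + j) mod n))" for i
  have edge: "cycle_edge vs i = \<psi> i ` {..<l + r}" for i unfolding cycle_edge_def \<psi>_def len ..
  have injp: "inj_on (\<psi> i) {..<l + 2 * r}" for i unfolding \<psi>_def by (rule inj)
  have c1: "card (cycle_edge vs i) = l + r" for i
    unfolding edge using inj_on_subset[OF injp[of i], of "{..<l + r}"] by (simp add: card_image)
  have c2: "card (cycle_edge vs i \<inter> cycle_edge vs ((i + 1) mod m)) = l" for i
  proof -
    have ce: "cycle_edge vs ((i + 1) mod m) = \<psi> i ` {r..<l + 2 * r}"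
    proof -
      have "((i + 1) mod m * r + j) mod n = (i * r + (r + j)) mod n" for j
      proof -
        have "(i + 1) mod m * r = (r * (i + 1)) mod n" unfolding m mult.commute[of "(i + 1) mod m" r] mult_mod_right ..
        then have "((i + 1) mod m * r + j) mod n = (r * (i + 1) + j) mod n" by (simp add: mod_add_left_eq)
        also have "r * (i + 1) + j = i * r + (r + j)" by (simp add: algebra_simps)
        finally show ?thesis .
      qed
      then have "cycle_edge vs ((i + 1) mod m) = (\<lambda>j. \<psi> i (r + j)) ` {..<l + r}" unfolding edge \<psi>_def by simp
      also have "\<dots> = \<psi> i ` ((\<lambda>j. r + j) ` {..<l + r})" by (simp add: image_image)
      also have "(\<lambda>j. r + j) ` {..<l + r} = {r..<l + 2 * r}"
        using image_add_atLeastLessThan[of r 0 "l + r"] by (simp add: lessThan_atLeast0 add.commute mult_2 add.left_commute)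
      finally show ?thesis .
    qed
    have sub: "{..<l + r} \<subseteq> {..<l + 2 * r}" "{r..<l + 2 * r} \<subseteq> {..<l + 2 * r}" by auto
    have "cycle_edge vs i \<inter> cycle_edge vs ((i + 1) mod m) = \<psi> i ` ({..<l + r} \<inter> {r..<l + 2 * r})"
      by (simp only: ce edge[of i] inj_on_image_Int[OF injp[of i] sub])
    also have "{..<l + r} \<inter> {r..<l + 2 * r} = {r..<l + r}" by auto
    also have "card (\<psi> i ` {r..<l + r}) = l" using inj_on_subset[OF injp[of i], of "{r..<l + r}"] by (simp add: card_image subset_iff)
    finally show ?thesis .
  qed
  define f where "f = (!) vs"
  have bij: "bij_betw f {..<card V} V"
    unfolding f_def by (rule bij_betw_nth[OF vs'(1)]) (use len vs'(2) in \<open>simp_all add: n_def\<close>)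
  have fe: "f ` ((\<lambda>j. (i * r + j) mod n) ` {..<l + r}) = cycle_edge vs i" for i
    unfolding f_def cycle_edge_def len by (simp add: image_image)
  have sub: "cycle_edges vs \<subseteq> E" unfolding cycle_edges_def len using w(2) by auto
  show ?thesis
    unfolding ham_cycle_def Let_def
  proof (intro conjI exI[of _ f])
    show "cycle_edges vs = (\<lambda>i. f ` ((\<lambda>j. (i * (l + r - l) + j) mod card V) ` {..<l + r})) ` {..<card V div (l + r - l)}"
      using fe unfolding cycle_edges_def len n_def by simp
  qed (use sub bij w(1) m0 dm c1 c2 fe in \<open>simp_all add: n_def\<close>)
qed

text \<open>For each offset \<open>j\<close>, at most one window has \<open>u\<close> at that
  offset, so \<open>u\<close> lies in at most \<open>l + r\<close> windows of at most
  \<open>l + r\<close> vertices each.\<close>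

lemma card_cycle_neighbours:
  assumes vs: "distinct vs" "r dvd length vs"
  shows "card (\<Union>{e \<in> cycle_edges vs. u \<in> e}) \<le> (l + r) * (l + r)"
proof -
  define n where "n = length vs"
  obtain m where m: "n = r * m" using vs(2) unfolding n_def by blast
  have dm: "n div r = m" using m r_pos by simp
  have one: "card {i. i < m \<and> vs ! ((i * r + j) mod n) = u} \<le> 1" for j
  proof -
    have "i = i'" if "i < m" "i' < m" "vs ! ((i * r + j) mod n) = u" "vs ! ((i' * r + j) mod n) = u" for i i'
    proof -
      have n0: "0 < n" using that(1) m r_pos by simp
      then have "(i * r + j) mod n < n" "(i' * r + j) mod n < n" by auto
      then have "(i * r + j) mod n = (i' * r + j) mod n" using that(3,4) vs(1) unfolding n_def by (metis nth_eq_iff_index_eq)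
      then have "[i * r + j = i' * r + j] (mod n)" unfolding unique_euclidean_semiring_class.cong_def .
      then have "[i * r = i' * r] (mod n)" by (simp add: cong_add_rcancel_nat)
      moreover have "i * r < n" "i' * r < n" using that(1,2) r_pos unfolding m by (simp_all add: mult.commute)
      ultimately have "i * r = i' * r" by (intro cong_less_modulus_unique_nat) auto
      then show ?thesis using r_pos by simp
    qed
    then show ?thesis by (intro card_le_Suc0_iff_eq[THEN iffD2, unfolded One_nat_def[symmetric]]) auto
  qed
  define I where "I = {i. i < m \<and> u \<in> cycle_edge vs i}"
  have "I \<subseteq> (\<Union>j<l + r. {i. i < m \<and> vs ! ((i * r + j) mod n) = u})" unfolding I_def cycle_edge_def n_def by auto
  then have "card I \<le> card (\<Union>j<l + r. {i. i < m \<and> vs ! ((i * r + j) mod n) = u})" by (intro card_mono) auto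
  also have "\<dots> \<le> (\<Sum>j<l + r. card {i. i < m \<and> vs ! ((i * r + j) mod n) = u})" by (rule card_UN_le) simp
  also have "\<dots> \<le> (\<Sum>j<l + r. 1)" using one by (intro sum_mono)
  finally have cI: "card I \<le> l + r" by simp
  have fI: "finite I" unfolding I_def by simp
  have "\<Union>{e \<in> cycle_edges vs. u \<in> e} \<subseteq> (\<Union>i\<in>I. cycle_edge vs i)"
    unfolding cycle_edges_def I_def n_def[symmetric] dm by auto
  moreover have "finite (\<Union>i\<in>I. cycle_edge vs i)" using fI unfolding cycle_edge_def by simp
  ultimately have "card (\<Union>{e \<in> cycle_edges vs. u \<in> e}) \<le> card (\<Union>i\<in>I. cycle_edge vs i)" by (intro card_mono)
  also have "\<dots> \<le> (\<Sum>i\<in>I. card (cycle_edge vs i))" by (rule card_UN_le[OF fI])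
  also have "\<dots> \<le> (\<Sum>i\<in>I. l + r)" unfolding cycle_edge_def by (intro sum_mono) (metis card_image_le card_lessThan finite_lessThan)
  also have "\<dots> \<le> (l + r) * (l + r)" using cI by simp
  finally show ?thesis .
qed

end

text \<open>Each entry after the first has at most \<open>D\<close> choices once its predecessor is
  known.\<close>

lemma card_lists_stepwise:
  assumes "finite V" "\<And>u. u \<in> V \<Longrightarrow> finite (N u) \<and> card (N u) \<le> D"
  shows "card {xs \<in> tuples V (Suc n). \<forall>p<n. xs ! Suc p \<in> N (xs ! p)} \<le> card V * D ^ n"
proof (induction n)
  case 0
  have "card {xs \<in> tuples V (Suc 0). \<forall>p<0. xs ! Suc p \<in> N (xs ! p)} = card (tuples V (Suc 0))" by simp
  then show ?case using assms(1) by (simp add: card_tuples)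
next
  case (Suc n)
  let ?S = "\<lambda>n. {xs \<in> tuples V (Suc n). \<forall>p<n. xs ! Suc p \<in> N (xs ! p)}"
  have fS: "finite (?S n)" using assms(1) by simp
  have mem: "xs ! n \<in> V" if "xs \<in> ?S n" for xs using that unfolding tuples_def by (auto simp: subset_iff)
  have "?S (Suc n) \<subseteq> (\<lambda>(xs, v). xs @ [v]) ` (SIGMA xs:?S n. N (xs ! n))"
  proof
    fix ys assume ys: "ys \<in> ?S (Suc n)"
    then have ly: "length ys = Suc (Suc n)" "set ys \<subseteq> V" and st: "\<And>p. p < Suc n \<Longrightarrow> ys ! Suc p \<in> N (ys ! p)" unfolding tuples_def by auto
    define xs v where "xs = butlast ys" and "v = last ys"
    have e: "ys = xs @ [v]" unfolding xs_def v_def using ly by (metis append_butlast_last_id length_0_conv nat.distinct(1))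
    have lx: "length xs = Suc n" unfolding xs_def using ly by simp
    have "xs ! Suc p \<in> N (xs ! p)" if "p < n" for p using st[of p] that lx unfolding e by (simp add: nth_append)
    then have "xs \<in> ?S n" using lx ly(2) unfolding tuples_def e by auto
    moreover have "v \<in> N (xs ! n)" using st[of n] lx unfolding e by (simp add: nth_append)
    ultimately show "ys \<in> (\<lambda>(xs, v). xs @ [v]) ` (SIGMA xs:?S n. N (xs ! n))" unfolding e by auto
  qed
  moreover have fin: "finite (SIGMA xs:?S n. N (xs ! n))" using fS assms(2) mem by (intro finite_SigmaI) auto
  ultimately have "card (?S (Suc n)) \<le> card (SIGMA xs:?S n. N (xs ! n))" by (meson card_image_le card_mono finite_imageI order_trans)
  also have "\<dots> = (\<Sum>xs\<in>?S n. card (N (xs ! n)))" using fS assms(2) mem by (intro card_SigmaI) auto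
  also have "\<dots> \<le> (\<Sum>xs\<in>?S n. D)" using assms(2) mem by (intro sum_mono) auto
  also have "\<dots> \<le> card V * D ^ n * D" using Suc.IH by simp
  finally show ?case by (simp add: ac_simps)
qed

context cycle_params
begin

text \<open>Consecutive vertices of the list share an edge of \<open>H\<close>, so given
  \<open>H\<close> each vertex has at most \<open>(l + r) * (l + r)\<close> possible successors. The
  bound on neighbours is read off from one fixed cycle \<open>ws\<close> with edge set
  \<open>H\<close>.\<close>

lemma card_cycle_lists:
  assumes fin: "finite V" and n: "l \<le> card V"
  shows "card {vs. spanning_cycle E V vs \<and> cycle_edges vs = H} \<le> card V * ((l + r) * (l + r)) ^ card V"
proof (cases "{vs. spanning_cycle E V vs \<and> cycle_edges vs = H} = {}")
  case True
  show ?thesis unfolding True by simp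
next
  case False
  define n' where "n' = card V - 1"
  have cV: "card V = Suc n'" using n l_pos unfolding n'_def by simp
  let ?K = "(l + r) * (l + r)"
  define N where "N u = (\<Union>{e \<in> H. u \<in> e})" for u
  have props: "r dvd card V" "length vs = card V" "distinct vs" "set vs = V" if "spanning_cycle E V vs" for vs
  proof -
    show len: "length vs = card V" by (rule spanning_cycle_length[OF that])
    have w: "walk E (vs @ take l vs)" and "distinct vs" "set vs = V" using that unfolding spanning_cycle_def by auto
    then show "distinct vs" "set vs = V" by auto
    obtain m where "length (vs @ take l vs) = l + r * m" using w by (rule walk_lengthE)
    then show "r dvd card V" using len n by simp
  qed
  obtain ws where ws: "spanning_cycle E V ws" "cycle_edges ws = H" using False by blast
  have cN: "finite (N u) \<and> card (N u) \<le> ?K" if "u \<in> V" for u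
  proof
    show "card (N u) \<le> ?K"
      unfolding N_def ws(2)[symmetric] using props[OF ws(1)] by (intro card_cycle_neighbours) auto
    show "finite (N u)" unfolding N_def ws(2)[symmetric] cycle_edges_def cycle_edge_def by auto
  qed
  have "{vs. spanning_cycle E V vs \<and> cycle_edges vs = H} \<subseteq> {xs \<in> tuples V (Suc n'). \<forall>p<n'. xs ! Suc p \<in> N (xs ! p)}"
  proof
    fix vs assume "vs \<in> {vs. spanning_cycle E V vs \<and> cycle_edges vs = H}"
    then have vs: "spanning_cycle E V vs" "cycle_edges vs = H" by auto
    have len: "length vs = Suc n'" using props(2)[OF vs(1)] cV by simp
    have "vs ! Suc p \<in> N (vs ! p)" if p: "p < n'" for p
    proof -
      \<comment> \<open>Window \<open>p div r\<close> contains both \<open>p\<close> and its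
        successor: the offset \<open>p mod r\<close> is at most \<open>r - 1\<close>, and
        \<open>l\<close> is at least 1.\<close>
      define i where "i = p div r"
      obtain m where m: "card V = r * m" using props(1)[OF vs(1)] by blast
      have "p < r * m" using p cV m by simp
      then have im: "i < length vs div r" unfolding i_def len cV[symmetric] m using r_pos by (simp add: less_mult_imp_div_less mult.commute)
      have pi: "i * r + p mod r = p" unfolding i_def by simp
      have "p mod r < r" using r_pos by simp
      then have j: "p mod r < l + r" "Suc (p mod r) < l + r" using l_pos by auto
      have "vs ! ((i * r + p mod r) mod length vs) = vs ! p" using p len unfolding pi by simp
      then have "vs ! p \<in> cycle_edge vs i" unfolding cycle_edge_def using j(1) by (metis imageI lessThan_iff)
      moreover have "vs ! ((i * r + Suc (p mod r)) mod length vs) = vs ! Suc p" using p len pi by simp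
      then have "vs ! Suc p \<in> cycle_edge vs i" unfolding cycle_edge_def using j(2) by (metis imageI lessThan_iff)
      moreover have "cycle_edge vs i \<in> H" unfolding vs(2)[symmetric] cycle_edges_def using im by blast
      ultimately show ?thesis unfolding N_def by blast
    qed
    then show "vs \<in> {xs \<in> tuples V (Suc n'). \<forall>p<n'. xs ! Suc p \<in> N (xs ! p)}"
      using len props(4)[OF vs(1)] unfolding tuples_def by simp
  qed
  moreover have "finite {xs \<in> tuples V (Suc n'). \<forall>p<n'. xs ! Suc p \<in> N (xs ! p)}" using fin by simp
  ultimately have "card {vs. spanning_cycle E V vs \<and> cycle_edges vs = H} \<le> card {xs \<in> tuples V (Suc n'). \<forall>p<n'. xs ! Suc p \<in> N (xs ! p)}"
    by (intro card_mono)
  also have "\<dots> \<le> card V * ?K ^ n'" by (rule card_lists_stepwise[OF fin cN])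
  also have "\<dots> \<le> card V * ?K ^ card V"
    unfolding cV using r_pos by (intro mult_le_mono2 power_increasing) auto
  finally show ?thesis .
qed

text \<open>A segment \<open>y\<close> from \<open>b\<close> to \<open>a\<close> is fixed. Removing
  it keeps the rest dense, and every Hamilton path of the rest from \<open>a\<close> to
  \<open>b\<close> is closed up by \<open>y\<close>. Dividing by the number of orderings with a
  common edge set turns ordered cycles into Hamilton cycles.\<close>

lemma many_ham_cycles:
  assumes \<epsilon>: "0 < \<epsilon>" "\<epsilon> \<le> 1"
  shows "\<exists>C>0. \<exists>n0. \<forall>E (V :: 'a set). dense E V (threshold + \<epsilon>) \<and> (\<forall>e\<in>E. e \<subseteq> V) \<and> n0 \<le> card V \<and> r dvd card V
    \<longrightarrow> exp (real (card V) * ln (real (card V)) - C * real (card V)) \<le> real (card {H. ham_cycle (l + r) l V E H})"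
proof -
  have \<epsilon>2: "0 < \<epsilon> / 2" "\<epsilon> / 2 \<le> 1" "0 < \<epsilon> / 4" using \<epsilon> by auto
  obtain q \<gamma> n1 where \<gamma>: "0 < \<gamma>" and dv: "r dvd q + l" and A: "\<And>E (V :: 'a set) a b. dense E V (threshold + \<epsilon>) \<Longrightarrow> n1 \<le> card V \<Longrightarrow>
    length a = l \<Longrightarrow> length b = l \<Longrightarrow> distinct (a @ b) \<Longrightarrow> set (a @ b) \<subseteq> V \<Longrightarrow>
    ample V q \<gamma> (\<lambda>y. walk E (a @ y @ b) \<and> distinct (a @ y @ b))"
    using connecting_walks[OF \<epsilon>, where 'a = 'a] by (elim exE conjE) (rule that; blast)
  obtain C0 m0 where P: "\<And>E (V :: 'a set) a b m. dense E V (threshold + \<epsilon> / 2) \<Longrightarrow> m0 \<le> m \<Longrightarrow> card V = l + r * m \<Longrightarrow>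
    length a = l \<Longrightarrow> length b = l \<Longrightarrow> distinct (a @ b) \<Longrightarrow> set (a @ b) \<subseteq> V \<Longrightarrow>
    exp (real (r * m) * ln (real m) - C0 * real m) \<le> real (card (ham_paths E V a b))"
    using count_ham_paths[OF \<epsilon>2(1,2), where 'a = 'a] by (elim exE conjE) (rule that; blast)
  obtain z where z: "q + l = r * z" using dv by blast
  define K where "K = (l + r) * (l + r)"
  have K: "1 \<le> real K" unfolding K_def using r_pos l_pos by (cases l) auto
  define s where "s = q + l"
  obtain n2 where n2: "\<And>n. n2 \<le> n \<Longrightarrow> (real s + 1) * ln (real n) + 0 \<le> 1 * real n"
    using eventually_log_linear_bound[of 1] by (metis zero_less_one)
  obtain n3 where n3: "\<And>n. n3 \<le> n \<Longrightarrow> real q \<le> \<epsilon> / 4 * real n" using eventually_linear_bound[OF \<epsilon>2(3)] by blast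
  \<comment> \<open>\<open>ln (2 * r)\<close> pays for passing from \<open>ln m\<close> to
    \<open>ln n\<close>, \<open>\<bar>C0\<bar>\<close> comes from the paths, \<open>ln K\<close>
    from the orderings, and 1 absorbs the logarithmic terms.\<close>
  define C where "C = ln (2 * real r) + \<bar>C0\<bar> + ln (real K) + 1"
  have C: "0 < C" unfolding C_def using K r_pos by (intro add_nonneg_pos add_nonneg_nonneg) auto
  define n0 where "n0 = n1 + n2 + n3 + r * (m0 + 2 * z + 1) + 2 * l + 2 * r"
  have "exp (real (card V) * ln (real (card V)) - C * real (card V)) \<le> real (card {H. ham_cycle (l + r) l V E H})"
    if V: "dense E V (threshold + \<epsilon>)" "\<And>e. e \<in> E \<Longrightarrow> e \<subseteq> V" and big: "n0 \<le> card V" and rV: "r dvd card V" for E and V :: "'a set"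
  proof -
    define n where "n = card V"
    have fin: "finite V" using V dense_finite by blast
    have n: "n1 \<le> n" "n2 \<le> n" "n3 \<le> n" "r * (m0 + 2 * z + 1) \<le> n" "2 * l + 2 * r \<le> n" using big unfolding n0_def n_def by auto
    have npos: "0 < n" using n(5) l_pos by linarith
    have V0: "V \<noteq> {}" using npos unfolding n_def by auto
    obtain n' where n': "n = r * n'" using rV unfolding n_def by blast
    have "m0 + 2 * z + 1 \<le> n'" using n(4) unfolding n' nat_mult_le_cancel1[OF r_pos] .
    define m where "m = n' - z"
    have m: "m0 \<le> m" "n' = m + z" "n' \<le> 2 * m" "0 < m" unfolding m_def using \<open>m0 + 2 * z + 1 \<le> n'\<close> by auto
    have "2 * l \<le> card V" using n(5) unfolding n_def by simp
    then obtain S where S: "S \<subseteq> V" "card S = 2 * l" using obtain_subset_with_card_n by metis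
    then have "finite S" using fin finite_subset by blast
    then obtain d where d: "set d = S" "distinct d" using finite_distinct_list by blast
    have ld: "length d = 2 * l" using distinct_card[OF d(2)] d(1) S(2) by simp
    define a b where "a = take l d" and "b = drop l d"
    have ab: "length a = l" "length b = l" "a @ b = d" unfolding a_def b_def using ld by auto
    have ab': "distinct (a @ b)" "set (a @ b) \<subseteq> V" "distinct (b @ a)" "set (b @ a) \<subseteq> V"
    proof -
      show 1: "distinct (a @ b)" "set (a @ b) \<subseteq> V" unfolding ab(3) using d S by auto
      then show "distinct (b @ a)" "set (b @ a) \<subseteq> V" by auto
    qed
    obtain y where y: "y \<in> tuples V q" "walk E (b @ y @ a)" "distinct (b @ y @ a)"
      using ample_ex[OF A[OF V(1) _ ab(2,1) ab'(3,4)] \<gamma> fin V0] n(1) unfolding n_def by blast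
    define V' where "V' = V - set y"
    have ly: "length y = q" "set y \<subseteq> V" using y(1) unfolding tuples_def by auto
    have cy: "card (set y) = q" using y(3) ly(1) distinct_card[of y] by simp
    have sy: "real (card (set y)) \<le> \<epsilon> / 4 * real (card V)" using n3[OF n(3)] unfolding cy n_def .
    have "0 \<le> threshold + \<epsilon> - 2 * (\<epsilon> / 4)" using threshold_nonneg \<epsilon> by simp
    then have "dense E V' (threshold + \<epsilon> - 2 * (\<epsilon> / 4))" unfolding V'_def by (rule dense_remove[OF V(1) ly(2) sy])
    moreover have half: "threshold + \<epsilon> - 2 * (\<epsilon> / 4) = threshold + \<epsilon> / 2" by simp
    ultimately have dV': "dense E V' (threshold + \<epsilon> / 2)" unfolding half by blast
    have "card V' = n - q" unfolding V'_def n_def cy[symmetric] using ly(2) by (intro card_Diff_subset) auto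
    also have "n = l + r * m + q" using z unfolding n' m(2) by (simp add: distrib_left)
    finally have cV': "card V' = l + r * m" by simp
    have n_eq: "n = r * m + s" using z unfolding s_def n' m(2) by (simp add: distrib_left)
    have "set (a @ b) \<subseteq> V'" unfolding V'_def using ab'(2) y(3) by auto
    then have cnt: "exp (real (r * m) * ln (real m) - C0 * real m) \<le> real (card (ham_paths E V' a b))"
      by (intro P[OF dV' m(1) cV' ab(1,2) ab'(1)])
    define CY where "CY = {vs. spanning_cycle E V vs}"
    have "CY \<subseteq> tuples V (card V)"
    proof
      fix vs assume "vs \<in> CY"
      then have vs: "spanning_cycle E V vs" unfolding CY_def by simp
      then have "set vs = V" unfolding spanning_cycle_def by simp
      then show "vs \<in> tuples V (card V)" using spanning_cycle_length[OF vs] unfolding tuples_def by simp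
    qed
    then have fCY: "finite CY" using fin by (meson finite_subset finite_tuples)
    have "(\<lambda>xs. xs @ y) ` ham_paths E V' a b \<subseteq> CY"
    proof
      fix vs assume "vs \<in> (\<lambda>xs. xs @ y) ` ham_paths E V' a b"
      then obtain xs where xs: "vs = xs @ y" "joins E a xs b" "distinct xs" "set xs = V'" unfolding ham_paths_def by auto
      have w: "walk E xs" "take l xs = a" "drop (length xs - l) xs = b" using xs(2) unfolding joins_def by auto
      have lx: "l \<le> length xs" using walk_length_ge[OF w(1)] .
      define xs' where "xs' = take (length xs - l) xs"
      have xb: "xs = xs' @ b" unfolding xs'_def w(3)[symmetric] by simp
      have w1: "walk E (xs' @ b)" using w(1) xb by simp
      have "walk E (xs' @ b @ (y @ a))" by (rule walk_append[OF w1 y(2) ab(2)])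
      moreover have "take l vs = a" unfolding xs(1) using w(2) lx by simp
      ultimately have "walk E (vs @ take l vs)" unfolding xs(1) using xb by simp
      moreover have "distinct vs" unfolding xs(1) using xs(3,4) y(3) unfolding V'_def by auto
      moreover have "set vs = V" unfolding xs(1) using xs(4) ly(2) unfolding V'_def by auto
      ultimately show "vs \<in> CY" unfolding CY_def spanning_cycle_def by simp
    qed
    moreover have "inj_on (\<lambda>xs. xs @ y) (ham_paths E V' a b)" by (rule inj_onI) simp
    ultimately have "card (ham_paths E V' a b) \<le> card CY" using fCY by (metis card_inj_on_le)
    then have cCY: "exp (real (r * m) * ln (real m) - C0 * real m) \<le> real (card CY)" using cnt by linarith
    define HH where "HH = {H. ham_cycle (l + r) l V E H}"
    have "E \<subseteq> Pow V" using V(2) by blast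
    then have "finite E" using fin by (meson finite_Pow_iff finite_subset)
    moreover have "HH \<subseteq> Pow E" unfolding HH_def ham_cycle_def by blast
    ultimately have fHH: "finite HH" by (meson finite_Pow_iff finite_subset)
    have lV: "l \<le> card V" "l + 2 * r \<le> card V" using n(5) unfolding n_def by auto
    have "CY \<subseteq> (\<Union>H\<in>HH. {vs. spanning_cycle E V vs \<and> cycle_edges vs = H})"
      unfolding CY_def HH_def using ham_cycle_cycle_edges[OF _ lV(2)] by blast
    moreover have "finite {vs. spanning_cycle E V vs \<and> cycle_edges vs = H}" for H
      using fCY unfolding CY_def by (rule finite_subset[rotated]) auto
    ultimately have "card CY \<le> card (\<Union>H\<in>HH. {vs. spanning_cycle E V vs \<and> cycle_edges vs = H})" using fHH by (intro card_mono) auto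
    also have "\<dots> \<le> (\<Sum>H\<in>HH. card {vs. spanning_cycle E V vs \<and> cycle_edges vs = H})" by (rule card_UN_le[OF fHH])
    also have "\<dots> \<le> (\<Sum>H\<in>HH. n * K ^ n)" unfolding n_def K_def by (intro sum_mono card_cycle_lists[OF fin lV(1)])
    finally have "card CY \<le> card HH * (n * K ^ n)" by simp
    then have "real (card CY) \<le> real (card HH * (n * K ^ n))" by (simp only: of_nat_le_iff)
    then have le: "exp (real (r * m) * ln (real m) - C0 * real m) \<le> real (card HH) * (real n * real K ^ n)" using cCY by simp
    have "real n * real K ^ n = exp (ln (real n) + real n * ln (real K))"
      using npos K by (simp add: exp_add exp_of_nat_mult)
    then have le2: "exp (real (r * m) * ln (real m) - C0 * real m - (ln (real n) + real n * ln (real K))) \<le> real (card HH)"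
      using le unfolding exp_diff[of _ "ln (real n) + real n * ln (real K)"] by (simp only: divide_le_eq exp_gt_zero if_True simp_thms)
    have "real n * ln (real n) - C * real n \<le> real (r * m) * ln (real m) - C0 * real m - (ln (real n) + real n * ln (real K))"
    proof -
      have "r * n' \<le> r * (2 * m)" using m(3) by (rule mult_le_mono2)
      then have "real n \<le> real (r * (2 * m))" unfolding n' by (simp only: of_nat_le_iff)
      then have "real n \<le> 2 * real r * real m" by simp
      moreover have "0 < 2 * real r * real m" using r_pos m(4) by simp
      ultimately have "ln (real n) \<le> ln (2 * real r * real m)" using npos by (subst ln_le_cancel_iff) auto
      also have "\<dots> = ln (2 * real r) + ln (real m)" using m(4) r_pos by (simp add: ln_mult)
      finally have "real (r * m) * ln (real n) \<le> real (r * m) * (ln (2 * real r) + ln (real m))" by (intro mult_left_mono) auto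
      then have e1: "real (r * m) * ln (real n) - real (r * m) * ln (2 * real r) \<le> real (r * m) * ln (real m)" by (simp add: algebra_simps)
      have "real (r * m) \<le> real n" unfolding n_eq by simp
      moreover have "0 \<le> ln (2 * real r)" using r_pos by simp
      ultimately have e2: "real (r * m) * ln (2 * real r) \<le> real n * ln (2 * real r)" by (intro mult_right_mono)
      have e3: "real (r * m) * ln (real n) = real n * ln (real n) - real s * ln (real n)" unfolding n_eq by (simp add: algebra_simps)
      have "1 * m \<le> r * m" using r_pos by (intro mult_le_mono1) simp
      then have "real m \<le> real n" unfolding n_eq by linarith
      then have "\<bar>C0\<bar> * real m \<le> \<bar>C0\<bar> * real n" by (intro mult_left_mono) auto
      moreover have "C0 * real m \<le> \<bar>C0\<bar> * real m" by (intro mult_right_mono) auto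
      ultimately have e4: "C0 * real m \<le> \<bar>C0\<bar> * real n" by linarith
      have e5: "real s * ln (real n) + ln (real n) \<le> real n" using n2[OF n(2)] by (simp add: algebra_simps)
      have "C * real n = real n * ln (2 * real r) + \<bar>C0\<bar> * real n + real n * ln (real K) + real n" unfolding C_def by (simp add: algebra_simps)
      then show ?thesis using e1 e2 e3 e4 e5 by linarith
    qed
    then have "exp (real n * ln (real n) - C * real n) \<le> real (card HH)" using le2 by (meson exp_le_cancel_iff order_trans)
    then show ?thesis unfolding n_def HH_def .
  qed
  then show ?thesis using C by (intro exI[of _ C] conjI exI[of _ n0]) auto
qed

text \<open>Twice the binomial coefficient is at least \<open>n\<^sup>2 - 2 * k * n\<close>, and for
  large \<open>n\<close> half of \<open>\<epsilon>\<close> absorbs the linear term.\<close>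

lemma eventually_dense:
  assumes \<epsilon>: "0 < \<epsilon>"
  shows "\<exists>n0. \<forall>E (V :: 'a set). kgraph (l + r) V E \<and> n0 \<le> card V \<and>
    (threshold + \<epsilon>) * real ((card V - (l + r) + 2) choose 2) \<le> real (min_deg (l + r - 2) V E) \<longrightarrow> dense E V (threshold + \<epsilon> / 2)"
proof -
  define k where "k = l + r"
  have \<epsilon>2: "0 < \<epsilon> / 2" using \<epsilon> by simp
  obtain n1 where n1: "\<And>n. n1 \<le> n \<Longrightarrow> (threshold + \<epsilon>) * (2 * real k) \<le> \<epsilon> / 2 * real n"
    using eventually_linear_bound[OF \<epsilon>2] by blast
  have "dense E V (threshold + \<epsilon> / 2)"
    if G: "kgraph k V E" and n: "n1 + k \<le> card V" and d: "(threshold + \<epsilon>) * real ((card V - k + 2) choose 2) \<le> real (min_deg (k - 2) V E)"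
    for E and V :: "'a set"
    unfolding dense_def
  proof (intro conjI ballI allI impI)
    show fin: "finite V" using G unfolding kgraph_def by blast
    have E: "card e = l + r \<and> e \<subseteq> V" if "e \<in> E" for e using G that unfolding kgraph_def k_def by blast
    then show "card e = l + r" if "e \<in> E" for e using that by blast
    fix T assume T: "T \<subseteq> V" "card T = l + r - 2"
    define N where "N = real (card V)"
    define M where "M = card V - k + 2"
    have M: "real M = N - real k + 2" unfolding M_def N_def using n by simp
    have k0: "0 \<le> N - real k" unfolding N_def using n by simp
    have th: "0 \<le> threshold + \<epsilon>" using threshold_nonneg \<epsilon> by simp
    have "N * N - 2 * real k * N \<le> (N - real k) * (N - real k)" by (simp add: algebra_simps)
    also have "\<dots> \<le> real M * (real M - 1)" unfolding M using k0 by (intro mult_mono) auto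
    also have "\<dots> = 2 * real (M choose 2)"
      by (cases M) (simp_all add: choose_two real_of_nat_div[of 2] algebra_simps)
    finally have c: "N * N - 2 * real k * N \<le> 2 * real (M choose 2)" .
    have "(threshold + \<epsilon>) * (2 * real k) * N \<le> \<epsilon> / 2 * N * N"
      unfolding N_def using n1[of "card V"] n by (intro mult_right_mono) auto
    then have "(threshold + \<epsilon> / 2) * N\<^sup>2 \<le> (threshold + \<epsilon>) * (N * N - 2 * real k * N)" by (simp add: power2_eq_square algebra_simps)
    also have "\<dots> \<le> (threshold + \<epsilon>) * (2 * real (M choose 2))" using c th by (rule mult_left_mono)
    also have "\<dots> \<le> 2 * real (min_deg (l + r - 2) V E)" using d unfolding M_def k_def by simp
    also have "\<dots> \<le> 2 * real (card {e \<in> E. T \<subseteq> e})"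
    proof -
      have "min_deg (l + r - 2) V E \<le> card {e \<in> E. T \<subseteq> e}"
        unfolding min_deg_def by (rule Min_le) (use fin T in auto)
      then show ?thesis by simp
    qed
    also have "\<dots> = real (card (link E V T))" using card_link[OF E fin T(2,1)] by simp
    finally show "(threshold + \<epsilon> / 2) * (real (card V))\<^sup>2 \<le> real (card (link E V T))" unfolding N_def .
  qed
  then show ?thesis unfolding k_def by (intro exI[of _ "n1 + (l + r)"]) blast
qed

end

theorem theorem1p5:
  fixes k l :: nat and \<epsilon> :: real
  assumes "k \<ge> 3" and "1 \<le> l" and "l \<le> k - 2" and "\<epsilon> > 0"
  shows "\<exists>C>0. \<exists>n0::nat. \<forall>(V::'a set) E.
           kgraph k V E \<and> card V \<ge> n0 \<and> (k - l) dvd card V \<and>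
           real (min_deg (k - 2) V E) \<ge>
             (ham_threshold (k - 2) k l + \<epsilon>) * real ((card V - k + 2) choose 2)
           \<longrightarrow> real (card {H. ham_cycle k l V E H}) \<ge>
                 exp (real (card V) * ln (real (card V)) - C * real (card V))"
proof -
  define r where "r = k - l"
  have k: "k = l + r" using assms(1,3) unfolding r_def by simp
  interpret cycle_params l r
    by unfold_locales (use assms(1-3) in \<open>auto simp: r_def\<close>)
  \<comment> \<open>The auxiliary results are stated for parameters at most 1; the degree hypothesis
    for \<open>\<epsilon>\<close> implies the one for \<open>\<eta>\<close>.\<close>
  define \<eta> where "\<eta> = min \<epsilon> 1"
  have \<eta>: "0 < \<eta>" "0 < \<eta> / 2" "\<eta> / 2 \<le> 1" "\<eta> \<le> \<epsilon>" unfolding \<eta>_def using assms(4) by auto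
  obtain C n1 where C: "0 < C" and n1: "\<And>E (V :: 'a set). dense E V (threshold + \<eta> / 2) \<Longrightarrow> (\<forall>e\<in>E. e \<subseteq> V) \<Longrightarrow> n1 \<le> card V \<Longrightarrow> r dvd card V
    \<Longrightarrow> exp (real (card V) * ln (real (card V)) - C * real (card V)) \<le> real (card {H. ham_cycle (l + r) l V E H})"
    using many_ham_cycles[OF \<eta>(2,3), where 'a = 'a] by (elim exE conjE) (rule that; blast)
  obtain n2 where n2: "\<And>E (V :: 'a set). kgraph (l + r) V E \<Longrightarrow> n2 \<le> card V \<Longrightarrow>
    (threshold + \<eta>) * real ((card V - (l + r) + 2) choose 2) \<le> real (min_deg (l + r - 2) V E) \<Longrightarrow> dense E V (threshold + \<eta> / 2)"
    using eventually_dense[OF \<eta>(1), where 'a = 'a] by blast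
  have "exp (real (card V) * ln (real (card V)) - C * real (card V)) \<le> real (card {H. ham_cycle k l V E H})"
    if "kgraph k V E" "n1 + n2 \<le> card V" "(k - l) dvd card V"
      "(ham_threshold (k - 2) k l + \<epsilon>) * real ((card V - k + 2) choose 2) \<le> real (min_deg (k - 2) V E)" for E and V :: "'a set"
  proof -
    have "(threshold + \<eta>) * real ((card V - k + 2) choose 2) \<le> (ham_threshold (k - 2) k l + \<epsilon>) * real ((card V - k + 2) choose 2)"
      unfolding k threshold_def using \<eta>(4) by (intro mult_right_mono) auto
    then have "(threshold + \<eta>) * real ((card V - (l + r) + 2) choose 2) \<le> real (min_deg (l + r - 2) V E)"
      using that(4) unfolding k by linarith
    then have "dense E V (threshold + \<eta> / 2)" using that(1,2) unfolding k by (intro n2) auto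
    moreover have "\<forall>e\<in>E. e \<subseteq> V" using that(1) unfolding kgraph_def by blast
    ultimately show ?thesis using n1[of E V] that(2,3) unfolding k by simp
  qed
  then show ?thesis using C by (intro exI[of _ C] conjI exI[of _ "n1 + n2"]) auto
qed

end
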